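(* Let $M$ be a $\sigma$-compact smooth manifold of dimension $k\ge 1$ with a locally Lebesgue measure $\mu$, let $G\subseteq \mathrm{U}_n(\mathbb{C})$ be a closed subgroup, and let $E=(P\times\mathbb{C}^n)/G\to M$ be the complex vector bundle associated to a $G$-principal bundle $P\to M$. Let $\kappa:\mathrm{Gau}\,E\to\mathrm{Aut}\,\mathrm{CAR}(L^2(E))$ be the action determined by $\kappa_\gamma(a(c))=a(V_\gamma c)$ for $\gamma\in\mathrm{Gau}\,E$, $c\in L^2(E)$, where $(V_\gamma c)(x)=\gamma(c(x))$. Then the fixed point algebra is trivial, $\mathrm{CAR}(L^2(E))^{\mathrm{Gau}\,E}=\mathbb{C}\mathbf{1}$, if either (i) $\mathbb{T}\mathbf{1}\subseteq G$ (i.e. $G$ contains all scalar matrices $z\mathbf{1}$ with $|z|=1$), or (ii) on the Fock space of $L^2(E)$ (the space of the Fock representation) one has $\Gamma(V(\mathrm{Gau}\,E))''\supseteq\Gamma(\mathrm{U}(L^\infty_{\mathbb{C}}(M)))$, where $\Gamma(U)$ denotes the second quantization on Fock space of a unitary $U$ on $L^2(E)$ and $''$ denotes the bicommutant.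
   Context: For a complex Hilbert space $\mathcal{H}$ (inner product antilinear in the first variable), $\mathrm{CAR}(\mathcal{H})$ is the unital $C^*$-algebra, unique up to natural isomorphism, generated by the image of a continuous antilinear map $a:\mathcal{H}\to\mathrm{CAR}(\mathcal{H})$ with $a(f)a(g)^*+a(g)^*a(f)=\langle f,g\rangle\mathbf{1}$ and $a(f)a(g)+a(g)a(f)=0$ for all $f,g\in\mathcal{H}$ (with $\mathrm{CAR}(\{0\})=\mathbb{C}\mathbf{1}$). Each unitary $U$ of $\mathcal{H}$ defines an automorphism $\alpha_U$ with $\alpha_U(a(f))=a(Uf)$; thus $\kappa_\gamma=\alpha_{V_\gamma}$. The fixed point algebra of a group acting by automorphisms is the set of elements fixed by all of these automorphisms. In $E=(P\times\mathbb{C}^n)/G$ the group $G$ acts by $g.(p,\mathbf{v})=(pg^{-1},g\mathbf{v})$ and $[p,\mathbf{v}]$ denotes the orbit of $(p,\mathbf{v})$. Since $G$ is unitary, $|[p,\mathbf{v}]|:=|\mathbf{v}|$ (Euclidean norm) is well defined. A locally Lebesgue measure $\mu$ on $M$ is a Borel measure, finite on compact sets, which in each local chart is equivalent (mutually absolutely continuous) to Lebesgue measure on $\mathbb{R}^k$ (e.g. one given by a nowhere vanishing smooth $k$-form). $L^2(E)$ is the Hilbert space completion of the space of smooth sections $c$ of $E$ with $\|c\|^2=\int_M|c(x)|^2\,d\mu(x)<\infty$. $L^\infty_{\mathbb{C}}(M)=L^\infty(M,\mu;\mathbb{C})$ acts on $L^2(E)$ by pointwise multiplication, and $\mathrm{U}(L^\infty_{\mathbb{C}}(M))$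 is its unitary group, viewed inside $\mathrm{U}(L^2(E))$. The gauge group $\mathrm{Gau}\,E$ consists of the smooth bundle automorphisms $\gamma$ of $E$ of the form $\gamma[p,\mathbf{v}]=[p,f(p)\mathbf{v}]$, where $f:P\to G$ is a smooth function with $f(pg)=g^{-1}f(p)g$ for all $p\in P$, $g\in G$. Each $V_\gamma$ is unitary on $L^2(E)$. The Fock representation $\pi_{\mathcal{F}}$ is the representation of $\mathrm{CAR}(\mathcal{H})$ on the antisymmetric Fock space $\bigoplus_{m\ge0}\Lambda^m\mathcal{H}$ (Hilbert space sum of antisymmetric tensor powers) in which $a(f)$ acts as the annihilation operator of $f$; for unitary $U$ on $\mathcal{H}$, $\Gamma(U)$ is the unitary acting on $\Lambda^m\mathcal{H}$ as the restriction of $U^{\otimes m}$ (and as $1$ for $m=0$). *)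

theory Defs
  imports "HOL-Analysis.Analysis"
begin

section \<open>Smooth maps and manifolds\<close>

primrec differentiable_upto :: "nat \<Rightarrow> 'a::real_normed_vector set \<Rightarrow> ('a \<Rightarrow> 'b::real_normed_vector) \<Rightarrow> bool"
  where
    "differentiable_upto 0 X f \<longleftrightarrow> continuous_on X f"
  | "differentiable_upto (Suc r) X f \<longleftrightarrow>
       (\<forall>x\<in>X. f differentiable (at x)) \<and>
       (\<forall>v. differentiable_upto r X (\<lambda>x. frechet_derivative f (at x) v))"

text \<open>Real smoothness (\<open>C\<^sup>\<infinity>\<close>); only to be used for open \<open>X\<close>.\<close>

definition smooth_on :: "'a::real_normed_vector set \<Rightarrow> ('a \<Rightarrow> 'b::real_normed_vector) \<Rightarrow> bool"
  where "smooth_on X f \<longleftrightarrow> (\<forall>r. differentiable_upto r X f)"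

text \<open>Smoothness on an arbitrary subset of a Euclidean space, by local smooth extension to the
  ambient space.  On an embedded submanifold (here: an open piece of \<open>\<real>\<^sup>d \<times> G\<close> with \<open>G\<close> a closed
  matrix group) this is smoothness for the submanifold structure.\<close>

definition smooth_on_subset :: "'a::real_normed_vector set \<Rightarrow> ('a \<Rightarrow> 'b::real_normed_vector) \<Rightarrow> bool"
  where "smooth_on_subset X f \<longleftrightarrow>
    (\<forall>x\<in>X. \<exists>W F. open W \<and> x \<in> W \<and> smooth_on W F \<and> (\<forall>y\<in>W \<inter> X. F y = f y))"

text \<open>A chart is a pair of its domain and its coordinate map; only the values of the coordinate map
  on the domain matter.  The manifold is the whole type, and the type class \<open>t2_space\<close> will supply
  the Hausdorff property.\<close>

type_synonym ('m, 'e) chart = "'m set \<times> ('m \<Rightarrow> 'e)"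

definition smooth_atlas :: "('m::topological_space, 'e::euclidean_space) chart set \<Rightarrow> bool"
  where "smooth_atlas \<A> \<longleftrightarrow>
    (\<Union>(U, \<phi>)\<in>\<A>. U) = UNIV \<and>
    (\<forall>(U, \<phi>)\<in>\<A>. open U \<and> open (\<phi> ` U) \<and> homeomorphism U (\<phi> ` U) \<phi> (inv_into U \<phi>)) \<and>
    (\<forall>(U, \<phi>)\<in>\<A>. \<forall>(W, \<psi>)\<in>\<A>. smooth_on (\<phi> ` (U \<inter> W)) (\<psi> \<circ> inv_into U \<phi>))"

definition smooth_fun ::
    "('m::topological_space, 'e::euclidean_space) chart set \<Rightarrow> 'm set \<Rightarrow> ('m \<Rightarrow> 'b::real_normed_vector) \<Rightarrow> bool"
  where "smooth_fun \<A> V f \<longleftrightarrow>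
    (\<forall>(U, \<phi>)\<in>\<A>. smooth_on (\<phi> ` (U \<inter> V)) (f \<circ> inv_into U \<phi>))"

definition smooth_map ::
    "('m::topological_space, 'e::euclidean_space) chart set \<Rightarrow>
     ('p::topological_space, 'd::euclidean_space) chart set \<Rightarrow> 'm set \<Rightarrow> ('m \<Rightarrow> 'p) \<Rightarrow> bool"
  where "smooth_map \<A> \<B> V f \<longleftrightarrow>
    continuous_on V f \<and>
    (\<forall>(U, \<phi>)\<in>\<A>. \<forall>(W, \<psi>)\<in>\<B>.
      smooth_on (\<phi> ` {x \<in> U \<inter> V. f x \<in> W}) (\<psi> \<circ> f \<circ> inv_into U \<phi>))"

definition sigma_compact_space :: "'m::topological_space itself \<Rightarrow> bool"
  where "sigma_compact_space _ \<longleftrightarrow>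
    (\<exists>K :: nat \<Rightarrow> 'm set. (\<forall>i. compact (K i)) \<and> (\<Union>i. K i) = UNIV)"

definition locally_Lebesgue ::
    "('m::topological_space, 'e::euclidean_space) chart set \<Rightarrow> 'm measure \<Rightarrow> bool"
  where "locally_Lebesgue \<A> \<mu> \<longleftrightarrow>
    sets \<mu> = sets borel \<and>
    (\<forall>K. compact K \<longrightarrow> emeasure \<mu> K < \<infinity>) \<and>
    (\<forall>(U, \<phi>)\<in>\<A>.
      let \<nu> = distr (restrict_space \<mu> U) (restrict_space borel (\<phi> ` U)) \<phi>;
          \<rho> = restrict_space lborel (\<phi> ` U)
      in absolutely_continuous \<rho> \<nu> \<and> absolutely_continuous \<nu> \<rho>)"


section \<open>Principal bundles, the associated vector bundle and the gauge group\<close>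

type_synonym 'n cmat = "complex^'n^'n"

definition unitary_matrix :: "'n::finite cmat \<Rightarrow> bool"
  where "unitary_matrix A \<longleftrightarrow>
    (\<chi> i j. cnj (A $ j $ i)) ** A = mat 1 \<and> A ** (\<chi> i j. cnj (A $ j $ i)) = mat 1"

definition closed_unitary_group :: "'n::finite cmat set \<Rightarrow> bool"
  where "closed_unitary_group G \<longleftrightarrow>
    G \<subseteq> Collect unitary_matrix \<and> closed G \<and> mat 1 \<in> G \<and>
    (\<forall>g\<in>G. \<forall>h\<in>G. g ** h \<in> G) \<and> (\<forall>g\<in>G. matrix_inv g \<in> G)"

record ('m, 'k, 'p, 'd, 'n) pbundle =
  base_atlas :: "('m, real^'k) chart set"
  total_atlas :: "('p, 'd) chart set"
  bproj :: "'p \<Rightarrow> 'm"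
  ract :: "'p \<Rightarrow> 'n cmat \<Rightarrow> 'p"  \<comment> \<open>right action\<close>
  grp :: "'n cmat set"

text \<open>The local triviality condition says that \<open>p \<mapsto> (\<pi> p, \<tau> p)\<close> is a \<open>G\<close>-equivariant
  diffeomorphism \<open>\<pi>\<^sup>-\<^sup>1(V) \<rightarrow> V \<times> G\<close>, with inverse \<open>(x, g) \<mapsto> s(x)g\<close>.\<close>

definition local_trivialization ::
    "('m::t2_space, 'k::finite, 'p::t2_space, 'd::euclidean_space, 'n::finite) pbundle \<Rightarrow>
     'm set \<Rightarrow> ('m \<Rightarrow> 'p) \<Rightarrow> ('p \<Rightarrow> 'n cmat) \<Rightarrow> bool"
  where "local_trivialization B V s \<tau> \<longleftrightarrow>
    open V \<and>
    smooth_map (base_atlas B) (total_atlas B) V s \<and>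
    smooth_fun (total_atlas B) (bproj B -` V) \<tau> \<and>
    (\<forall>x\<in>V. bproj B (s x) = x \<and> (\<forall>g\<in>grp B. \<tau> (ract B (s x) g) = g)) \<and>
    (\<forall>p\<in>bproj B -` V. \<tau> p \<in> grp B \<and> ract B (s (bproj B p)) (\<tau> p) = p \<and>
       (\<forall>g\<in>grp B. \<tau> (ract B p g) = \<tau> p ** g))"

definition smooth_right_action ::
    "('m::t2_space, 'k::finite, 'p::t2_space, 'd::euclidean_space, 'n::finite) pbundle \<Rightarrow> bool"
  where "smooth_right_action B \<longleftrightarrow>
    (\<forall>p. ract B p (mat 1) = p) \<and>
    (\<forall>p. \<forall>g\<in>grp B. \<forall>h\<in>grp B. ract B (ract B p g) h = ract B p (g ** h)) \<and>
    continuous_on (UNIV \<times> grp B) (\<lambda>(p, g). ract B p g) \<and>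
    (\<forall>(U, \<phi>)\<in>total_atlas B. \<forall>(W, \<psi>)\<in>total_atlas B.
      smooth_on_subset {(\<phi> p, g) | p g. p \<in> U \<and> g \<in> grp B \<and> ract B p g \<in> W}
        (\<lambda>(y, g). \<psi> (ract B (inv_into U \<phi> y) g)))"

definition principal_bundle ::
    "('m::t2_space, 'k::finite, 'p::t2_space, 'd::euclidean_space, 'n::finite) pbundle \<Rightarrow> bool"
  where "principal_bundle B \<longleftrightarrow>
    smooth_atlas (base_atlas B) \<and>
    smooth_atlas (total_atlas B) \<and>
    closed_unitary_group (grp B) \<and>
    smooth_map (total_atlas B) (base_atlas B) UNIV (bproj B) \<and>
    smooth_right_action B \<and>
    (\<forall>p. \<forall>g\<in>grp B. bproj B (ract B p g) = bproj B p) \<and>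
    (\<forall>x. \<exists>V s \<tau>. x \<in> V \<and> local_trivialization B V s \<tau>)"

text \<open>Points of \<open>E = (P \<times> \<complex>\<^sup>n)/G\<close> are orbits, that is, sets of pairs.\<close>

type_synonym ('p, 'n) epoint = "('p \<times> (complex^'n)) set"

definition eorbit ::
    "('m, 'k::finite, 'p, 'd, 'n::finite) pbundle \<Rightarrow> 'p \<Rightarrow> complex^'n \<Rightarrow> ('p, 'n) epoint"
  where "eorbit B p v = {(ract B p (matrix_inv g), g *v v) | g. g \<in> grp B}"

definition etotal :: "('m, 'k::finite, 'p, 'd, 'n::finite) pbundle \<Rightarrow> ('p, 'n) epoint set"
  where "etotal B = {eorbit B p v | p v. True}"

definition ezero :: "('m, 'k::finite, 'p, 'd, 'n::finite) pbundle \<Rightarrow> 'm \<Rightarrow> ('p, 'n) epoint"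
  where "ezero B x = {(p, 0) | p. bproj B p = x}"

text \<open>Fibrewise operations: \<open>[p,v] + [p,w] = [p,v+w]\<close>, \<open>z[p,v] = [p,zv]\<close>,
  \<open>\<langle>[p,v],[p,w]\<rangle> = \<langle>v,w\<rangle>\<close> (antilinear on the left), \<open>|[p,v]| = |v|\<close>.\<close>

definition eadd :: "('p, 'n::finite) epoint \<Rightarrow> ('p, 'n) epoint \<Rightarrow> ('p, 'n) epoint"
  where "eadd e e' = {(p, v + w) | p v w. (p, v) \<in> e \<and> (p, w) \<in> e'}"

definition escale :: "complex \<Rightarrow> ('p, 'n::finite) epoint \<Rightarrow> ('p, 'n) epoint"
  where "escale z e = {(p, z *s v) | p v. (p, v) \<in> e}"

definition einner :: "('p, 'n::finite) epoint \<Rightarrow> ('p, 'n) epoint \<Rightarrow> complex"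
  where "einner e e' =
    (THE z. \<exists>p v w. (p, v) \<in> e \<and> (p, w) \<in> e' \<and> z = (\<Sum>i\<in>UNIV. cnj (v $ i) * w $ i))"

definition enorm :: "('p, 'n::finite) epoint \<Rightarrow> real"
  where "enorm e = (THE r. \<exists>p v. (p, v) \<in> e \<and> r = norm v)"

text \<open>\<open>E\<close> carries the quotient smooth structure, for which \<open>P \<times> \<complex>\<^sup>n \<rightarrow> E\<close> is a surjective submersion;
  so a map into \<open>E\<close> is smooth iff it locally lifts to a smooth map into \<open>P \<times> \<complex>\<^sup>n\<close>.  For measurable
  sections the lift to \<open>P\<close> is still taken smooth, that is, the section is Borel measurable in local
  trivializations.\<close>

definition smooth_section ::
    "('m::t2_space, 'k::finite, 'p::t2_space, 'd::euclidean_space, 'n::finite) pbundle \<Rightarrow>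
     ('m \<Rightarrow> ('p, 'n) epoint) \<Rightarrow> bool"
  where "smooth_section B c \<longleftrightarrow>
    (\<forall>x. \<exists>V s v. open V \<and> x \<in> V \<and>
       smooth_map (base_atlas B) (total_atlas B) V s \<and> smooth_fun (base_atlas B) V v \<and>
       (\<forall>y\<in>V. bproj B (s y) = y \<and> c y = eorbit B (s y) (v y)))"

definition measurable_section ::
    "('m::t2_space, 'k::finite, 'p::t2_space, 'd::euclidean_space, 'n::finite) pbundle \<Rightarrow>
     ('m \<Rightarrow> ('p, 'n) epoint) \<Rightarrow> bool"
  where "measurable_section B c \<longleftrightarrow>
    (\<forall>x. \<exists>V s v. open V \<and> x \<in> V \<and>
       smooth_map (base_atlas B) (total_atlas B) V s \<and>
       v \<in> borel_measurable (restrict_space borel V) \<and>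
       (\<forall>y\<in>V. bproj B (s y) = y \<and> c y = eorbit B (s y) (v y)))"

text \<open>Gauge transformations are normalized to be \<open>undefined\<close> outside \<open>E\<close>.  A map
  \<open>[p,v] \<mapsto> [p,f(p)v]\<close> as below is automatically a smooth bundle automorphism, with inverse given
  by \<open>p \<mapsto> f(p)\<^sup>-\<^sup>1\<close>.\<close>

definition gauge_group ::
    "('m::t2_space, 'k::finite, 'p::t2_space, 'd::euclidean_space, 'n::finite) pbundle \<Rightarrow>
     (('p, 'n) epoint \<Rightarrow> ('p, 'n) epoint) set"
  where "gauge_group B =
    {\<gamma> \<in> extensional (etotal B). \<exists>f.
       smooth_fun (total_atlas B) UNIV f \<and> range f \<subseteq> grp B \<and>
       (\<forall>p. \<forall>g\<in>grp B. f (ract B p g) = matrix_inv g ** f p ** g) \<and>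
       (\<forall>p v. \<gamma> (eorbit B p v) = eorbit B p (f p *v v))}"


section \<open>Hilbert spaces and bounded operators\<close>

text \<open>Complex Hilbert spaces with explicit carrier; \<open>hinner\<close> is antilinear in its first argument.
  Operators are functions of which only the values on the carrier matter.\<close>

record 'v hspace =
  hcarrier :: "'v set"
  hzero :: "'v"
  hadd :: "'v \<Rightarrow> 'v \<Rightarrow> 'v"
  hscale :: "complex \<Rightarrow> 'v \<Rightarrow> 'v"
  hinner :: "'v \<Rightarrow> 'v \<Rightarrow> complex"

definition hnorm :: "'v hspace \<Rightarrow> 'v \<Rightarrow> real"
  where "hnorm H x = sqrt (Re (hinner H x x))"

definition hdist :: "'v hspace \<Rightarrow> 'v \<Rightarrow> 'v \<Rightarrow> real"
  where "hdist H x y = hnorm H (hadd H x (hscale H (-1) y))"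

definition bounded_ops :: "'v hspace \<Rightarrow> ('v \<Rightarrow> 'v) set"
  where "bounded_ops H = {T.
    (\<forall>x\<in>hcarrier H. T x \<in> hcarrier H) \<and>
    (\<forall>x\<in>hcarrier H. \<forall>y\<in>hcarrier H. T (hadd H x y) = hadd H (T x) (T y)) \<and>
    (\<forall>z. \<forall>x\<in>hcarrier H. T (hscale H z x) = hscale H z (T x)) \<and>
    (\<exists>C. \<forall>x\<in>hcarrier H. hnorm H (T x) \<le> C * hnorm H x)}"

definition commutant :: "'v hspace \<Rightarrow> ('v \<Rightarrow> 'v) set \<Rightarrow> ('v \<Rightarrow> 'v) set"
  where "commutant H \<S> =
    {T \<in> bounded_ops H. \<forall>S\<in>\<S>. \<forall>x\<in>hcarrier H. T (S x) = S (T x)}"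

definition bicommutant :: "'v hspace \<Rightarrow> ('v \<Rightarrow> 'v) set \<Rightarrow> ('v \<Rightarrow> 'v) set"
  where "bicommutant H \<S> = commutant H (commutant H \<S>)"

definition is_orthonormal_basis :: "'v hspace \<Rightarrow> 'v set \<Rightarrow> bool"
  where "is_orthonormal_basis H X \<longleftrightarrow>
    X \<subseteq> hcarrier H \<and>
    (\<forall>x\<in>X. \<forall>y\<in>X. hinner H x y = (if x = y then 1 else 0)) \<and>
    (\<forall>x\<in>hcarrier H. (\<forall>b\<in>X. hinner H b x = 0) \<longrightarrow> x = hzero H)"


section \<open>The Hilbert space of \<open>L\<^sup>2\<close> sections\<close>

text \<open>The completion of the space of smooth square integrable sections is realized as its closure
  in the space of almost everywhere classes of measurable square integrable sections.\<close>

definition square_integrable_section ::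
    "'m measure \<Rightarrow> ('m \<Rightarrow> ('p, 'n::finite) epoint) \<Rightarrow> bool"
  where "square_integrable_section \<mu> c \<longleftrightarrow> (\<integral>\<^sup>+x. ennreal ((enorm (c x))\<^sup>2) \<partial>\<mu>) < \<infinity>"

definition L2_section ::
    "('m::t2_space, 'k::finite, 'p::t2_space, 'd::euclidean_space, 'n::finite) pbundle \<Rightarrow> 'm measure \<Rightarrow>
     ('m \<Rightarrow> ('p, 'n) epoint) \<Rightarrow> bool"
  where "L2_section B \<mu> c \<longleftrightarrow>
    measurable_section B c \<and> square_integrable_section \<mu> c \<and>
    (\<exists>s. (\<forall>j::nat. smooth_section B (s j) \<and> square_integrable_section \<mu> (s j)) \<and>
      (\<lambda>j. \<integral>\<^sup>+x. ennreal ((enorm (eadd (s j x) (escale (-1) (c x))))\<^sup>2) \<partial>\<mu>) \<longlonglongrightarrow> 0)"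

definition ae_class ::
    "('m::t2_space, 'k::finite, 'p::t2_space, 'd::euclidean_space, 'n::finite) pbundle \<Rightarrow> 'm measure \<Rightarrow>
     ('m \<Rightarrow> ('p, 'n) epoint) \<Rightarrow> ('m \<Rightarrow> ('p, 'n) epoint) set"
  where "ae_class B \<mu> c = {d. measurable_section B d \<and> (AE x in \<mu>. d x = c x)}"

definition ae_rep :: "('m \<Rightarrow> ('p, 'n) epoint) set \<Rightarrow> 'm \<Rightarrow> ('p, 'n::finite) epoint"
  where "ae_rep X = (SOME c. c \<in> X)"

definition L2_space ::
    "('m::t2_space, 'k::finite, 'p::t2_space, 'd::euclidean_space, 'n::finite) pbundle \<Rightarrow> 'm measure \<Rightarrow>
     ('m \<Rightarrow> ('p, 'n) epoint) set hspace"
  where "L2_space B \<mu> =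
    \<lparr>hcarrier = {ae_class B \<mu> c | c. L2_section B \<mu> c},
     hzero = ae_class B \<mu> (ezero B),
     hadd = (\<lambda>X Y. ae_class B \<mu> (\<lambda>x. eadd (ae_rep X x) (ae_rep Y x))),
     hscale = (\<lambda>z X. ae_class B \<mu> (\<lambda>x. escale z (ae_rep X x))),
     hinner = (\<lambda>X Y. \<integral>x. einner (ae_rep X x) (ae_rep Y x) \<partial>\<mu>)\<rparr>"

definition gauge_op ::
    "('m::t2_space, 'k::finite, 'p::t2_space, 'd::euclidean_space, 'n::finite) pbundle \<Rightarrow> 'm measure \<Rightarrow>
     (('p, 'n) epoint \<Rightarrow> ('p, 'n) epoint) \<Rightarrow>
     ('m \<Rightarrow> ('p, 'n) epoint) set \<Rightarrow> ('m \<Rightarrow> ('p, 'n) epoint) set"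
  where "gauge_op B \<mu> \<gamma> X = ae_class B \<mu> (\<lambda>x. \<gamma> (ae_rep X x))"

definition mult_op ::
    "('m::t2_space, 'k::finite, 'p::t2_space, 'd::euclidean_space, 'n::finite) pbundle \<Rightarrow> 'm measure \<Rightarrow>
     ('m \<Rightarrow> complex) \<Rightarrow> ('m \<Rightarrow> ('p, 'n) epoint) set \<Rightarrow> ('m \<Rightarrow> ('p, 'n) epoint) set"
  where "mult_op B \<mu> h X = ae_class B \<mu> (\<lambda>x. escale (h x) (ae_rep X x))"

text \<open>The unitary elements of \<open>L\<^sup>\<infinity>\<close> are the classes of measurable functions of modulus one a.e.\<close>

definition Linfty_unitary_ops ::
    "('m::t2_space, 'k::finite, 'p::t2_space, 'd::euclidean_space, 'n::finite) pbundle \<Rightarrow> 'm measure \<Rightarrow>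
     (('m \<Rightarrow> ('p, 'n) epoint) set \<Rightarrow> ('m \<Rightarrow> ('p, 'n) epoint) set) set"
  where "Linfty_unitary_ops B \<mu> =
    {mult_op B \<mu> h | h. h \<in> borel_measurable \<mu> \<and> (AE x in \<mu>. cmod (h x) = 1)}"


section \<open>Antisymmetric Fock space\<close>

text \<open>The Hilbert space tensor power \<open>H\<^sup>\<otimes>\<^sup>m\<close> is realized as the space of bounded Hilbert-Schmidt
  \<open>m\<close>-antilinear functionals \<open>\<Phi>\<close> on \<open>H\<^sup>m\<close> (tuples are lists of length \<open>m\<close>), where
  \<open>f\<^sub>1 \<otimes> \<dots> \<otimes> f\<^sub>m\<close> is the functional \<open>(g\<^sub>1,\<dots>,g\<^sub>m) \<mapsto> \<langle>g\<^sub>1,f\<^sub>1\<rangle> \<cdots> \<langle>g\<^sub>m,f\<^sub>m\<rangle>\<close> and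
  \<open>\<langle>\<Phi>,\<Psi>\<rangle>\<close> is the sum of \<open>cnj (\<Phi> b) * \<Psi> b\<close> over the tuples \<open>b\<close> from an orthonormal basis,
  whose choice is immaterial.  \<open>\<Lambda>\<^sup>mH\<close> is the subspace of the antisymmetric functionals.  An element
  of Fock space is a family \<open>(\<Phi>\<^sub>m)\<^sub>m\<close>, given as one function on the lists of all lengths.\<close>

definition some_basis :: "'v hspace \<Rightarrow> 'v set"
  where "some_basis H = (SOME X. is_orthonormal_basis H X)"

definition multi_antilinear :: "'v hspace \<Rightarrow> ('v list \<Rightarrow> complex) \<Rightarrow> bool"
  where "multi_antilinear H \<Phi> \<longleftrightarrow>
    (\<forall>xs\<in>lists (hcarrier H). \<forall>ys\<in>lists (hcarrier H). \<forall>f\<in>hcarrier H.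
      (\<forall>g\<in>hcarrier H. \<Phi> (xs @ hadd H f g # ys) = \<Phi> (xs @ f # ys) + \<Phi> (xs @ g # ys)) \<and>
      (\<forall>z. \<Phi> (xs @ hscale H z f # ys) = cnj z * \<Phi> (xs @ f # ys)))"

definition multi_bounded :: "'v hspace \<Rightarrow> ('v list \<Rightarrow> complex) \<Rightarrow> bool"
  where "multi_bounded H \<Phi> \<longleftrightarrow>
    (\<forall>m. \<exists>C. \<forall>gs\<in>lists (hcarrier H). length gs = m \<longrightarrow>
      cmod (\<Phi> gs) \<le> C * prod_list (map (hnorm H) gs))"

definition antisymmetric_form :: "'v hspace \<Rightarrow> ('v list \<Rightarrow> complex) \<Rightarrow> bool"
  where "antisymmetric_form H \<Phi> \<longleftrightarrow>
    (\<forall>gs\<in>lists (hcarrier H). \<forall>i j. i < j \<and> j < length gs \<longrightarrow>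
      \<Phi> (gs[i := gs ! j, j := gs ! i]) = - \<Phi> gs)"

definition fock_space :: "'v hspace \<Rightarrow> ('v list \<Rightarrow> complex) hspace"
  where "fock_space H =
    \<lparr>hcarrier = {\<Phi>.
       (\<forall>gs. gs \<notin> lists (hcarrier H) \<longrightarrow> \<Phi> gs = 0) \<and>
       multi_antilinear H \<Phi> \<and> multi_bounded H \<Phi> \<and> antisymmetric_form H \<Phi> \<and>
       (\<lambda>bs. (cmod (\<Phi> bs))\<^sup>2) summable_on lists (some_basis H)},
     hzero = (\<lambda>gs. 0),
     hadd = (\<lambda>\<Phi> \<Psi> gs. \<Phi> gs + \<Psi> gs),
     hscale = (\<lambda>z \<Phi> gs. z * \<Phi> gs),
     hinner = (\<lambda>\<Phi> \<Psi>. \<Sum>\<^sub>\<infinity>bs\<in>lists (some_basis H). cnj (\<Phi> bs) * \<Psi> bs)\<rparr>"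

text \<open>\<open>\<Gamma>(U)\<close> for unitary \<open>U\<close>: since \<open>\<langle>g,Uf\<rangle> = \<langle>U\<^sup>-\<^sup>1g,f\<rangle>\<close>, the operator \<open>U\<^sup>\<otimes>\<^sup>m\<close> sends the functional
  \<open>\<Phi>\<close> to \<open>(g\<^sub>1,\<dots>,g\<^sub>m) \<mapsto> \<Phi>(U\<^sup>-\<^sup>1g\<^sub>1,\<dots>,U\<^sup>-\<^sup>1g\<^sub>m)\<close>.\<close>

definition second_quant ::
    "'v hspace \<Rightarrow> ('v \<Rightarrow> 'v) \<Rightarrow> ('v list \<Rightarrow> complex) \<Rightarrow> 'v list \<Rightarrow> complex"
  where "second_quant H U \<Phi> gs =
    (if gs \<in> lists (hcarrier H) then \<Phi> (map (inv_into (hcarrier H) U) gs) else 0)"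


section \<open>The CAR algebra\<close>

class cstar_algebra = real_normed_algebra_1 + banach +
  fixes scaleC :: "complex \<Rightarrow> 'a \<Rightarrow> 'a"
    and star :: "'a \<Rightarrow> 'a"
  assumes scaleC_add_right: "scaleC z (x + y) = scaleC z x + scaleC z y"
    and scaleC_add_left: "scaleC (z + w) x = scaleC z x + scaleC w x"
    and scaleC_scaleC: "scaleC z (scaleC w x) = scaleC (z * w) x"
    and scaleC_of_real: "scaleC (complex_of_real r) x = scaleR r x"
    and mult_scaleC_left: "scaleC z x * y = scaleC z (x * y)"
    and mult_scaleC_right: "x * scaleC z y = scaleC z (x * y)"
    and norm_scaleC: "norm (scaleC z x) = cmod z * norm x"
    and star_star: "star (star x) = x"
    and star_add: "star (x + y) = star x + star y"
    and star_scaleC: "star (scaleC z x) = scaleC (cnj z) (star x)"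
    and star_mult: "star (x * y) = star y * star x"
    and cstar_identity: "norm (star x * x) = (norm x)\<^sup>2"

definition cstar_subalgebra :: "'a::cstar_algebra set \<Rightarrow> bool"
  where "cstar_subalgebra S \<longleftrightarrow>
    closed S \<and> 1 \<in> S \<and> (\<forall>x\<in>S. \<forall>y\<in>S. x + y \<in> S \<and> x * y \<in> S) \<and>
    (\<forall>x\<in>S. star x \<in> S \<and> (\<forall>z. scaleC z x \<in> S))"

definition star_automorphism :: "('a::cstar_algebra \<Rightarrow> 'a) \<Rightarrow> bool"
  where "star_automorphism \<alpha> \<longleftrightarrow>
    bij \<alpha> \<and> (\<forall>x y. \<alpha> (x + y) = \<alpha> x + \<alpha> y \<and> \<alpha> (x * y) = \<alpha> x * \<alpha> y) \<and>
    (\<forall>x. \<alpha> (star x) = star (\<alpha> x) \<and> (\<forall>z. \<alpha> (scaleC z x) = scaleC z (\<alpha> x)))"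

text \<open>\<open>is_CAR_algebra H a\<close>: the type \<open>'a\<close>, with generators \<open>a(f)\<close>, is the algebra \<open>CAR(H)\<close>.\<close>

definition is_CAR_algebra :: "'v hspace \<Rightarrow> ('v \<Rightarrow> 'a::cstar_algebra) \<Rightarrow> bool"
  where "is_CAR_algebra H a \<longleftrightarrow>
    (\<forall>f\<in>hcarrier H. \<forall>g\<in>hcarrier H. a (hadd H f g) = a f + a g) \<and>
    (\<forall>z. \<forall>f\<in>hcarrier H. a (hscale H z f) = scaleC (cnj z) (a f)) \<and>
    (\<forall>f\<in>hcarrier H. \<forall>\<epsilon>>0. \<exists>\<delta>>0. \<forall>g\<in>hcarrier H. hdist H g f < \<delta> \<longrightarrow> dist (a g) (a f) < \<epsilon>) \<and>
    (\<forall>f\<in>hcarrier H. \<forall>g\<in>hcarrier H.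
      a f * star (a g) + star (a g) * a f = scaleC (hinner H f g) 1 \<and>
      a f * a g + a g * a f = 0) \<and>
    (\<forall>S. cstar_subalgebra S \<and> a ` hcarrier H \<subseteq> S \<longrightarrow> S = UNIV)"

definition fixed_point_algebra :: "'g set \<Rightarrow> ('g \<Rightarrow> 'a \<Rightarrow> 'a) \<Rightarrow> 'a set"
  where "fixed_point_algebra \<G> \<kappa> = {x. \<forall>\<gamma>\<in>\<G>. \<kappa> \<gamma> x = x}"

end

theory Submission
  imports Defs "HOL-Library.Function_Algebras"
begin

text \<open>
  It suffices that the gauge action on \<open>L\<^sup>2(E)\<close> is weakly mixing: for finitely many \<open>f, g\<close> there is
  \<open>\<gamma>\<close> making all \<open>|\<langle>V\<^sub>\<gamma> f, g\<rangle>|\<close> small.  Indeed, approximate a fixed point \<open>x\<close> by a polynomial \<open>p\<close> in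
  orthonormal self-adjoint generators \<open>e\<^sub>i\<close>, and let \<open>e\<^sub>0\<close> be one more such generator.  As
  \<open>\<kappa>\<^sub>\<gamma>\<close> is contractive, \<open>x\<close> is also close to \<open>\<kappa>\<^sub>\<gamma>(p)\<close>, which almost commutes with the even elements
  \<open>e\<^sub>0 e\<^sub>i\<close> when \<open>V\<^sub>\<gamma>\<close> moves the generators nearly orthogonally to the original ones.  Hence averaging over
  the conjugations by the \<open>e\<^sub>0 e\<^sub>i\<close>, which turns \<open>p\<close> into a scalar, almost fixes \<open>x\<close>, so \<open>x\<close> is
  close to a scalar.

  In case (i) weak mixing comes from the smooth functions on \<open>M\<close> of modulus one: they separate points,
  and the diagonal is a null set because \<open>\<mu>\<close> is diffuse.  In case (ii) an action that is not weakly mixing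
  has a nonzero invariant Hilbert--Schmidt operator, obtained by minimizing the norm over a convex hull.
  Extended by zero from the one-particle space, it lies in the commutant on Fock space, so by hypothesis
  it commutes with all functions of modulus one, which is impossible because these are weakly mixing.
\<close>

section \<open>C*-algebras\<close>

text \<open>Products of two generators are used because they nearly commute with every moved
  generator, whatever the parity of \<open>p\<close>; a single generator nearly anticommutes with it
  and would change the sign of odd terms. The extra generator \<open>e0\<close> is itself supplied
  by weak mixing: some moved generator is nearly orthogonal to all of \<open>E\<close>, so its
  Gram-Schmidt residual does not vanish. Contractivity makes the error bounds independent of the
  group element. In case (ii) the danger is that the minimization ends at zero. Failure of weak
  mixing excludes this: it bounds from below the trace pairing of every convex combination with the
  initial finite rank operator, and the bound survives in the limit. Only limits of matrix
  coefficients are formed, with bounded antilinear functionals in place of vectors, so neither a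
  completion of the finite rank operators nor Riesz representation enters. A Borel lift of the base
  to the principal bundle turns sections into functions with values in \<open>complex^'n\<close>;
  classes modulo null sets are handled by one quotient map.\<close>

lemma scaleC_zero_left [simp]: "scaleC 0 (x::'a::cstar_algebra) = 0"
  using scaleC_of_real[of 0 x] by simp

lemma scaleC_one [simp]: "scaleC 1 (x::'a::cstar_algebra) = x"
  using scaleC_of_real[of 1 x] by simp

lemma scaleC_zero_right [simp]: "scaleC z (0::'a::cstar_algebra) = 0"
  using norm_scaleC[of z "0::'a"] by simp

lemma scaleC_minus_left [simp]: "scaleC (- z) (x::'a::cstar_algebra) = - scaleC z x"
  using scaleC_add_left[of z "- z" x] by (simp add: eq_neg_iff_add_eq_0 add.commute)

lemma scaleC_minus_right [simp]: "scaleC z (- x::'a::cstar_algebra) = - scaleC z x"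
  using scaleC_add_right[of z x "- x"] by (simp add: eq_neg_iff_add_eq_0 add.commute)

lemma scaleC_diff_right: "scaleC z (x - y::'a::cstar_algebra) = scaleC z x - scaleC z y"
  using scaleC_add_right[of z x "- y"] by simp

lemma scaleC_one_cancel [simp]: "scaleC z (1::'a::cstar_algebra) = scaleC w 1 \<longleftrightarrow> z = w"
proof
  assume "scaleC z (1::'a) = scaleC w 1"
  then have "scaleC (z - w) (1::'a) = 0"
    using scaleC_add_left[of z "- w" "1::'a"] by simp
  then have "cmod (z - w) = 0" using norm_scaleC[of "z - w" "1::'a"] by simp
  then show "z = w" by simp
qed simp

lemma star_zero [simp]: "star (0::'a::cstar_algebra) = 0"
  using star_scaleC[of 0 "0::'a"] by simp

lemma star_one [simp]: "star (1::'a::cstar_algebra) = 1"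
  using star_mult[of "star 1" "1::'a"] by (simp add: star_star)

lemma star_minus [simp]: "star (- x::'a::cstar_algebra) = - star x"
  using star_scaleC[of "-1" x] by simp

lemma star_scaleR: "star (r *\<^sub>R x::'a::cstar_algebra) = r *\<^sub>R star x"
  using star_scaleC[of "complex_of_real r" x] by (simp add: scaleC_of_real)

text \<open>One inequality is enough: the C*-identity gives
  \<open>norm y \<le> norm (star y)\<close>, and \<open>star\<close> is an involution.\<close>

lemma norm_star [simp]: "norm (star x::'a::cstar_algebra) = norm x"
proof -
  have le: "norm y \<le> norm (star y)" for y :: 'a
  proof (cases "y = 0")
    case False
    have "norm y * norm y \<le> norm (star y) * norm y"
      using cstar_identity[of y] norm_mult_ineq[of "star y" y] by (simp add: power2_eq_square)
    then show ?thesis using False by simp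
  qed simp
  show ?thesis using le[of x] le[of "star x"] by (simp add: star_star)
qed

lemma bounded_linear_star: "bounded_linear (star :: 'a::cstar_algebra \<Rightarrow> 'a)"
  by (rule bounded_linear_intro[where K = 1]) (auto simp: star_add star_scaleR)

lemma norm_selfadjoint_sq: "star x = x \<Longrightarrow> (norm (x::'a::cstar_algebra))\<^sup>2 = norm (x * x)"
  using cstar_identity[of x] by simp

lemma selfadjoint_square_eq_0: "star x = x \<Longrightarrow> x * x = 0 \<Longrightarrow> (x::'a::cstar_algebra) = 0"
  using norm_selfadjoint_sq[of x] by simp

text \<open>The binomial series for the square root of \<open>1 - u\<close> converges absolutely and
  replaces continuous functional calculus. As a limit of real polynomials in \<open>u\<close>, the
  root inherits self-adjointness and commutes with everything that commutes with
  \<open>u\<close>.\<close>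

lemma sqrt_one_minus_exists:
  fixes u :: "'a::cstar_algebra"
  assumes u: "norm u < 1" "star u = u"
  obtains z where "z * z = 1 - u" "star z = z" "\<And>y. y * u = u * y \<Longrightarrow> y * z = z * y"
proof -
  define c :: "nat \<Rightarrow> real" where "c n = (1/2) gchoose n" for n
  define s where "s n = c n *\<^sub>R (- u) ^ n" for n
  define z where "z = (\<Sum>n. s n)"
  \<comment> \<open>Convergence of the scalar series at some \<open>t > norm u\<close> gives
    absolute convergence at \<open>norm u\<close>.\<close>
  obtain t where t: "norm u < t" "t < 1" using dense[OF u(1)] by blast
  have t0: "0 < t" using t(1) norm_ge_zero[of u] by linarith
  have "summable (\<lambda>n. c n * t ^ n)"
    using sqrt_series[of t] t(2) t0 unfolding c_def by (auto simp: sums_iff)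
  then have "summable (\<lambda>n. norm (c n * (norm u) ^ n))"
    by (rule powser_insidea) (use t t0 in auto)
  then have sn: "summable (\<lambda>n. norm (s n))"
  proof (rule summable_comparison_test')
    fix n :: nat
    show "norm (norm (s n)) \<le> norm (c n * norm u ^ n)"
      unfolding s_def using norm_power_ineq[of "- u" n]
      by (simp add: abs_mult mult_left_mono)
  qed
  then have ss: "summable s" by (rule summable_norm_cancel)
  \<comment> \<open>By Vandermonde with \<open>1/2 + 1/2 = 1\<close> the coefficients of the square
    are \<open>1 gchoose k\<close>, which vanish from \<open>k = 2\<close> on.\<close>
  have conv: "(\<Sum>i\<le>k. s i * s (k - i)) = (if k = 0 then 1 else if k = 1 then - u else 0)" for k
  proof -
    have "(\<Sum>i\<le>k. s i * s (k - i)) = (\<Sum>i\<le>k. (c i * c (k - i)) *\<^sub>R (- u) ^ k)"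
    proof (rule sum.cong[OF refl])
      fix i assume "i \<in> {..k}"
      then have "(- u) ^ i * (- u) ^ (k - i) = (- u) ^ k" by (simp flip: power_add)
      then show "s i * s (k - i) = (c i * c (k - i)) *\<^sub>R (- u) ^ k"
        by (simp add: s_def mult.commute)
    qed
    also have "\<dots> = (\<Sum>i\<le>k. c i * c (k - i)) *\<^sub>R (- u) ^ k" by (simp add: scaleR_sum_left)
    also have "(\<Sum>i\<le>k. c i * c (k - i)) = (1::real) gchoose k"
      unfolding c_def using gbinomial_Vandermonde[of "1/2::real" "1/2" k]
      by (simp add: atMost_atLeast0)
    also have "(1::real) gchoose k = of_nat (1 choose k)"
      by (metis binomial_gbinomial of_nat_1)
    finally show ?thesis by (cases k) (auto simp: binomial_eq_0)
  qed
  have "(\<lambda>k. \<Sum>i\<le>k. s i * s (k - i)) sums (z * z)"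
    unfolding z_def by (rule Cauchy_product_sums[OF sn sn])
  moreover have "(\<lambda>k. \<Sum>i\<le>k. s i * s (k - i)) sums (1 - u)"
  proof -
    have "(\<lambda>k. if k = 0 then 1 else if k = 1 then - u else 0) sums
        (\<Sum>k\<in>{0,1::nat}. if k = 0 then 1 else if k = 1 then - u else 0)"
      by (rule sums_finite) auto
    then show ?thesis unfolding conv by simp
  qed
  ultimately have zz: "z * z = 1 - u" by (rule sums_unique2)
  have spow: "star (x ^ n) = star x ^ n" for x :: 'a and n
    by (induction n) (auto simp: star_mult power_commutes)
  have zs: "star z = z"
    unfolding z_def bounded_linear.suminf[OF bounded_linear_star ss]
    by (simp add: s_def[abs_def] star_scaleR spow u)
  have zc: "y * z = z * y" if "y * u = u * y" for y
  proof -
    have pc: "y * (- u) ^ n = (- u) ^ n * y" for n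
      by (rule power_commuting_commutes[symmetric]) (use that in simp)
    show ?thesis
      unfolding z_def suminf_mult[OF ss, symmetric] suminf_mult2[OF ss]
      by (simp add: s_def pc)
  qed
  show ?thesis using that zz zs zc by blast
qed

lemma star_automorphismD:
  assumes "star_automorphism \<alpha>"
  shows "\<alpha> (x + y) = \<alpha> x + \<alpha> y" "\<alpha> (x * y) = \<alpha> x * \<alpha> y" "\<alpha> (star x) = star (\<alpha> x)"
    "\<alpha> (scaleC z x) = scaleC z (\<alpha> x)" "\<alpha> 1 = 1" "\<alpha> (x - y) = \<alpha> x - \<alpha> y"
proof -
  note A = assms[unfolded star_automorphism_def]
  show "\<alpha> (x + y) = \<alpha> x + \<alpha> y" "\<alpha> (x * y) = \<alpha> x * \<alpha> y" "\<alpha> (star x) = star (\<alpha> x)"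
    "\<alpha> (scaleC z x) = scaleC z (\<alpha> x)" using A by auto
  \<comment> \<open>Unitality comes from surjectivity: a preimage of 1 shows that the image of 1
    equals 1.\<close>
  obtain w where w: "\<alpha> w = 1" using A by (metis bij_pointE)
  show "\<alpha> 1 = 1" using A w by (metis mult.right_neutral mult.left_neutral)
  have "\<alpha> (x - y) + \<alpha> y = \<alpha> x" using A by (metis diff_add_cancel)
  then show "\<alpha> (x - y) = \<alpha> x - \<alpha> y" by (simp add: eq_diff_eq)
qed

text \<open>For self-adjoint \<open>y\<close> of norm less than one write \<open>1 - y\<^sup>2 = z\<^sup>2\<close> with \<open>z\<close> self-adjoint and
  commuting with \<open>y\<close>.  Then \<open>w = \<alpha> y + i \<alpha> z\<close> is unitary, so its real part \<open>\<alpha> y\<close> has norm at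
  most one.\<close>

lemma star_automorphism_norm_le:
  fixes \<alpha> :: "'a::cstar_algebra \<Rightarrow> 'a"
  assumes \<alpha>: "star_automorphism \<alpha>"
  shows "norm (\<alpha> x) \<le> norm x"
proof -
  note A = star_automorphismD[OF \<alpha>]
  have le1: "norm (\<alpha> y) \<le> 1" if y: "star y = y" "norm y < 1" for y
  proof -
    have "norm (y * y) < 1"
      unfolding norm_selfadjoint_sq[OF y(1), symmetric] using y(2) by (simp add: power_less_one_iff)
    moreover have "star (y * y) = y * y" by (simp add: star_mult y)
    ultimately obtain z where z: "z * z = 1 - y * y" "star z = z"
        "\<And>x. x * (y * y) = (y * y) * x \<Longrightarrow> x * z = z * x"
      using sqrt_one_minus_exists by blast
    have c: "\<alpha> y * \<alpha> z = \<alpha> z * \<alpha> y" using z(3)[of y] by (simp add: mult.assoc flip: A)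
    define w where "w = \<alpha> y + scaleC \<i> (\<alpha> z)"
    have sw: "star w = \<alpha> y - scaleC \<i> (\<alpha> z)"
      by (simp add: w_def star_add star_scaleC y z flip: A(3))
    have "star w * w = \<alpha> y * \<alpha> y + \<alpha> z * \<alpha> z"
      unfolding sw by (simp add: w_def algebra_simps mult_scaleC_left mult_scaleC_right scaleC_scaleC
        scaleC_diff_right scaleC_add_right c)
    also have "\<dots> = \<alpha> (y * y + z * z)" by (simp add: A)
    also have "\<dots> = 1" by (simp add: z A)
    finally have "(norm w)\<^sup>2 = 1" using cstar_identity[of w] by simp
    then have nw: "norm w = 1" by (simp add: power2_eq_1_iff)
       (metis abs_norm_cancel abs_1 norm_ge_zero not_one_le_zero neg_0_le_iff_le)
    have "2 *\<^sub>R \<alpha> y = w + star w" unfolding sw by (simp add: w_def scaleR_2)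
    then have "2 * norm (\<alpha> y) \<le> norm w + norm (star w)"
      by (metis norm_scaleR norm_triangle_ineq abs_numeral)
    then show ?thesis by (simp add: nw)
  qed
  \<comment> \<open>Scaling by \<open>norm y + e\<close> puts the norm strictly below one, as the
    square root requires; \<open>e\<close> is then arbitrary.\<close>
  have le: "norm (\<alpha> y) \<le> norm y" if y: "star y = y" for y
  proof (rule field_le_epsilon)
    fix e :: real assume e: "e > 0"
    define r where "r = norm y + e"
    have r: "r > 0" using e by (simp add: r_def add_nonneg_pos)
    have ar: "\<alpha> ((1/r) *\<^sub>R y) = (1/r) *\<^sub>R \<alpha> y"
      using A(4)[of "complex_of_real (1/r)" y] by (simp only: scaleC_of_real)
    have "norm ((1/r) *\<^sub>R y) < 1" using r e by (simp add: r_def divide_less_eq)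
    then have "norm (\<alpha> ((1/r) *\<^sub>R y)) \<le> 1" by (intro le1) (simp_all add: star_scaleR y)
    then show "norm (\<alpha> y) \<le> norm y + e" using r unfolding ar by (simp add: r_def divide_le_eq)
  qed
  \<comment> \<open>The C*-identity reduces an arbitrary element to the self-adjoint
    \<open>star x * x\<close>.\<close>
  have "(norm (\<alpha> x))\<^sup>2 = norm (\<alpha> (star x * x))" by (simp add: A cstar_identity)
  also have "\<dots> \<le> norm (star x * x)" by (intro le) (simp add: star_mult star_star)
  finally have "(norm (\<alpha> x))\<^sup>2 \<le> (norm x)\<^sup>2" by (simp add: cstar_identity)
  then show ?thesis by (simp add: power2_le_iff_abs_le)
qed

section \<open>Fixed points of weakly mixing actions on the CAR algebra\<close>

text \<open>Words grow by one generator on the left only, so that each later induction treats a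
  single generator at a time; closure under products is derived.\<close>

inductive_set poly_span :: "'a::cstar_algebra set \<Rightarrow> 'a set" for S where
  one: "1 \<in> poly_span S"
| add: "p \<in> poly_span S \<Longrightarrow> q \<in> poly_span S \<Longrightarrow> p + q \<in> poly_span S"
| scaleC: "p \<in> poly_span S \<Longrightarrow> scaleC z p \<in> poly_span S"
| mult: "s \<in> S \<Longrightarrow> p \<in> poly_span S \<Longrightarrow> s * p \<in> poly_span S"

lemma poly_span_zero: "0 \<in> poly_span S"
  using poly_span.scaleC[OF poly_span.one, of 0 S] by simp

lemma poly_span_scaleR: "p \<in> poly_span S \<Longrightarrow> r *\<^sub>R p \<in> poly_span S"
  using poly_span.scaleC[where z = "complex_of_real r"] by (fastforce simp: scaleC_of_real)

lemma poly_span_uminus: "p \<in> poly_span S \<Longrightarrow> - p \<in> poly_span S"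
  using poly_span.scaleC[where z = "-1"] by fastforce

lemma poly_span_sum: "(\<And>i. i \<in> I \<Longrightarrow> f i \<in> poly_span S) \<Longrightarrow> sum f I \<in> poly_span S"
  by (induction I rule: infinite_finite_induct) (auto intro: poly_span_zero poly_span.add)

lemma poly_span_mult: "p \<in> poly_span S \<Longrightarrow> q \<in> poly_span S \<Longrightarrow> p * q \<in> poly_span S"
  by (induction p rule: poly_span.induct)
    (auto simp: algebra_simps mult_scaleC_left intro: poly_span.intros)

lemma poly_span_base: "s \<in> S \<Longrightarrow> s \<in> poly_span S"
  using poly_span.mult[OF _ poly_span.one, of s S] by simp

lemma poly_span_mono: "p \<in> poly_span S \<Longrightarrow> S \<subseteq> poly_span T \<Longrightarrow> p \<in> poly_span T"
  by (induction p rule: poly_span.induct) (auto intro: poly_span.intros poly_span_mult)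

lemma poly_span_star:
  assumes "p \<in> poly_span S" "\<And>s. s \<in> S \<Longrightarrow> star s = s"
  shows "star p \<in> poly_span S"
  using assms(1)
  by (induction p rule: poly_span.induct)
    (auto simp: star_add star_scaleC star_mult assms(2) intro: poly_span.intros poly_span_mult poly_span_base)

lemma poly_span_finite:
  "p \<in> poly_span S \<Longrightarrow> \<exists>F. finite F \<and> F \<subseteq> S \<and> p \<in> poly_span F"
proof (induction p rule: poly_span.induct)
  case one
  then show ?case by (intro exI[of _ "{}"]) (auto intro: poly_span.one)
next
  case (add p q)
  then obtain F G where "finite F" "F \<subseteq> S" "p \<in> poly_span F" "finite G" "G \<subseteq> S" "q \<in> poly_span G"
    by blast
  moreover from this have "p \<in> poly_span (F \<union> G)" "q \<in> poly_span (F \<union> G)"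
    by (auto elim!: poly_span_mono intro: poly_span_base)
  ultimately show ?case by (intro exI[of _ "F \<union> G"]) (auto intro: poly_span.add)
next
  case (scaleC p z)
  then show ?case by (blast intro: poly_span.scaleC)
next
  case (mult s p)
  then obtain F where F: "finite F" "F \<subseteq> S" "p \<in> poly_span F" by blast
  then have "p \<in> poly_span (insert s F)"
    by (auto elim!: poly_span_mono intro: poly_span_base)
  then show ?case using F mult by (intro exI[of _ "insert s F"]) (auto intro: poly_span.mult)
qed

lemma poly_span_empty: "p \<in> poly_span {} \<Longrightarrow> \<exists>z. p = scaleC z 1"
proof (induction p rule: poly_span.induct)
  case one
  show ?case by (rule exI[of _ 1]) simp
qed (auto simp: scaleC_scaleC simp flip: scaleC_add_left)

text \<open>Known in physics as Majorana operators. For the Clifford form \<open>b\<close> below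
  these are the orthonormal families (\<open>majorana_iff\<close>).\<close>

definition majorana_system :: "'a::cstar_algebra set \<Rightarrow> bool" where
  "majorana_system E \<longleftrightarrow> (\<forall>e\<in>E. star e = e \<and> e * e = 1) \<and> (\<forall>e\<in>E. \<forall>s\<in>E. e \<noteq> s \<longrightarrow> e * s = - (s * e))"

lemma majorana_system_subset: "majorana_system E \<Longrightarrow> D \<subseteq> E \<Longrightarrow> majorana_system D"
  unfolding majorana_system_def by blast

lemma norm_majorana: "star e = e \<Longrightarrow> e * e = 1 \<Longrightarrow> norm (e::'a::cstar_algebra) = 1"
  using norm_selfadjoint_sq[of e] norm_ge_zero[of e] by (auto simp: power2_eq_1_iff)

text \<open>An occurrence of \<open>e\<close> can be moved to the far left at the cost of a sign,
  and two of them cancel because \<open>e * e = 1\<close>; hence the first power of \<open>e\<close>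
  is enough.\<close>

lemma poly_span_split:
  assumes E: "majorana_system E" "e \<in> E" and p: "p \<in> poly_span E"
  shows "\<exists>q r. q \<in> poly_span (E - {e}) \<and> r \<in> poly_span (E - {e}) \<and> p = q + e * r"
  using p
proof (induction p rule: poly_span.induct)
  case one
  have "1 = 1 + e * 0" by simp
  then show ?case using poly_span.one poly_span_zero by blast
next
  case (add p1 p2)
  then obtain q1 r1 q2 r2 where "q1 \<in> poly_span (E - {e})" "r1 \<in> poly_span (E - {e})"
    "q2 \<in> poly_span (E - {e})" "r2 \<in> poly_span (E - {e})" "p1 = q1 + e * r1" "p2 = q2 + e * r2" by blast
  then show ?case
    by (intro exI[of _ "q1 + q2"] exI[of _ "r1 + r2"]) (auto intro: poly_span.add simp: algebra_simps)
next
  case (scaleC p z)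
  then obtain q r where "q \<in> poly_span (E - {e})" "r \<in> poly_span (E - {e})" "p = q + e * r" by blast
  then show ?case
    by (intro exI[of _ "scaleC z q"] exI[of _ "scaleC z r"])
      (auto intro: poly_span.scaleC simp: scaleC_add_right mult_scaleC_right)
next
  case (mult s p)
  then obtain q r where qr: "q \<in> poly_span (E - {e})" "r \<in> poly_span (E - {e})" "p = q + e * r" by blast
  show ?case
  proof (cases "s = e")
    case True
    have "e * (e * r) = r" using E by (simp add: majorana_system_def flip: mult.assoc)
    then have "s * p = r + e * q" by (simp add: True qr(3) distrib_left)
    then show ?thesis using qr(1,2) by (intro exI[of _ r] exI[of _ q]) simp
  next
    case False
    then have se: "s * e = - (e * s)" using E mult(1) unfolding majorana_system_def by blast
    have "s * p = s * q + (s * e) * r"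
      by (simp add: qr(3) distrib_left mult.assoc)
    then have "s * p = s * q + e * (- (s * r))" by (simp add: se mult.assoc)
    moreover have "s * q \<in> poly_span (E - {e})" "- (s * r) \<in> poly_span (E - {e})"
      using qr False mult(1) by (auto intro!: poly_span.mult poly_span_uminus)
    ultimately show ?thesis by (intro exI[of _ "s * q"] exI[of _ "- (s * r)"]) simp
  qed
qed

text \<open>Conjugation by \<open>e\<^sub>0 e\<close> fixes all other generators and changes the sign of \<open>e\<close>; averaging over it
  eliminates \<open>e\<close> from a polynomial.\<close>

lemma near_scalar_if_almost_commuting:
  fixes x :: "'a::cstar_algebra"
  assumes "finite E" "majorana_system (insert e0 E)" "e0 \<notin> E"
    and "p \<in> poly_span E" "norm (x - p) \<le> \<epsilon>"
    and "\<And>e. e \<in> E \<Longrightarrow> norm (e0 * e * x - x * (e0 * e)) \<le> \<eta>"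
  shows "\<exists>z. norm (x - scaleC z 1) \<le> \<epsilon> + real (card E) * \<eta>"
  using assms
proof (induction E arbitrary: p \<epsilon> rule: finite_induct)
  case empty
  then show ?case using poly_span_empty by fastforce
next
  case (insert e E)
  note M = insert.prems(1)[unfolded majorana_system_def]
  have anti: "a * b = - (b * a)" if "a \<in> insert e0 (insert e E)" "b \<in> insert e0 (insert e E)" "a \<noteq> b" for a b
    using M that by blast
  \<comment> \<open>\<open>v\<close> is the inverse of \<open>w\<close>, and both have norm at most
    1, so conjugation by \<open>w\<close> does not increase errors.\<close>
  define w v where "w = e0 * e" and "v = e * e0"
  have e0e0: "e0 * e0 = 1" and ee: "e * e = 1" and se: "star e0 = e0" "star e = e" using M by blast+
  have wv: "w * v = 1" "v * w = 1"
    by (simp_all add: w_def v_def mult.assoc e0e0 ee) (simp_all add: e0e0 ee flip: mult.assoc)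
  have "norm e = 1" "norm e0 = 1" by (intro norm_majorana ee e0e0 se)+
  then have nw: "norm w \<le> 1" "norm v \<le> 1"
    unfolding w_def v_def using norm_mult_ineq[of e0 e] norm_mult_ineq[of e e0] by auto
  have "majorana_system (insert e E)" using insert.prems(1) by (rule majorana_system_subset) blast
  then obtain q r where qr: "q \<in> poly_span (insert e E - {e})" "r \<in> poly_span (insert e E - {e})" "p = q + e * r"
    using poly_span_split[of "insert e E" e p] insert.prems(3) by blast
  have E': "insert e E - {e} = E" using insert.hyps by auto
  \<comment> \<open>A generator different from \<open>e\<close> and \<open>e0\<close> passes two
    factors and picks up two signs.\<close>
  have cw: "w * y = y * w" if "y \<in> poly_span E" for y
    using that
  proof (induction y rule: poly_span.induct)
    case (mult s y)
    have "s \<noteq> e" "s \<noteq> e0" using mult insert by auto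
    then have es: "e * s = - (s * e)" "e0 * s = - (s * e0)" using mult(1) by (auto intro: anti)
    have "w * s = - ((e0 * s) * e)" by (simp add: w_def mult.assoc es(1))
    also have "\<dots> = s * w" unfolding es(2) by (simp add: w_def mult.assoc)
    finally have "w * (s * y) = s * (w * y)" by (simp flip: mult.assoc)
    then show ?case by (simp add: mult.IH mult.assoc)
  qed (auto simp: algebra_simps mult_scaleC_left mult_scaleC_right)
  have "e0 * e = - (e * e0)" by (rule anti) (use insert.prems(2) in auto)
  then have we: "w * e * v = - e"
    unfolding w_def v_def by (simp add: mult.assoc ee) (simp add: e0e0 ee flip: mult.assoc)
  have "w * p * v = w * q * v + w * e * (r * v)" by (simp add: qr(3) algebra_simps)
  also have "w * q * v = q" using cw[of q] qr(1) wv E' by (simp add: mult.assoc)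
  also have "r * v = v * (w * r) * v" by (simp add: wv flip: mult.assoc)
  also have "\<dots> = v * r" using cw[of r] qr(2) E' by (simp add: mult.assoc wv)
  also have "w * e * (v * r) = - (e * r)" using we by (simp flip: mult.assoc)
  finally have wp: "w * p * v = q - e * r" by simp
  define y where "y = w * x * v"
  have "norm (y - (q - e * r)) = norm (w * (x - p) * v)" by (simp add: y_def algebra_simps flip: wp)
  also have "\<dots> \<le> norm (w * (x - p)) * norm v" by (rule norm_mult_ineq)
  also have "\<dots> \<le> (norm w * norm (x - p)) * norm v" by (intro mult_right_mono norm_mult_ineq) auto
  also have "\<dots> \<le> (1 * \<epsilon>) * 1"
    using order_trans[OF norm_ge_zero insert.prems(4)]
    by (intro mult_mono nw insert.prems mult_nonneg_nonneg) auto
  finally have d1: "norm (y - (q - e * r)) \<le> \<epsilon>" by simp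
  have "norm (y - x) = norm ((w * x - x * w) * v)" by (simp add: y_def algebra_simps wv mult.assoc)
  also have "\<dots> \<le> norm (w * x - x * w) * norm v" by (rule norm_mult_ineq)
  also have "\<dots> \<le> \<eta> * 1"
    using insert.prems(5)[of e] nw by (intro mult_mono) (auto simp: w_def intro: order_trans[OF norm_ge_zero])
  finally have d2: "norm (y - x) \<le> \<eta>" by simp
  \<comment> \<open>\<open>q\<close> is the mean of \<open>p = q + e * r\<close> and its conjugate
    \<open>q - e * r\<close>. These lie within \<epsilon> of \<open>x\<close> and of
    \<open>y\<close>, and replacing \<open>y\<close> by \<open>x\<close> costs \<eta>.\<close>
  have "2 *\<^sub>R (x - q) = (x - p) + (y - (q - e * r)) - (y - x)"
    by (simp add: qr(3) scaleR_2)
  then have "norm (2 *\<^sub>R (x - q)) \<le> norm (x - p) + norm (y - (q - e * r)) + norm (y - x)"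
    using norm_triangle_ineq4[of "(x - p) + (y - (q - e * r))" "y - x"]
      norm_triangle_ineq[of "x - p" "y - (q - e * r)"] by simp
  then have "2 * norm (x - q) \<le> norm (x - p) + norm (y - (q - e * r)) + norm (y - x)" by simp
  then have "norm (x - q) \<le> \<epsilon> + \<eta>"
    using d1 d2 insert.prems(4) norm_ge_zero[of "y - x"] by linarith
  \<comment> \<open>Each eliminated generator adds one \<eta> to the error, which is why \<epsilon>
    is kept arbitrary in the induction.\<close>
  then have "\<exists>z. norm (x - scaleC z 1) \<le> (\<epsilon> + \<eta>) + real (card E) * \<eta>"
    using insert.prems qr(1) E'
    by (intro insert.IH[of q]) (auto intro: majorana_system_subset)
  then show ?case using insert.hyps by (simp add: algebra_simps)
qed

section \<open>The Clifford form on self-adjoint generators and Gram-Schmidt\<close>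

text \<open>In the application \<open>C\<close> consists of all \<open>a f + star (a f)\<close>, and
  \<open>b\<close> is the real part of the inner product. Bilinearity and positivity of
  \<open>b\<close> are consequences: the first follows by comparing anticommutators, the second from
  the C*-identity. Thus all that is used of the inner product is read off the CAR relations.\<close>

locale clifford_space =
  fixes C :: "'a::cstar_algebra set" and b :: "'a \<Rightarrow> 'a \<Rightarrow> real"
  assumes C_add: "x \<in> C \<Longrightarrow> y \<in> C \<Longrightarrow> x + y \<in> C"
    and C_scaleR: "x \<in> C \<Longrightarrow> r *\<^sub>R x \<in> C"
    and C_star: "x \<in> C \<Longrightarrow> star x = x"
    and clifford: "x \<in> C \<Longrightarrow> y \<in> C \<Longrightarrow> x * y + y * x = (2 * b x y) *\<^sub>R 1"
begin

lemma C_zero: "x \<in> C \<Longrightarrow> 0 \<in> C"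
  using C_scaleR[of x 0] by simp

lemma C_sum: "x \<in> C \<Longrightarrow> (\<And>i. i \<in> I \<Longrightarrow> f i \<in> C) \<Longrightarrow> sum f I \<in> C"
  by (induction I rule: infinite_finite_induct) (auto intro: C_zero C_add)

lemma C_diff: "x \<in> C \<Longrightarrow> y \<in> C \<Longrightarrow> x - y \<in> C"
  using C_add[of x "(-1) *\<^sub>R y"] C_scaleR[of y "-1"] by simp

lemma b_eqI: "x \<in> C \<Longrightarrow> y \<in> C \<Longrightarrow> x * y + y * x = (2 * r) *\<^sub>R 1 \<Longrightarrow> b x y = r"
  using clifford[of x y] by simp

lemma b_commute: "x \<in> C \<Longrightarrow> y \<in> C \<Longrightarrow> b x y = b y x"
  by (rule b_eqI) (auto simp: clifford[symmetric] add.commute)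

lemma b_add: "x \<in> C \<Longrightarrow> y \<in> C \<Longrightarrow> w \<in> C \<Longrightarrow> b (x + y) w = b x w + b y w"
proof (rule b_eqI)
  assume x: "x \<in> C" "y \<in> C" "w \<in> C"
  have "(x + y) * w + w * (x + y) = (x * w + w * x) + (y * w + w * y)" by (simp add: algebra_simps)
  then show "(x + y) * w + w * (x + y) = (2 * (b x w + b y w)) *\<^sub>R 1"
    using x by (simp add: clifford scaleR_left_distrib distrib_left)
qed (auto intro: C_add)

lemma b_scaleR: "x \<in> C \<Longrightarrow> w \<in> C \<Longrightarrow> b (r *\<^sub>R x) w = r * b x w"
proof (rule b_eqI)
  assume x: "x \<in> C" "w \<in> C"
  have "r *\<^sub>R x * w + w * r *\<^sub>R x = r *\<^sub>R (x * w + w * x)" by (simp add: algebra_simps)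
  then show "r *\<^sub>R x * w + w * r *\<^sub>R x = (2 * (r * b x w)) *\<^sub>R 1"
    using x by (simp add: clifford)
qed (auto intro: C_scaleR)

lemma b_diff: "x \<in> C \<Longrightarrow> y \<in> C \<Longrightarrow> w \<in> C \<Longrightarrow> b (x - y) w = b x w - b y w"
  using b_add[of x "(-1) *\<^sub>R y" w] b_scaleR[of y w "-1"] C_scaleR[of y "-1"] by simp

lemma b_sum:
  assumes "w \<in> C" "\<And>i. i \<in> I \<Longrightarrow> f i \<in> C"
  shows "b (sum f I) w = (\<Sum>i\<in>I. b (f i) w)"
proof -
  have b0: "b 0 w = 0" using b_scaleR[OF assms(1) assms(1), of 0] by simp
  show ?thesis using assms(2)
  proof (induction I rule: infinite_finite_induct)
    case (insert i I)
    then show ?case using C_sum[OF assms(1), of I f] by (simp add: b_add assms(1))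
  qed (auto simp: b0)
qed

lemma square: "x \<in> C \<Longrightarrow> x * x = b x x *\<^sub>R 1"
  using clifford[of x x] by (metis scaleR_2 scaleR_scaleR scaleR_left_imp_eq zero_neq_numeral)

text \<open>If \<open>b x x = - t * t\<close> with \<open>t > 0\<close>, then
  \<open>y = x + \<i> t\<close> satisfies \<open>star y * y = 0\<close>, so \<open>x\<close> would
  be the scalar \<open>- \<i> t\<close>, which is not self-adjoint.\<close>

lemma b_nonneg: assumes x: "x \<in> C" shows "0 \<le> b x x"
proof (rule ccontr)
  assume neg: "\<not> 0 \<le> b x x"
  define t where "t = sqrt (- b x x)"
  have t: "t > 0" "t * t = - b x x" using neg by (auto simp: t_def)
  define y where "y = x + scaleC (\<i> * t) 1"
  have "star y * y = x * x + (t * t) *\<^sub>R 1"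
    by (simp add: y_def star_add star_scaleC C_star[OF x] algebra_simps mult_scaleC_left
      mult_scaleC_right scaleC_scaleC scaleC_diff_right scaleC_add_right flip: scaleC_of_real)
  then have "star y * y = 0" by (simp add: square[OF x] t)
  then have "y = 0" using cstar_identity[of y] by simp
  then have "x = scaleC (- (\<i> * t)) 1" by (simp add: y_def eq_neg_iff_add_eq_0)
  then have "scaleC (- (\<i> * t)) (1::'a) = scaleC (\<i> * t) 1"
    using C_star[OF x] by (metis complex_cnj_complex_of_real complex_cnj_i complex_cnj_minus
      complex_cnj_mult minus_minus mult_minus_left star_one star_scaleC)
  then show False using t by (simp only: scaleC_one_cancel) (simp add: complex_eq_iff)
qed

lemma b_eq_0: "x \<in> C \<Longrightarrow> b x x = 0 \<Longrightarrow> x = 0"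
  using selfadjoint_square_eq_0[of x] by (simp add: C_star square)

lemma majorana_iff:
  assumes "E \<subseteq> C"
  shows "majorana_system E \<longleftrightarrow> (\<forall>e\<in>E. \<forall>s\<in>E. b e s = (if e = s then 1 else 0))"
proof -
  have "e * e = 1 \<longleftrightarrow> b e e = 1" if "e \<in> E" for e
    using square[of e] assms that by (metis scaleR_one subsetD scaleR_cancel_right zero_neq_one)
  moreover have "e * s = - (s * e) \<longleftrightarrow> b e s = 0" if "e \<in> E" "s \<in> E" for e s
  proof -
    have "e \<in> C" "s \<in> C" using assms that by auto
    then show ?thesis using clifford[of e s] by (simp add: eq_neg_iff_add_eq_0)
  qed
  moreover have "star e = e" if "e \<in> E" for e using C_star assms that by auto
  ultimately show ?thesis unfolding majorana_system_def by auto
qed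

definition proj :: "'a set \<Rightarrow> 'a \<Rightarrow> 'a" where
  "proj E x = (\<Sum>e\<in>E. b x e *\<^sub>R e)"

text \<open>Orthogonal decomposition for \<open>b\<close>. The last identity, Pythagoras, detects
  whether \<open>x\<close> already lies in the real span of \<open>E\<close>.\<close>

lemma residual:
  assumes E: "finite E" "E \<subseteq> C" "majorana_system E" and x: "x \<in> C"
  shows "x - proj E x \<in> C" "e \<in> E \<Longrightarrow> b (x - proj E x) e = 0"
    "b (x - proj E x) (x - proj E x) = b x x - (\<Sum>e\<in>E. (b x e)\<^sup>2)"
proof -
  have pC: "proj E x \<in> C" unfolding proj_def by (rule C_sum[OF x]) (use E C_scaleR in auto)
  show rC: "x - proj E x \<in> C" by (rule C_diff[OF x pC])
  have pw: "b (proj E x) w = (\<Sum>e\<in>E. b x e * b e w)" if "w \<in> C" for w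
    unfolding proj_def using that E C_scaleR by (subst b_sum) (auto intro!: sum.cong simp: b_scaleR subset_iff)
  have r0: "b (x - proj E x) e = 0" if e: "e \<in> E" for e
  proof -
    have "(\<Sum>s\<in>E. b x s * b s e) = (\<Sum>s\<in>E. if s = e then b x e else 0)"
      using E e by (intro sum.cong) (auto simp: majorana_iff)
    then show ?thesis using e E x pC by (subst b_diff) (auto simp: pw subset_iff)
  qed
  show "e \<in> E \<Longrightarrow> b (x - proj E x) e = 0" by (rule r0)
  have rp: "b (x - proj E x) (proj E x) = 0"
    using E r0 rC pC by (subst b_commute) (auto simp: pw b_commute subset_iff intro!: sum.neutral)
  have "b (x - proj E x) (x - proj E x) = b x (x - proj E x) - b (proj E x) (x - proj E x)"
    by (rule b_diff[OF x pC rC])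
  also have "\<dots> = b x (x - proj E x)" using rp b_commute[OF pC rC] by simp
  also have "\<dots> = b x x - b (proj E x) x" using b_commute[OF x rC] b_diff[OF x pC x] by simp
  finally show "b (x - proj E x) (x - proj E x) = b x x - (\<Sum>e\<in>E. (b x e)\<^sup>2)"
    using E x by (simp add: pw power2_eq_square b_commute subset_iff cong: sum.cong)
qed

text \<open>The Gram-Schmidt step: \<open>pos\<close> excludes equality in Bessel's inequality, so
  the residual has positive length and can be normalized.\<close>

lemma extend_majorana:
  assumes E: "finite E" "E \<subseteq> C" "majorana_system E" and x: "x \<in> C"
    and pos: "b x x \<noteq> (\<Sum>e\<in>E. (b x e)\<^sup>2)"
  defines "r \<equiv> x - proj E x" defines "e0 \<equiv> (1 / sqrt (b r r)) *\<^sub>R r"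
  shows "e0 \<in> C" "e0 \<notin> E" "majorana_system (insert e0 E)" "x = proj E x + sqrt (b r r) *\<^sub>R e0"
proof -
  note R = residual[OF E x, folded r_def]
  have rr: "b r r > 0" using R(3) pos b_nonneg[OF R(1)] by linarith
  show C: "e0 \<in> C" unfolding e0_def by (rule C_scaleR[OF R(1)])
  have be0: "b e0 w = (1 / sqrt (b r r)) * b r w" if "w \<in> C" for w
    unfolding e0_def by (rule b_scaleR[OF R(1) that])
  have "b e0 e0 = (1 / sqrt (b r r)) * ((1 / sqrt (b r r)) * b r r)"
    by (simp only: be0[OF C] b_commute[OF R(1) C] be0[OF R(1)])
  then have 1: "b e0 e0 = 1" using rr by (simp add: field_simps)
  have 0: "b e0 e = 0" "b e e0 = 0" if "e \<in> E" for e
  proof -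
    have "e \<in> C" using that E by auto
    then show "b e0 e = 0" "b e e0 = 0"
      using be0[of e] R(2)[OF that] b_commute[OF _ C, of e] by auto
  qed
  show "e0 \<notin> E" using 0 1 by fastforce
  then show "majorana_system (insert e0 E)"
    using E C 0 1 by (subst majorana_iff) (auto simp: majorana_iff)
  show "x = proj E x + sqrt (b r r) *\<^sub>R e0" using rr by (simp add: e0_def r_def)
qed

lemma proj_in_poly_span: "proj E x \<in> poly_span E"
  unfolding proj_def by (intro poly_span_sum poly_span_scaleR poly_span_base)

text \<open>Gram-Schmidt along \<open>F\<close>: an element with equality in Bessel's inequality has
  residual 0 by definiteness of \<open>b\<close> and contributes no new generator.\<close>

lemma majorana_basis_exists:
  assumes "finite F" "F \<subseteq> C"
  shows "\<exists>E. finite E \<and> E \<subseteq> C \<and> majorana_system E \<and> F \<subseteq> poly_span E"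
  using assms
proof (induction F rule: finite_induct)
  case empty
  show ?case by (intro exI[of _ "{}"]) (auto simp: majorana_system_def)
next
  case (insert x F)
  then obtain E where E: "finite E" "E \<subseteq> C" "majorana_system E" "F \<subseteq> poly_span E" by auto
  have x: "x \<in> C" using insert by auto
  show ?case
  proof (cases "b x x = (\<Sum>e\<in>E. (b x e)\<^sup>2)")
    case True
    then have "x = proj E x" using residual[OF E(1-3) x] b_eq_0 by (metis diff_self right_minus_eq)
    then have "x \<in> poly_span E" using proj_in_poly_span by metis
    then show ?thesis using E by (intro exI[of _ E]) auto
  next
    case False
    note X = extend_majorana[OF E(1-3) x False]
    let ?r = "x - proj E x"
    let ?E = "insert ((1 / sqrt (b ?r ?r)) *\<^sub>R ?r) E"
    have "E \<subseteq> poly_span ?E" using poly_span_base by blast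
    then have mono: "p \<in> poly_span ?E" if "p \<in> poly_span E" for p using that poly_span_mono by blast
    have "x \<in> poly_span ?E"
      by (subst X(4)) (intro poly_span.add mono proj_in_poly_span poly_span_scaleR poly_span_base insertI1)
    moreover have "F \<subseteq> poly_span ?E" using E(4) mono by blast
    ultimately show ?thesis using X E by (intro exI[of _ ?E]) auto
  qed
qed

end

section \<open>Commutator estimates uniform in the automorphism\<close>

text \<open>The order of quantifiers matters: \<open>K\<close> depends on the polynomial but not on
  \<alpha> or \<delta>, so the group element can be chosen after \<open>K\<close> is known.\<close>

definition comm_bound :: "'a::cstar_algebra set \<Rightarrow> 'a set \<Rightarrow> real \<Rightarrow> 'a \<Rightarrow> bool" where
  "comm_bound F E K p \<longleftrightarrow> K \<ge> 0 \<and> (\<forall>\<alpha> \<delta> e e'. star_automorphism \<alpha> \<longrightarrow>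
    (\<forall>s\<in>F. \<forall>e\<in>E. norm (\<alpha> s * e + e * \<alpha> s) \<le> \<delta>) \<longrightarrow> \<delta> \<ge> 0 \<longrightarrow> e \<in> E \<longrightarrow> e' \<in> E \<longrightarrow>
    norm (e' * e * \<alpha> p - \<alpha> p * (e' * e)) \<le> K * \<delta>)"

lemma comm_boundI:
  assumes "K \<ge> 0" "\<And>\<alpha> \<delta> e e'. star_automorphism \<alpha> \<Longrightarrow>
      \<forall>s\<in>F. \<forall>e\<in>E. norm (\<alpha> s * e + e * \<alpha> s) \<le> \<delta> \<Longrightarrow> \<delta> \<ge> 0 \<Longrightarrow> e \<in> E \<Longrightarrow> e' \<in> E \<Longrightarrow>
      norm (e' * e * \<alpha> p - \<alpha> p * (e' * e)) \<le> K * \<delta>"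
  shows "comm_bound F E K p"
  using assms unfolding comm_bound_def by simp

lemma comm_boundD:
  assumes "comm_bound F E K p"
  shows "K \<ge> 0" "star_automorphism \<alpha> \<Longrightarrow>
      \<forall>s\<in>F. \<forall>e\<in>E. norm (\<alpha> s * e + e * \<alpha> s) \<le> \<delta> \<Longrightarrow> \<delta> \<ge> 0 \<Longrightarrow> e \<in> E \<Longrightarrow> e' \<in> E \<Longrightarrow>
      norm (e' * e * \<alpha> p - \<alpha> p * (e' * e)) \<le> K * \<delta>"
  using assms unfolding comm_bound_def by simp_all

text \<open>Commutators obey the Leibniz rule, which reduces the estimate to generators; the norms
  of \<open>\<alpha> s\<close> and \<open>\<alpha> p\<close> stay controlled because automorphisms
  are contractive.\<close>

lemma almost_commuting_bound:
  fixes p :: "'a::cstar_algebra"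
  assumes "p \<in> poly_span F" and E: "\<And>e. e \<in> E \<Longrightarrow> norm e \<le> 1"
  shows "\<exists>K. comm_bound F E K p"
  using assms(1)
proof (induction p rule: poly_span.induct)
  case one
  show ?case by (intro exI[of _ 0] comm_boundI) (simp_all add: star_automorphismD)
next
  case (add p q)
  then obtain K L where K: "comm_bound F E K p" and L: "comm_bound F E L q" by blast
  note K = comm_boundD[OF K] and L = comm_boundD[OF L]
  show ?case
  proof (intro exI[of _ "K + L"] comm_boundI)
    fix \<alpha> :: "'a \<Rightarrow> 'a" and \<delta> :: real and e e'
    assume a: "star_automorphism \<alpha>" "\<forall>s\<in>F. \<forall>e\<in>E. norm (\<alpha> s * e + e * \<alpha> s) \<le> \<delta>" "0 \<le> \<delta>" "e \<in> E" "e' \<in> E"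
    have "e' * e * \<alpha> (p + q) - \<alpha> (p + q) * (e' * e) =
        (e' * e * \<alpha> p - \<alpha> p * (e' * e)) + (e' * e * \<alpha> q - \<alpha> q * (e' * e))"
      by (simp add: star_automorphismD(1)[OF a(1)] distrib_left distrib_right)
    then show "norm (e' * e * \<alpha> (p + q) - \<alpha> (p + q) * (e' * e)) \<le> (K + L) * \<delta>"
      using norm_triangle_mono[OF K(2)[OF a] L(2)[OF a]] by (simp add: distrib_right)
  qed (use K L in auto)
next
  case (scaleC p z)
  then obtain K where "comm_bound F E K p" by blast
  note K = comm_boundD[OF this]
  show ?case
  proof (intro exI[of _ "cmod z * K"] comm_boundI)
    fix \<alpha> :: "'a \<Rightarrow> 'a" and \<delta> :: real and e e'
    assume a: "star_automorphism \<alpha>" "\<forall>s\<in>F. \<forall>e\<in>E. norm (\<alpha> s * e + e * \<alpha> s) \<le> \<delta>" "0 \<le> \<delta>" "e \<in> E" "e' \<in> E"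
    have "e' * e * \<alpha> (scaleC z p) - \<alpha> (scaleC z p) * (e' * e) = scaleC z (e' * e * \<alpha> p - \<alpha> p * (e' * e))"
      by (simp add: star_automorphismD(4)[OF a(1)] mult_scaleC_left mult_scaleC_right scaleC_diff_right)
    then show "norm (e' * e * \<alpha> (scaleC z p) - \<alpha> (scaleC z p) * (e' * e)) \<le> cmod z * K * \<delta>"
      using mult_left_mono[OF K(2)[OF a], of "cmod z"] by (simp add: norm_scaleC mult.assoc)
  qed (use K in auto)
next
  case (mult s p)
  then obtain K where "comm_bound F E K p" by blast
  note K = comm_boundD[OF this]
  show ?case
  proof (intro exI[of _ "2 * norm p + norm s * K"] comm_boundI)
    fix \<alpha> :: "'a \<Rightarrow> 'a" and \<delta> :: real and e e'
    assume a: "star_automorphism \<alpha>" "\<forall>s\<in>F. \<forall>e\<in>E. norm (\<alpha> s * e + e * \<alpha> s) \<le> \<delta>" "0 \<le> \<delta>" "e \<in> E" "e' \<in> E"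
    let ?s = "\<alpha> s" and ?p = "\<alpha> p" and ?w = "e' * e"
    \<comment> \<open>Moving \<open>e' * e\<close> past a generator uses two anticommutators, and
      their signs cancel.\<close>
    have "?w * ?s - ?s * ?w = e' * (?s * e + e * ?s) - (?s * e' + e' * ?s) * e"
      by (simp add: algebra_simps)
    also have "norm \<dots> \<le> norm (e' * (?s * e + e * ?s)) + norm ((?s * e' + e' * ?s) * e)"
      by (rule norm_triangle_ineq4)
    also have "\<dots> \<le> norm e' * norm (?s * e + e * ?s) + norm (?s * e' + e' * ?s) * norm e"
      by (intro add_mono norm_mult_ineq)
    also have "\<dots> \<le> 1 * \<delta> + \<delta> * 1"
      using a E mult(1) by (intro add_mono mult_mono) auto
    finally have ws: "norm (?w * ?s - ?s * ?w) \<le> 2 * \<delta>" by simp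
    have "?w * \<alpha> (s * p) - \<alpha> (s * p) * ?w = (?w * ?s - ?s * ?w) * ?p + ?s * (?w * ?p - ?p * ?w)"
      by (simp add: star_automorphismD(2)[OF a(1)] algebra_simps)
    also have "norm \<dots> \<le> norm ((?w * ?s - ?s * ?w) * ?p) + norm (?s * (?w * ?p - ?p * ?w))"
      by (rule norm_triangle_ineq)
    also have "\<dots> \<le> norm (?w * ?s - ?s * ?w) * norm ?p + norm ?s * norm (?w * ?p - ?p * ?w)"
      by (intro add_mono norm_mult_ineq)
    also have "\<dots> \<le> (2 * \<delta>) * norm p + norm s * (K * \<delta>)"
      using ws K(2)[OF a] star_automorphism_norm_le[OF a(1)] a(3) by (intro add_mono mult_mono) auto
    finally show "norm (?w * \<alpha> (s * p) - \<alpha> (s * p) * ?w) \<le> (2 * norm p + norm s * K) * \<delta>"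
      by (simp add: algebra_simps)
  qed (use K in auto)
qed

lemma bounded_linear_scaleC_right: "bounded_linear (\<lambda>x::'a::cstar_algebra. scaleC z x)"
proof (rule bounded_linear_intro[where K = "cmod z"])
  show "scaleC z (r *\<^sub>R x) = r *\<^sub>R scaleC z x" for r and x :: 'a
    by (simp add: scaleC_scaleC mult.commute flip: scaleC_of_real)
qed (auto simp: norm_scaleC scaleC_add_right)

lemma bounded_linear_scaleC_left: "bounded_linear (\<lambda>z. scaleC z (x::'a::cstar_algebra))"
proof (rule bounded_linear_intro[where K = "norm x"])
  show "scaleC (r *\<^sub>R z) x = r *\<^sub>R scaleC z x" for r and z
    by (simp add: scaleC_scaleC scaleR_conv_of_real[where 'a = complex] flip: scaleC_of_real)
qed (auto simp: norm_scaleC scaleC_add_left)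

lemma cstar_subalgebra_closure_poly_span:
  fixes S :: "'a::cstar_algebra set"
  assumes S: "\<And>s. s \<in> S \<Longrightarrow> star s = s"
  shows "cstar_subalgebra (closure (poly_span S))"
proof -
  have 1: "(1::'a) \<in> closure (poly_span S)" using closure_subset poly_span.one by blast
  have 2: "x + y \<in> closure (poly_span S) \<and> x * y \<in> closure (poly_span S)"
    if xy: "x \<in> closure (poly_span S)" "y \<in> closure (poly_span S)" for x y
  proof -
    obtain f g where f: "\<And>n. f n \<in> poly_span S" "f \<longlonglongrightarrow> x" and g: "\<And>n. g n \<in> poly_span S" "g \<longlonglongrightarrow> y"
      using xy unfolding closure_sequential by blast
    show ?thesis unfolding closure_sequential
    proof (intro conjI exI)
      show "(\<lambda>n. f n + g n) \<longlonglongrightarrow> x + y" "(\<lambda>n. f n * g n) \<longlonglongrightarrow> x * y" by (intro tendsto_intros f g)+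
    qed (use f g in \<open>auto intro: poly_span.add poly_span_mult\<close>)
  qed
  have 3: "h x \<in> closure (poly_span S)"
    if x: "x \<in> closure (poly_span S)" and h: "bounded_linear h" "\<And>p. p \<in> poly_span S \<Longrightarrow> h p \<in> poly_span S"
    for x and h :: "'a \<Rightarrow> 'a"
  proof -
    obtain f where "\<And>n. f n \<in> poly_span S" "f \<longlonglongrightarrow> x"
      using x unfolding closure_sequential by blast
    then show ?thesis unfolding closure_sequential
      using h by (intro exI[of _ "\<lambda>n. h (f n)"]) (auto intro: bounded_linear.tendsto)
  qed
  have 4: "star x \<in> closure (poly_span S)" if "x \<in> closure (poly_span S)" for x
    by (rule 3[OF that bounded_linear_star]) (rule poly_span_star[OF _ S])
  have 5: "scaleC z x \<in> closure (poly_span S)" if "x \<in> closure (poly_span S)" for x z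
    by (rule 3[OF that bounded_linear_scaleC_right]) (rule poly_span.scaleC)
  show ?thesis unfolding cstar_subalgebra_def using 1 2 4 5 by simp
qed

theorem CAR_fixed_point_scalar:
  fixes H :: "'v hspace" and a :: "'v \<Rightarrow> 'a::cstar_algebra"
  assumes CAR: "is_CAR_algebra H a"
    and H_add: "\<And>f g. f \<in> hcarrier H \<Longrightarrow> g \<in> hcarrier H \<Longrightarrow> hadd H f g \<in> hcarrier H"
    and H_scale: "\<And>z f. f \<in> hcarrier H \<Longrightarrow> hscale H z f \<in> hcarrier H"
    and V: "\<And>\<gamma> f. \<gamma> \<in> \<G> \<Longrightarrow> f \<in> hcarrier H \<Longrightarrow> V \<gamma> f \<in> hcarrier H"
    and \<kappa>_aut: "\<And>\<gamma>. \<gamma> \<in> \<G> \<Longrightarrow> star_automorphism (\<kappa> \<gamma>)"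
    and \<kappa>_gen: "\<And>\<gamma> f. \<gamma> \<in> \<G> \<Longrightarrow> f \<in> hcarrier H \<Longrightarrow> \<kappa> \<gamma> (a f) = a (V \<gamma> f)"
    and WM: "\<And>F \<delta>. finite F \<Longrightarrow> F \<subseteq> hcarrier H \<Longrightarrow> \<delta> > 0 \<Longrightarrow>
      \<exists>\<gamma>\<in>\<G>. \<forall>f\<in>F. \<forall>g\<in>F. cmod (hinner H (V \<gamma> f) g) < \<delta>"
    and x: "\<And>\<gamma>. \<gamma> \<in> \<G> \<Longrightarrow> \<kappa> \<gamma> x = x"
  shows "\<exists>z. x = scaleC z 1"
proof -
  \<comment> \<open>The self-adjoint field of \<open>f\<close>. It is real linear in
    \<open>f\<close>, and its anticommutators are scalars given by the real part of the inner
    product.\<close>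
  define c where "c f = a f + star (a f)" for f
  define C where "C = c ` hcarrier H"
  define b where "b x y = (THE r. x * y + y * x = (2 * r) *\<^sub>R (1::'a))" for x y
  note CAR' = CAR[unfolded is_CAR_algebra_def]
  note C2 = CAR'[THEN conjunct2] note C3 = C2[THEN conjunct2] note C4 = C3[THEN conjunct2]
  have a_add: "a (hadd H f g) = a f + a g" if "f \<in> hcarrier H" "g \<in> hcarrier H" for f g
    using CAR'[THEN conjunct1] that by simp
  have a_scale: "a (hscale H z f) = scaleC (cnj z) (a f)" if "f \<in> hcarrier H" for f z
    using C2[THEN conjunct1] that by simp
  have car1: "a f * star (a g) + star (a g) * a f = scaleC (hinner H f g) 1"
    if "f \<in> hcarrier H" "g \<in> hcarrier H" for f g
    using C4[THEN conjunct1] that by simp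
  have car2: "a f * a g + a g * a f = 0"
    if "f \<in> hcarrier H" "g \<in> hcarrier H" for f g
    using C4[THEN conjunct1] that by simp
  have gen: "S = UNIV" if "cstar_subalgebra S" "a ` hcarrier H \<subseteq> S" for S
    using C4[THEN conjunct2] that by simp
  have anti: "c f * c g + c g * c f = (2 * Re (hinner H f g)) *\<^sub>R 1"
    if fg: "f \<in> hcarrier H" "g \<in> hcarrier H" for f g
  proof -
    have "star (a f * star (a g) + star (a g) * a f) = a g * star (a f) + star (a f) * a g"
      by (simp add: star_add star_mult star_star)
    then have cj: "a g * star (a f) + star (a f) * a g = scaleC (cnj (hinner H f g)) 1"
      by (simp add: car1 fg star_scaleC)
    have "star (a g * a f + a f * a g) = 0" by (simp add: car2 fg)
    then have c2: "star (a f) * star (a g) + star (a g) * star (a f) = 0" by (simp add: star_add star_mult)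
    have "c f * c g + c g * c f = (a f * star (a g) + star (a g) * a f) + (a g * star (a f) + star (a f) * a g)
        + (a f * a g + a g * a f) + (star (a f) * star (a g) + star (a g) * star (a f))"
      by (simp add: c_def algebra_simps)
    also have "\<dots> = scaleC (hinner H f g + cnj (hinner H f g)) 1"
      unfolding c2 cj by (simp add: car1 car2 fg scaleC_add_left)
    also have "\<dots> = (2 * Re (hinner H f g)) *\<^sub>R 1"
      by (simp only: complex_add_cnj scaleC_of_real)
    finally show ?thesis .
  qed
  have b: "b (c f) (c g) = Re (hinner H f g)" if "f \<in> hcarrier H" "g \<in> hcarrier H" for f g
    unfolding b_def anti[OF that] by simp
  interpret clifford_space C b
  proof
    show "x + y \<in> C" if xy: "x \<in> C" "y \<in> C" for x y
    proof -
      obtain f g where "x = c f" "y = c g" "f \<in> hcarrier H" "g \<in> hcarrier H" using xy unfolding C_def by blast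
      then have "x + y = c (hadd H f g)" "hadd H f g \<in> hcarrier H" by (auto simp: c_def a_add star_add H_add)
      then show ?thesis unfolding C_def by blast
    qed
    show "r *\<^sub>R x \<in> C" if x: "x \<in> C" for x r
    proof -
      obtain f where "x = c f" "f \<in> hcarrier H" using x unfolding C_def by blast
      then have "r *\<^sub>R x = c (hscale H (complex_of_real r) f)" "hscale H (complex_of_real r) f \<in> hcarrier H"
        by (auto simp: c_def a_scale star_scaleR H_scale scaleC_of_real scaleR_right_distrib)
      then show ?thesis unfolding C_def by blast
    qed
    show "star x = x" if "x \<in> C" for x
      using that unfolding C_def c_def by (auto simp: star_add star_star add.commute)
    show "x * y + y * x = (2 * b x y) *\<^sub>R 1" if "x \<in> C" "y \<in> C" for x y
      using that unfolding C_def by (auto simp: b anti)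
  qed
  have \<kappa>c: "\<kappa> \<gamma> (c f) = c (V \<gamma> f)" if "\<gamma> \<in> \<G>" "f \<in> hcarrier H" for \<gamma> f
    using star_automorphismD[OF \<kappa>_aut[OF that(1)]] \<kappa>_gen[OF that] by (simp add: c_def)
  have "closure (poly_span C) = UNIV"
  proof (rule gen)
    show "cstar_subalgebra (closure (poly_span C))" by (rule cstar_subalgebra_closure_poly_span) (rule C_star)
    show "a ` hcarrier H \<subseteq> closure (poly_span C)"
    proof
      fix y assume "y \<in> a ` hcarrier H"
      then obtain f where f: "y = a f" "f \<in> hcarrier H" by blast
      \<comment> \<open>As \<open>a\<close> is antilinear, \<i> times the field of
        \<open>\<i> f\<close> is \<open>a f - star (a f)\<close>, so the two fields together recover
        \<open>a f\<close>.\<close>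
      have "c f + scaleC \<i> (c (hscale H \<i> f)) = a f + a f"
        by (simp add: c_def a_scale f star_scaleC scaleC_add_right scaleC_diff_right scaleC_scaleC)
      then have "scaleC (1/2) (c f + scaleC \<i> (c (hscale H \<i> f))) = scaleC (1/2) (a f + a f)" by simp
      also have "\<dots> = scaleC (1/2 + 1/2) (a f)" unfolding scaleC_add_left scaleC_add_right ..
      also have "\<dots> = y" using f by simp
      finally have "y = scaleC (1/2) (c f + scaleC \<i> (c (hscale H \<i> f)))" by simp
      also have "\<dots> \<in> poly_span C"
        using f H_scale by (intro poly_span.scaleC poly_span.add poly_span_base) (auto simp: C_def)
      finally show "y \<in> closure (poly_span C)" using closure_subset by blast
    qed
  qed
  then have dense: "\<exists>p\<in>poly_span C. norm (x - p) < \<epsilon>" if "\<epsilon> > 0" for \<epsilon>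
    using that closure_approachable[of x "poly_span C"] by (auto simp: dist_norm norm_minus_commute)
  have approx: "\<exists>z. norm (x - scaleC z 1) \<le> 4 * \<epsilon>" if \<epsilon>: "\<epsilon> > 0" for \<epsilon>
  proof -
    obtain P where P: "P \<in> poly_span C" "norm (x - P) < \<epsilon>" using dense[OF \<epsilon>] by blast
    obtain F where F: "finite F" "F \<subseteq> C" "P \<in> poly_span F" using poly_span_finite[OF P(1)] by blast
    obtain E where E: "finite E" "E \<subseteq> C" "majorana_system E" "F \<subseteq> poly_span E"
      using majorana_basis_exists[OF F(1,2)] by blast
    have PE: "P \<in> poly_span E" using F(3) E(4) by (rule poly_span_mono)
    show ?thesis
    proof (cases "E = {}")
      case True
      then obtain z where "P = scaleC z 1" using poly_span_empty[of P] PE by blast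
      then show ?thesis using P(2) \<epsilon> by (intro exI[of _ z]) simp
    next
      case False
      then obtain f1 where f1: "f1 \<in> hcarrier H" "c f1 \<in> E" using E(2) unfolding C_def by blast
      obtain FE where FE: "FE \<subseteq> hcarrier H" "finite FE" "E = c ` FE"
        using finite_subset_image[OF E(1) E(2)[unfolded C_def]] by blast
      \<comment> \<open>With this bound the squared coefficients of the moved generator along
        \<open>E\<close> add up to at most \<open>card E / (1 + card E)^2 < 1\<close>, whereas its
        own squared length is 1; hence it does not lie in the span of \<open>E\<close>.\<close>
      define \<delta>1 where "\<delta>1 = 1 / (1 + real (card E))"
      have \<delta>1: "\<delta>1 > 0" by (simp add: \<delta>1_def add_pos_nonneg)
      obtain \<gamma>1 where \<gamma>1: "\<gamma>1 \<in> \<G>" "\<And>f g. f \<in> insert f1 FE \<Longrightarrow> g \<in> insert f1 FE \<Longrightarrow> cmod (hinner H (V \<gamma>1 f) g) < \<delta>1"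
        using WM[of "insert f1 FE" \<delta>1, OF _ _ \<delta>1] FE(1,2) f1(1) by (metis finite_insert insert_subset)
      let ?y = "c (V \<gamma>1 f1)"
      have yC: "?y \<in> C" using V \<gamma>1(1) f1 unfolding C_def by blast
      have "?y * ?y = \<kappa> \<gamma>1 (c f1 * c f1)"
        by (simp add: \<kappa>c[OF \<gamma>1(1) f1(1)] star_automorphismD(2)[OF \<kappa>_aut[OF \<gamma>1(1)]])
      also have "\<dots> = 1" using E(3) f1 \<gamma>1(1) by (simp add: majorana_system_def star_automorphismD \<kappa>_aut)
      finally have byy: "b ?y ?y = 1"
        using square[OF yC] by (metis scaleR_cancel_right scaleR_one zero_neq_one)
      have "(\<Sum>e\<in>E. (b ?y e)\<^sup>2) \<le> (\<Sum>e\<in>E. \<delta>1\<^sup>2)"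
      proof (rule sum_mono)
        fix e assume "e \<in> E"
        then obtain g where g: "e = c g" "g \<in> FE" using FE by blast
        have "\<bar>b ?y e\<bar> \<le> cmod (hinner H (V \<gamma>1 f1) g)"
          using g FE f1 V \<gamma>1(1) by (subst g(1), subst b) (auto simp: abs_Re_le_cmod)
        also have "\<dots> \<le> \<delta>1" using \<gamma>1(2)[of f1 g] g by simp
        finally show "(b ?y e)\<^sup>2 \<le> \<delta>1\<^sup>2" using abs_le_square_iff[of "b ?y e" \<delta>1] \<delta>1 by simp
      qed
      also have "\<dots> = real (card E) / (1 + real (card E))\<^sup>2" by (simp add: \<delta>1_def power_divide)
      also have "\<dots> < 1"
        by (simp add: divide_less_eq add_pos_nonneg) (simp add: power2_eq_square algebra_simps add_pos_nonneg)
      finally have ne: "b ?y ?y \<noteq> (\<Sum>e\<in>E. (b ?y e)\<^sup>2)" using byy by simp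
      define e0 where "e0 = (1 / sqrt (b (?y - proj E ?y) (?y - proj E ?y))) *\<^sub>R (?y - proj E ?y)"
      note e0 = extend_majorana(1-3)[OF E(1-3) yC ne, folded e0_def]
      have nE: "norm e \<le> 1" if "e \<in> insert e0 E" for e
        using e0(3) that norm_majorana[of e] unfolding majorana_system_def by (metis order_refl)
      obtain K where "comm_bound F (insert e0 E) K P"
        using almost_commuting_bound[OF F(3), of "insert e0 E"] nE by blast
      note K = comm_boundD[OF this]
      obtain D where D: "D \<subseteq> hcarrier H" "finite D" "F \<union> insert e0 E = c ` D"
        using finite_subset_image[of "F \<union> insert e0 E" c "hcarrier H"] E F e0(1) unfolding C_def by auto
      \<comment> \<open>Chosen so that the accumulated error
        \<open>card E * (K * (2 * \<delta>))\<close> is at most \<epsilon>; the added 1 keeps the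
        denominator positive.\<close>
      define \<delta>' where "\<delta>' = \<epsilon> / (K * real (card E) + 1)"
      define \<delta> where "\<delta> = \<delta>' / 2"
      have Kc: "0 \<le> K * real (card E)" using K(1) by simp
      have \<delta>: "\<delta> > 0" unfolding \<delta>_def \<delta>'_def using \<epsilon> Kc by simp
      obtain \<gamma> where \<gamma>: "\<gamma> \<in> \<G>" "\<And>f g. f \<in> D \<Longrightarrow> g \<in> D \<Longrightarrow> cmod (hinner H (V \<gamma> f) g) < \<delta>"
        using WM[OF D(2,1) \<delta>] by blast
      note A = \<kappa>_aut[OF \<gamma>(1)]
      have ac: "norm (\<kappa> \<gamma> s * e + e * \<kappa> \<gamma> s) \<le> 2 * \<delta>" if se: "s \<in> F" "e \<in> insert e0 E" for s e
      proof -
        obtain f g where fg: "s = c f" "e = c g" "f \<in> D" "g \<in> D" using se D(3) by blast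
        have fgH: "f \<in> hcarrier H" "g \<in> hcarrier H" "V \<gamma> f \<in> hcarrier H" using fg D V \<gamma>(1) by auto
        have "norm (\<kappa> \<gamma> s * e + e * \<kappa> \<gamma> s) = 2 * \<bar>Re (hinner H (V \<gamma> f) g)\<bar>"
          by (simp add: fg(1,2) \<kappa>c[OF \<gamma>(1)] fgH anti abs_mult)
        also have "\<dots> \<le> 2 * \<delta>"
          using abs_Re_le_cmod[of "hinner H (V \<gamma> f) g"] \<gamma>(2)[OF fg(3,4)] by simp
        finally show ?thesis .
      qed
      \<comment> \<open>Here invariance of \<open>x\<close> enters:
        \<open>x - \<kappa> \<gamma> P\<close> is the image of \<open>x - P\<close>.\<close>
      have kx: "norm (x - \<kappa> \<gamma> P) \<le> \<epsilon>"
      proof -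
        have "x - \<kappa> \<gamma> P = \<kappa> \<gamma> (x - P)" using x[OF \<gamma>(1)] by (simp add: star_automorphismD(6)[OF A])
        then show ?thesis using star_automorphism_norm_le[OF A, of "x - P"] P(2) by simp
      qed
      have "norm (\<kappa> \<gamma> P - P) = norm ((x - P) - (x - \<kappa> \<gamma> P))" by simp
      also have "\<dots> \<le> norm (x - P) + norm (x - \<kappa> \<gamma> P)" by (rule norm_triangle_ineq4)
      finally have "norm (\<kappa> \<gamma> P - P) \<le> 2 * \<epsilon>" using kx P(2) by linarith
      moreover have "norm (e0 * e * \<kappa> \<gamma> P - \<kappa> \<gamma> P * (e0 * e)) \<le> K * (2 * \<delta>)" if "e \<in> E" for e
        by (rule K(2)[OF A]) (use ac \<delta> that in auto)
      \<comment> \<open>The averaging is applied to \<open>\<kappa> \<gamma> P\<close>, for which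
        the commutator bound \<open>K\<close> is available; \<open>P\<close> lies within
        \<open>2 * \<epsilon>\<close> of it.\<close>
      ultimately have "\<exists>z. norm (\<kappa> \<gamma> P - scaleC z 1) \<le> 2 * \<epsilon> + real (card E) * (K * (2 * \<delta>))"
        by (intro near_scalar_if_almost_commuting[OF E(1) e0(3,2) PE])
      then obtain z where z: "norm (\<kappa> \<gamma> P - scaleC z 1) \<le> 2 * \<epsilon> + real (card E) * (K * (2 * \<delta>))" ..
      have "2 * \<delta> = \<epsilon> / (K * real (card E) + 1)" by (simp add: \<delta>_def flip: \<delta>'_def)
      then have "real (card E) * (K * (2 * \<delta>)) = (K * real (card E)) * \<epsilon> / (K * real (card E) + 1)"
        by simp
      also have "\<dots> \<le> \<epsilon>" using Kc \<epsilon> by (simp add: divide_le_eq)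
      finally have "norm (\<kappa> \<gamma> P - scaleC z 1) \<le> 3 * \<epsilon>" using z by linarith
      then have "norm ((x - \<kappa> \<gamma> P) + (\<kappa> \<gamma> P - scaleC z 1)) \<le> 4 * \<epsilon>"
        using norm_triangle_mono[OF kx] by fastforce
      then show ?thesis by (intro exI[of _ z]) simp
    qed
  qed
  \<comment> \<open>The scalars are an isometric copy of the complex plane, hence closed, so it
    suffices that \<open>x\<close> is arbitrarily close to them.\<close>
  have "complete (range (\<lambda>z. scaleC z (1::'a)))"
    by (rule complete_isometric_image[of 1 UNIV])
      (auto simp: norm_scaleC bounded_linear_scaleC_left complete_UNIV)
  then have "closed (range (\<lambda>z. scaleC z (1::'a)))" by (rule complete_imp_closed)
  moreover have "x \<in> closure (range (\<lambda>z. scaleC z (1::'a)))"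
    unfolding closure_approachable
  proof (intro allI impI)
    fix e :: real assume "e > 0"
    then obtain z where "norm (x - scaleC z 1) \<le> 4 * (e / 8)" using approx[of "e / 8"] by auto
    then show "\<exists>y\<in>range (\<lambda>z. scaleC z 1). dist y x < e"
      using \<open>e > 0\<close> by (intro bexI[of _ "scaleC z 1"]) (auto simp: dist_norm norm_minus_commute)
  qed
  ultimately show ?thesis by (auto simp: closure_closed)
qed

section \<open>Calculus of smooth functions\<close>

text \<open>Since \<open>X\<close> is open, derivatives at its points depend only on the values in
  \<open>X\<close>, so agreement passes from one order to the next.\<close>

lemma differentiable_upto_cong:
  assumes "open X" "\<And>x. x \<in> X \<Longrightarrow> f x = g x" "differentiable_upto r X f"
  shows "differentiable_upto r X g"
  using assms(2,3)
proof (induction r arbitrary: f g)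
  case 0
  then show ?case by (simp cong: continuous_on_cong)
next
  case (Suc r)
  have d: "(g has_derivative frechet_derivative f (at x)) (at x)" if "x \<in> X" for x
  proof -
    have "(f has_derivative frechet_derivative f (at x)) (at x)"
      using Suc.prems that by (simp add: frechet_derivative_works[symmetric])
    then show ?thesis
      by (rule has_derivative_transform_within_open[OF _ assms(1) that]) (rule Suc.prems)
  qed
  then have "frechet_derivative f (at x) = frechet_derivative g (at x)" if "x \<in> X" for x
    using that by (simp add: frechet_derivative_at)
  moreover have "g differentiable (at x)" if "x \<in> X" for x
    using d[OF that] by (auto simp: differentiable_def)
  ultimately show ?case
    using Suc.prems Suc.IH[of "\<lambda>x. frechet_derivative f (at x) v" "\<lambda>x. frechet_derivative g (at x) v" for v]
    by simp
qed

lemma differentiable_upto_SucI: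
  assumes "open X" "\<And>x. x \<in> X \<Longrightarrow> (f has_derivative D x) (at x)"
    and "\<And>v. differentiable_upto r X (\<lambda>x. D x v)"
  shows "differentiable_upto (Suc r) X f"
proof -
  have "D x = frechet_derivative f (at x)" if "x \<in> X" for x
    by (rule frechet_derivative_at[OF assms(2)[OF that]])
  then have "differentiable_upto r X (\<lambda>x. frechet_derivative f (at x) v)" for v
    by (intro differentiable_upto_cong[OF assms(1) _ assms(3)[of v]]) simp
  then show ?thesis using assms(2) by (auto simp: differentiable_def)
qed

lemma differentiable_upto_SucD:
  assumes "differentiable_upto (Suc r) X f"
  shows "x \<in> X \<Longrightarrow> (f has_derivative frechet_derivative f (at x)) (at x)"
    and "differentiable_upto r X (\<lambda>x. frechet_derivative f (at x) v)"
  using assms by (simp_all add: frechet_derivative_works[symmetric])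

lemma differentiable_upto_continuous_on:
  assumes "differentiable_upto r X f" "open X"
  shows "continuous_on X f"
proof (cases r)
  case 0
  then show ?thesis using assms by simp
next
  case (Suc r')
  then show ?thesis using assms
    by (auto intro!: continuous_at_imp_continuous_on differentiable_imp_continuous_within)
qed

lemma differentiable_upto_pred:
  "differentiable_upto (Suc r) X f \<Longrightarrow> open X \<Longrightarrow> differentiable_upto r X f"
proof (induction r arbitrary: f)
  case 0
  then show ?case using differentiable_upto_continuous_on[of "Suc 0" X f] by simp
next
  case (Suc r)
  then show ?case by (auto simp del: differentiable_upto.simps(1))
qed

lemma differentiable_upto_subset:
  "differentiable_upto r X f \<Longrightarrow> Y \<subseteq> X \<Longrightarrow> differentiable_upto r Y f"
  by (induction r arbitrary: f) (auto intro: continuous_on_subset)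

lemma differentiable_upto_local:
  assumes "\<And>x. x \<in> X \<Longrightarrow> \<exists>Y. open Y \<and> x \<in> Y \<and> differentiable_upto r Y f"
  shows "differentiable_upto r X f"
  using assms
proof (induction r arbitrary: f)
  case 0
  have "isCont f x" if "x \<in> X" for x
    using 0[OF that] by (auto simp: continuous_on_eq_continuous_at)
  then show ?case by (simp add: continuous_at_imp_continuous_on)
next
  case (Suc r)
  have "differentiable_upto r X (\<lambda>x. frechet_derivative f (at x) v)" for v
    by (rule Suc.IH) (use Suc.prems in fastforce)
  moreover have "f differentiable at x" if "x \<in> X" for x using Suc.prems[OF that] by auto
  ultimately show ?case by simp
qed

lemma differentiable_upto_const: "open X \<Longrightarrow> differentiable_upto r X (\<lambda>x. c)"
proof (induction r arbitrary: c)
  case (Suc r)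
  then show ?case by (intro differentiable_upto_SucI[where D = "\<lambda>x v. 0"]) auto
qed simp

lemma differentiable_upto_bounded_linear:
  assumes "open X" "bounded_linear h" "differentiable_upto r X f"
  shows "differentiable_upto r X (\<lambda>x. h (f x))"
  using assms(3)
proof (induction r arbitrary: f)
  case 0
  then show ?case using bounded_linear.continuous_on[OF assms(2)] by simp
next
  case (Suc r)
  show ?case
    by (rule differentiable_upto_SucI[OF assms(1), where D = "\<lambda>x v. h (frechet_derivative f (at x) v)"])
      (use Suc differentiable_upto_SucD[OF Suc.prems] in
        \<open>auto intro: bounded_linear.has_derivative[OF assms(2)]\<close>)
qed

lemma differentiable_upto_ident: "open X \<Longrightarrow> differentiable_upto r X (\<lambda>x. x)"
proof (cases r)
  case (Suc r')
  assume "open X"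
  then show ?thesis unfolding Suc
    by (intro differentiable_upto_SucI[where D = "\<lambda>x v. v"]) (auto intro: differentiable_upto_const)
qed simp

lemma differentiable_upto_add:
  assumes "open X" "differentiable_upto r X f" "differentiable_upto r X g"
  shows "differentiable_upto r X (\<lambda>x. f x + g x)"
  using assms(2,3)
proof (induction r arbitrary: f g)
  case (Suc r)
  note D = differentiable_upto_SucD[OF Suc.prems(1)] differentiable_upto_SucD[OF Suc.prems(2)]
  show ?case
    by (rule differentiable_upto_SucI[OF assms(1) has_derivative_add[OF D(1) D(3)]])
      (auto intro: Suc.IH D)
qed (auto intro: continuous_intros)

lemma differentiable_upto_sum:
  assumes "open X" "\<And>i. i \<in> I \<Longrightarrow> differentiable_upto r X (f i)"
  shows "differentiable_upto r X (\<lambda>x. \<Sum>i\<in>I. f i x)"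
  using assms(2)
  by (induction I rule: infinite_finite_induct)
    (auto intro: differentiable_upto_const differentiable_upto_add assms(1))

lemma differentiable_upto_bilinear:
  assumes "open X" "bounded_bilinear h" "differentiable_upto r X f" "differentiable_upto r X g"
  shows "differentiable_upto r X (\<lambda>x. h (f x) (g x))"
  using assms(3,4)
proof (induction r arbitrary: f g)
  case 0
  then show ?case using bounded_bilinear.continuous_on[OF assms(2)] by simp
next
  case (Suc r)
  note D = differentiable_upto_SucD[OF Suc.prems(1)] differentiable_upto_SucD[OF Suc.prems(2)]
  show ?case
    by (rule differentiable_upto_SucI[OF assms(1) bounded_bilinear.FDERIV[OF assms(2) D(1) D(3)]])
      (assumption | intro differentiable_upto_add[OF assms(1)] Suc.IH D(2,4)
        differentiable_upto_pred[OF Suc.prems(1) assms(1)] differentiable_upto_pred[OF Suc.prems(2) assms(1)])+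
qed

lemma differentiable_upto_compose:
  fixes g :: "'b::euclidean_space \<Rightarrow> 'c::real_normed_vector"
  assumes "open X" "open Y" "f ` X \<subseteq> Y" "differentiable_upto r X f" "differentiable_upto r Y g"
  shows "differentiable_upto r X (\<lambda>x. g (f x))"
  using assms(4,5)
proof (induction r arbitrary: g)
  case 0
  then show ?case using continuous_on_compose2[of Y g X f] assms(3) by simp
next
  case (Suc r)
  note D = differentiable_upto_SucD[OF Suc.prems(1)] differentiable_upto_SucD[OF Suc.prems(2)]
  \<comment> \<open>The chain rule differentiates \<open>g\<close> in the direction of the
    derivative of \<open>f\<close>, which varies with \<open>x\<close>. Expanding this direction in
    \<open>Basis\<close> leaves finitely many products with fixed directions, to which the induction
    applies.\<close>
  define E where "E x v = (\<Sum>b\<in>Basis. (frechet_derivative f (at x) v \<bullet> b) *\<^sub>R frechet_derivative g (at (f x)) b)"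
    for x v
  show ?case
  proof (rule differentiable_upto_SucI[OF assms(1), where D = E])
    fix x assume x: "x \<in> X"
    then have "f x \<in> Y" using assms(3) by blast
    then have gd: "(g has_derivative frechet_derivative g (at (f x))) (at (f x))" by (rule D(3))
    have lin: "linear (frechet_derivative g (at (f x)))"
      using gd by (rule has_derivative_linear)
    have "E x = (\<lambda>v. frechet_derivative g (at (f x)) (frechet_derivative f (at x) v))"
    proof
      fix v
      have "frechet_derivative g (at (f x)) (\<Sum>b\<in>Basis. (frechet_derivative f (at x) v \<bullet> b) *\<^sub>R b) = E x v"
        unfolding E_def by (simp add: linear_sum[OF lin] linear_cmul[OF lin])
      then show "E x v = frechet_derivative g (at (f x)) (frechet_derivative f (at x) v)"
        by (simp add: euclidean_representation)
    qed
    then show "((\<lambda>x. g (f x)) has_derivative E x) (at x)"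
      using has_derivative_compose[OF D(1)[OF x] gd] by simp
  next
    fix v
    show "differentiable_upto r X (\<lambda>x. E x v)" unfolding E_def
    proof (intro differentiable_upto_sum[OF assms(1)] differentiable_upto_bilinear[OF assms(1) bounded_bilinear_scaleR])
      fix b :: 'b
      show "differentiable_upto r X (\<lambda>x. frechet_derivative f (at x) v \<bullet> b)"
        by (rule differentiable_upto_bounded_linear[OF assms(1) bounded_linear_inner_left D(2)])
      show "differentiable_upto r X (\<lambda>x. frechet_derivative g (at (f x)) b)"
        by (rule Suc.IH[OF differentiable_upto_pred[OF Suc.prems(1) assms(1)] D(4)])
    qed
  qed
qed

lemma smooth_on_cong: "smooth_on X f \<Longrightarrow> open X \<Longrightarrow> (\<And>x. x \<in> X \<Longrightarrow> f x = g x) \<Longrightarrow> smooth_on X g"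
  unfolding smooth_on_def using differentiable_upto_cong by blast

lemma smooth_on_subset: "smooth_on X f \<Longrightarrow> Y \<subseteq> X \<Longrightarrow> smooth_on Y f"
  unfolding smooth_on_def using differentiable_upto_subset by blast

lemma smooth_on_local:
  assumes "\<And>x. x \<in> X \<Longrightarrow> \<exists>Y. open Y \<and> x \<in> Y \<and> smooth_on Y f"
  shows "smooth_on X f"
  unfolding smooth_on_def
proof (intro allI differentiable_upto_local)
  fix r x assume "x \<in> X"
  then obtain Y where "open Y" "x \<in> Y" "smooth_on Y f" using assms by blast
  then show "\<exists>Y. open Y \<and> x \<in> Y \<and> differentiable_upto r Y f" unfolding smooth_on_def by blast
qed

lemma smooth_on_continuous: "smooth_on X f \<Longrightarrow> open X \<Longrightarrow> continuous_on X f"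
  unfolding smooth_on_def using differentiable_upto_continuous_on by blast

lemma smooth_on_const: "open X \<Longrightarrow> smooth_on X (\<lambda>x. c)"
  unfolding smooth_on_def using differentiable_upto_const by blast

lemma smooth_on_ident: "open X \<Longrightarrow> smooth_on X (\<lambda>x. x)"
  unfolding smooth_on_def using differentiable_upto_ident by blast

lemma smooth_on_bounded_linear:
  "open X \<Longrightarrow> bounded_linear h \<Longrightarrow> smooth_on X f \<Longrightarrow> smooth_on X (\<lambda>x. h (f x))"
  unfolding smooth_on_def using differentiable_upto_bounded_linear by blast

lemma smooth_on_bilinear:
  "open X \<Longrightarrow> bounded_bilinear h \<Longrightarrow> smooth_on X f \<Longrightarrow> smooth_on X g \<Longrightarrow> smooth_on X (\<lambda>x. h (f x) (g x))"
  unfolding smooth_on_def using differentiable_upto_bilinear by blast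

lemma smooth_on_add:
  "open X \<Longrightarrow> smooth_on X f \<Longrightarrow> smooth_on X g \<Longrightarrow> smooth_on X (\<lambda>x. f x + g x)"
  unfolding smooth_on_def using differentiable_upto_add by blast

lemma smooth_on_compose:
  fixes g :: "'b::euclidean_space \<Rightarrow> 'c::real_normed_vector"
  shows "open X \<Longrightarrow> open Y \<Longrightarrow> f ` X \<subseteq> Y \<Longrightarrow> smooth_on X f \<Longrightarrow> smooth_on Y g \<Longrightarrow> smooth_on X (\<lambda>x. g (f x))"
  unfolding smooth_on_def using differentiable_upto_compose by blast

section \<open>The flat function and the exponential phase\<close>

text \<open>All powers of \<open>1/t\<close> in front of \<open>exp (- 1/t)\<close> are carried
  along because differentiation raises the power by one and by two; the family is then closed under
  derivatives. The bump functions use \<open>flat 0\<close>.\<close>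

definition flat :: "nat \<Rightarrow> real \<Rightarrow> real" where
  "flat n t = (if t \<le> 0 then 0 else inverse t ^ n * exp (- inverse t))"

lemma flat_DERIV: "(flat n has_real_derivative (flat (n + 2) t - real n * flat (n + 1) t)) (at t)"
proof -
  consider "t < 0" | "t > 0" | "t = 0" by linarith
  then show ?thesis
  proof cases
    case 1
    have "((\<lambda>x. 0) has_real_derivative 0) (at t)" by simp
    then have "(flat n has_real_derivative 0) (at t)"
      by (rule has_field_derivative_transform_within_open[of _ _ _ "{..<0}"]) (use 1 in \<open>auto simp: flat_def\<close>)
    then show ?thesis using 1 by (simp add: flat_def)
  next
    case 2
    have "((\<lambda>t. inverse t ^ n * exp (- inverse t)) has_real_derivative
        (flat (n + 2) t - real n * flat (n + 1) t)) (at t)"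
      using 2 by (auto intro!: derivative_eq_intros simp: flat_def field_simps power2_eq_square)
        (cases n; simp add: field_simps)+
    then show ?thesis
      by (rule has_field_derivative_transform_within_open[of _ _ _ "{0<..}"]) (use 2 in \<open>auto simp: flat_def\<close>)
  next
    case 3
    \<comment> \<open>At the origin the difference quotient is \<open>flat (n + 1)\<close>, which
      vanishes on the left and is beaten by the exponential on the right.\<close>
    have "((\<lambda>h. flat n h / h) \<longlongrightarrow> 0) (at_left 0)"
      by (rule tendsto_eventually) (auto simp: eventually_at_left_field flat_def intro!: exI[of _ "-1"])
    moreover have "((\<lambda>h. flat n h / h) \<longlongrightarrow> 0) (at_right 0)"
    proof (rule Lim_transform_eventually)
      show "((\<lambda>h::real. inverse h ^ (n + 1) / exp (inverse h)) \<longlongrightarrow> 0) (at_right 0)"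
        by (rule filterlim_compose[OF tendsto_power_div_exp_0 filterlim_inverse_at_top_right])
      show "\<forall>\<^sub>F h in at_right 0. inverse h ^ (n + 1) / exp (inverse h) = flat n h / h"
        by (auto simp: eventually_at_right_field flat_def exp_minus field_simps intro!: exI[of _ 1])
    qed
    ultimately have "((\<lambda>h. flat n h / h) \<longlongrightarrow> 0) (at 0)" by (rule filterlim_split_at)
    then show ?thesis using 3 by (simp add: DERIV_def flat_def)
  qed
qed

lemma smooth_on_flat: "smooth_on UNIV (flat n)"
proof -
  have "differentiable_upto r UNIV (flat n)" for r
  proof (induction r arbitrary: n)
    case 0
    have "isCont (flat n) t" for t using flat_DERIV DERIV_isCont by blast
    then show ?case by (simp add: continuous_at_imp_continuous_on)
  next
    case (Suc r)
    show ?case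
    proof (rule differentiable_upto_SucI)
      show "(flat n has_derivative (\<lambda>v. (flat (n + 2) t - real n * flat (n + 1) t) * v)) (at t)" for t
        using flat_DERIV[of n t] unfolding has_field_derivative_def .
      have "differentiable_upto r UNIV (\<lambda>t. v * flat (n + 2) t + (- (v * real n)) * flat (n + 1) t)" for v
        by (intro differentiable_upto_add differentiable_upto_bounded_linear[OF _ bounded_linear_mult_right] Suc.IH) auto
      then show "differentiable_upto r UNIV (\<lambda>t. (flat (n + 2) t - real n * flat (n + 1) t) * v)" for v
        by (rule differentiable_upto_cong[rotated 2]) (auto simp: algebra_simps)
    qed simp
  qed
  then show ?thesis unfolding smooth_on_def by blast
qed

lemma smooth_on_cis: "smooth_on UNIV cis"
proof -
  \<comment> \<open>Two free coefficients make this class of functions closed under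
    differentiation.\<close>
  have trig: "differentiable_upto r UNIV (\<lambda>t::real. A * cos t + B * sin t)" for r A B
  proof (induction r arbitrary: A B)
    case 0
    show ?case by (simp add: continuous_intros)
  next
    case (Suc r)
    show ?case
    proof (rule differentiable_upto_SucI)
      show "((\<lambda>t. A * cos t + B * sin t) has_derivative (\<lambda>v. (B * v) * cos t + (- (A * v)) * sin t)) (at t)" for t
        by (auto intro!: derivative_eq_intros simp: algebra_simps)
      show "differentiable_upto r UNIV (\<lambda>t. (B * v) * cos t + (- (A * v)) * sin t)" for v
        by (rule Suc.IH)
    qed simp
  qed
  have "differentiable_upto r UNIV (\<lambda>t. complex_of_real (1 * cos t + 0 * sin t) + \<i> * complex_of_real (0 * cos t + 1 * sin t))" for r
    by (intro differentiable_upto_add differentiable_upto_bounded_linear[OF _ bounded_linear_mult_right]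
      differentiable_upto_bounded_linear[OF _ bounded_linear_of_real] trig) auto
  then have "differentiable_upto r UNIV cis" for r
    by (rule differentiable_upto_cong[rotated 2]) (auto simp: complex_eq_iff)
  then show ?thesis unfolding smooth_on_def by blast
qed

section \<open>Smooth functions on manifolds\<close>

lemma smooth_atlasD:
  assumes "smooth_atlas \<A>" "(U, \<phi>) \<in> \<A>"
  shows "open U" "open (\<phi> ` U)" "continuous_on U \<phi>" "continuous_on (\<phi> ` U) (inv_into U \<phi>)"
    "x \<in> U \<Longrightarrow> inv_into U \<phi> (\<phi> x) = x"
    "(W, \<psi>) \<in> \<A> \<Longrightarrow> smooth_on (\<phi> ` (U \<inter> W)) (\<psi> \<circ> inv_into U \<phi>)"
    "W \<subseteq> U \<Longrightarrow> open W \<Longrightarrow> open (\<phi> ` W)"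
proof -
  have *: "open U" "open (\<phi> ` U)" "homeomorphism U (\<phi> ` U) \<phi> (inv_into U \<phi>)"
    using assms unfolding smooth_atlas_def by blast+
  then show "open U" "open (\<phi> ` U)" "continuous_on U \<phi>" "continuous_on (\<phi> ` U) (inv_into U \<phi>)"
    "x \<in> U \<Longrightarrow> inv_into U \<phi> (\<phi> x) = x" by (auto simp: homeomorphism_def)
  show "(W, \<psi>) \<in> \<A> \<Longrightarrow> smooth_on (\<phi> ` (U \<inter> W)) (\<psi> \<circ> inv_into U \<phi>)"
    using assms unfolding smooth_atlas_def by blast
  show "open (\<phi> ` W)" if "W \<subseteq> U" "open W"
    using homeomorphism_imp_open_map[OF *(3), of W] *(1,2) that
    by (simp add: openin_open_eq)
qed

lemma smooth_atlas_chart: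
  assumes "smooth_atlas \<A>"
  obtains U \<phi> where "(U, \<phi>) \<in> \<A>" "x \<in> U"
proof -
  have "x \<in> (\<Union>(U, \<phi>)\<in>\<A>. U)" using assms unfolding smooth_atlas_def by simp
  then show ?thesis using that by blast
qed

lemma smooth_funD: "smooth_fun \<A> V f \<Longrightarrow> (U, \<phi>) \<in> \<A> \<Longrightarrow> smooth_on (\<phi> ` (U \<inter> V)) (f \<circ> inv_into U \<phi>)"
  unfolding smooth_fun_def by blast

lemma smooth_fun_local:
  assumes \<A>: "smooth_atlas \<A>" and V: "open V"
    and loc: "\<And>x. x \<in> V \<Longrightarrow> \<exists>W g. open W \<and> x \<in> W \<and> smooth_fun \<A> W g \<and> (\<forall>y\<in>W \<inter> V. g y = f y)"
  shows "smooth_fun \<A> V f"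
  unfolding smooth_fun_def
proof (intro ballI, clarify)
  fix U \<phi> assume U: "(U, \<phi>) \<in> \<A>"
  note C = smooth_atlasD[OF \<A> U]
  show "smooth_on (\<phi> ` (U \<inter> V)) (f \<circ> inv_into U \<phi>)"
  proof (rule smooth_on_local)
    fix y assume "y \<in> \<phi> ` (U \<inter> V)"
    then obtain x where x: "y = \<phi> x" "x \<in> U" "x \<in> V" by blast
    obtain W g where W: "open W" "x \<in> W" "smooth_fun \<A> W g" "\<And>y. y \<in> W \<inter> V \<Longrightarrow> g y = f y"
      using loc[OF x(3)] by blast
    have o: "open (\<phi> ` (U \<inter> (W \<inter> V)))" by (intro C(7) open_Int C(1) W V) auto
    have "smooth_on (\<phi> ` (U \<inter> (W \<inter> V))) (g \<circ> inv_into U \<phi>)"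
      by (rule smooth_on_subset[OF smooth_funD[OF W(3) U]]) blast
    then have "smooth_on (\<phi> ` (U \<inter> (W \<inter> V))) (f \<circ> inv_into U \<phi>)"
      by (rule smooth_on_cong[OF _ o]) (auto simp: C(5) W(4))
    then show "\<exists>Y. open Y \<and> y \<in> Y \<and> smooth_on Y (f \<circ> inv_into U \<phi>)"
      using o x W(2) by blast
  qed
qed

lemma smooth_fun_subset: "smooth_fun \<A> V f \<Longrightarrow> W \<subseteq> V \<Longrightarrow> smooth_fun \<A> W f"
  unfolding smooth_fun_def by (fastforce intro: smooth_on_subset)

lemma smooth_fun_continuous:
  fixes \<A> :: "('m::t2_space, 'e::euclidean_space) chart set"
  assumes \<A>: "smooth_atlas \<A>" and V: "open V" and f: "smooth_fun \<A> V f"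
  shows "continuous_on V f"
proof (rule continuous_at_imp_continuous_on, rule ballI)
  fix x assume x: "x \<in> V"
  obtain U \<phi> where U: "(U, \<phi>) \<in> \<A>" "x \<in> U" using smooth_atlas_chart[OF \<A>] .
  note C = smooth_atlasD[OF \<A> U(1)]
  have o: "open (U \<inter> V)" using C(1) V by blast
  have "continuous_on (\<phi> ` (U \<inter> V)) (f \<circ> inv_into U \<phi>)"
    by (rule smooth_on_continuous[OF smooth_funD[OF f U(1)]]) (use C(7) o in auto)
  with continuous_on_subset[OF C(3) Int_lower1[of U V]]
  have "continuous_on (U \<inter> V) ((f \<circ> inv_into U \<phi>) \<circ> \<phi>)" by (rule continuous_on_compose)
  then have "continuous_on (U \<inter> V) f"
    by (rule continuous_on_eq) (simp add: C(5))
  then show "isCont f x" using o x U(2) by (simp add: continuous_on_eq_continuous_at)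
qed

lemma smooth_fun_const: "smooth_atlas \<A> \<Longrightarrow> open V \<Longrightarrow> smooth_fun \<A> V (\<lambda>x. c)"
  unfolding smooth_fun_def o_def
  by (clarify, rule smooth_on_const) (auto intro: smooth_atlasD(7)[of \<A>] dest: smooth_atlasD(1))

lemma smooth_fun_bounded_linear:
  assumes "smooth_atlas \<A>" "open V" "bounded_linear h" "smooth_fun \<A> V f"
  shows "smooth_fun \<A> V (\<lambda>x. h (f x))"
  unfolding smooth_fun_def
proof (intro ballI, clarify)
  fix U \<phi> assume U: "(U, \<phi>) \<in> \<A>"
  note C = smooth_atlasD[OF assms(1) U]
  have "open (\<phi> ` (U \<inter> V))" by (intro C(7) open_Int C(1) assms) auto
  then show "smooth_on (\<phi> ` (U \<inter> V)) ((\<lambda>x. h (f x)) \<circ> inv_into U \<phi>)"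
    using smooth_on_bounded_linear[OF _ assms(3) smooth_funD[OF assms(4) U]] by (simp add: o_def)
qed

lemma smooth_fun_bilinear:
  assumes "smooth_atlas \<A>" "open V" "bounded_bilinear h" "smooth_fun \<A> V f" "smooth_fun \<A> V g"
  shows "smooth_fun \<A> V (\<lambda>x. h (f x) (g x))"
  unfolding smooth_fun_def
proof (intro ballI, clarify)
  fix U \<phi> assume U: "(U, \<phi>) \<in> \<A>"
  note C = smooth_atlasD[OF assms(1) U]
  have "open (\<phi> ` (U \<inter> V))" by (intro C(7) open_Int C(1) assms) auto
  then show "smooth_on (\<phi> ` (U \<inter> V)) ((\<lambda>x. h (f x) (g x)) \<circ> inv_into U \<phi>)"
    using smooth_on_bilinear[OF _ assms(3) smooth_funD[OF assms(4) U] smooth_funD[OF assms(5) U]]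
    by (simp add: o_def)
qed

lemma smooth_fun_add:
  assumes "smooth_atlas \<A>" "open V" "smooth_fun \<A> V f" "smooth_fun \<A> V g"
  shows "smooth_fun \<A> V (\<lambda>x. f x + g x)"
  unfolding smooth_fun_def
proof (intro ballI, clarify)
  fix U \<phi> assume U: "(U, \<phi>) \<in> \<A>"
  note C = smooth_atlasD[OF assms(1) U]
  have "open (\<phi> ` (U \<inter> V))" by (intro C(7) open_Int C(1) assms) auto
  then show "smooth_on (\<phi> ` (U \<inter> V)) ((\<lambda>x. f x + g x) \<circ> inv_into U \<phi>)"
    using smooth_on_add[OF _ smooth_funD[OF assms(3) U] smooth_funD[OF assms(4) U]] by (simp add: o_def)
qed

lemma smooth_fun_compose_map:
  assumes \<A>: "smooth_atlas \<A>" and \<B>: "smooth_atlas \<B>" and V: "open V" and W: "open W"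
    and s: "smooth_map \<A> \<B> V s" "s ` V \<subseteq> W" and f: "smooth_fun \<B> W f"
  shows "smooth_fun \<A> V (\<lambda>x. f (s x))"
  unfolding smooth_fun_def
proof (intro ballI, clarify)
  fix U \<phi> assume U: "(U, \<phi>) \<in> \<A>"
  note C = smooth_atlasD[OF \<A> U]
  have cs: "continuous_on V s" using s(1) unfolding smooth_map_def by blast
  show "smooth_on (\<phi> ` (U \<inter> V)) ((\<lambda>x. f (s x)) \<circ> inv_into U \<phi>)"
  proof (rule smooth_on_local)
    fix y assume "y \<in> \<phi> ` (U \<inter> V)"
    then obtain x where x: "y = \<phi> x" "x \<in> U" "x \<in> V" by blast
    obtain U' \<psi> where U': "(U', \<psi>) \<in> \<B>" "s x \<in> U'" using smooth_atlas_chart[OF \<B>] .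
    note C' = smooth_atlasD[OF \<B> U'(1)]
    \<comment> \<open>Smoothness of \<open>s\<close> is tested only where \<open>s\<close> lands in
      the domain of the target chart. That this set is open comes from the continuity clause of
      \<open>smooth_map\<close>.\<close>
    define N where "N = {x \<in> U \<inter> V. s x \<in> U'}"
    have "N = U \<inter> (V \<inter> s -` U')" by (auto simp: N_def)
    moreover have "open (V \<inter> s -` U')"
      using continuous_on_open_vimage[OF V, of s] cs C'(1) by (simp add: Int_commute)
    ultimately have oN: "open N" using open_Int[OF C(1)] by blast
    have oY: "open (\<phi> ` N)" by (rule C(7)[OF _ oN]) (auto simp: N_def)
    have oZ: "open (\<psi> ` (U' \<inter> W))" by (intro C'(7) open_Int C'(1) W) auto
    have 1: "smooth_on (\<phi> ` N) (\<psi> \<circ> s \<circ> inv_into U \<phi>)"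
      using s(1) U U'(1) unfolding smooth_map_def N_def by blast
    have "smooth_on (\<phi> ` N) (\<lambda>y. (f \<circ> inv_into U' \<psi>) ((\<psi> \<circ> s \<circ> inv_into U \<phi>) y))"
      by (rule smooth_on_compose[OF oY oZ _ 1 smooth_funD[OF f U'(1)]])
        (use s(2) in \<open>auto simp: N_def C(5) image_subset_iff\<close>)
    then have "smooth_on (\<phi> ` N) ((\<lambda>x. f (s x)) \<circ> inv_into U \<phi>)"
      by (rule smooth_on_cong[OF _ oY]) (auto simp: N_def C(5) C'(5))
    then show "\<exists>Y. open Y \<and> y \<in> Y \<and> smooth_on Y ((\<lambda>x. f (s x)) \<circ> inv_into U \<phi>)"
      using oY x U'(2) by (auto simp: N_def)
  qed
qed

section \<open>Unitary matrices\<close>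

definition adj :: "complex^'n^'n \<Rightarrow> complex^'n^'n" where
  "adj A = (\<chi> i j. cnj (A $ j $ i))"

definition cip :: "complex^'n \<Rightarrow> complex^'n \<Rightarrow> complex" where
  "cip v w = (\<Sum>i\<in>UNIV. cnj (v $ i) * w $ i)"

lemma unitary_matrix_adj: "unitary_matrix A \<longleftrightarrow> adj A ** A = mat 1 \<and> A ** adj A = mat 1"
  unfolding unitary_matrix_def adj_def ..

lemma matrix_vector_scalar: "(A::complex^'n::finite^'n) *v (z *s v) = z *s (A *v v)"
  by (simp add: vec_eq_iff matrix_vector_mult_def sum_distrib_left mult_ac)

lemma adj_matrix_mult: "adj (A ** (C::complex^'n::finite^'n)) = adj C ** adj A"
  by (simp add: adj_def vec_eq_iff matrix_matrix_mult_def mult.commute)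

lemma norm_scalar_vector: "norm (z *s (v::complex^'n::finite)) = cmod z * norm v"
  by (simp add: norm_vec_def L2_set_right_distrib norm_mult)

lemma adj_adj [simp]: "adj (adj A) = A"
  by (simp add: adj_def vec_eq_iff)

lemma matrix_inv_unitary: "unitary_matrix A \<Longrightarrow> matrix_inv A = adj (A::complex^'n::finite^'n)"
proof -
  assume "unitary_matrix A"
  then have A: "A ** adj A = mat 1 \<and> adj A ** A = mat 1" by (simp add: unitary_matrix_adj)
  then have "A ** matrix_inv A = mat 1 \<and> matrix_inv A ** A = mat 1"
    unfolding matrix_inv_def by (rule someI)
  then have "matrix_inv A = (adj A ** A) ** matrix_inv A" using A by simp
  also have "\<dots> = adj A ** (A ** matrix_inv A)" by (rule matrix_mul_assoc[symmetric])
  also have "\<dots> = adj A" using \<open>A ** matrix_inv A = mat 1 \<and> _\<close> by simp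
  finally show ?thesis .
qed

lemma cip_adj: "cip (A *v v) w = cip v (adj A *v w)"
proof -
  have "cip (A *v v) w = (\<Sum>i\<in>UNIV. \<Sum>j\<in>UNIV. cnj (A $ i $ j) * cnj (v $ j) * w $ i)"
    by (simp add: cip_def matrix_vector_mult_def sum_distrib_right)
  also have "\<dots> = (\<Sum>j\<in>UNIV. \<Sum>i\<in>UNIV. cnj (A $ i $ j) * cnj (v $ j) * w $ i)" by (rule sum.swap)
  also have "\<dots> = cip v (adj A *v w)"
    by (simp add: cip_def adj_def matrix_vector_mult_def sum_distrib_left mult_ac)
  finally show ?thesis .
qed

lemma cip_unitary: "unitary_matrix A \<Longrightarrow> cip (A *v v) (A *v w) = cip v w"
  by (simp add: cip_adj matrix_vector_mul_assoc unitary_matrix_adj)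

lemma cip_self: "cip v v = complex_of_real ((norm v)\<^sup>2)"
proof -
  have "cnj z * z = complex_of_real ((cmod z)\<^sup>2)" for z by (metis complex_norm_square mult.commute)
  then show ?thesis unfolding cip_def by (simp add: norm_vec_def L2_set_def sum_nonneg)
qed

lemma norm_unitary: "unitary_matrix A \<Longrightarrow> norm (A *v v) = norm (v::complex^'n)"
proof -
  assume "unitary_matrix A"
  then have "complex_of_real ((norm (A *v v))\<^sup>2) = complex_of_real ((norm v)\<^sup>2)"
    using cip_unitary[of A v v] by (simp only: cip_self)
  then show ?thesis by (simp only: of_real_eq_iff) simp
qed

lemma cip_commute: "cip w v = cnj (cip v w)"
  by (simp add: cip_def mult.commute)

lemma cip_add_right: "cip v (w + w') = cip v w + cip v w'"
  by (simp add: cip_def distrib_left sum.distrib)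

lemma cip_scale_right: "cip v (z *s w) = z * cip v w"
  by (simp add: cip_def sum_distrib_left mult_ac)

text \<open>A crude consequence of the inequality between arithmetic and geometric means, enough to
  derive integrability of pointwise inner products from square integrability.\<close>

lemma norm_cip_le: "cmod (cip v w) \<le> (norm v)\<^sup>2 + (norm w)\<^sup>2"
proof -
  have "cmod (cip v w) \<le> (\<Sum>i\<in>UNIV. cmod (v $ i) * cmod (w $ i))"
    unfolding cip_def by (rule order_trans[OF norm_sum]) (simp add: norm_mult)
  also have "\<dots> \<le> (\<Sum>i\<in>UNIV. (cmod (v $ i))\<^sup>2 + (cmod (w $ i))\<^sup>2)"
  proof (rule sum_mono)
    fix i
    have "2 * (cmod (v $ i) * cmod (w $ i)) \<le> (cmod (v $ i))\<^sup>2 + (cmod (w $ i))\<^sup>2"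
      using sum_squares_bound[of "cmod (v $ i)" "cmod (w $ i)"] by simp
    moreover have "0 \<le> cmod (v $ i) * cmod (w $ i)" by simp
    ultimately show "cmod (v $ i) * cmod (w $ i) \<le> (cmod (v $ i))\<^sup>2 + (cmod (w $ i))\<^sup>2" by linarith
  qed
  also have "\<dots> = (norm v)\<^sup>2 + (norm w)\<^sup>2"
    by (simp add: norm_vec_def L2_set_def sum_nonneg sum.distrib)
  finally show ?thesis .
qed

lemma bounded_bilinear_matrix_matrix: "bounded_bilinear ((**) :: complex^'n::finite^'n \<Rightarrow> _ \<Rightarrow> complex^'n^'n)"
  unfolding bilinear_conv_bounded_bilinear[symmetric] bilinear_def
  by (auto intro!: linearI simp: vec_eq_iff matrix_matrix_mult_def algebra_simps sum.distrib scaleR_sum_right)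

lemma bounded_bilinear_matrix_vector: "bounded_bilinear ((*v) :: complex^'n::finite^'n \<Rightarrow> _ \<Rightarrow> complex^'n)"
  unfolding bilinear_conv_bounded_bilinear[symmetric] bilinear_def
  by (auto intro!: linearI simp: vec_eq_iff matrix_vector_mult_def algebra_simps sum.distrib scaleR_sum_right)

lemma bounded_bilinear_scalar_vector: "bounded_bilinear ((*s) :: complex \<Rightarrow> _ \<Rightarrow> complex^'n::finite)"
  unfolding bilinear_conv_bounded_bilinear[symmetric] bilinear_def
  by (auto intro!: linearI simp: vec_eq_iff algebra_simps)

lemma bounded_linear_adj: "bounded_linear (adj :: complex^'n::finite^'n \<Rightarrow> _)"
  unfolding linear_conv_bounded_linear[symmetric]
  by (auto intro!: linearI simp: vec_eq_iff adj_def)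

lemma bounded_linear_mat: "bounded_linear (mat :: complex \<Rightarrow> complex^'n::finite^'n)"
  unfolding linear_conv_bounded_linear[symmetric]
  by (auto intro!: linearI simp: vec_eq_iff mat_def)

lemma mat_mult_vec: "mat z *v (v::complex^'n::finite) = z *s v"
  by (simp add: vec_eq_iff matrix_vector_mult_def mat_def if_distrib[of "\<lambda>x. x * _"] cong: if_cong)

lemma mat_mult_commute: "mat z ** (A::complex^'n::finite^'n) = A ** mat z"
  by (simp add: vec_eq_iff matrix_matrix_mult_def mat_def if_distrib[of "\<lambda>x. x * _"]
      if_distrib[of "\<lambda>x. _ * x"] mult.commute cong: if_cong)

section \<open>Principal bundles and their associated vector bundles\<close>

locale gbundle =
  fixes B :: "('m::t2_space, 'k::finite, 'p::t2_space, 'd::euclidean_space, 'n::finite) pbundle"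
  assumes principal: "principal_bundle B"
begin

lemma base_atlas: "smooth_atlas (base_atlas B)" and total_atlas: "smooth_atlas (total_atlas B)"
  and grp: "closed_unitary_group (grp B)"
  and bproj_smooth: "smooth_map (total_atlas B) (base_atlas B) UNIV (bproj B)"
  and bproj_ract: "g \<in> grp B \<Longrightarrow> bproj B (ract B p g) = bproj B p"
  and triv_exists: "\<exists>V s \<tau>. x \<in> V \<and> local_trivialization B V s \<tau>"
  and ract_one: "ract B p (mat 1) = p"
  and ract_ract: "g \<in> grp B \<Longrightarrow> h \<in> grp B \<Longrightarrow> ract B (ract B p g) h = ract B p (g ** h)"
  using principal unfolding principal_bundle_def smooth_right_action_def by auto

lemma grp_unitary: "g \<in> grp B \<Longrightarrow> unitary_matrix g"
  and grp_one: "mat 1 \<in> grp B"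
  and grp_mult: "g \<in> grp B \<Longrightarrow> h \<in> grp B \<Longrightarrow> g ** h \<in> grp B"
  using grp unfolding closed_unitary_group_def by blast+

lemma grp_adj: "g \<in> grp B \<Longrightarrow> adj g \<in> grp B"
  using grp matrix_inv_unitary[of g] unfolding closed_unitary_group_def by fastforce

lemma adj_mult: "g \<in> grp B \<Longrightarrow> adj g ** g = mat 1" "g \<in> grp B \<Longrightarrow> g ** adj g = mat 1"
  using grp_unitary[of g] unfolding unitary_matrix_adj by blast+

lemma adj_mult_assoc:
  "g \<in> grp B \<Longrightarrow> adj g ** (g ** A) = A" "g \<in> grp B \<Longrightarrow> g ** (adj g ** A) = A"
  by (simp_all add: matrix_mul_assoc adj_mult)

lemma adj_mult_vec: "g \<in> grp B \<Longrightarrow> adj g *v (g *v v) = v" "g \<in> grp B \<Longrightarrow> g *v (adj g *v v) = v"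
  by (simp_all add: matrix_vector_mul_assoc adj_mult)

lemma bproj_continuous: "continuous_on UNIV (bproj B)"
  using bproj_smooth unfolding smooth_map_def by blast

lemma open_bproj_vimage: "open V \<Longrightarrow> open (bproj B -` V)"
  using bproj_continuous by (rule open_vimage[rotated])

lemma trivD:
  assumes "local_trivialization B V s \<tau>"
  shows "open V" "smooth_map (base_atlas B) (total_atlas B) V s"
    "smooth_fun (total_atlas B) (bproj B -` V) \<tau>"
    "x \<in> V \<Longrightarrow> bproj B (s x) = x"
    "bproj B p \<in> V \<Longrightarrow> \<tau> p \<in> grp B" "bproj B p \<in> V \<Longrightarrow> ract B (s (bproj B p)) (\<tau> p) = p"
    "bproj B p \<in> V \<Longrightarrow> g \<in> grp B \<Longrightarrow> \<tau> (ract B p g) = \<tau> p ** g"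
  using assms unfolding local_trivialization_def by auto

text \<open>Freeness, and below transitivity on fibres, are read off the coordinate \<tau> of a
  local trivialization, in which the action is right multiplication.\<close>

lemma ract_free:
  assumes "g \<in> grp B" "h \<in> grp B" "ract B p g = ract B p h"
  shows "g = h"
proof -
  obtain V s \<tau> where T: "bproj B p \<in> V" "local_trivialization B V s \<tau>" using triv_exists by blast
  note T' = trivD[OF T(2)]
  have "\<tau> p ** g = \<tau> p ** h" using T'(7)[OF T(1)] assms by metis
  then have "adj (\<tau> p) ** (\<tau> p ** g) = adj (\<tau> p) ** (\<tau> p ** h)" by simp
  then show ?thesis using T'(5)[OF T(1)] by (simp add: adj_mult_assoc)
qed

lemma ract_transitive:
  assumes "bproj B p = bproj B q"
  shows "\<exists>g\<in>grp B. q = ract B p g"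
proof -
  obtain V s \<tau> where T: "bproj B p \<in> V" "local_trivialization B V s \<tau>" using triv_exists by blast
  note T' = trivD[OF T(2)]
  let ?x = "s (bproj B p)"
  have p: "ract B ?x (\<tau> p) = p" "\<tau> p \<in> grp B" and q: "ract B ?x (\<tau> q) = q" "\<tau> q \<in> grp B"
    using T'(5,6)[of p] T'(5,6)[of q] T(1) assms by auto
  have "ract B p (adj (\<tau> p) ** \<tau> q) = ract B (ract B ?x (\<tau> p)) (adj (\<tau> p) ** \<tau> q)" using p by simp
  also have "\<dots> = ract B ?x (\<tau> p ** (adj (\<tau> p) ** \<tau> q))" using p q by (intro ract_ract grp_mult grp_adj)
  also have "\<dots> = q" using p q by (simp add: adj_mult_assoc)
  finally show ?thesis using p q by (intro bexI[of _ "adj (\<tau> p) ** \<tau> q"]) (auto intro: grp_mult grp_adj)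
qed

text \<open>Replacing \<open>g\<close> by its inverse \<open>adj g\<close> exhibits the orbit as a
  graph over the right translates of \<open>p\<close>.\<close>

lemma eorbit_altdef: "eorbit B p v = {(ract B p g, adj g *v v) | g. g \<in> grp B}"
proof -
  have "eorbit B p v = {(ract B p (adj g), g *v v) | g. g \<in> grp B}"
    unfolding eorbit_def using matrix_inv_unitary grp_unitary by (metis (no_types, lifting))
  also have "\<dots> = {(ract B p g, adj g *v v) | g. g \<in> grp B}"
    using grp_adj adj_adj by (metis (no_types, opaque_lifting))
  finally show ?thesis .
qed

lemma eorbit_base: "(p, v) \<in> eorbit B p v"
proof -
  have "adj (mat 1) *v v = v" using adj_mult_vec(1)[OF grp_one, of v] by simp
  then show ?thesis
    unfolding eorbit_altdef by (intro CollectI exI[of _ "mat 1"]) (simp add: ract_one grp_one)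
qed

text \<open>By freeness the orbit has exactly one vector over each point of the fibre through
  \<open>p\<close>; this makes the fibrewise operations well defined.\<close>

lemma eorbit_mem:
  assumes "g \<in> grp B"
  shows "(ract B p g, w) \<in> eorbit B p v \<longleftrightarrow> w = adj g *v v"
  unfolding eorbit_altdef using assms ract_free[of g _ p] by auto

text \<open>The change of frame rule behind every comparison of local coordinates.\<close>

lemma eorbit_ract:
  assumes g: "g \<in> grp B"
  shows "eorbit B (ract B p g) v = eorbit B p (g *v v)"
proof -
  have "eorbit B (ract B p g) v = {(ract B p (g ** h), adj h *v v) | h. h \<in> grp B}"
    unfolding eorbit_altdef by (rule Collect_cong, rule ex_cong1) (auto simp: ract_ract g)
  also have "\<dots> = {(ract B p h, adj h *v (g *v v)) | h. h \<in> grp B}"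
  proof (intro set_eqI iffI; clarify)
    fix h assume h: "h \<in> grp B"
    have "adj (g ** h) *v (g *v v) = adj h *v v"
    proof -
      have "adj (g ** h) = adj h ** adj g"
        by (simp add: adj_def vec_eq_iff matrix_matrix_mult_def mult.commute)
      then show ?thesis using g by (simp add: adj_mult_vec flip: matrix_vector_mul_assoc)
    qed
    then show "\<exists>ha. (ract B p (g ** h), adj h *v v) = (ract B p ha, adj ha *v (g *v v)) \<and> ha \<in> grp B"
      using g h grp_mult by (intro exI[of _ "g ** h"]) auto
  next
    fix h assume h: "h \<in> grp B"
    have "adj (adj g ** h) *v v = adj h *v (g *v v)"
      by (simp add: adj_def vec_eq_iff matrix_matrix_mult_def mult.commute matrix_vector_mul_assoc)
    then show "\<exists>ha. (ract B p h, adj h *v (g *v v)) = (ract B p (g ** ha), adj ha *v v) \<and> ha \<in> grp B"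
      using g h by (intro exI[of _ "adj g ** h"]) (auto simp: adj_mult_assoc intro: grp_mult grp_adj)
  qed
  finally show ?thesis by (simp add: eorbit_altdef)
qed

lemma eorbit_eq_iff: "eorbit B p v = eorbit B p w \<longleftrightarrow> v = w"
proof
  assume "eorbit B p v = eorbit B p w"
  then have "(ract B p (mat 1), v) \<in> eorbit B p w" using eorbit_base[of p v] by (simp add: ract_one)
  then have "v = adj (mat 1) *v w" using eorbit_mem[OF grp_one] by blast
  then show "v = w" using adj_mult_vec(1)[OF grp_one, of w] by simp
qed simp

lemma eorbitE:
  assumes "e \<in> eorbit B p v"
  obtains g where "g \<in> grp B" "e = (ract B p g, adj g *v v)"
  using assms unfolding eorbit_altdef by blast

lemma eadd_eorbit: "eadd (eorbit B p v) (eorbit B p w) = eorbit B p (v + w)"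
proof (intro set_eqI iffI)
  fix e assume "e \<in> eadd (eorbit B p v) (eorbit B p w)"
  then obtain q v' w' where e: "e = (q, v' + w')" "(q, v') \<in> eorbit B p v" "(q, w') \<in> eorbit B p w"
    unfolding eadd_def by blast
  obtain g where g: "g \<in> grp B" "q = ract B p g" "v' = adj g *v v" using e(2) by (auto elim: eorbitE)
  then have "w' = adj g *v w" using e(3) eorbit_mem by auto
  then show "e \<in> eorbit B p (v + w)" using e g by (simp add: eorbit_mem matrix_vector_right_distrib)
next
  fix e assume "e \<in> eorbit B p (v + w)"
  then obtain g where g: "g \<in> grp B" "e = (ract B p g, adj g *v (v + w))" by (rule eorbitE)
  then have "(ract B p g, adj g *v v) \<in> eorbit B p v" "(ract B p g, adj g *v w) \<in> eorbit B p w"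
    by (simp_all add: eorbit_mem)
  then show "e \<in> eadd (eorbit B p v) (eorbit B p w)"
    unfolding eadd_def g(2) matrix_vector_right_distrib by blast
qed

lemma escale_eorbit: "escale z (eorbit B p v) = eorbit B p (z *s v)"
  unfolding escale_def by (auto elim!: eorbitE simp: eorbit_mem matrix_vector_scalar)

lemma enorm_eorbit: "enorm (eorbit B p v) = norm v"
  unfolding enorm_def
proof (rule the_equality)
  show "\<exists>q w. (q, w) \<in> eorbit B p v \<and> norm v = norm w" using eorbit_base by blast
  show "r = norm v" if "\<exists>q w. (q, w) \<in> eorbit B p v \<and> r = norm w" for r
    using that norm_unitary[OF grp_unitary[OF grp_adj]] by (auto elim!: eorbitE)
qed

lemma einner_eorbit: "einner (eorbit B p v) (eorbit B p w) = cip v w"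
  unfolding einner_def
proof (rule the_equality)
  show "\<exists>q v' w'. (q, v') \<in> eorbit B p v \<and> (q, w') \<in> eorbit B p w \<and> cip v w = (\<Sum>i\<in>UNIV. cnj (v' $ i) * w' $ i)"
    using eorbit_base unfolding cip_def by blast
  fix z assume "\<exists>q v' w'. (q, v') \<in> eorbit B p v \<and> (q, w') \<in> eorbit B p w \<and> z = (\<Sum>i\<in>UNIV. cnj (v' $ i) * w' $ i)"
  then obtain q v' w' where e: "(q, v') \<in> eorbit B p v" "(q, w') \<in> eorbit B p w" "z = cip v' w'"
    unfolding cip_def by blast
  obtain g where g: "g \<in> grp B" "q = ract B p g" "v' = adj g *v v" using e(1) by (auto elim: eorbitE)
  then have "w' = adj g *v w" using e(2) eorbit_mem by auto
  then show "z = cip v w" using e g cip_unitary[OF grp_unitary[OF grp_adj[OF g(1)]]] by simp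
qed

lemma ezero_eorbit: "ezero B (bproj B p) = eorbit B p 0"
proof (intro set_eqI iffI)
  fix e assume "e \<in> ezero B (bproj B p)"
  then obtain q where "e = (q, 0)" "bproj B q = bproj B p" unfolding ezero_def by blast
  moreover from this obtain g where "g \<in> grp B" "q = ract B p g" using ract_transitive[of p q] by auto
  ultimately show "e \<in> eorbit B p 0" by (simp add: eorbit_mem)
qed (auto simp: ezero_def bproj_ract elim!: eorbitE)

text \<open>Gauge transformations are handled through these equivariant functions; on the group
  \<open>adj\<close> agrees with \<open>matrix_inv\<close>.\<close>

definition gfun :: "('p \<Rightarrow> complex^'n^'n) \<Rightarrow> bool" where
  "gfun f \<longleftrightarrow> smooth_fun (total_atlas B) UNIV f \<and> range f \<subseteq> grp B \<and>
    (\<forall>p. \<forall>g\<in>grp B. f (ract B p g) = adj g ** f p ** g)"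

lemma gauge_group_gfun:
  assumes "\<gamma> \<in> gauge_group B"
  shows "\<exists>f. gfun f \<and> (\<forall>p v. \<gamma> (eorbit B p v) = eorbit B p (f p *v v))"
proof -
  obtain f where f: "smooth_fun (total_atlas B) UNIV f" "range f \<subseteq> grp B"
    "\<And>p g. g \<in> grp B \<Longrightarrow> f (ract B p g) = matrix_inv g ** f p ** g"
    "\<And>p v. \<gamma> (eorbit B p v) = eorbit B p (f p *v v)"
    using assms unfolding gauge_group_def by blast
  have "matrix_inv g = adj g" if "g \<in> grp B" for g using that matrix_inv_unitary grp_unitary by blast
  then have "gfun f" using f(1-3) unfolding gfun_def by simp
  then show ?thesis using f(4) by blast
qed

lemma gfun_gauge_group:
  assumes f: "gfun f"
  shows "\<exists>\<gamma>\<in>gauge_group B. \<forall>p v. \<gamma> (eorbit B p v) = eorbit B p (f p *v v)"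
proof
  \<comment> \<open>Applying \<open>f\<close> to each pair of an orbit yields an orbit again by
    equivariance; \<open>restrict\<close> supplies the normalization outside
    \<open>etotal B\<close>.\<close>
  define \<gamma> where "\<gamma> = restrict (\<lambda>e. {(p, f p *v v) | p v. (p, v) \<in> e}) (etotal B)"
  show *: "\<forall>p v. \<gamma> (eorbit B p v) = eorbit B p (f p *v v)"
  proof (intro allI)
    fix p v
    have "eorbit B p v \<in> etotal B" unfolding etotal_def by blast
    then have "\<gamma> (eorbit B p v) = {(q, f q *v w) | q w. (q, w) \<in> eorbit B p v}" by (simp add: \<gamma>_def)
    also have "\<dots> = {(ract B p g, f (ract B p g) *v (adj g *v v)) | g. g \<in> grp B}"
      unfolding eorbit_altdef by blast
    also have "\<dots> = {(ract B p g, adj g *v (f p *v v)) | g. g \<in> grp B}"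
    proof -
      have "f (ract B p g) *v (adj g *v v) = adj g *v (f p *v v)" if "g \<in> grp B" for g
      proof -
        have "f (ract B p g) = adj g ** f p ** g" using f that unfolding gfun_def by blast
        then show ?thesis by (simp add: adj_mult_vec[OF that] flip: matrix_vector_mul_assoc)
      qed
      then show ?thesis by (intro Collect_cong) metis
    qed
    finally show "\<gamma> (eorbit B p v) = eorbit B p (f p *v v)" by (simp add: eorbit_altdef)
  qed
  have "matrix_inv g = adj g" if "g \<in> grp B" for g using that matrix_inv_unitary grp_unitary by blast
  then have "\<forall>p. \<forall>g\<in>grp B. f (ract B p g) = matrix_inv g ** f p ** g" using f unfolding gfun_def by simp
  then show "\<gamma> \<in> gauge_group B"
    unfolding gauge_group_def using * f by (auto simp: \<gamma>_def gfun_def)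
qed

lemma gfunD:
  assumes "gfun f"
  shows "smooth_fun (total_atlas B) UNIV f" "f p \<in> grp B"
    "g \<in> grp B \<Longrightarrow> f (ract B p g) = adj g ** (f p ** g)"
  using assms unfolding gfun_def by (auto simp: matrix_mul_assoc)

lemma gfunI:
  assumes "smooth_fun (total_atlas B) UNIV f" "\<And>p. f p \<in> grp B"
    "\<And>p g. g \<in> grp B \<Longrightarrow> f (ract B p g) = adj g ** (f p ** g)"
  shows "gfun f"
  using assms unfolding gfun_def by (auto simp: matrix_mul_assoc)

lemma gfun_adj: assumes f: "gfun f" shows "gfun (\<lambda>p. adj (f p))"
proof (rule gfunI)
  show "smooth_fun (total_atlas B) UNIV (\<lambda>p. adj (f p))"
    by (rule smooth_fun_bounded_linear[OF total_atlas open_UNIV bounded_linear_adj gfunD(1)[OF f]])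
  show "adj (f p) \<in> grp B" for p by (intro grp_adj gfunD(2)[OF f])
  show "adj (f (ract B p g)) = adj g ** (adj (f p) ** g)" if "g \<in> grp B" for p g
    unfolding gfunD(3)[OF f that] adj_matrix_mult adj_adj matrix_mul_assoc ..
qed

lemma gfun_mult: assumes f: "gfun f" and h: "gfun h" shows "gfun (\<lambda>p. f p ** h p)"
proof (rule gfunI)
  show "smooth_fun (total_atlas B) UNIV (\<lambda>p. f p ** h p)"
    by (rule smooth_fun_bilinear[OF total_atlas open_UNIV bounded_bilinear_matrix_matrix
      gfunD(1)[OF f] gfunD(1)[OF h]])
  show "f p ** h p \<in> grp B" for p by (intro grp_mult gfunD(2)[OF f] gfunD(2)[OF h])
  fix p g assume g: "g \<in> grp B"
  have "f (ract B p g) ** h (ract B p g) = adj g ** (f p ** (g ** (adj g ** (h p ** g))))"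
    unfolding gfunD(3)[OF f g] gfunD(3)[OF h g] by (simp only: matrix_mul_assoc)
  also have "\<dots> = adj g ** ((f p ** h p) ** g)"
    unfolding adj_mult_assoc(2)[OF g] by (simp only: matrix_mul_assoc)
  finally show "f (ract B p g) ** h (ract B p g) = adj g ** ((f p ** h p) ** g)" .
qed

text \<open>Scalar matrices are central, so a function pulled back from the base is invariant under
  conjugation. This is how hypothesis (i) produces gauge transformations.\<close>

lemma gfun_scalar:
  assumes G: "\<forall>z. cmod z = 1 \<longrightarrow> mat z \<in> grp B" and h: "smooth_fun (base_atlas B) UNIV h" "\<And>x. cmod (h x) = 1"
  shows "gfun (\<lambda>p. mat (h (bproj B p)))"
proof (rule gfunI)
  show "smooth_fun (total_atlas B) UNIV (\<lambda>p. mat (h (bproj B p)) :: complex^'n^'n)"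
    by (rule smooth_fun_bounded_linear[OF total_atlas open_UNIV bounded_linear_mat], rule smooth_fun_compose_map[OF total_atlas base_atlas open_UNIV open_UNIV bproj_smooth subset_UNIV h(1)])
  show "mat (h (bproj B p)) \<in> grp B" for p using G h(2) by blast
  fix p g assume g: "g \<in> grp B"
  show "mat (h (bproj B (ract B p g))) = adj g ** (mat (h (bproj B p)) ** g)"
    unfolding bproj_ract[OF g] mat_mult_commute[of _ g] adj_mult_assoc(1)[OF g] ..
qed

text \<open>A smooth section comes with its own local lifts \<open>s'\<close>; passing from them to
  the lift of the trivialization multiplies the coordinate by the smooth matrix
  \<open>\<tau> (s' y)\<close>. Such a common frame is what allows sections to be added.\<close>

lemma smooth_section_coord:
  assumes c: "smooth_section B c" and T: "local_trivialization B V s \<tau>"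
  shows "\<exists>u. smooth_fun (base_atlas B) V u \<and> (\<forall>y\<in>V. c y = eorbit B (s y) (u y))"
proof -
  note T' = trivD[OF T]
  have loc: "\<exists>W u. open W \<and> x \<in> W \<and> W \<subseteq> V \<and> smooth_fun (base_atlas B) W u \<and> (\<forall>y\<in>W. c y = eorbit B (s y) (u y))"
    if x: "x \<in> V" for x
  proof -
    obtain W s' v where W: "open W" "x \<in> W" "smooth_map (base_atlas B) (total_atlas B) W s'"
        "smooth_fun (base_atlas B) W v" "\<And>y. y \<in> W \<Longrightarrow> bproj B (s' y) = y"
        "\<And>y. y \<in> W \<Longrightarrow> c y = eorbit B (s' y) (v y)"
      using c unfolding smooth_section_def by meson
    have o: "open (W \<inter> V)" using W(1) T'(1) by blast
    have s': "smooth_map (base_atlas B) (total_atlas B) (W \<inter> V) s'"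
      unfolding smooth_map_def
    proof (intro conjI ballI, goal_cases)
      case 1
      show ?case using W(3) unfolding smooth_map_def by (auto intro: continuous_on_subset)
    next
      case (2 C)
      obtain U \<phi> where C: "C = (U, \<phi>)" by (cases C)
      show ?case unfolding C
      proof (clarify)
        fix U' \<psi> assume U': "(U', \<psi>) \<in> total_atlas B"
        have "smooth_on (\<phi> ` {x \<in> U \<inter> W. s' x \<in> U'}) (\<psi> \<circ> s' \<circ> inv_into U \<phi>)"
          using W(3) 2 U' unfolding smooth_map_def C by blast
        then show "smooth_on (\<phi> ` {x \<in> U \<inter> (W \<inter> V). s' x \<in> U'}) (\<psi> \<circ> s' \<circ> inv_into U \<phi>)"
          by (rule smooth_on_subset) blast
      qed
    qed
    have \<tau>s: "smooth_fun (base_atlas B) (W \<inter> V) (\<lambda>y. \<tau> (s' y))"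
      by (rule smooth_fun_compose_map[OF base_atlas total_atlas o open_bproj_vimage[OF T'(1)] s' _ T'(3)])
        (use W(5) in auto)
    have "smooth_fun (base_atlas B) (W \<inter> V) (\<lambda>y. \<tau> (s' y) *v v y)"
      by (rule smooth_fun_bilinear[OF base_atlas o bounded_bilinear_matrix_vector \<tau>s
        smooth_fun_subset[OF W(4) Int_lower1]])
    moreover have "c y = eorbit B (s y) (\<tau> (s' y) *v v y)" if y: "y \<in> W \<inter> V" for y
    proof -
      have "bproj B (s' y) = y" "\<tau> (s' y) \<in> grp B" using W(5) T'(5)[of "s' y"] y by auto
      then have "eorbit B (s y) (\<tau> (s' y) *v v y) = eorbit B (ract B (s y) (\<tau> (s' y))) (v y)"
        by (simp add: eorbit_ract)
      also have "ract B (s y) (\<tau> (s' y)) = s' y" using T'(6)[of "s' y"] W(5) y by auto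
      finally show ?thesis using W(6) y by auto
    qed
    ultimately show ?thesis using o W(2) x by blast
  qed
  define u where "u y = (SOME v. c y = eorbit B (s y) v)" for y
  have u: "c y = eorbit B (s y) (u y)" if "y \<in> V" for y
    using loc[OF that] unfolding u_def by (metis (mono_tags, lifting) someI_ex)
  have "smooth_fun (base_atlas B) V u"
  proof (rule smooth_fun_local[OF base_atlas T'(1)])
    fix x assume "x \<in> V"
    from loc[OF this] obtain W v where W: "open W" "x \<in> W" "W \<subseteq> V" "smooth_fun (base_atlas B) W v"
      "\<forall>y\<in>W. c y = eorbit B (s y) (v y)" by blast
    then have "v y = u y" if "y \<in> W" for y using that u[of y] eorbit_eq_iff by (metis subsetD)
    then show "\<exists>W g. open W \<and> x \<in> W \<and> smooth_fun (base_atlas B) W g \<and> (\<forall>y\<in>W \<inter> V. g y = u y)"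
      using W by blast
  qed
  then show ?thesis using u by blast
qed

lemma smooth_sectionI:
  assumes "\<And>V s \<tau>. local_trivialization B V s \<tau> \<Longrightarrow>
    \<exists>u. smooth_fun (base_atlas B) V u \<and> (\<forall>y\<in>V. c y = eorbit B (s y) (u y))"
  shows "smooth_section B c"
  unfolding smooth_section_def
proof
  fix x
  obtain V s \<tau> where T: "x \<in> V" "local_trivialization B V s \<tau>" using triv_exists by blast
  obtain u where "smooth_fun (base_atlas B) V u" "\<forall>y\<in>V. c y = eorbit B (s y) (u y)"
    using assms[OF T(2)] by blast
  then show "\<exists>V s v. open V \<and> x \<in> V \<and> smooth_map (base_atlas B) (total_atlas B) V s \<and>
      smooth_fun (base_atlas B) V v \<and> (\<forall>y\<in>V. bproj B (s y) = y \<and> c y = eorbit B (s y) (v y))"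
    using T trivD[OF T(2)] by (intro exI[of _ V] exI[of _ s] exI[of _ u]) auto
qed

lemma smooth_section_ezero: "smooth_section B (ezero B)"
proof (rule smooth_sectionI)
  fix V s \<tau> assume T: "local_trivialization B V s \<tau>"
  have "ezero B y = eorbit B (s y) 0" if "y \<in> V" for y
    using ezero_eorbit[of "s y"] trivD(4)[OF T that] by simp
  then show "\<exists>u. smooth_fun (base_atlas B) V u \<and> (\<forall>y\<in>V. ezero B y = eorbit B (s y) (u y))"
    using smooth_fun_const[OF base_atlas trivD(1)[OF T], of 0] by blast
qed

lemma smooth_section_eadd:
  assumes "smooth_section B c" "smooth_section B c'"
  shows "smooth_section B (\<lambda>x. eadd (c x) (c' x))"
proof (rule smooth_sectionI)
  fix V s \<tau> assume T: "local_trivialization B V s \<tau>"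
  obtain u u' where u: "smooth_fun (base_atlas B) V u" "\<And>y. y \<in> V \<Longrightarrow> c y = eorbit B (s y) (u y)"
    "smooth_fun (base_atlas B) V u'" "\<And>y. y \<in> V \<Longrightarrow> c' y = eorbit B (s y) (u' y)"
    using smooth_section_coord[OF _ T] assms by meson
  have "smooth_fun (base_atlas B) V (\<lambda>y. u y + u' y)"
    by (rule smooth_fun_add[OF base_atlas trivD(1)[OF T] u(1,3)])
  then show "\<exists>u. smooth_fun (base_atlas B) V u \<and> (\<forall>y\<in>V. eadd (c y) (c' y) = eorbit B (s y) (u y))"
    using u by (intro exI[of _ "\<lambda>y. u y + u' y"]) (simp add: eadd_eorbit)
qed

lemma smooth_section_escale:
  assumes "smooth_section B c" "smooth_fun (base_atlas B) UNIV h"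
  shows "smooth_section B (\<lambda>x. escale (h x) (c x))"
proof (rule smooth_sectionI)
  fix V s \<tau> assume T: "local_trivialization B V s \<tau>"
  obtain u where u: "smooth_fun (base_atlas B) V u" "\<And>y. y \<in> V \<Longrightarrow> c y = eorbit B (s y) (u y)"
    using smooth_section_coord[OF assms(1) T] by meson
  have "smooth_fun (base_atlas B) V (\<lambda>y. h y *s u y)"
    by (rule smooth_fun_bilinear[OF base_atlas trivD(1)[OF T] bounded_bilinear_scalar_vector
      smooth_fun_subset[OF assms(2) subset_UNIV] u(1)])
  then show "\<exists>u. smooth_fun (base_atlas B) V u \<and> (\<forall>y\<in>V. escale (h y) (c y) = eorbit B (s y) (u y))"
    using u by (intro exI[of _ "\<lambda>y. h y *s u y"]) (simp add: escale_eorbit)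
qed

lemma smooth_section_gauge:
  assumes "smooth_section B c" "gfun f" "\<And>p v. \<gamma> (eorbit B p v) = eorbit B p (f p *v v)"
  shows "smooth_section B (\<lambda>x. \<gamma> (c x))"
proof (rule smooth_sectionI)
  fix V s \<tau> assume T: "local_trivialization B V s \<tau>"
  obtain u where u: "smooth_fun (base_atlas B) V u" "\<And>y. y \<in> V \<Longrightarrow> c y = eorbit B (s y) (u y)"
    using smooth_section_coord[OF assms(1) T] by meson
  have "smooth_fun (base_atlas B) V (\<lambda>y. f (s y))"
    by (rule smooth_fun_compose_map[OF base_atlas total_atlas trivD(1)[OF T] open_UNIV trivD(2)[OF T]
      subset_UNIV gfunD(1)[OF assms(2)]])
  from smooth_fun_bilinear[OF base_atlas trivD(1)[OF T] bounded_bilinear_matrix_vector this u(1)]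
  have "smooth_fun (base_atlas B) V (\<lambda>y. f (s y) *v u y)" .
  then show "\<exists>u. smooth_fun (base_atlas B) V u \<and> (\<forall>y\<in>V. \<gamma> (c y) = eorbit B (s y) (u y))"
    using u by (intro exI[of _ "\<lambda>y. f (s y) *v u y"]) (simp add: assms(3))
qed

end

section \<open>The space of square integrable sections\<close>

text \<open>Finitely many sets cover each compact piece. The countability is what allows Borel
  objects to be glued.\<close>

lemma sigma_compact_countable_subcover:
  fixes \<C> :: "'m::topological_space set set"
  assumes "sigma_compact_space TYPE('m)" "\<And>C. C \<in> \<C> \<Longrightarrow> open C" "\<Union>\<C> = UNIV"
  shows "\<exists>\<D>\<subseteq>\<C>. countable \<D> \<and> \<Union>\<D> = UNIV"
proof -
  obtain K :: "nat \<Rightarrow> 'm set" where K: "\<And>i. compact (K i)" "(\<Union>i. K i) = UNIV"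
    using assms(1) unfolding sigma_compact_space_def by blast
  have "\<exists>\<D>\<subseteq>\<C>. finite \<D> \<and> K i \<subseteq> \<Union>\<D>" for i
    using K(1)[of i] assms(2,3) by (metis compactE subset_UNIV)
  then obtain \<D> where D: "\<And>i. \<D> i \<subseteq> \<C>" "\<And>i. finite (\<D> i)" "\<And>i. K i \<subseteq> \<Union>(\<D> i)" by metis
  show ?thesis
  proof (intro exI[of _ "\<Union>i. \<D> i"] conjI)
    show "countable (\<Union>i. \<D> i)" using D(2) by (auto intro: countable_finite)
    have "x \<in> \<Union>(\<Union>i. \<D> i)" for x
    proof -
      obtain i where "x \<in> K i" using K(2) by (metis UNIV_I UN_E)
      then obtain C where "C \<in> \<D> i" "x \<in> C" using D(3)[of i] by blast
      then show ?thesis by blast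
    qed
    then show "\<Union>(\<Union>i. \<D> i) = UNIV" by blast
  qed (use D(1) in blast)
qed

lemma borel_measurable_restrict_UNIV:
  "f \<in> borel_measurable (restrict_space borel UNIV) \<longleftrightarrow> f \<in> borel_measurable borel"
  by (rule arg_cong[where f = "\<lambda>M. f \<in> M", OF measurable_cong_sets]) (simp_all add: sets_restrict_space)

lemma borel_measurable_restrict_cover:
  assumes "countable \<C>" "\<And>C. C \<in> \<C> \<Longrightarrow> C \<in> sets borel" "\<Union>\<C> = UNIV" "A \<in> sets borel"
    and "\<And>C. C \<in> \<C> \<Longrightarrow> f \<in> borel_measurable (restrict_space borel (A \<inter> C))"
  shows "f \<in> borel_measurable (restrict_space borel A)"
proof (rule measurable_piecewise_restrict[OF assms(1)])
  fix C assume C: "C \<in> \<C>"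
  then show "C \<inter> space (restrict_space borel A) \<in> sets (restrict_space borel A)"
    using assms(2,4) by (simp add: space_restrict_space sets_restrict_space_iff)
  have "restrict_space (restrict_space borel A) C = restrict_space borel (A \<inter> C)"
    using assms(2,4) C by (simp add: restrict_restrict_space)
  then show "f \<in> borel_measurable (restrict_space (restrict_space borel A) C)" using assms(5)[OF C] by simp
qed (use assms(3) in auto)

lemma borel_measurable_bilinear:
  fixes f :: "'a \<Rightarrow> 'b::euclidean_space" and g :: "'a \<Rightarrow> 'c::euclidean_space"
  assumes "bounded_bilinear h" "f \<in> borel_measurable M" "g \<in> borel_measurable M"
  shows "(\<lambda>x. h (f x) (g x)) \<in> borel_measurable M"
  by (rule borel_measurable_continuous_Pair[OF assms(2,3)])
    (intro bounded_bilinear.continuous_on[OF assms(1)] continuous_intros)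

lemma borel_measurable_bounded_linear:
  assumes "bounded_linear h" "f \<in> borel_measurable M"
  shows "(\<lambda>x. h (f x)) \<in> borel_measurable M"
  by (rule measurable_compose[OF assms(2) borel_measurable_continuous_onI])
    (intro linear_continuous_on assms(1))

locale gbundle_measure = gbundle B
  for B :: "('m::t2_space, 'k::finite, 'p::t2_space, 'd::euclidean_space, 'n::finite) pbundle" +
  fixes \<mu> :: "'m measure"
  assumes sigma_compact: "sigma_compact_space TYPE('m)"
    and loc_Lebesgue: "locally_Lebesgue (base_atlas B) \<mu>"
begin

lemma sets_mu [measurable_cong]: "sets \<mu> = sets borel"
  using loc_Lebesgue[unfolded locally_Lebesgue_def] by (rule conjunct1)

lemma space_mu [simp]: "space \<mu> = UNIV"
  using sets_eq_imp_space_eq[OF sets_mu] by simp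

lemma borel_measurable_mu: "f \<in> borel_measurable \<mu> \<longleftrightarrow> f \<in> borel_measurable borel"
  by (simp add: measurable_cong_sets[OF sets_mu refl])

lemma countable_trivializations:
  "\<exists>T :: nat \<Rightarrow> 'm set \<times> ('m \<Rightarrow> 'p) \<times> ('p \<Rightarrow> complex^'n^'n).
    (\<forall>i. local_trivialization B (fst (T i)) (fst (snd (T i))) (snd (snd (T i)))) \<and> (\<Union>i. fst (T i)) = UNIV"
proof -
  define \<C> where "\<C> = {V. \<exists>s \<tau>. local_trivialization B V s \<tau>}"
  have "open C" if "C \<in> \<C>" for C using that trivD(1) unfolding \<C>_def by blast
  moreover have "\<Union>\<C> = UNIV" using triv_exists unfolding \<C>_def by blast
  ultimately have "\<exists>\<D>\<subseteq>\<C>. countable \<D> \<and> \<Union>\<D> = UNIV"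
    by (rule sigma_compact_countable_subcover[OF sigma_compact])
  then obtain \<D> where D: "\<D> \<subseteq> \<C>" "countable \<D>" "\<Union>\<D> = UNIV" by blast
  have ne: "\<D> \<noteq> {}" using D(3) by auto
  have "\<exists>s \<tau>. local_trivialization B (from_nat_into \<D> i) s \<tau>" for i
    using from_nat_into[OF ne, of i] D(1) unfolding \<C>_def by blast
  then obtain s \<tau> where "\<And>i. local_trivialization B (from_nat_into \<D> i) (s i) (\<tau> i)" by metis
  moreover have "(\<Union>i. from_nat_into \<D> i) = UNIV" using range_from_nat_into[OF ne D(2)] D(3) by auto
  ultimately show ?thesis by (intro exI[of _ "\<lambda>i. (from_nat_into \<D> i, s i, \<tau> i)"]) auto
qed

text \<open>A Borel lift \<open>M \<rightarrow> P\<close> is glued from countably many local trivializations.\<close>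

definition trivs where "trivs = (SOME T :: nat \<Rightarrow> 'm set \<times> ('m \<Rightarrow> 'p) \<times> ('p \<Rightarrow> complex^'n^'n).
    (\<forall>i. local_trivialization B (fst (T i)) (fst (snd (T i))) (snd (snd (T i)))) \<and> (\<Union>i. fst (T i)) = UNIV)"

definition Vn where "Vn i = fst (trivs i)"
definition sn where "sn i = fst (snd (trivs i))"
definition tn where "tn i = snd (snd (trivs i))"
definition idx where "idx x = (LEAST i. x \<in> Vn i)"
definition lift where "lift x = sn (idx x) x"
definition section_of where "section_of v x = eorbit B (lift x) (v x)"

lemma triv_n: "local_trivialization B (Vn i) (sn i) (tn i)" and Vn_cover: "(\<Union>i. Vn i) = UNIV"
  using someI_ex[OF countable_trivializations] unfolding trivs_def[symmetric] Vn_def sn_def tn_def by blast+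

lemmas trivn = trivD[OF triv_n]

lemma idx_Vn: "x \<in> Vn (idx x)"
  using Vn_cover unfolding idx_def by (metis LeastI UNIV_I UN_E)

lemma bproj_lift: "bproj B (lift x) = x"
  unfolding lift_def by (rule trivn(4)[OF idx_Vn])

lemma idx_borel: "{x. idx x = i} \<in> sets borel"
proof -
  have "{x. idx x = i} = Vn i - (\<Union>j<i. Vn j)"
  proof (intro set_eqI iffI)
    fix x assume "x \<in> {x. idx x = i}"
    then have i: "i = (LEAST i. x \<in> Vn i)" "x \<in> Vn i" using idx_Vn[of x] by (simp_all add: idx_def)
    then have "x \<notin> Vn j" if "j < i" for j using not_less_Least[of j "\<lambda>i. x \<in> Vn i"] that by simp
    then show "x \<in> Vn i - (\<Union>j<i. Vn j)" using i(2) by simp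
  next
    fix x assume x: "x \<in> Vn i - (\<Union>j<i. Vn j)"
    then have "idx x = i" unfolding idx_def by (intro Least_equality) (auto simp: not_less[symmetric])
    then show "x \<in> {x. idx x = i}" by simp
  qed
  moreover have "Vn j \<in> sets borel" for j using trivn(1) by (rule borel_open)
  ultimately show ?thesis by simp
qed

text \<open>The trivialization coordinate of \<open>s y\<close>, which is the group element carrying
  \<open>lift y\<close> to \<open>s y\<close>.\<close>

definition transition where "transition s y = tn (idx y) (s y)"

lemma transition:
  assumes "bproj B (s y) = y"
  shows "transition s y \<in> grp B" "s y = ract B (lift y) (transition s y)"
  using trivn(5)[of "s y" "idx y"] trivn(6)[of "s y" "idx y"] idx_Vn[of y] assms
  unfolding transition_def lift_def by simp_all

lemma measurable_idx_cover:
  assumes "A \<in> sets borel" "\<And>i. f \<in> borel_measurable (restrict_space borel (A \<inter> {x. idx x = i}))"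
  shows "f \<in> borel_measurable (restrict_space borel A)"
  by (rule borel_measurable_restrict_cover[of "range (\<lambda>i. {x. idx x = i})"]) (use assms idx_borel in auto)

text \<open>On each Borel piece \<open>idx x = i\<close> a single trivialization is in force, and
  its coordinate is continuous along \<open>s\<close>.\<close>

lemma transition_measurable:
  assumes V: "open V" and s: "continuous_on V s" "\<And>y. y \<in> V \<Longrightarrow> bproj B (s y) = y"
  shows "transition s \<in> borel_measurable (restrict_space borel V)"
proof (rule measurable_idx_cover)
  fix i
  let ?A = "V \<inter> {x. idx x = i}"
  have sub: "?A \<subseteq> V \<inter> Vn i" using idx_Vn by blast
  have o: "open (bproj B -` Vn i)" by (rule open_bproj_vimage[OF trivn(1)])
  have "continuous_on (bproj B -` Vn i) (tn i)" by (rule smooth_fun_continuous[OF total_atlas o trivn(3)])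
  then have "continuous_on (V \<inter> Vn i) (\<lambda>y. tn i (s y))"
    by (rule continuous_on_compose2) (use s in \<open>auto intro: continuous_on_subset\<close>)
  then have "(\<lambda>y. tn i (s y)) \<in> borel_measurable (restrict_space borel ?A)"
    by (intro borel_measurable_continuous_on_restrict continuous_on_subset[OF _ sub])
  then show "transition s \<in> borel_measurable (restrict_space borel ?A)"
    by (rule measurable_cong[THEN iffD1, rotated]) (auto simp: space_restrict_space transition_def)
qed (use V in auto)

lemma section_of_local:
  assumes "bproj B (s y) = y"
  shows "eorbit B (s y) w = eorbit B (lift y) (transition s y *v w)"
  using eorbit_ract[OF transition(1)[of s y, OF assms]] transition(2)[of s y, OF assms] by simp

lemma section_of_eq_iff: "section_of v x = section_of w x \<longleftrightarrow> v x = w x"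
  unfolding section_of_def by (rule eorbit_eq_iff)

lemma measurable_section_of:
  assumes v: "v \<in> borel_measurable borel"
  shows "measurable_section B (section_of v)"
  unfolding measurable_section_def
proof
  fix x
  define i where "i = idx x"
  \<comment> \<open>Going from the Borel frame back to the smooth frame \<open>sn i\<close> inverts
    the transition matrix.\<close>
  define u where "u y = adj (transition (sn i) y) *v v y" for y
  have c: "continuous_on (Vn i) (sn i)" using trivn(2) unfolding smooth_map_def by blast
  have "transition (sn i) \<in> borel_measurable (restrict_space borel (Vn i))"
    by (rule transition_measurable[OF trivn(1) c trivn(4)])
  then have "u \<in> borel_measurable (restrict_space borel (Vn i))"
    unfolding u_def
    by (rule borel_measurable_bilinear[OF bounded_bilinear_matrix_vector
        borel_measurable_bounded_linear[OF bounded_linear_adj] measurable_restrict_space1[OF v]])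
  moreover have "section_of v y = eorbit B (sn i y) (u y)" if y: "y \<in> Vn i" for y
    using transition(1)[of "sn i" y, OF trivn(4)[OF y]]
    by (simp add: section_of_local[of "sn i" y, OF trivn(4)[OF y]] u_def adj_mult_vec section_of_def)
  moreover have "x \<in> Vn i" unfolding i_def by (rule idx_Vn)
  ultimately show "\<exists>V s v'. open V \<and> x \<in> V \<and> smooth_map (base_atlas B) (total_atlas B) V s \<and>
      v' \<in> borel_measurable (restrict_space borel V) \<and>
      (\<forall>y\<in>V. bproj B (s y) = y \<and> section_of v y = eorbit B (s y) (v' y))"
    using trivn(1,2,4) by (intro exI[of _ "Vn i"] exI[of _ "sn i"] exI[of _ u]) blast
qed

text \<open>With \<open>measurable_section_of\<close> this identifies measurable sections with Borel
  functions into \<open>complex^'n\<close>. Coordinates in the frame \<open>lift\<close> are unique,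
  so the local ones agree and glue along a countable cover.\<close>

lemma measurable_section_cases:
  assumes c: "measurable_section B c"
  obtains v where "v \<in> borel_measurable borel" "c = section_of v"
proof -
  define v where "v y = (SOME v. c y = eorbit B (lift y) v)" for y
  have loc: "\<exists>V. open V \<and> x \<in> V \<and> (\<forall>y\<in>V. c y = eorbit B (lift y) (v y)) \<and> v \<in> borel_measurable (restrict_space borel V)" for x
  proof -
    obtain V s u where V: "open V" "x \<in> V" "smooth_map (base_atlas B) (total_atlas B) V s"
        "u \<in> borel_measurable (restrict_space borel V)"
        "\<And>y. y \<in> V \<Longrightarrow> bproj B (s y) = y" "\<And>y. y \<in> V \<Longrightarrow> c y = eorbit B (s y) (u y)"
      using c unfolding measurable_section_def by meson
    have cu: "c y = eorbit B (lift y) (transition s y *v u y)" if y: "y \<in> V" for y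
      using section_of_local[of s y, OF V(5)[OF y]] V(6)[OF y] by simp
    then have cv: "c y = eorbit B (lift y) (v y)" if y: "y \<in> V" for y
      using y unfolding v_def by (metis (mono_tags, lifting) someI_ex)
    have vu: "v y = transition s y *v u y" if y: "y \<in> V" for y
      using cu[OF y] cv[OF y] eorbit_eq_iff by metis
    have "transition s \<in> borel_measurable (restrict_space borel V)"
      using V(3,5) by (intro transition_measurable V(1)) (auto simp: smooth_map_def)
    then have "(\<lambda>y. transition s y *v u y) \<in> borel_measurable (restrict_space borel V)"
      by (rule borel_measurable_bilinear[OF bounded_bilinear_matrix_vector _ V(4)])
    then have "v \<in> borel_measurable (restrict_space borel V)"
      by (rule measurable_cong[THEN iffD1, rotated]) (auto simp: space_restrict_space vu)
    then show ?thesis using V(1,2) cv by blast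
  qed
  define \<C> where "\<C> = {V. open V \<and> v \<in> borel_measurable (restrict_space borel V)}"
  obtain \<D> where D: "\<D> \<subseteq> \<C>" "countable \<D>" "\<Union>\<D> = UNIV"
  proof -
    have "\<exists>\<D>\<subseteq>\<C>. countable \<D> \<and> \<Union>\<D> = UNIV"
    proof (rule sigma_compact_countable_subcover[OF sigma_compact])
      show "\<Union>\<C> = UNIV" using loc unfolding \<C>_def by blast
    qed (simp add: \<C>_def)
    then show ?thesis using that by blast
  qed
  have "v \<in> borel_measurable (restrict_space borel UNIV)"
    by (rule borel_measurable_restrict_cover[OF D(2) _ D(3)]) (use D(1) in \<open>auto simp: \<C>_def\<close>)
  moreover have "c = section_of v" using loc unfolding section_of_def by blast
  ultimately show ?thesis using that by (simp add: borel_measurable_restrict_UNIV)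
qed

lemma smooth_section_measurable:
  assumes "smooth_section B c"
  shows "measurable_section B c"
  unfolding measurable_section_def
proof
  fix x
  obtain V s v where V: "open V" "x \<in> V" "smooth_map (base_atlas B) (total_atlas B) V s"
    "smooth_fun (base_atlas B) V v" "\<forall>y\<in>V. bproj B (s y) = y \<and> c y = eorbit B (s y) (v y)"
    using assms unfolding smooth_section_def by meson
  have "v \<in> borel_measurable (restrict_space borel V)"
    by (intro borel_measurable_continuous_on_restrict smooth_fun_continuous[OF base_atlas V(1,4)])
  then show "\<exists>V s v. open V \<and> x \<in> V \<and> smooth_map (base_atlas B) (total_atlas B) V s \<and>
      v \<in> borel_measurable (restrict_space borel V) \<and>
      (\<forall>y\<in>V. bproj B (s y) = y \<and> c y = eorbit B (s y) (v y))"
    using V by blast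
qed

lemma section_of_pointwise:
  "eadd (section_of v x) (section_of w x) = section_of (v + w) x"
  "escale z (section_of v x) = section_of (\<lambda>x. z *s v x) x"
  "enorm (section_of v x) = norm (v x)" "einner (section_of v x) (section_of w x) = cip (v x) (w x)"
  "section_of 0 = ezero B"
proof -
  show "section_of 0 = ezero B"
    using ezero_eorbit bproj_lift by (intro ext) (metis section_of_def zero_fun_apply)
qed (simp_all add: section_of_def eadd_eorbit escale_eorbit enorm_eorbit einner_eorbit)

section \<open>Square integrable functions in the Borel frame\<close>

definition sqn :: "('m \<Rightarrow> complex^'n) \<Rightarrow> ennreal" where
  "sqn v = (\<integral>\<^sup>+x. ennreal ((norm (v x))\<^sup>2) \<partial>\<mu>)"

definition smooth_L2 :: "('m \<Rightarrow> complex^'n) set" where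
  "smooth_L2 = {w. w \<in> borel_measurable borel \<and> smooth_section B (section_of w) \<and> sqn w < \<infinity>}"

text \<open>Coordinate functions rather than classes. \<open>L2_section_iff\<close> matches this
  \<epsilon> form of the closure with the sequences in \<open>L2_section\<close>.\<close>

definition L2 :: "('m \<Rightarrow> complex^'n) set" where
  "L2 = {v. v \<in> borel_measurable borel \<and> sqn v < \<infinity> \<and> (\<forall>\<epsilon>>0. \<exists>w\<in>smooth_L2. sqn (w - v) < ennreal \<epsilon>)}"

lemma L2_section_iff: "L2_section B \<mu> c \<longleftrightarrow> (\<exists>v\<in>L2. c = section_of v)"
proof
  assume c: "L2_section B \<mu> c"
  then obtain v where v: "v \<in> borel_measurable borel" "c = section_of v"
    using measurable_section_cases unfolding L2_section_def by blast
  obtain s where s: "\<And>j::nat. smooth_section B (s j)" "\<And>j. square_integrable_section \<mu> (s j)"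
      "(\<lambda>j. \<integral>\<^sup>+x. ennreal ((enorm (eadd (s j x) (escale (-1) (c x))))\<^sup>2) \<partial>\<mu>) \<longlonglongrightarrow> 0"
    using c unfolding L2_section_def by blast
  have "\<exists>w. w \<in> borel_measurable borel \<and> s j = section_of w" for j
    using measurable_section_cases[OF smooth_section_measurable[OF s(1)]] by metis
  then obtain w where w: "\<And>j. w j \<in> borel_measurable borel" "\<And>j. s j = section_of (w j)" by metis
  have wL: "w j \<in> smooth_L2" for j
    using w s(1,2)[of j] by (simp add: smooth_L2_def square_integrable_section_def sqn_def section_of_pointwise)
  have "(\<integral>\<^sup>+x. ennreal ((enorm (eadd (s j x) (escale (-1) (c x))))\<^sup>2) \<partial>\<mu>) = sqn (w j - v)" for j
    by (simp add: w(2) v(2) section_of_pointwise sqn_def vector_sneg_minus1[symmetric])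
  then have lim: "(\<lambda>j. sqn (w j - v)) \<longlonglongrightarrow> 0" using s(3) by simp
  have "\<exists>w\<in>smooth_L2. sqn (w - v) < ennreal \<epsilon>" if "\<epsilon> > 0" for \<epsilon>
  proof -
    have "\<forall>\<^sub>F j in sequentially. sqn (w j - v) < ennreal \<epsilon>" using order_tendstoD(2)[OF lim] that by simp
    then show ?thesis using wL unfolding eventually_sequentially by blast
  qed
  moreover have "sqn v < \<infinity>"
    using c by (simp add: L2_section_def square_integrable_section_def v(2) sqn_def section_of_pointwise)
  ultimately show "\<exists>v\<in>L2. c = section_of v" using v unfolding L2_def by blast
next
  assume "\<exists>v\<in>L2. c = section_of v"
  then obtain v where v: "v \<in> L2" "c = section_of v" by blast
  have "\<exists>w\<in>smooth_L2. sqn (w - v) < ennreal (1 / Suc j)" for j using v(1) unfolding L2_def by simp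
  then obtain w where w: "\<And>j. w j \<in> smooth_L2" "\<And>j. sqn (w j - v) < ennreal (1 / Suc j)" by metis
  have "(\<lambda>j. ennreal (1 / Suc j)) \<longlonglongrightarrow> ennreal 0"
    by (intro tendsto_ennrealI) (rule LIMSEQ_Suc[OF lim_1_over_n])
  then have l0: "(\<lambda>j. ennreal (1 / Suc j)) \<longlonglongrightarrow> 0" by simp
  have lim: "(\<lambda>j. sqn (w j - v)) \<longlonglongrightarrow> 0"
    by (rule tendsto_sandwich[OF _ _ tendsto_const l0]) (simp_all add: less_imp_le[OF w(2)] del: of_nat_Suc)
  show "L2_section B \<mu> c" unfolding L2_section_def
  proof (intro conjI exI[of _ "\<lambda>j. section_of (w j)"] allI)
    show "measurable_section B c" using v measurable_section_of unfolding L2_def by blast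
    show "square_integrable_section \<mu> c"
      using v by (simp add: L2_def square_integrable_section_def sqn_def section_of_pointwise)
    show "smooth_section B (section_of (w j))" for j using w(1) unfolding smooth_L2_def by blast
    show "square_integrable_section \<mu> (section_of (w j))" for j
      using w(1)[of j] by (simp add: smooth_L2_def square_integrable_section_def sqn_def section_of_pointwise)
    show "(\<lambda>j. \<integral>\<^sup>+x. ennreal ((enorm (eadd (section_of (w j) x) (escale (-1) (c x))))\<^sup>2) \<partial>\<mu>) \<longlonglongrightarrow> 0"
      using lim by (simp add: v(2) section_of_pointwise sqn_def vector_sneg_minus1[symmetric])
  qed
qed

lemma L2_measurable: "v \<in> L2 \<Longrightarrow> v \<in> borel_measurable borel"
  unfolding L2_def by blast

lemma L2_approx: "v \<in> L2 \<Longrightarrow> \<epsilon> > 0 \<Longrightarrow> \<exists>w\<in>smooth_L2. sqn (w - v) < ennreal \<epsilon>"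
  unfolding L2_def by blast

lemma smooth_L2_subset: "smooth_L2 \<subseteq> L2"
proof
  fix w assume w: "w \<in> smooth_L2"
  have "sqn (w - w) = 0" by (simp add: sqn_def)
  then show "w \<in> L2" using w unfolding L2_def smooth_L2_def by fastforce
qed

text \<open>The pointwise inequality \<open>(a + b)^2 \<le> 2 a^2 + 2 b^2\<close> takes the place of
  Minkowski; constants do not matter for approximation.\<close>

lemma sqn_add:
  assumes [measurable]: "v \<in> borel_measurable borel" "w \<in> borel_measurable borel"
  shows "sqn (v + w) \<le> 2 * sqn v + 2 * sqn w"
proof -
  have "sqn (v + w) \<le> (\<integral>\<^sup>+x. 2 * ennreal ((norm (v x))\<^sup>2) + 2 * ennreal ((norm (w x))\<^sup>2) \<partial>\<mu>)"
    unfolding sqn_def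
  proof (rule nn_integral_mono)
    fix x
    have "(norm (v x + w x))\<^sup>2 \<le> (norm (v x) + norm (w x))\<^sup>2" by (intro power_mono norm_triangle_ineq) simp
    also have "\<dots> \<le> 2 * (norm (v x))\<^sup>2 + 2 * (norm (w x))\<^sup>2"
      using sum_squares_bound[of "norm (v x)" "norm (w x)"] by (simp add: power2_sum)
    finally have "ennreal ((norm (v x + w x))\<^sup>2) \<le> ennreal (2 * (norm (v x))\<^sup>2 + 2 * (norm (w x))\<^sup>2)"
      by (rule ennreal_leI)
    then show "ennreal ((norm ((v + w) x))\<^sup>2) \<le> 2 * ennreal ((norm (v x))\<^sup>2) + 2 * ennreal ((norm (w x))\<^sup>2)"
      by (simp add: ennreal_mult)
  qed
  also have "\<dots> = 2 * sqn v + 2 * sqn w"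
    unfolding sqn_def by (simp add: nn_integral_add nn_integral_cmult)
  finally show ?thesis .
qed

lemma sqn_pointwise_eq: "(\<And>x. norm (v x) = norm (w x)) \<Longrightarrow> sqn v = sqn w"
  unfolding sqn_def by simp

lemma L2_closedI:
  assumes v: "v \<in> borel_measurable borel" "sqn v < \<infinity>"
    and ap: "\<And>\<epsilon>. \<epsilon> > 0 \<Longrightarrow> \<exists>w\<in>L2. sqn (w - v) < ennreal \<epsilon>"
  shows "v \<in> L2"
  unfolding L2_def
proof (intro CollectI conjI allI impI v)
  fix \<epsilon> :: real assume \<epsilon>: "\<epsilon> > 0"
  \<comment> \<open>The factors 2 of \<open>sqn_add\<close> turn two errors
    \<open>\<epsilon> / 4\<close> into \<epsilon>.\<close>
  obtain w where w: "w \<in> L2" "sqn (w - v) < ennreal (\<epsilon> / 4)" using ap[of "\<epsilon> / 4"] \<epsilon> by auto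
  obtain u where u: "u \<in> smooth_L2" "sqn (u - w) < ennreal (\<epsilon> / 4)"
    using L2_approx[OF w(1), of "\<epsilon> / 4"] \<epsilon> by auto
  have m: "u \<in> borel_measurable borel" "w \<in> borel_measurable borel"
    using u(1) w(1) by (auto simp: smooth_L2_def L2_def)
  have "u - v = (u - w) + (w - v)" by simp
  then have "sqn (u - v) \<le> 2 * sqn (u - w) + 2 * sqn (w - v)"
    using sqn_add[of "u - w" "w - v"] m v(1) by (simp add: fun_diff_def)
  also have "\<dots> < 2 * ennreal (\<epsilon> / 4) + 2 * ennreal (\<epsilon> / 4)"
    using u(2) w(2) by (intro add_strict_mono ennreal_mult_strict_left_mono) auto
  also have "\<dots> = ennreal \<epsilon>" using \<epsilon>
    by (simp add: ennreal_mult[symmetric] ennreal_plus[symmetric] del: ennreal_plus flip: ennreal_numeral)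
  finally show "\<exists>w\<in>smooth_L2. sqn (w - v) < ennreal \<epsilon>" using u(1) by blast
qed

lemma L2_add:
  assumes "v \<in> L2" "w \<in> L2"
  shows "v + w \<in> L2"
proof -
  have sm: "u + u' \<in> smooth_L2" if "u \<in> smooth_L2" "u' \<in> smooth_L2" for u u'
  proof -
    have m: "u \<in> borel_measurable borel" "u' \<in> borel_measurable borel"
      "sqn u < \<infinity>" "sqn u' < \<infinity>" "smooth_section B (section_of u)" "smooth_section B (section_of u')"
      using that by (auto simp: smooth_L2_def)
    have "sqn (u + u') \<le> 2 * sqn u + 2 * sqn u'" by (rule sqn_add[OF m(1,2)])
    also have "\<dots> < \<infinity>" using m(3,4) by (simp add: ennreal_mult_less_top)
    finally have "sqn (u + u') < \<infinity>" .
    moreover have "section_of (u + u') = (\<lambda>x. eadd (section_of u x) (section_of u' x))"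
      by (simp add: section_of_pointwise)
    ultimately show ?thesis using m smooth_section_eadd[OF m(5,6)]
      by (simp add: smooth_L2_def) (simp add: plus_fun_def)
  qed
  have m: "v \<in> borel_measurable borel" "w \<in> borel_measurable borel" "sqn v < \<infinity>" "sqn w < \<infinity>"
    using assms by (auto simp: L2_def)
  show ?thesis
  proof (rule L2_closedI)
    show "v + w \<in> borel_measurable borel" using m by (simp add: plus_fun_def)
    have "sqn (v + w) \<le> 2 * sqn v + 2 * sqn w" by (rule sqn_add[OF m(1,2)])
    also have "\<dots> < \<infinity>" using m(3,4) by (simp add: ennreal_mult_less_top)
    finally show "sqn (v + w) < \<infinity>" .
    fix \<epsilon> :: real assume "\<epsilon> > 0"
    then have "ennreal (\<epsilon> / 4) > 0" "\<epsilon> / 4 > 0" by auto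
    then obtain u u' where u: "u \<in> smooth_L2" "sqn (u - v) < ennreal (\<epsilon> / 4)"
        "u' \<in> smooth_L2" "sqn (u' - w) < ennreal (\<epsilon> / 4)"
      using assms unfolding L2_def by blast
    have "sqn ((u - v) + (u' - w)) \<le> 2 * sqn (u - v) + 2 * sqn (u' - w)"
      using u m by (intro sqn_add) (auto simp: smooth_L2_def fun_diff_def)
    also have "\<dots> < 2 * ennreal (\<epsilon> / 4) + 2 * ennreal (\<epsilon> / 4)"
      using u by (intro add_strict_mono ennreal_mult_strict_left_mono) auto
    also have "\<dots> = ennreal \<epsilon>" using \<open>\<epsilon> > 0\<close>
      by (simp add: ennreal_mult[symmetric] ennreal_plus[symmetric] del: ennreal_plus flip: ennreal_numeral)
    finally have "sqn ((u + u') - (v + w)) < ennreal \<epsilon>" by (simp add: algebra_simps)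
    then show "\<exists>x\<in>L2. sqn (x - (v + w)) < ennreal \<epsilon>" using sm[OF u(1,3)] smooth_L2_subset by blast
  qed
qed

text \<open>Pointwise multiplication by scalars of constant modulus and by unitary matrices are treated
  together: both are real linear and scale the norm.\<close>

lemma L2_pointwise:
  assumes v: "v \<in> L2"
    and meas: "\<And>u. u \<in> borel_measurable borel \<Longrightarrow> F u \<in> borel_measurable borel"
    and smooth: "\<And>u. smooth_section B (section_of u) \<Longrightarrow> smooth_section B (section_of (F u))"
    and diff: "\<And>u u'. F u - F u' = F (u - u')"
    and norm: "\<And>u x. norm (F u x) = r * norm (u x)" and r: "0 \<le> r"
  shows "F v \<in> L2"
proof -
  have sq: "sqn (F u) = ennreal (r\<^sup>2) * sqn u" if [measurable]: "u \<in> borel_measurable borel" for u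
    unfolding sqn_def by (simp add: norm power_mult_distrib ennreal_mult nn_integral_cmult)
  have vm: "v \<in> borel_measurable borel" "sqn v < \<infinity>" using v by (auto simp: L2_def)
  show ?thesis
  proof (rule L2_closedI)
    show "F v \<in> borel_measurable borel" by (rule meas[OF vm(1)])
    show "sqn (F v) < \<infinity>" using vm by (simp add: sq ennreal_mult_less_top)
    fix \<epsilon> :: real assume \<epsilon>: "\<epsilon> > 0"
    \<comment> \<open>The added 1 also covers \<open>r = 0\<close>.\<close>
    define \<delta> where "\<delta> = \<epsilon> / (r\<^sup>2 + 1)"
    have rp: "r\<^sup>2 + 1 > 0" by (simp add: add_nonneg_pos)
    have \<delta>: "\<delta> > 0" "r\<^sup>2 * \<delta> < \<epsilon>" using \<epsilon> rp by (auto simp: \<delta>_def divide_less_eq)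
    then obtain w where w: "w \<in> smooth_L2" "sqn (w - v) < ennreal \<delta>" using v unfolding L2_def by blast
    have wm: "w \<in> borel_measurable borel" "smooth_section B (section_of w)" "sqn w < \<infinity>"
      using w by (auto simp: smooth_L2_def)
    have "F w \<in> smooth_L2" using wm by (simp add: smooth_L2_def meas smooth sq ennreal_mult_less_top)
    moreover have "sqn (F w - F v) = ennreal (r\<^sup>2) * sqn (w - v)"
      unfolding diff using wm vm by (intro sq) (simp add: fun_diff_def)
    moreover have "ennreal (r\<^sup>2) * sqn (w - v) \<le> ennreal (r\<^sup>2) * ennreal \<delta>"
      using w(2) by (intro mult_left_mono) auto
    moreover have "ennreal (r\<^sup>2) * ennreal \<delta> < ennreal \<epsilon>"
      using \<delta> \<epsilon> by (simp add: ennreal_mult[symmetric] ennreal_lessI)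
    ultimately show "\<exists>x\<in>L2. sqn (x - F v) < ennreal \<epsilon>"
      using smooth_L2_subset by (intro bexI[of _ "F w"]) auto
  qed
qed

lemma L2_scale:
  assumes "v \<in> L2"
  shows "(\<lambda>x. z *s v x) \<in> L2"
proof (rule L2_pointwise[OF assms, where r = "cmod z"])
  fix u :: "'m \<Rightarrow> complex^'n"
  show "u \<in> borel_measurable borel \<Longrightarrow> (\<lambda>x. z *s u x) \<in> borel_measurable borel"
    by (intro borel_measurable_bilinear[OF bounded_bilinear_scalar_vector]) auto
  show "smooth_section B (section_of u) \<Longrightarrow> smooth_section B (section_of (\<lambda>x. z *s u x))"
    using smooth_section_escale[OF _ smooth_fun_const[OF base_atlas open_UNIV], of "section_of u" z]
    by (simp add: section_of_pointwise)
qed (auto simp: norm_scalar_vector fun_eq_iff vector_ssub_ldistrib)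

lemma L2_zero: "0 \<in> L2"
proof -
  have "(0 :: 'm \<Rightarrow> complex^'n) \<in> smooth_L2"
    by (simp add: smooth_L2_def sqn_def section_of_pointwise smooth_section_ezero) (simp add: zero_fun_def)
  then show ?thesis using smooth_L2_subset by blast
qed

lemma L2_unimodular:
  assumes v: "v \<in> L2" and h: "smooth_fun (base_atlas B) UNIV h" "\<And>x. cmod (h x) = 1"
  shows "(\<lambda>x. h x *s v x) \<in> L2"
proof (rule L2_pointwise[OF v, where r = 1])
  fix u :: "'m \<Rightarrow> complex^'n"
  have "h \<in> borel_measurable borel"
    by (intro borel_measurable_continuous_onI smooth_fun_continuous[OF base_atlas open_UNIV h(1)])
  then show "u \<in> borel_measurable borel \<Longrightarrow> (\<lambda>x. h x *s u x) \<in> borel_measurable borel"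
    by (intro borel_measurable_bilinear[OF bounded_bilinear_scalar_vector])
  have "section_of (\<lambda>x. h x *s u x) = (\<lambda>x. escale (h x) (section_of u x))"
    by (simp add: section_of_def escale_eorbit fun_eq_iff)
  then show "smooth_section B (section_of u) \<Longrightarrow> smooth_section B (section_of (\<lambda>x. h x *s u x))"
    using smooth_section_escale[OF _ h(1), of "section_of u"] by simp
qed (auto simp: norm_scalar_vector h fun_eq_iff vector_ssub_ldistrib)

lemma gfun_lift_measurable:
  assumes "gfun f"
  shows "(\<lambda>x. f (lift x)) \<in> borel_measurable borel"
proof -
  have "(\<lambda>x. f (lift x)) \<in> borel_measurable (restrict_space borel UNIV)"
  proof (rule measurable_idx_cover)
    fix i
    have c: "continuous_on (Vn i) (sn i)" using trivn(2) unfolding smooth_map_def by blast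
    have "continuous_on (Vn i) (\<lambda>x. f (sn i x))"
      by (rule continuous_on_compose2[OF smooth_fun_continuous[OF total_atlas open_UNIV gfunD(1)[OF assms]] c]) simp
    then have "(\<lambda>x. f (sn i x)) \<in> borel_measurable (restrict_space borel (UNIV \<inter> {x. idx x = i}))"
      using idx_Vn by (intro borel_measurable_continuous_on_restrict) (auto elim: continuous_on_subset)
    then show "(\<lambda>x. f (lift x)) \<in> borel_measurable (restrict_space borel (UNIV \<inter> {x. idx x = i}))"
      by (rule measurable_cong[THEN iffD1, rotated]) (auto simp: space_restrict_space lift_def)
  qed simp
  then show ?thesis by (simp add: borel_measurable_restrict_UNIV)
qed

lemma L2_gauge:
  assumes v: "v \<in> L2" and f: "gfun f"
  shows "(\<lambda>x. f (lift x) *v v x) \<in> L2"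
proof (rule L2_pointwise[OF v, where r = 1])
  obtain \<gamma> where \<gamma>: "\<And>p v. \<gamma> (eorbit B p v) = eorbit B p (f p *v v)" using gfun_gauge_group[OF f] by blast
  fix u :: "'m \<Rightarrow> complex^'n"
  show "u \<in> borel_measurable borel \<Longrightarrow> (\<lambda>x. f (lift x) *v u x) \<in> borel_measurable borel"
    by (intro borel_measurable_bilinear[OF bounded_bilinear_matrix_vector] gfun_lift_measurable f)
  have "section_of (\<lambda>x. f (lift x) *v u x) = (\<lambda>x. \<gamma> (section_of u x))"
    by (intro ext) (simp add: section_of_def \<gamma>)
  then show "smooth_section B (section_of u) \<Longrightarrow> smooth_section B (section_of (\<lambda>x. f (lift x) *v u x))"
    using smooth_section_gauge[OF _ f \<gamma>] by simp
  show "norm (f (lift x) *v u x) = 1 * norm (u x)" for x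
    using norm_unitary[OF grp_unitary[OF gfunD(2)[OF f]]] by simp
qed (auto simp: fun_eq_iff matrix_vector_mult_diff_distrib)

end

section \<open>Semi-inner product spaces and invariant Hilbert--Schmidt forms\<close>

text \<open>Vectors are represented modulo the null vectors of a semi-inner product, so that concrete
  functions can stand for their almost everywhere classes.\<close>

locale sip_space =
  fixes L :: "'x::ab_group_add set" and sc :: "complex \<Rightarrow> 'x \<Rightarrow> 'x" and ip :: "'x \<Rightarrow> 'x \<Rightarrow> complex"
  assumes zero_mem: "0 \<in> L"
    and add_mem: "x \<in> L \<Longrightarrow> y \<in> L \<Longrightarrow> x + y \<in> L"
    and sc_mem: "x \<in> L \<Longrightarrow> sc z x \<in> L"
    and sc_minus: "x \<in> L \<Longrightarrow> sc (-1) x = - x"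
    and ip_add_right: "x \<in> L \<Longrightarrow> y \<in> L \<Longrightarrow> w \<in> L \<Longrightarrow> ip x (y + w) = ip x y + ip x w"
    and ip_sc_right: "x \<in> L \<Longrightarrow> y \<in> L \<Longrightarrow> ip x (sc z y) = z * ip x y"
    and ip_cnj: "x \<in> L \<Longrightarrow> y \<in> L \<Longrightarrow> ip y x = cnj (ip x y)"
    and ip_self_nonneg: "x \<in> L \<Longrightarrow> 0 \<le> Re (ip x x)"
begin

definition nsq :: "'x \<Rightarrow> real" where "nsq x = Re (ip x x)"

lemma nsq_nonneg: "x \<in> L \<Longrightarrow> 0 \<le> nsq x"
  unfolding nsq_def by (rule ip_self_nonneg)

lemma ip_self: "x \<in> L \<Longrightarrow> ip x x = complex_of_real (nsq x)"
  using ip_cnj[of x x] unfolding nsq_def by (simp add: complex_eq_iff)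

lemma minus_mem: "x \<in> L \<Longrightarrow> - x \<in> L"
  using sc_mem[of x "-1"] sc_minus[of x] by simp

lemma diff_mem: "x \<in> L \<Longrightarrow> y \<in> L \<Longrightarrow> x - y \<in> L"
  using add_mem[of x "- y"] minus_mem[of y] by simp

lemma ip_minus_right: "x \<in> L \<Longrightarrow> y \<in> L \<Longrightarrow> ip x (- y) = - ip x y"
  using ip_sc_right[of x y "-1"] sc_minus[of y] by simp

lemma ip_diff_right: "x \<in> L \<Longrightarrow> y \<in> L \<Longrightarrow> w \<in> L \<Longrightarrow> ip x (y - w) = ip x y - ip x w"
  using ip_add_right[of x y "- w"] ip_minus_right[of x w] minus_mem[of w] by simp

lemma ip_add_left: "x \<in> L \<Longrightarrow> y \<in> L \<Longrightarrow> w \<in> L \<Longrightarrow> ip (y + w) x = ip y x + ip w x"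
  using ip_cnj[of x "y + w"] ip_cnj[of x y] ip_cnj[of x w] ip_add_right[of x y w] add_mem by simp

lemma ip_diff_left: "x \<in> L \<Longrightarrow> y \<in> L \<Longrightarrow> w \<in> L \<Longrightarrow> ip (y - w) x = ip y x - ip w x"
  using ip_cnj[of x "y - w"] ip_cnj[of x y] ip_cnj[of x w] ip_diff_right[of x y w] diff_mem by simp

lemma ip_sc_left: "x \<in> L \<Longrightarrow> y \<in> L \<Longrightarrow> ip (sc z y) x = cnj z * ip y x"
  using ip_cnj[of x "sc z y"] ip_cnj[of x y] ip_sc_right[of x y z] sc_mem by simp

lemma ip_zero_right: "x \<in> L \<Longrightarrow> ip x 0 = 0"
  using ip_diff_right[of x x x] by simp

lemma sum_mem: "(\<And>i. i \<in> I \<Longrightarrow> f i \<in> L) \<Longrightarrow> sum f I \<in> L"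
  by (induction I rule: infinite_finite_induct) (auto intro: zero_mem add_mem)

lemma ip_sum_right:
  assumes "x \<in> L" "\<And>i. i \<in> I \<Longrightarrow> f i \<in> L"
  shows "ip x (sum f I) = (\<Sum>i\<in>I. ip x (f i))"
  using assms(2)
proof (induction I rule: infinite_finite_induct)
  case (insert i I)
  then show ?case using ip_add_right[OF assms(1), of "f i" "sum f I"] sum_mem[of I f] by simp
qed (auto simp: ip_zero_right assms(1))

lemma cmod_ip_commute: "x \<in> L \<Longrightarrow> y \<in> L \<Longrightarrow> cmod (ip x y) = cmod (ip y x)"
  using ip_cnj[of x y] by simp

lemma nsq_diff:
  assumes "x \<in> L" "y \<in> L"
  shows "nsq (x - y) = nsq x - 2 * Re (ip x y) + nsq y"
proof -
  have "ip (x - y) (x - y) = (ip x x - ip x y) - (ip y x - ip y y)"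
    using assms diff_mem by (simp add: ip_diff_left ip_diff_right)
  then show ?thesis using ip_cnj[OF assms] by (simp add: nsq_def)
qed

lemma cauchy_schwarz:
  assumes x: "x \<in> L" and y: "y \<in> L"
  shows "(cmod (ip x y))\<^sup>2 \<le> nsq x * nsq y"
proof -
  define c where "c = (cmod (ip x y))\<^sup>2"
  \<comment> \<open>This is the squared length of \<open>x - sc z y\<close> with
    \<open>z = t * ip y x\<close>, as a polynomial in \<open>t\<close>.\<close>
  have pos: "0 \<le> nsq x - 2 * t * c + t\<^sup>2 * c * nsq y" for t :: real
  proof -
    define z where "z = complex_of_real t * ip y x"
    have "nsq (x - sc z y) = nsq x - 2 * Re (ip x (sc z y)) + nsq (sc z y)"
      by (rule nsq_diff) (auto intro: x y sc_mem)
    also have "ip x (sc z y) = complex_of_real (t * c)"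
    proof -
      have "complex_of_real c = ip x y * ip y x"
        unfolding c_def complex_norm_square using ip_cnj[OF x y] by simp
      then show ?thesis by (simp add: ip_sc_right x y z_def mult_ac)
    qed
    also have "nsq (sc z y) = t\<^sup>2 * c * nsq y"
    proof -
      have "ip (sc z y) (sc z y) = (z * cnj z) * ip y y"
        by (simp add: ip_sc_right ip_sc_left y sc_mem)
      also have "z * cnj z = complex_of_real ((cmod z)\<^sup>2)" by (rule complex_norm_square[symmetric])
      also have "(cmod z)\<^sup>2 = t\<^sup>2 * c"
        using cmod_ip_commute[OF x y] by (simp add: z_def c_def norm_mult power_mult_distrib)
      finally show ?thesis by (simp add: nsq_def)
    qed
    finally show ?thesis using nsq_nonneg[of "x - sc z y"] x y diff_mem sc_mem by simp
  qed
  show ?thesis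
  proof (cases "nsq y = 0")
    case True
    have "c \<le> 0"
    proof (rule ccontr)
      assume "\<not> c \<le> 0"
      then have "c > 0" by simp
      \<comment> \<open>For a null vector \<open>y\<close> the quadratic term is missing, and this
        \<open>t\<close> gives the remaining linear polynomial the value -1.\<close>
      then show False using pos[of "(nsq x + 1) / (2 * c)"] True by simp
    qed
    then show ?thesis using True by (simp add: c_def)
  next
    case False
    then have yp: "nsq y > 0" using nsq_nonneg[OF y] by simp
    then have "0 \<le> nsq x - c / nsq y" using pos[of "1 / nsq y"] by (simp add: power2_eq_square)
    then show ?thesis using yp by (simp add: c_def field_simps)
  qed
qed

lemma null_orthogonal: "x \<in> L \<Longrightarrow> y \<in> L \<Longrightarrow> nsq y = 0 \<Longrightarrow> ip x y = 0"
  using cauchy_schwarz[of x y] by simp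

section \<open>Orthonormal families and finite rank operators\<close>

definition orthonormal :: "'x set \<Rightarrow> bool" where
  "orthonormal E \<longleftrightarrow> E \<subseteq> L \<and> (\<forall>e\<in>E. \<forall>f\<in>E. ip e f = (if e = f then 1 else 0))"

lemma orthonormal_residual:
  assumes E: "finite E" "orthonormal E" and u: "u \<in> L"
  defines "s \<equiv> (\<Sum>e\<in>E. sc (ip e u) e)"
  shows "s \<in> L" "e \<in> E \<Longrightarrow> ip e (u - s) = 0" "nsq (u - s) = nsq u - (\<Sum>e\<in>E. (cmod (ip e u))\<^sup>2)"
    "g \<in> L \<Longrightarrow> ip g s = (\<Sum>e\<in>E. ip g e * ip e u)"
proof -
  have EL: "e \<in> L" if "e \<in> E" for e using E that unfolding orthonormal_def by blast
  show s: "s \<in> L" unfolding s_def by (intro sum_mem sc_mem EL)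
  show gs: "ip g s = (\<Sum>e\<in>E. ip g e * ip e u)" if "g \<in> L" for g
    unfolding s_def using that EL by (subst ip_sum_right) (auto intro!: sc_mem sum.cong simp: ip_sc_right)
  show r0: "ip e (u - s) = 0" if e: "e \<in> E" for e
  proof -
    have "(\<Sum>f\<in>E. ip e f * ip f u) = (\<Sum>f\<in>E. if f = e then ip e u else 0)"
      using E e unfolding orthonormal_def by (intro sum.cong) auto
    then show ?thesis using e E u s EL by (simp add: ip_diff_right gs)
  qed
  have us: "ip u s = complex_of_real (\<Sum>e\<in>E. (cmod (ip e u))\<^sup>2)"
  proof -
    have "ip u e * ip e u = complex_of_real ((cmod (ip e u))\<^sup>2)" if "e \<in> E" for e
      using ip_cnj[OF EL[OF that] u] by (metis complex_norm_square mult.commute)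
    then show ?thesis using u by (simp add: gs cong: sum.cong)
  qed
  have "ip s s = (\<Sum>e\<in>E. ip s e * ip e u)" using s by (rule gs)
  also have "\<dots> = (\<Sum>e\<in>E. ip u e * ip e u)"
  proof (rule sum.cong[OF refl])
    fix e assume e: "e \<in> E"
    have "ip e s = ip e u" using r0[OF e] ip_diff_right[OF EL[OF e] u s] by simp
    then show "ip s e * ip e u = ip u e * ip e u" using ip_cnj[OF EL[OF e] s] ip_cnj[OF EL[OF e] u] by simp
  qed
  also have "\<dots> = ip u s" using gs[OF u] by simp
  finally have "nsq s = Re (ip u s)" by (simp add: nsq_def)
  then show "nsq (u - s) = nsq u - (\<Sum>e\<in>E. (cmod (ip e u))\<^sup>2)"
    using nsq_diff[OF u s] us by simp
qed

lemma bessel: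
  assumes "finite E" "orthonormal E" "u \<in> L"
  shows "(\<Sum>e\<in>E. (cmod (ip e u))\<^sup>2) \<le> nsq u"
  using orthonormal_residual(1,3)[OF assms] nsq_nonneg[of "u - (\<Sum>e\<in>E. sc (ip e u) e)"] diff_mem assms(3)
  by simp

text \<open>The expansion of \<open>u\<close> is asserted only after pairing with \<open>g\<close>:
  the residual may be a nonzero null vector, which no inner product sees.\<close>

lemma gram_schmidt:
  assumes "finite S" "S \<subseteq> L"
  shows "\<exists>E. finite E \<and> orthonormal E \<and> (\<forall>u\<in>S. \<forall>g\<in>L. ip g u = (\<Sum>e\<in>E. ip g e * ip e u))"
  using assms
proof (induction S rule: finite_induct)
  case empty
  show ?case by (intro exI[of _ "{}"]) (auto simp: orthonormal_def)
next
  case (insert u S)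
  then obtain E where E: "finite E" "orthonormal E"
    and S: "\<And>u g. u \<in> S \<Longrightarrow> g \<in> L \<Longrightarrow> ip g u = (\<Sum>e\<in>E. ip g e * ip e u)" by auto
  have u: "u \<in> L" and SL: "S \<subseteq> L" using insert.prems by auto
  have EL: "e \<in> L" if "e \<in> E" for e using E that unfolding orthonormal_def by blast
  define s where "s = (\<Sum>e\<in>E. sc (ip e u) e)"
  note R = orthonormal_residual[OF E u, folded s_def]
  define r where "r = u - s"
  have r: "r \<in> L" unfolding r_def by (rule diff_mem[OF u R(1)])
  have gu: "ip g u = (\<Sum>e\<in>E. ip g e * ip e u) + ip g r" if "g \<in> L" for g
    using that R(1,4) u by (simp add: r_def ip_diff_right)
  have r0: "ip e r = 0" "ip r e = 0" if "e \<in> E" for e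
    using R(2)[OF that] ip_cnj[OF EL[OF that] r] by (auto simp: r_def)
  show ?case
  proof (cases "nsq r = 0")
    case True
    then have "ip g u = (\<Sum>e\<in>E. ip g e * ip e u)" if "g \<in> L" for g
      using gu[OF that] null_orthogonal[OF that r] by simp
    then show ?thesis using E S by (intro exI[of _ E]) auto
  next
    case False
    then have rp: "nsq r > 0" using nsq_nonneg[OF r] by simp
    define k where "k = complex_of_real (1 / sqrt (nsq r))"
    define e0 where "e0 = sc k r"
    have e0: "e0 \<in> L" unfolding e0_def by (rule sc_mem[OF r])
    have "(1 / sqrt (nsq r)) * (1 / sqrt (nsq r)) * nsq r = 1" using rp by simp
    then have k: "k * k * complex_of_real (nsq r) = 1"
      unfolding k_def of_real_mult[symmetric] by (simp only: of_real_1)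
    have ck: "cnj k = k" by (simp add: k_def)
    have "ip e0 e0 = k * (k * ip r r)" by (simp add: e0_def ip_sc_left ip_sc_right r sc_mem ck)
    then have e0e0: "ip e0 e0 = 1" using k ip_self[OF r] by (simp add: mult.assoc)
    have e0E: "ip e e0 = 0" "ip e0 e = 0" if "e \<in> E" for e
      using r0[OF that] EL[OF that] by (simp_all add: e0_def ip_sc_left ip_sc_right r)
    have nin: "e0 \<notin> E" using e0E e0e0 by fastforce
    have on: "orthonormal (insert e0 E)"
      using E(2) e0 e0e0 e0E nin unfolding orthonormal_def by auto
    have "ip g u = (\<Sum>e\<in>insert e0 E. ip g e * ip e u)" if g: "g \<in> L" for g
    proof -
      have "ip r u = ip r r"
        using gu[OF r] r0 by simp
      then have "ip g e0 * ip e0 u = (k * k * complex_of_real (nsq r)) * ip g r"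
        using g u r by (simp add: e0_def ip_sc_left ip_sc_right ck ip_self)
      then show ?thesis using gu[OF g] nin E(1) k by simp
    qed
    moreover have "ip g v = (\<Sum>e\<in>insert e0 E. ip g e * ip e v)" if g: "g \<in> L" and v: "v \<in> S" for g v
    proof -
      have "ip e0 v = 0" using S[OF v e0] e0E by simp
      then show ?thesis using S[OF v g] nin E(1) by simp
    qed
    ultimately show ?thesis using on E(1) by (intro exI[of _ "insert e0 E"]) auto
  qed
qed

text \<open>A list of pairs \<open>(r, x)\<close> stands for the finite rank operator \<open>\<Sum> r |x\<rangle>\<langle>x|\<close>; \<open>hs\<close> is the
  Hilbert--Schmidt inner product of two such operators.\<close>

definition hs :: "(real \<times> 'x) list \<Rightarrow> (real \<times> 'x) list \<Rightarrow> real" where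
  "hs p q = (\<Sum>(r, x)\<leftarrow>p. \<Sum>(s, y)\<leftarrow>q. r * s * (cmod (ip x y))\<^sup>2)"

text \<open>For \<open>\<phi> = (\<lambda>x. ip x f)\<close> this is the matrix coefficient
  \<open>ip g (T f)\<close> of the operator \<open>T\<close> that \<open>p\<close> stands for. A
  bounded antilinear \<phi> takes the place of \<open>f\<close>, which avoids Riesz
  representation.\<close>

definition app :: "(real \<times> 'x) list \<Rightarrow> ('x \<Rightarrow> complex) \<Rightarrow> 'x \<Rightarrow> complex" where
  "app p \<phi> g = (\<Sum>(r, x)\<leftarrow>p. complex_of_real r * ip g x * \<phi> x)"

definition scal :: "real \<Rightarrow> (real \<times> 'x) list \<Rightarrow> (real \<times> 'x) list" where
  "scal c p = map (\<lambda>(r, x). (c * r, x)) p"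

definition mapv :: "('x \<Rightarrow> 'x) \<Rightarrow> (real \<times> 'x) list \<Rightarrow> (real \<times> 'x) list" where
  "mapv A p = map (\<lambda>(r, x). (r, A x)) p"

abbreviation ops :: "(real \<times> 'x) list set" where
  "ops \<equiv> {p. snd ` set p \<subseteq> L}"

lemma sum_list_nth: "(\<Sum>(r, x)\<leftarrow>p. F r x) = (\<Sum>i<length p. F (fst (p ! i)) (snd (p ! i)))"
  by (simp add: sum_list_sum_nth atLeast0LessThan case_prod_unfold)

lemma hs_append: "hs (p @ q) w = hs p w + hs q w" "hs w (p @ q) = hs w p + hs w q"
  unfolding hs_def by (simp_all add: case_prod_unfold sum_list_addf)

lemma hs_scal: "hs (scal c p) w = c * hs p w" "hs w (scal c p) = c * hs w p"
  unfolding hs_def scal_def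
  by (simp_all add: case_prod_unfold o_def sum_list_const_mult[symmetric] mult_ac)

lemma app_append: "app (p @ q) \<phi> g = app p \<phi> g + app q \<phi> g"
  unfolding app_def by simp

lemma app_scal: "app (scal c p) \<phi> g = complex_of_real c * app p \<phi> g"
  unfolding app_def scal_def
  by (simp add: case_prod_unfold o_def sum_list_const_mult[symmetric] mult_ac)

lemma ops_append: "p \<in> ops \<Longrightarrow> q \<in> ops \<Longrightarrow> p @ q \<in> ops"
  by auto

lemma ops_scal: "p \<in> ops \<Longrightarrow> scal c p \<in> ops"
  by (auto simp: scal_def)

lemma ops_nth: "p \<in> ops \<Longrightarrow> i < length p \<Longrightarrow> snd (p ! i) \<in> L"
  using nth_mem by blast

text \<open>With an orthonormal \<open>E\<close> that expands the vectors in \<open>p\<close>, the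
  operator has the matrix \<open>R\<close>, and \<open>hs p p\<close> is the sum of the squared
  moduli of its entries; hence it is nonnegative even if some weights are negative. Cauchy-Schwarz
  over \<open>E \<times> E\<close> and Bessel then bound the matrix coefficients.\<close>

lemma ker_bound:
  assumes p: "p \<in> ops" and w: "w \<in> L" and g: "g \<in> L"
  shows "(cmod (app p (\<lambda>x. ip x g) w))\<^sup>2 \<le> hs p p * nsq w * nsq g" "0 \<le> hs p p"
proof -
  define I where "I = {..<length p}"
  define r where "r i = complex_of_real (fst (p ! i))" for i
  define x where "x i = snd (p ! i)" for i
  have x: "x i \<in> L" if "i \<in> I" for i using ops_nth[OF p] that by (simp add: x_def I_def)
  have "finite (snd ` set p)" "snd ` set p \<subseteq> L" using p by auto
  then obtain E where E: "finite E" "orthonormal E"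
    and S: "\<And>u g. u \<in> snd ` set p \<Longrightarrow> g \<in> L \<Longrightarrow> ip g u = (\<Sum>e\<in>E. ip g e * ip e u)"
    using gram_schmidt by meson
  have EL: "e \<in> L" if "e \<in> E" for e using E that unfolding orthonormal_def by blast
  have S1: "ip g (x i) = (\<Sum>e\<in>E. ip g e * ip e (x i))" if "i \<in> I" "g \<in> L" for i g
    using that by (intro S) (auto simp: x_def I_def)
  have S2: "ip (x i) g = (\<Sum>e\<in>E. ip (x i) e * ip e g)" if i: "i \<in> I" and g: "g \<in> L" for i g
  proof -
    have "ip (x i) g = cnj (\<Sum>e\<in>E. ip g e * ip e (x i))" using ip_cnj[OF g x[OF i]] S1[OF i g] by simp
    also have "\<dots> = (\<Sum>e\<in>E. ip (x i) e * ip e g)"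
      unfolding cnj_sum complex_cnj_mult
      using ip_cnj[OF g EL] ip_cnj[OF EL x[OF i]] by (intro sum.cong) (auto simp: mult.commute)
    finally show ?thesis .
  qed
  define R where "R e e' = (\<Sum>i\<in>I. r i * ip e (x i) * ip (x i) e')" for e e'
  have appI: "app p \<phi> h = (\<Sum>i\<in>I. r i * ip h (x i) * \<phi> (x i))" for \<phi> h
    unfolding app_def sum_list_nth I_def r_def x_def ..
  have ker: "app p (\<lambda>x. ip x g) w = (\<Sum>(e, e')\<in>E \<times> E. R e e' * (ip w e * ip e' g))"
  proof -
    have "app p (\<lambda>x. ip x g) w = (\<Sum>i\<in>I. r i * (\<Sum>e\<in>E. ip w e * ip e (x i)) * (\<Sum>e'\<in>E. ip (x i) e' * ip e' g))"
      unfolding appI using S1[OF _ w] S2[OF _ g] by (intro sum.cong) auto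
    also have "\<dots> = (\<Sum>i\<in>I. \<Sum>e\<in>E. \<Sum>e'\<in>E. r i * ip e (x i) * ip (x i) e' * (ip w e * ip e' g))"
      by (simp add: sum_distrib_left sum_distrib_right mult_ac)
    also have "\<dots> = (\<Sum>e\<in>E. \<Sum>i\<in>I. \<Sum>e'\<in>E. r i * ip e (x i) * ip (x i) e' * (ip w e * ip e' g))"
      by (rule sum.swap)
    also have "\<dots> = (\<Sum>e\<in>E. \<Sum>e'\<in>E. \<Sum>i\<in>I. r i * ip e (x i) * ip (x i) e' * (ip w e * ip e' g))"
      by (intro sum.cong[OF refl] sum.swap)
    finally show ?thesis by (simp only: R_def sum_distrib_right sum.cartesian_product[symmetric])
  qed
  have "(\<Sum>(e, e')\<in>E \<times> E. R e e' * cnj (R e e')) = complex_of_real (hs p p)"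
  proof -
    have cR: "cnj (R e e') = (\<Sum>j\<in>I. r j * ip (x j) e * ip e' (x j))" if "e \<in> E" "e' \<in> E" for e e'
      unfolding R_def cnj_sum complex_cnj_mult
    proof (intro sum.cong[OF refl])
      fix j assume "j \<in> I"
      then show "cnj (r j) * cnj (ip e (x j)) * cnj (ip (x j) e') = r j * ip (x j) e * ip e' (x j)"
        using ip_cnj[OF EL[OF that(1)] x[of j]] ip_cnj[OF x[of j] EL[OF that(2)]] by (simp add: r_def)
    qed
    have "(\<Sum>(e, e')\<in>E \<times> E. R e e' * cnj (R e e')) =
        (\<Sum>e\<in>E. \<Sum>e'\<in>E. \<Sum>i\<in>I. \<Sum>j\<in>I. r i * r j * (ip (x j) e * ip e (x i)) * (ip (x i) e' * ip e' (x j)))"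
      unfolding sum.cartesian_product[symmetric]
      by (intro sum.cong[OF refl], simp only: cR) (simp add: R_def sum_product mult_ac)
    also have "\<dots> = (\<Sum>e\<in>E. \<Sum>i\<in>I. \<Sum>e'\<in>E. \<Sum>j\<in>I. r i * r j * (ip (x j) e * ip e (x i)) * (ip (x i) e' * ip e' (x j)))"
      by (intro sum.cong[OF refl] sum.swap)
    also have "\<dots> = (\<Sum>i\<in>I. \<Sum>e\<in>E. \<Sum>j\<in>I. \<Sum>e'\<in>E. r i * r j * (ip (x j) e * ip e (x i)) * (ip (x i) e' * ip e' (x j)))"
      by (subst sum.swap) (intro sum.cong[OF refl] sum.swap)
    also have "\<dots> = (\<Sum>i\<in>I. \<Sum>j\<in>I. \<Sum>e\<in>E. \<Sum>e'\<in>E. r i * r j * (ip (x j) e * ip e (x i)) * (ip (x i) e' * ip e' (x j)))"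
      by (intro sum.cong[OF refl] sum.swap)
    also have "\<dots> = (\<Sum>i\<in>I. \<Sum>j\<in>I. r i * r j * (\<Sum>e\<in>E. ip (x j) e * ip e (x i)) * (\<Sum>e'\<in>E. ip (x i) e' * ip e' (x j)))"
      by (intro sum.cong[OF refl]) (simp add: sum_distrib_left sum_distrib_right mult_ac)
    also have "\<dots> = (\<Sum>i\<in>I. \<Sum>j\<in>I. r i * r j * complex_of_real ((cmod (ip (x i) (x j)))\<^sup>2))"
    proof (intro sum.cong[OF refl])
      fix i j assume ij: "i \<in> I" "j \<in> I"
      have "ip (x j) (x i) * ip (x i) (x j) = complex_of_real ((cmod (ip (x i) (x j)))\<^sup>2)"
        unfolding complex_norm_square using ip_cnj[OF x[OF ij(1)] x[OF ij(2)]] by (simp add: mult.commute)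
      then show "r i * r j * (\<Sum>e\<in>E. ip (x j) e * ip e (x i)) * (\<Sum>e'\<in>E. ip (x i) e' * ip e' (x j)) =
          r i * r j * complex_of_real ((cmod (ip (x i) (x j)))\<^sup>2)"
        using S1[OF ij(1) x[OF ij(2)]] S1[OF ij(2) x[OF ij(1)]] by (simp add: mult.assoc)
    qed
    also have "\<dots> = complex_of_real (hs p p)"
      by (simp add: hs_def sum_list_nth r_def x_def I_def)
    finally show ?thesis .
  qed
  then have "complex_of_real (\<Sum>(e, e')\<in>E \<times> E. (cmod (R e e'))\<^sup>2) = complex_of_real (hs p p)"
    unfolding of_real_sum case_prod_unfold complex_norm_square by simp
  then have RR: "(\<Sum>(e, e')\<in>E \<times> E. (cmod (R e e'))\<^sup>2) = hs p p" by (simp only: of_real_eq_iff)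
  show "0 \<le> hs p p" unfolding RR[symmetric] by (intro sum_nonneg) auto
  have "cmod (app p (\<lambda>x. ip x g) w) \<le> (\<Sum>(e, e')\<in>E \<times> E. cmod (R e e') * (cmod (ip w e) * cmod (ip e' g)))"
    unfolding ker by (rule order_trans[OF norm_sum]) (simp add: case_prod_unfold norm_mult)
  then have "(cmod (app p (\<lambda>x. ip x g) w))\<^sup>2 \<le>
      (\<Sum>z\<in>E \<times> E. cmod (R (fst z) (snd z)) * (cmod (ip w (fst z)) * cmod (ip (snd z) g)))\<^sup>2"
    by (intro power_mono) (auto simp: case_prod_unfold)
  also have "\<dots> \<le> (\<Sum>z\<in>E \<times> E. (cmod (R (fst z) (snd z)))\<^sup>2) * (\<Sum>z\<in>E \<times> E. (cmod (ip w (fst z)) * cmod (ip (snd z) g))\<^sup>2)"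
    by (rule Cauchy_Schwarz_ineq_sum)
  also have "(\<Sum>z\<in>E \<times> E. (cmod (R (fst z) (snd z)))\<^sup>2) = hs p p" using RR by (simp add: case_prod_unfold)
  also have "(\<Sum>z\<in>E \<times> E. (cmod (ip w (fst z)) * cmod (ip (snd z) g))\<^sup>2) =
      (\<Sum>e\<in>E. (cmod (ip e w))\<^sup>2) * (\<Sum>e\<in>E. (cmod (ip e g))\<^sup>2)"
    unfolding sum_product sum.cartesian_product case_prod_unfold
    by (intro sum.cong[OF refl]) (simp add: power_mult_distrib cmod_ip_commute[OF w EL] mem_Times_iff)
  also have "hs p p * \<dots> \<le> hs p p * (nsq w * nsq g)"
    using \<open>0 \<le> hs p p\<close> by (intro mult_left_mono mult_mono bessel[OF E] w g nsq_nonneg sum_nonneg) auto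
  finally show "(cmod (app p (\<lambda>x. ip x g) w))\<^sup>2 \<le> hs p p * nsq w * nsq g" by (simp add: mult.assoc)
qed

text \<open>Antilinear like \<open>ip\<close> in its first argument, and like the functionals that
  model one-particle vectors in Fock space.\<close>

definition bounded_functional :: "real \<Rightarrow> ('x \<Rightarrow> complex) \<Rightarrow> bool" where
  "bounded_functional C \<phi> \<longleftrightarrow> 0 \<le> C \<and> (\<forall>x\<in>L. \<forall>y\<in>L. \<phi> (x + y) = \<phi> x + \<phi> y) \<and>
    (\<forall>z. \<forall>x\<in>L. \<phi> (sc z x) = cnj z * \<phi> x) \<and> (\<forall>x\<in>L. cmod (\<phi> x) \<le> C * sqrt (nsq x))"

lemma bounded_functional_ip:
  assumes "f \<in> L"
  shows "bounded_functional (sqrt (nsq f)) (\<lambda>x. ip x f)"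
  unfolding bounded_functional_def
proof (intro conjI ballI allI)
  show "cmod (ip x f) \<le> sqrt (nsq f) * sqrt (nsq x)" if "x \<in> L" for x
    using real_sqrt_le_mono[OF cauchy_schwarz[OF that assms]] by (simp add: real_sqrt_mult mult.commute)
qed (auto simp: ip_add_left ip_sc_left assms nsq_nonneg)

lemma bounded_functional_sum:
  assumes "bounded_functional C \<phi>" "\<And>i. i \<in> I \<Longrightarrow> f i \<in> L"
  shows "\<phi> (sum f I) = (\<Sum>i\<in>I. \<phi> (f i))"
proof -
  have "\<phi> (0 + 0) = \<phi> 0 + \<phi> 0" using assms(1) zero_mem unfolding bounded_functional_def by blast
  then have 0: "\<phi> 0 = 0" by simp
  show ?thesis using assms(2)
  proof (induction I rule: infinite_finite_induct)
    case (insert i I)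
    have "\<phi> (f i + sum f I) = \<phi> (f i) + \<phi> (sum f I)"
      using assms(1) insert.prems sum_mem[of I f] unfolding bounded_functional_def by simp
    then show ?case using insert by simp
  qed (simp_all add: 0)
qed

text \<open>The value is \<open>\<phi> z\<close> for \<open>z = T g\<close>, since \<phi> is
  antilinear and the weights are real. The length of \<open>z\<close> is estimated by pairing it
  with itself: \<open>ip z z\<close> is again a matrix coefficient, so \<open>ker_bound\<close> with
  \<open>w = z\<close> applies.\<close>

lemma app_bound:
  assumes p: "p \<in> ops" and \<phi>: "bounded_functional C \<phi>" and g: "g \<in> L"
  shows "cmod (app p \<phi> g) \<le> C * sqrt (nsq g) * sqrt (hs p p)"
proof -
  have C: "0 \<le> C" using \<phi> unfolding bounded_functional_def by blast
  define I where "I = {..<length p}"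
  define r where "r i = complex_of_real (fst (p ! i))" for i
  define x where "x i = snd (p ! i)" for i
  have x: "x i \<in> L" if "i \<in> I" for i using ops_nth[OF p] that by (simp add: x_def I_def)
  have appI: "app p \<psi> h = (\<Sum>i\<in>I. r i * ip h (x i) * \<psi> (x i))" for \<psi> h
    unfolding app_def sum_list_nth I_def r_def x_def ..
  define z where "z = (\<Sum>i\<in>I. sc (r i * ip (x i) g) (x i))"
  have z: "z \<in> L" unfolding z_def by (intro sum_mem sc_mem x)
  have "\<phi> z = (\<Sum>i\<in>I. \<phi> (sc (r i * ip (x i) g) (x i)))"
    unfolding z_def by (rule bounded_functional_sum[OF \<phi>]) (intro sc_mem x)
  also have "\<dots> = app p \<phi> g" unfolding appI
  proof (rule sum.cong[OF refl])
    fix i assume i: "i \<in> I"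
    have "\<phi> (sc (r i * ip (x i) g) (x i)) = cnj (r i * ip (x i) g) * \<phi> (x i)"
      using \<phi> x[OF i] unfolding bounded_functional_def by blast
    then show "\<phi> (sc (r i * ip (x i) g) (x i)) = r i * ip g (x i) * \<phi> (x i)"
      using ip_cnj[OF x[OF i] g] by (simp add: r_def)
  qed
  finally have \<phi>z: "app p \<phi> g = \<phi> z" ..
  have "ip z z = app p (\<lambda>x. ip x g) z"
  proof -
    have "ip z z = (\<Sum>i\<in>I. ip z (sc (r i * ip (x i) g) (x i)))"
      using ip_sum_right[OF z, of I "\<lambda>i. sc (r i * ip (x i) g) (x i)"] x sc_mem unfolding z_def[symmetric] by blast
    also have "\<dots> = (\<Sum>i\<in>I. r i * ip z (x i) * ip (x i) g)"
      by (intro sum.cong[OF refl]) (simp add: ip_sc_right z x)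
    finally show ?thesis unfolding appI .
  qed
  then have "cmod (app p (\<lambda>x. ip x g) z) = nsq z"
    using ip_self[OF z] nsq_nonneg[OF z] by (metis norm_of_real abs_of_nonneg)
  then have "(nsq z)\<^sup>2 \<le> hs p p * nsq z * nsq g"
    using ker_bound(1)[OF p z g] by simp
  then have "nsq z \<le> hs p p * nsq g"
    using nsq_nonneg[OF z] nsq_nonneg[OF g] ker_bound(2)[OF p z g]
    by (cases "nsq z = 0") (auto simp: power2_eq_square algebra_simps mult_le_cancel_left)
  then have "sqrt (nsq z) \<le> sqrt (nsq g) * sqrt (hs p p)"
    using real_sqrt_le_mono by (fastforce simp: real_sqrt_mult mult.commute)
  moreover have "cmod (\<phi> z) \<le> C * sqrt (nsq z)" using \<phi> z unfolding bounded_functional_def by blast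
  ultimately show ?thesis
    unfolding \<phi>z using mult_left_mono[OF _ C, of "sqrt (nsq z)"] by (fastforce simp: mult.assoc)
qed

section \<open>Isometries and convex hulls of conjugate operators\<close>

definition isom :: "('x \<Rightarrow> 'x) \<Rightarrow> bool" where
  "isom A \<longleftrightarrow> A ` L = L \<and> (\<forall>x\<in>L. \<forall>y\<in>L. ip (A x) (A y) = ip x y \<and> A (x - y) = A x - A y)"

lemma isomD:
  assumes "isom A"
  shows "x \<in> L \<Longrightarrow> A x \<in> L" "y \<in> L \<Longrightarrow> \<exists>x\<in>L. y = A x"
    "x \<in> L \<Longrightarrow> y \<in> L \<Longrightarrow> ip (A x) (A y) = ip x y" "x \<in> L \<Longrightarrow> y \<in> L \<Longrightarrow> nsq (A x - A y) = nsq (x - y)"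
  using assms diff_mem unfolding isom_def nsq_def by (blast, blast, blast, metis)

lemma ops_mapv: "isom A \<Longrightarrow> p \<in> ops \<Longrightarrow> mapv A p \<in> ops"
  using isomD(1)[of A] by (auto simp: mapv_def)

lemma hs_mapv:
  assumes "isom A" "p \<in> ops" "q \<in> ops"
  shows "hs (mapv A p) (mapv A q) = hs p q"
proof -
  have "ip (A (snd a)) (A (snd b)) = ip (snd a) (snd b)" if "a \<in> set p" "b \<in> set q" for a b
    using assms(2,3) that by (intro isomD(3)[OF assms(1)]) auto
  then show ?thesis
    unfolding hs_def mapv_def map_map o_def case_prod_unfold
    by (intro arg_cong[where f = sum_list] map_cong refl) simp
qed

lemma app_mapv:
  assumes "isom A" "p \<in> ops" "g \<in> L"
  shows "app (mapv A p) \<phi> (A g) = app p (\<lambda>x. \<phi> (A x)) g"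
  unfolding app_def mapv_def map_map o_def case_prod_unfold
  using assms isomD(3)[OF assms(1)]
  by (auto intro!: arg_cong[where f = sum_list] map_cong simp: image_subset_iff)

abbreviation diffp :: "(real \<times> 'x) list \<Rightarrow> (real \<times> 'x) list \<Rightarrow> (real \<times> 'x) list" where
  "diffp p q \<equiv> p @ scal (-1) q"

abbreviation midp :: "(real \<times> 'x) list \<Rightarrow> (real \<times> 'x) list \<Rightarrow> (real \<times> 'x) list" where
  "midp p q \<equiv> scal (1/2) p @ scal (1/2) q"

lemma parallelogram: "hs (diffp p q) (diffp p q) = 2 * hs p p + 2 * hs q q - 4 * hs (midp p q) (midp p q)"
  by (simp add: hs_append hs_scal algebra_simps)

text \<open>The base elements are the conjugates by \<open>A\<close> of the sum of
  \<open>|f><f|\<close> over \<open>F\<close>. Midpoints generate enough of the convex hull, as the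
  parallelogram law asks for no other combination.\<close>

inductive_set mhull for \<A> :: "('x \<Rightarrow> 'x) set" and F :: "'x list" where
  base: "A \<in> \<A> \<Longrightarrow> map (\<lambda>f. (1, A f)) F \<in> mhull \<A> F"
| mid: "p \<in> mhull \<A> F \<Longrightarrow> q \<in> mhull \<A> F \<Longrightarrow> midp p q \<in> mhull \<A> F"

lemma mhull_ops:
  assumes "p \<in> mhull \<A> F" "\<And>A. A \<in> \<A> \<Longrightarrow> isom A" "set F \<subseteq> L"
  shows "p \<in> ops"
  using assms(1)
proof (induction p rule: mhull.induct)
  case (base A)
  then show ?case using isomD(1)[OF assms(2)] assms(3) by auto
next
  case (mid p q)
  then show ?case by (intro ops_append ops_scal)
qed

lemma mhull_mapv:
  assumes "p \<in> mhull \<A> F" "A \<in> \<A>" "\<And>A A'. A \<in> \<A> \<Longrightarrow> A' \<in> \<A> \<Longrightarrow> A \<circ> A' \<in> \<A>"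
  shows "mapv A p \<in> mhull \<A> F"
  using assms(1)
proof (induction p rule: mhull.induct)
  case (base A')
  have "mapv A (map (\<lambda>f. (1, A' f)) F) = map (\<lambda>f. (1, (A \<circ> A') f)) F" by (simp add: mapv_def)
  then show ?case using mhull.base[OF assms(3)[OF assms(2) base]] by simp
next
  case (mid p q)
  have "mapv A (midp p q) = midp (mapv A p) (mapv A q)"
    by (simp add: mapv_def scal_def case_prod_unfold o_def)
  then show ?case using mhull.mid[OF mid.IH] by simp
qed

text \<open>The parallelogram law makes any minimizing sequence of the Hilbert--Schmidt norm Cauchy and, as
  isometries preserve this norm, asymptotically invariant.\<close>

lemma minimizing_sequence:
  assumes isom: "\<And>A. A \<in> \<A> \<Longrightarrow> isom A" and comp: "\<And>A A'. A \<in> \<A> \<Longrightarrow> A' \<in> \<A> \<Longrightarrow> A \<circ> A' \<in> \<A>"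
    and ne: "\<A> \<noteq> {}" and F: "set F \<subseteq> L"
  obtains p where "\<And>n::nat. p n \<in> mhull \<A> F"
    "\<And>m n. m \<le> n \<Longrightarrow> hs (diffp (p n) (p m)) (diffp (p n) (p m)) \<le> 4 / real (Suc m)"
    "\<And>n A. A \<in> \<A> \<Longrightarrow> hs (diffp (p n) (mapv A (p n))) (diffp (p n) (mapv A (p n))) \<le> 4 / real (Suc n)"
proof -
  define X where "X = (\<lambda>p. hs p p) ` mhull \<A> F"
  define d where "d = Inf X"
  have ops: "p \<in> ops" if "p \<in> mhull \<A> F" for p using mhull_ops[OF that isom F] .
  have Xne: "X \<noteq> {}" using ne mhull.base unfolding X_def by blast
  have nn: "0 \<le> hs p p" if "p \<in> ops" for p using ker_bound(2)[OF that zero_mem zero_mem] .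
  have bdd: "bdd_below X" unfolding X_def using nn ops by (intro bdd_belowI2[of _ 0]) auto
  have dle: "d \<le> hs p p" if "p \<in> mhull \<A> F" for p
    unfolding d_def by (rule cInf_lower[OF _ bdd]) (use that X_def in blast)
  have "\<exists>p\<in>mhull \<A> F. hs p p < d + 1 / real (Suc n)" for n
  proof -
    have "Inf X < d + 1 / real (Suc n)" by (simp add: d_def)
    then obtain y where "y \<in> X" "y < d + 1 / real (Suc n)" using cInf_lessD[OF Xne] by blast
    then show ?thesis unfolding X_def by blast
  qed
  then obtain p where p: "\<And>n. p n \<in> mhull \<A> F" "\<And>n. hs (p n) (p n) < d + 1 / real (Suc n)" by metis
  \<comment> \<open>The midpoint of \<open>q\<close> and \<open>q'\<close> cannot fall below the
    infimum \<open>d\<close>, so the parallelogram law leaves at most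
    \<open>2 (d + e) + 2 (d + e) - 4 d\<close>.\<close>
  have close: "hs (diffp q q') (diffp q q') \<le> 4 * e"
    if "q \<in> mhull \<A> F" "q' \<in> mhull \<A> F" "hs q q \<le> d + e" "hs q' q' \<le> d + e" for q q' e
    using dle[OF mhull.mid[OF that(1,2)]] that(3,4) unfolding parallelogram by linarith
  show ?thesis
  proof (rule that[OF p(1)])
    fix m n :: nat assume "m \<le> n"
    then have "1 / real (Suc n) \<le> 1 / real (Suc m)" by (simp add: frac_le)
    then have "hs (p n) (p n) \<le> d + 1 / real (Suc m)" using p(2)[of n] by linarith
    from close[OF p(1) p(1) this less_imp_le[OF p(2)]]
    show "hs (diffp (p n) (p m)) (diffp (p n) (p m)) \<le> 4 / real (Suc m)" by simp
  next
    fix n A assume A: "A \<in> \<A>"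
    have "hs (mapv A (p n)) (mapv A (p n)) = hs (p n) (p n)"
      by (rule hs_mapv[OF isom[OF A] ops[OF p(1)] ops[OF p(1)]])
    then have "hs (mapv A (p n)) (mapv A (p n)) \<le> d + 1 / real (Suc n)" using p(2)[of n] by simp
    from close[OF p(1) mhull_mapv[OF p(1) A comp] less_imp_le[OF p(2)] this]
    show "hs (diffp (p n) (mapv A (p n))) (diffp (p n) (mapv A (p n))) \<le> 4 / real (Suc n)" by simp
  qed
qed

text \<open>The sum is the trace pairing of \<open>p\<close> with the initial operator. It is affine
  in \<open>p\<close>, so a lower bound for all conjugates persists under midpoints; this keeps the
  minimizing sequence away from zero.\<close>

lemma mhull_lower_bound:
  assumes p: "p \<in> mhull \<A> F" and isom: "\<And>A. A \<in> \<A> \<Longrightarrow> isom A" and F: "set F \<subseteq> L"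
    and bound: "\<And>A. A \<in> \<A> \<Longrightarrow> \<delta> \<le> (\<Sum>f\<leftarrow>F. \<Sum>f'\<leftarrow>F. (cmod (ip f (A f')))\<^sup>2)"
  shows "\<delta> \<le> (\<Sum>f\<leftarrow>F. Re (app p (\<lambda>x. ip x f) f))"
  using p
proof (induction p rule: mhull.induct)
  case (base A)
  have "Re (app (map (\<lambda>f. (1, A f)) F) (\<lambda>x. ip x f) f) = (\<Sum>f'\<leftarrow>F. (cmod (ip f (A f')))\<^sup>2)"
    if f: "f \<in> set F" for f
  proof -
    have fL: "f \<in> L" using f F by blast
    have "app (map (\<lambda>f. (1, A f)) F) (\<lambda>x. ip x f) f = (\<Sum>f'\<leftarrow>F. ip f (A f') * ip (A f') f)"
      by (simp add: app_def o_def)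
    also have "\<dots> = (\<Sum>f'\<leftarrow>F. complex_of_real ((cmod (ip f (A f')))\<^sup>2))"
    proof (intro arg_cong[where f = sum_list] map_cong refl)
      fix f' assume "f' \<in> set F"
      then have "A f' \<in> L" using F isomD(1)[OF isom[OF base]] by blast
      then show "ip f (A f') * ip (A f') f = complex_of_real ((cmod (ip f (A f')))\<^sup>2)"
        using ip_cnj[OF fL] by (simp only: complex_norm_square)
    qed
    also have "\<dots> = complex_of_real (\<Sum>f'\<leftarrow>F. (cmod (ip f (A f')))\<^sup>2)"
      by (induction F) auto
    finally show ?thesis by simp
  qed
  then have "(\<Sum>f\<leftarrow>F. Re (app (map (\<lambda>f. (1, A f)) F) (\<lambda>x. ip x f) f)) = (\<Sum>f\<leftarrow>F. \<Sum>f'\<leftarrow>F. (cmod (ip f (A f')))\<^sup>2)"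
    by (intro arg_cong[where f = sum_list] map_cong refl)
  then show ?case using bound[OF base] by simp
next
  case (mid p q)
  have "(\<Sum>f\<leftarrow>F. Re (app (midp p q) (\<lambda>x. ip x f) f)) =
      (1/2) * (\<Sum>f\<leftarrow>F. Re (app p (\<lambda>x. ip x f) f)) + (1/2) * (\<Sum>f\<leftarrow>F. Re (app q (\<lambda>x. ip x f) f))"
    by (simp add: app_append app_scal sum_list_addf sum_list_const_mult[symmetric] o_def)
  then show ?case using mid.IH by linarith
qed

end

section \<open>Operators on Fock space induced by invariant forms\<close>

lemma sqrt_inverse_tendsto: "(\<lambda>m. K * sqrt (4 / real (Suc m))) \<longlonglongrightarrow> 0"
proof -
  have "(\<lambda>m. 4 * (1 / real (Suc m))) \<longlonglongrightarrow> 4 * 0" by (intro tendsto_intros LIMSEQ_Suc[OF lim_1_over_n])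
  then have "(\<lambda>m. K * sqrt (4 / real (Suc m))) \<longlonglongrightarrow> K * sqrt 0" by (intro tendsto_intros) simp
  then show ?thesis by simp
qed

context sip_space
begin

definition minseq :: "(nat \<Rightarrow> (real \<times> 'x) list) \<Rightarrow> bool" where
  "minseq p \<longleftrightarrow> (\<forall>n. p n \<in> ops) \<and>
    (\<forall>m n. m \<le> n \<longrightarrow> hs (diffp (p n) (p m)) (diffp (p n) (p m)) \<le> 4 / real (Suc m))"

text \<open>The limit is taken for each functional and vector separately, so no completion of the
  finite rank operators has to be formed.\<close>

definition lim_app :: "(nat \<Rightarrow> (real \<times> 'x) list) \<Rightarrow> ('x \<Rightarrow> complex) \<Rightarrow> 'x \<Rightarrow> complex" where
  "lim_app p \<phi> g = lim (\<lambda>n. app (p n) \<phi> g)"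

lemma app_diff: "app (diffp p q) \<phi> g = app p \<phi> g - app q \<phi> g"
  by (simp add: app_append app_scal)

lemma app_cong: "p \<in> ops \<Longrightarrow> (\<And>x. x \<in> L \<Longrightarrow> \<phi> x = \<psi> x) \<Longrightarrow> app p \<phi> g = app p \<psi> g"
  unfolding app_def case_prod_unfold by (intro arg_cong[where f = sum_list] map_cong refl) auto

lemma lim_app_cong: "minseq p \<Longrightarrow> (\<And>x. x \<in> L \<Longrightarrow> \<phi> x = \<psi> x) \<Longrightarrow> lim_app p \<phi> g = lim_app p \<psi> g"
  unfolding lim_app_def minseq_def using app_cong[of _ \<phi> \<psi> g] by simp

lemma app_diff_bound:
  assumes "p \<in> ops" "q \<in> ops" "hs (diffp p q) (diffp p q) \<le> h" "bounded_functional C \<phi>" "g \<in> L"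
  shows "cmod (app p \<phi> g - app q \<phi> g) \<le> C * sqrt (nsq g) * sqrt h"
proof -
  have "cmod (app (diffp p q) \<phi> g) \<le> C * sqrt (nsq g) * sqrt (hs (diffp p q) (diffp p q))"
    by (rule app_bound[OF ops_append[OF assms(1) ops_scal[OF assms(2)]] assms(4,5)])
  also have "\<dots> \<le> C * sqrt (nsq g) * sqrt h"
    using assms(3,4,5) nsq_nonneg unfolding bounded_functional_def
    by (intro mult_left_mono real_sqrt_le_mono) auto
  finally show ?thesis by (simp add: app_diff)
qed

text \<open>By \<open>app_diff_bound\<close> the Cauchy property for \<open>hs\<close> transfers to
  matrix coefficients. The rate in the second claim serves to bound the limit and later to compare
  it with one finite rank operator.\<close>

lemma lim_app_tendsto:
  assumes p: "minseq p" and \<phi>: "bounded_functional C \<phi>" and g: "g \<in> L"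
  shows "(\<lambda>n. app (p n) \<phi> g) \<longlonglongrightarrow> lim_app p \<phi> g"
    "cmod (lim_app p \<phi> g - app (p m) \<phi> g) \<le> C * sqrt (nsq g) * sqrt (4 / real (Suc m))"
proof -
  define K where "K = C * sqrt (nsq g)"
  have b: "cmod (app (p n) \<phi> g - app (p m) \<phi> g) \<le> K * sqrt (4 / real (Suc m))" if "m \<le> n" for m n
    using p that unfolding K_def minseq_def by (intro app_diff_bound[OF _ _ _ \<phi> g]) auto
  have "Cauchy (\<lambda>n. app (p n) \<phi> g)"
  proof (rule CauchyI')
    fix e :: real assume "0 < e"
    then have "\<forall>\<^sub>F m in sequentially. K * sqrt (4 / real (Suc m)) < e"
      using order_tendstoD(2)[OF sqrt_inverse_tendsto] by blast
    then obtain M where M: "\<And>m. m \<ge> M \<Longrightarrow> K * sqrt (4 / real (Suc m)) < e"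
      unfolding eventually_sequentially by blast
    show "\<exists>M. \<forall>m\<ge>M. \<forall>n>m. dist (app (p m) \<phi> g) (app (p n) \<phi> g) < e"
    proof (intro exI[of _ M] allI impI)
      fix m n assume "M \<le> m" "m < n"
      then show "dist (app (p m) \<phi> g) (app (p n) \<phi> g) < e"
        using b[of m n] M[of m] by (simp add: dist_norm norm_minus_commute)
    qed
  qed
  then show lim: "(\<lambda>n. app (p n) \<phi> g) \<longlonglongrightarrow> lim_app p \<phi> g"
    unfolding lim_app_def using Cauchy_convergent convergent_LIMSEQ_iff by blast
  have "(\<lambda>n. cmod (app (p n) \<phi> g - app (p m) \<phi> g)) \<longlonglongrightarrow> cmod (lim_app p \<phi> g - app (p m) \<phi> g)"
    by (intro tendsto_intros lim)
  then show "cmod (lim_app p \<phi> g - app (p m) \<phi> g) \<le> C * sqrt (nsq g) * sqrt (4 / real (Suc m))"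
    by (rule LIMSEQ_le_const2) (use b K_def in blast)
qed

lemma app_add_left:
  "p \<in> ops \<Longrightarrow> g \<in> L \<Longrightarrow> h \<in> L \<Longrightarrow> app p \<phi> (g + h) = app p \<phi> g + app p \<phi> h"
  unfolding app_def case_prod_unfold sum_list_addf[symmetric]
  by (intro arg_cong[where f = sum_list] map_cong refl) (auto simp: ip_add_left algebra_simps image_subset_iff)

lemma app_sc_left:
  "p \<in> ops \<Longrightarrow> g \<in> L \<Longrightarrow> app p \<phi> (sc z g) = cnj z * app p \<phi> g"
  unfolding app_def case_prod_unfold sum_list_const_mult[symmetric]
  by (intro arg_cong[where f = sum_list] map_cong refl) (auto simp: ip_sc_left algebra_simps image_subset_iff)

lemma app_functional_add: "app p (\<lambda>x. \<phi> x + \<psi> x) g = app p \<phi> g + app p \<psi> g"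
  unfolding app_def case_prod_unfold sum_list_addf[symmetric] by (simp add: algebra_simps)

lemma app_functional_scale: "app p (\<lambda>x. z * \<phi> x) g = z * app p \<phi> g"
  unfolding app_def case_prod_unfold sum_list_const_mult[symmetric] by (simp add: algebra_simps)

text \<open>The summand 2 is \<open>sqrt (4 / real (Suc 0))\<close>, the bound for the distance
  between the limit and \<open>p 0\<close>.\<close>

definition lim_norm :: "(nat \<Rightarrow> (real \<times> 'x) list) \<Rightarrow> real" where
  "lim_norm p = sqrt (hs (p 0) (p 0)) + 2"

lemma lim_norm_nonneg: "minseq p \<Longrightarrow> 0 \<le> lim_norm p"
  unfolding lim_norm_def minseq_def using ker_bound(2)[OF _ zero_mem zero_mem, of "p 0"] by simp

lemma lim_app_bounded_functional:
  assumes p: "minseq p" and \<phi>: "bounded_functional C \<phi>"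
  shows "bounded_functional (C * lim_norm p) (lim_app p \<phi>)"
proof -
  have po: "p n \<in> ops" for n using p unfolding minseq_def by blast
  have C: "0 \<le> C" using \<phi> unfolding bounded_functional_def by blast
  show ?thesis unfolding bounded_functional_def
  proof (intro conjI ballI allI)
    show "0 \<le> C * lim_norm p" using C lim_norm_nonneg[OF p] by simp
    show "lim_app p \<phi> (x + y) = lim_app p \<phi> x + lim_app p \<phi> y" if "x \<in> L" "y \<in> L" for x y
    proof (rule LIMSEQ_unique)
      show "(\<lambda>n. app (p n) \<phi> (x + y)) \<longlonglongrightarrow> lim_app p \<phi> (x + y)"
        by (rule lim_app_tendsto(1)[OF p \<phi> add_mem[OF that]])
      show "(\<lambda>n. app (p n) \<phi> (x + y)) \<longlonglongrightarrow> lim_app p \<phi> x + lim_app p \<phi> y"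
        unfolding app_add_left[OF po that] by (intro tendsto_add lim_app_tendsto(1)[OF p \<phi>] that)
    qed
    show "lim_app p \<phi> (sc z x) = cnj z * lim_app p \<phi> x" if "x \<in> L" for z x
    proof (rule LIMSEQ_unique)
      show "(\<lambda>n. app (p n) \<phi> (sc z x)) \<longlonglongrightarrow> lim_app p \<phi> (sc z x)"
        by (rule lim_app_tendsto(1)[OF p \<phi> sc_mem[OF that]])
      show "(\<lambda>n. app (p n) \<phi> (sc z x)) \<longlonglongrightarrow> cnj z * lim_app p \<phi> x"
        unfolding app_sc_left[OF po that] by (intro tendsto_mult_left lim_app_tendsto(1)[OF p \<phi>] that)
    qed
    show "cmod (lim_app p \<phi> x) \<le> C * lim_norm p * sqrt (nsq x)" if x: "x \<in> L" for x
    proof -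
      have "cmod (lim_app p \<phi> x) \<le> cmod (lim_app p \<phi> x - app (p 0) \<phi> x) + cmod (app (p 0) \<phi> x)"
        by (metis diff_add_cancel norm_triangle_ineq)
      also have "\<dots> \<le> C * sqrt (nsq x) * sqrt (4 / real (Suc 0)) + C * sqrt (nsq x) * sqrt (hs (p 0) (p 0))"
        by (intro add_mono lim_app_tendsto(2)[OF p \<phi> x] app_bound[OF po \<phi> x])
      finally show ?thesis by (simp add: lim_norm_def algebra_simps)
    qed
  qed
qed

lemma lim_app_functional_add:
  assumes p: "minseq p" and \<phi>: "bounded_functional C \<phi>" and \<psi>: "bounded_functional D \<psi>" and g: "g \<in> L"
  shows "lim_app p (\<lambda>x. \<phi> x + \<psi> x) g = lim_app p \<phi> g + lim_app p \<psi> g"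
  unfolding lim_app_def app_functional_add
  by (intro limI tendsto_add lim_app_tendsto(1)[OF p \<phi> g, unfolded lim_app_def] lim_app_tendsto(1)[OF p \<psi> g, unfolded lim_app_def])

lemma lim_app_functional_scale:
  assumes p: "minseq p" and \<phi>: "bounded_functional C \<phi>" and g: "g \<in> L"
  shows "lim_app p (\<lambda>x. z * \<phi> x) g = z * lim_app p \<phi> g"
  unfolding lim_app_def app_functional_scale
  by (intro limI tendsto_mult_left lim_app_tendsto(1)[OF p \<phi> g, unfolded lim_app_def])

text \<open>Moving \<open>p n\<close>, the functional and the vector by \<open>A\<close> together
  changes nothing, and moving \<open>p n\<close> alone has an effect that tends to zero.\<close>

lemma lim_app_invariant:
  assumes p: "minseq p" and A: "isom A"
    and inv: "\<And>n. hs (diffp (p n) (mapv A (p n))) (diffp (p n) (mapv A (p n))) \<le> 4 / real (Suc n)"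
    and \<phi>: "bounded_functional C \<phi>" and \<psi>: "bounded_functional D \<psi>"
    and eq: "\<And>x. x \<in> L \<Longrightarrow> \<psi> (A x) = \<phi> x" and g: "g \<in> L"
  shows "lim_app p \<psi> (A g) = lim_app p \<phi> g"
proof -
  have po: "p n \<in> ops" for n using p unfolding minseq_def by blast
  have Ag: "A g \<in> L" by (rule isomD(1)[OF A g])
  have e: "app (mapv A (p n)) \<psi> (A g) = app (p n) \<phi> g" for n
    unfolding app_mapv[OF A po g] using app_cong[OF po, of "\<lambda>x. \<psi> (A x)" \<phi>] eq by blast
  have b: "norm (app (p n) \<psi> (A g) - app (p n) \<phi> g) \<le> D * sqrt (nsq (A g)) * sqrt (4 / real (Suc n))" for n
    using app_diff_bound[OF po ops_mapv[OF A po] inv \<psi> Ag, of n] e by simp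
  have "(\<lambda>n. app (p n) \<psi> (A g) - app (p n) \<phi> g) \<longlonglongrightarrow> 0"
    by (rule tendsto_0_le[OF sqrt_inverse_tendsto, where K = 1 and K1 = "D * sqrt (nsq (A g))"])
      (use b in \<open>auto intro!: always_eventually order_trans[OF b]\<close>)
  moreover have "(\<lambda>n. app (p n) \<psi> (A g) - app (p n) \<phi> g) \<longlonglongrightarrow> lim_app p \<psi> (A g) - lim_app p \<phi> g"
    by (intro tendsto_diff lim_app_tendsto(1)[OF p \<psi> Ag] lim_app_tendsto(1)[OF p \<phi> g])
  ultimately have "lim_app p \<psi> (A g) - lim_app p \<phi> g = 0" by (rule LIMSEQ_unique[symmetric])
  then show ?thesis by simp
qed

lemma nsq_orthonormal_sum:
  assumes "finite Y" "orthonormal Y"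
  shows "nsq (\<Sum>e\<in>Y. sc (z e) e) = (\<Sum>e\<in>Y. (cmod (z e))\<^sup>2)"
proof -
  have EL: "e \<in> L" if "e \<in> Y" for e using assms that unfolding orthonormal_def by blast
  define s where "s = (\<Sum>e\<in>Y. sc (z e) e)"
  have s: "s \<in> L" unfolding s_def by (intro sum_mem sc_mem EL)
  have gs: "ip g s = (\<Sum>e\<in>Y. z e * ip g e)" if "g \<in> L" for g
    unfolding s_def using that EL by (subst ip_sum_right) (auto intro!: sc_mem sum.cong simp: ip_sc_right)
  have es: "ip e s = z e" if e: "e \<in> Y" for e
  proof -
    have "(\<Sum>f\<in>Y. z f * ip e f) = (\<Sum>f\<in>Y. if f = e then z e else 0)"
      using assms e unfolding orthonormal_def by (intro sum.cong) auto
    then show ?thesis using e assms(1) by (simp add: gs EL)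
  qed
  have "ip s s = (\<Sum>e\<in>Y. z e * ip s e)" using s by (rule gs)
  also have "\<dots> = (\<Sum>e\<in>Y. complex_of_real ((cmod (z e))\<^sup>2))"
    unfolding complex_norm_square using es ip_cnj[OF EL s] by (intro sum.cong) auto
  finally show ?thesis unfolding s_def[symmetric] by (simp add: nsq_def)
qed

lemma functional_on_orthonormal_sum:
  assumes "orthonormal Y" "bounded_functional C \<phi>"
  shows "\<phi> (\<Sum>e\<in>Y. sc (z e) e) = (\<Sum>e\<in>Y. cnj (z e) * \<phi> e)"
proof -
  have EL: "e \<in> L" if "e \<in> Y" for e using assms that unfolding orthonormal_def by blast
  have "\<phi> (\<Sum>e\<in>Y. sc (z e) e) = (\<Sum>e\<in>Y. \<phi> (sc (z e) e))"
    by (rule bounded_functional_sum[OF assms(2)]) (intro sc_mem EL)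
  then show ?thesis using assms(2) EL unfolding bounded_functional_def by (simp cong: sum.cong)
qed

text \<open>By antilinearity the value of \<phi> at the vector with coefficients
  \<open>\<phi> e\<close> is exactly the sum \<open>T\<close> in question, and boundedness of \<phi>
  there reads \<open>T \<le> C * sqrt T\<close>.\<close>

lemma functional_bessel:
  assumes "finite Y" "orthonormal Y" "bounded_functional C \<phi>"
  shows "(\<Sum>e\<in>Y. (cmod (\<phi> e))\<^sup>2) \<le> C\<^sup>2"
proof -
  define T where "T = (\<Sum>e\<in>Y. (cmod (\<phi> e))\<^sup>2)"
  define s where "s = (\<Sum>e\<in>Y. sc (\<phi> e) e)"
  have T0: "0 \<le> T" unfolding T_def by (intro sum_nonneg) auto
  have s: "s \<in> L" using assms(2) unfolding s_def orthonormal_def by (intro sum_mem sc_mem) auto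
  have "\<phi> s = complex_of_real T"
    unfolding s_def functional_on_orthonormal_sum[OF assms(2,3)] T_def of_real_sum complex_norm_square
    by (simp add: mult.commute)
  then have "T = cmod (\<phi> s)" using T0 by simp
  also have "\<dots> \<le> C * sqrt (nsq s)" using assms(3) s unfolding bounded_functional_def by blast
  also have "nsq s = T" unfolding s_def T_def by (rule nsq_orthonormal_sum[OF assms(1,2)])
  finally have "T \<le> C * sqrt T" .
  then have "sqrt T * sqrt T \<le> C * sqrt T" using T0 by simp
  then have "sqrt T \<le> C \<or> T = 0"
    using T0 mult_right_le_imp_le[of "sqrt T" "sqrt T" C] by force
  then have "sqrt T \<le> C" using assms(3) unfolding bounded_functional_def by auto
  then have "(sqrt T)\<^sup>2 \<le> C\<^sup>2" using T0 by (intro power_mono) auto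
  then show ?thesis using T0 by (simp add: T_def)
qed

lemma nsq_null_cong:
  assumes "g \<in> L" "y \<in> L" "a \<in> L" "nsq (g - y) = 0"
  shows "nsq (a - g) = nsq (a - y)" "ip a g = ip a y"
proof -
  have eq: "ip b g = ip b y" if "b \<in> L" for b
    using null_orthogonal[OF that diff_mem[OF assms(1,2)] assms(4)] ip_diff_right[OF that assms(1,2)] by simp
  then show "ip a g = ip a y" using assms by blast
  have "ip g g = ip g y" using eq assms by blast
  also have "\<dots> = cnj (ip y g)" by (rule ip_cnj[OF assms(2,1)])
  also have "\<dots> = ip y y" using eq[OF assms(2)] ip_cnj[OF assms(2,2)] by simp
  finally have "nsq g = nsq y" by (simp add: nsq_def)
  then show "nsq (a - g) = nsq (a - y)" using eq[OF assms(3)] nsq_diff assms by simp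
qed

end

section \<open>Complete spaces and total orthonormal sets\<close>

text \<open>Completeness is required along geometrically fast sequences, the form in which almost
  everywhere convergence can be proved without passing to a subsequence. Limits are unique only up
  to null vectors.\<close>

locale complete_sip_space = sip_space L sc ip
  for L :: "'x::ab_group_add set" and sc :: "complex \<Rightarrow> 'x \<Rightarrow> 'x" and ip :: "'x \<Rightarrow> 'x \<Rightarrow> complex" +
  assumes complete: "(\<And>n::nat. x n \<in> L) \<Longrightarrow> (\<And>m n. m \<le> n \<Longrightarrow> nsq (x n - x m) \<le> 1 / 4 ^ m) \<Longrightarrow>
    \<exists>y\<in>L. (\<lambda>n. nsq (x n - y)) \<longlonglongrightarrow> 0"
begin

definition total :: "'x set \<Rightarrow> bool" where
  "total E \<longleftrightarrow> (\<forall>x\<in>L. (\<forall>e\<in>E. ip e x = 0) \<longrightarrow> nsq x = 0)"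

lemma orthonormal_subset: "orthonormal E \<Longrightarrow> Y \<subseteq> E \<Longrightarrow> orthonormal Y"
  unfolding orthonormal_def by blast

text \<open>\<open>E\<close> may be uncountable, so the partial sums run along finite sets whose
  coefficient sums approach the supremum. They converge by completeness, and \<open>g\<close> minus
  the limit is orthogonal to \<open>E\<close>, hence null by totality.\<close>

lemma total_approx:
  assumes E: "orthonormal E" "total E" and g: "g \<in> L" and \<epsilon>: "\<epsilon> > 0"
  shows "\<exists>Y. finite Y \<and> Y \<subseteq> E \<and> nsq (g - (\<Sum>e\<in>Y. sc (ip e g) e)) < \<epsilon>"
proof -
  define c where "c e = (cmod (ip e g))\<^sup>2" for e
  define X where "X = sum c ` {Y. finite Y \<and> Y \<subseteq> E}"
  define s where "s = Sup X"
  have EL: "e \<in> L" if "e \<in> E" for e using E(1) that unfolding orthonormal_def by blast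
  have bound: "sum c Y \<le> nsq g" if "finite Y" "Y \<subseteq> E" for Y
    unfolding c_def by (rule bessel[OF that(1) orthonormal_subset[OF E(1) that(2)] g])
  have bdd: "bdd_above X" unfolding X_def using bound by (intro bdd_aboveI2[of _ _ "nsq g"]) auto
  have les: "sum c Y \<le> s" if "finite Y" "Y \<subseteq> E" for Y
    unfolding s_def by (rule cSup_upper[OF _ bdd]) (use that X_def in blast)
  have "\<exists>Y. finite Y \<and> Y \<subseteq> E \<and> s - 1 / 4 ^ n < sum c Y" for n :: nat
  proof -
    have "X \<noteq> {}" unfolding X_def by blast
    moreover have "s - 1 / 4 ^ n < Sup X" by (simp add: s_def)
    ultimately obtain x where "x \<in> X" "s - 1 / 4 ^ n < x" using less_cSupD by blast
    then show ?thesis unfolding X_def by blast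
  qed
  then obtain Z where Z: "\<And>n::nat. finite (Z n)" "\<And>n. Z n \<subseteq> E" "\<And>n. s - 1 / 4 ^ n < sum c (Z n)" by metis
  \<comment> \<open>Unions make the finite sets increasing, so that differences of partial sums are
    sums over \<open>Y n - Y m\<close>.\<close>
  define Y where "Y n = (\<Union>k\<le>n. Z k)" for n
  have Y: "finite (Y n)" "Y n \<subseteq> E" for n using Z unfolding Y_def by auto
  have Ymono: "m \<le> n \<Longrightarrow> Y m \<subseteq> Y n" for m n unfolding Y_def by fastforce
  have Ysum: "s - 1 / 4 ^ n < sum c (Y n)" for n
  proof -
    have "sum c (Z n) \<le> sum c (Y n)"
      by (rule sum_mono2[OF Y(1)]) (auto simp: Y_def c_def)
    then show ?thesis using Z(3)[of n] by linarith
  qed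
  define x where "x n = (\<Sum>e\<in>Y n. sc (ip e g) e)" for n
  note R = orthonormal_residual[OF Y(1) orthonormal_subset[OF E(1) Y(2)] g, folded x_def]
  have xL: "x n \<in> L" for n by (rule R(1))
  have tail: "nsq (x n - x m) \<le> 1 / 4 ^ m" if "m \<le> n" for m n
  proof -
    have "x n - x m = (\<Sum>e\<in>Y n - Y m. sc (ip e g) e)"
      using sum.subset_diff[OF Ymono[OF that] Y(1), of "\<lambda>e. sc (ip e g) e"] by (simp add: x_def)
    moreover have "orthonormal (Y n - Y m)" by (rule orthonormal_subset[OF E(1)]) (use Y in blast)
    ultimately have "nsq (x n - x m) = sum c (Y n - Y m)"
      using nsq_orthonormal_sum[of "Y n - Y m" "\<lambda>e. ip e g"] Y(1)[of n] by (simp add: c_def)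
    also have "\<dots> = sum c (Y n) - sum c (Y m)" by (rule sum_diff[OF Y(1) Ymono[OF that]])
    also have "\<dots> \<le> 1 / 4 ^ m" using les[OF Y, of n] Ysum[of m] by linarith
    finally show ?thesis .
  qed
  obtain y where y: "y \<in> L" "(\<lambda>n. nsq (x n - y)) \<longlonglongrightarrow> 0"
    using complete[of x, OF xL tail] by blast
  have "ip b (g - y) = 0" if b: "b \<in> E" for b
  proof -
    \<comment> \<open>The squared coefficient at an element outside \<open>Y n\<close> fits into the
      gap between \<open>sum c (Y n)\<close> and the supremum.\<close>
    have gx: "(cmod (ip b (g - x n)))\<^sup>2 \<le> 1 / 4 ^ n" for n
    proof (cases "b \<in> Y n")
      case True
      then show ?thesis using R(2) by simp
    next
      case False
      have "ip b e = 0" if "e \<in> Y n" for e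
        using E(1) b that Y(2)[of n] False unfolding orthonormal_def by (metis subsetD)
      then have "ip b (x n) = 0" using R(4)[OF EL[OF b], of n] by simp
      then have "(cmod (ip b (g - x n)))\<^sup>2 = c b" by (simp add: c_def ip_diff_right EL b g xL)
      also have "c b = sum c (insert b (Y n)) - sum c (Y n)" using False Y(1) by simp
      also have "\<dots> \<le> 1 / 4 ^ n" using les[of "insert b (Y n)"] Y b Ysum[of n] by (simp add: False)
      finally show ?thesis .
    qed
    have nb: "nsq b = 1" using E(1) b unfolding orthonormal_def nsq_def by simp
    have xy: "(cmod (ip b (x n - y)))\<^sup>2 \<le> nsq (x n - y)" for n
      using cauchy_schwarz[OF EL[OF b] diff_mem[OF xL y(1)]] nb by simp
    have "cmod (ip b (g - y)) \<le> sqrt (1 / 4 ^ n) + sqrt (nsq (x n - y))" for n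
    proof -
      have "ip b (g - y) = ip b (g - x n) + ip b (x n - y)"
        by (simp add: ip_diff_right EL b g y xL)
      then have "cmod (ip b (g - y)) \<le> cmod (ip b (g - x n)) + cmod (ip b (x n - y))"
        by (metis norm_triangle_ineq)
      also have "\<dots> \<le> sqrt (1 / 4 ^ n) + sqrt (nsq (x n - y))"
        using gx[of n] xy[of n] by (intro add_mono real_le_rsqrt)
      finally show ?thesis .
    qed
    moreover have "(\<lambda>n. sqrt (1 / 4 ^ n) + sqrt (nsq (x n - y))) \<longlonglongrightarrow> sqrt 0 + sqrt 0"
    proof (intro tendsto_add tendsto_real_sqrt y(2))
      show "(\<lambda>n. 1 / 4 ^ n :: real) \<longlonglongrightarrow> 0"
        using LIMSEQ_realpow_zero[of "1/4::real"] by (simp add: power_divide)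
    qed
    ultimately have "cmod (ip b (g - y)) \<le> sqrt 0 + sqrt 0"
      by (intro LIMSEQ_le_const) auto
    then show ?thesis by simp
  qed
  then have null: "nsq (g - y) = 0" using E(2) diff_mem[OF g y(1)] unfolding total_def by blast
  have "\<forall>\<^sub>F n in sequentially. nsq (x n - y) < \<epsilon>" using order_tendstoD(2)[OF y(2) \<epsilon>] .
  then obtain n where "nsq (x n - y) < \<epsilon>" unfolding eventually_sequentially by blast
  then have "nsq (x n - g) < \<epsilon>" using nsq_null_cong(1)[OF g y(1) xL null] by simp
  moreover have "nsq (g - x n) = nsq (x n - g)"
    using nsq_diff[OF g xL] nsq_diff[OF xL g] ip_cnj[OF g xL, of n] by simp
  ultimately have "nsq (g - x n) < \<epsilon>" by simp
  then show ?thesis using Y[of n] by (intro exI[of _ "Y n"]) (simp add: x_def)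
qed

text \<open>The constant \<open>C\<close> serves to pass from finite sums to \<open>g\<close>, but
  the resulting bound depends only on the values on \<open>E\<close>. This sharpens the bound to the
  Fock norm in \<open>fock_functional\<close>.\<close>

lemma functional_total_bound:
  assumes E: "orthonormal E" "total E" and \<phi>: "bounded_functional C \<phi>"
    and S: "\<And>Y. finite Y \<Longrightarrow> Y \<subseteq> E \<Longrightarrow> (\<Sum>e\<in>Y. (cmod (\<phi> e))\<^sup>2) \<le> S" and g: "g \<in> L"
  shows "cmod (\<phi> g) \<le> sqrt S * sqrt (nsq g)"
proof (rule field_le_epsilon)
  fix \<delta> :: real assume \<delta>: "\<delta> > 0"
  have C: "0 \<le> C" using \<phi> unfolding bounded_functional_def by blast
  \<comment> \<open>Makes \<open>C * sqrt \<epsilon>\<close> at most \<delta>, also for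
    \<open>C = 0\<close>.\<close>
  define \<epsilon> where "\<epsilon> = (\<delta> / (C + 1))\<^sup>2"
  have \<epsilon>: "\<epsilon> > 0" using \<delta> C by (simp add: \<epsilon>_def)
  obtain Y where Y: "finite Y" "Y \<subseteq> E" "nsq (g - (\<Sum>e\<in>Y. sc (ip e g) e)) < \<epsilon>"
    using total_approx[OF E g \<epsilon>] by blast
  note oY = orthonormal_subset[OF E(1) Y(2)]
  define s where "s = (\<Sum>e\<in>Y. sc (ip e g) e)"
  note R = orthonormal_residual[OF Y(1) oY g, folded s_def]
  have "\<phi> ((g - s) + s) = \<phi> (g - s) + \<phi> s"
    using \<phi> R(1) diff_mem[OF g R(1)] unfolding bounded_functional_def by blast
  then have "cmod (\<phi> g) \<le> cmod (\<phi> (g - s)) + cmod (\<phi> s)" by (simp add: norm_triangle_ineq)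
  also have "cmod (\<phi> (g - s)) \<le> \<delta>"
  proof -
    have "cmod (\<phi> (g - s)) \<le> C * sqrt (nsq (g - s))"
      using \<phi> diff_mem[OF g R(1)] unfolding bounded_functional_def by blast
    also have "\<dots> \<le> C * sqrt \<epsilon>" using Y(3) C by (intro mult_left_mono real_sqrt_le_mono) (auto simp: s_def)
    also have "\<dots> = C * (\<delta> / (C + 1))" using \<delta> C by (simp add: \<epsilon>_def)
    also have "\<dots> \<le> \<delta>" using \<delta> C by (simp add: divide_le_eq)
    finally show ?thesis .
  qed
  also have "cmod (\<phi> s) \<le> sqrt S * sqrt (nsq g)"
  proof -
    have "cmod (\<phi> s) = cmod (\<Sum>e\<in>Y. cnj (ip e g) * \<phi> e)"
      unfolding s_def functional_on_orthonormal_sum[OF oY \<phi>] ..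
    also have "\<dots> \<le> (\<Sum>e\<in>Y. cmod (\<phi> e) * cmod (ip e g))"
      by (rule order_trans[OF norm_sum]) (simp add: norm_mult mult.commute)
    finally have "(cmod (\<phi> s))\<^sup>2 \<le> (\<Sum>e\<in>Y. cmod (\<phi> e) * cmod (ip e g))\<^sup>2"
      by (intro power_mono) auto
    also have "\<dots> \<le> (\<Sum>e\<in>Y. (cmod (\<phi> e))\<^sup>2) * (\<Sum>e\<in>Y. (cmod (ip e g))\<^sup>2)"
      by (rule Cauchy_Schwarz_ineq_sum)
    also have "\<dots> \<le> S * nsq g"
      using S[OF Y(1,2)] S[of "{}"] by (intro mult_mono bessel[OF Y(1) oY g] sum_nonneg) auto
    finally show ?thesis by (simp add: real_le_rsqrt flip: real_sqrt_mult)
  qed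
  finally show "cmod (\<phi> g) \<le> sqrt S * sqrt (nsq g) + \<delta>" by simp
qed

end

section \<open>Hilbert spaces as quotients, and their Fock spaces\<close>

text \<open>\<open>Q\<close> is the quotient map identifying vectors at distance zero. Computations
  take place in \<open>L\<close> and are transported to \<open>H\<close> through it.\<close>

locale sip_hspace = complete_sip_space L sc ip
  for L :: "'x::ab_group_add set" and sc :: "complex \<Rightarrow> 'x \<Rightarrow> 'x" and ip :: "'x \<Rightarrow> 'x \<Rightarrow> complex" +
  fixes H :: "'v hspace" and Q :: "'x \<Rightarrow> 'v"
  assumes hcarrier_Q: "hcarrier H = Q ` L"
    and hadd_Q: "x \<in> L \<Longrightarrow> y \<in> L \<Longrightarrow> hadd H (Q x) (Q y) = Q (x + y)"
    and hscale_Q: "x \<in> L \<Longrightarrow> hscale H z (Q x) = Q (sc z x)"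
    and hinner_Q: "x \<in> L \<Longrightarrow> y \<in> L \<Longrightarrow> hinner H (Q x) (Q y) = ip x y"
    and hzero_Q: "hzero H = Q 0"
    and Q_eq_iff: "x \<in> L \<Longrightarrow> y \<in> L \<Longrightarrow> Q x = Q y \<longleftrightarrow> nsq (x - y) = 0"
begin

definition rep :: "'v \<Rightarrow> 'x" where "rep v = (SOME x. x \<in> L \<and> Q x = v)"

lemma rep: "v \<in> hcarrier H \<Longrightarrow> rep v \<in> L" "v \<in> hcarrier H \<Longrightarrow> Q (rep v) = v"
proof -
  have "\<exists>x. x \<in> L \<and> Q x = v" if "v \<in> hcarrier H" for v using that unfolding hcarrier_Q by blast
  then show "v \<in> hcarrier H \<Longrightarrow> rep v \<in> L" "v \<in> hcarrier H \<Longrightarrow> Q (rep v) = v"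
    unfolding rep_def by (metis (mono_tags, lifting) someI_ex)+
qed

lemma Q_mem: "x \<in> L \<Longrightarrow> Q x \<in> hcarrier H"
  unfolding hcarrier_Q by blast

lemma hnorm_Q: "x \<in> L \<Longrightarrow> hnorm H (Q x) = sqrt (nsq x)"
  unfolding hnorm_def nsq_def by (simp add: hinner_Q)

lemma functional_null:
  assumes "bounded_functional C \<phi>" "x \<in> L" "y \<in> L" "nsq (x - y) = 0"
  shows "\<phi> x = \<phi> y"
proof -
  have "cmod (\<phi> (x - y)) \<le> C * sqrt (nsq (x - y))"
    using assms(1) diff_mem[OF assms(2,3)] unfolding bounded_functional_def by blast
  then have 0: "\<phi> (x - y) = 0" using assms(4) by simp
  have "\<phi> ((x - y) + y) = \<phi> (x - y) + \<phi> y"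
    using assms(1,3) diff_mem[OF assms(2,3)] unfolding bounded_functional_def by blast
  then show ?thesis using 0 by simp
qed

lemma functional_rep: "bounded_functional C \<phi> \<Longrightarrow> x \<in> L \<Longrightarrow> \<phi> (rep (Q x)) = \<phi> x"
  using rep[OF Q_mem, of x] Q_eq_iff[of "rep (Q x)" x] functional_null[of C \<phi> "rep (Q x)" x] by blast

text \<open>The choice \<open>some_basis\<close> becomes meaningful through this Zorn argument: a
  nonzero vector orthogonal to a maximal orthonormal set could be normalized and added to
  it.\<close>

lemma basis_exists: "\<exists>X. is_orthonormal_basis H X"
proof -
  define \<S> where "\<S> = {X. X \<subseteq> hcarrier H \<and> (\<forall>x\<in>X. \<forall>y\<in>X. hinner H x y = (if x = y then 1 else 0))}"
  have "\<exists>M\<in>\<S>. \<forall>X\<in>\<S>. M \<subseteq> X \<longrightarrow> X = M"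
  proof (rule subset_Zorn_nonempty)
    show "\<S> \<noteq> {}" unfolding \<S>_def by blast
    fix \<C> assume C: "\<C> \<noteq> {}" "subset.chain \<S> \<C>"
    then have S: "\<C> \<subseteq> \<S>" and lin: "\<And>X Y. X \<in> \<C> \<Longrightarrow> Y \<in> \<C> \<Longrightarrow> X \<subseteq> Y \<or> Y \<subseteq> X"
      unfolding subset.chain_def by auto
    have "hinner H x y = (if x = y then 1 else 0)" if xy: "x \<in> \<Union>\<C>" "y \<in> \<Union>\<C>" for x y
    proof -
      obtain X Y where "X \<in> \<C>" "x \<in> X" "Y \<in> \<C>" "y \<in> Y" using xy by blast
      then obtain Z where "Z \<in> \<C>" "x \<in> Z" "y \<in> Z" using lin by blast
      then show ?thesis using S unfolding \<S>_def by blast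
    qed
    moreover have "\<Union>\<C> \<subseteq> hcarrier H" using S unfolding \<S>_def by blast
    ultimately show "\<Union>\<C> \<in> \<S>" unfolding \<S>_def by blast
  qed
  then obtain M where M: "M \<in> \<S>" "\<And>X. X \<in> \<S> \<Longrightarrow> M \<subseteq> X \<Longrightarrow> X = M" by blast
  have MH: "M \<subseteq> hcarrier H" and on: "\<And>x y. x \<in> M \<Longrightarrow> y \<in> M \<Longrightarrow> hinner H x y = (if x = y then 1 else 0)"
    using M(1) unfolding \<S>_def by blast+
  have "x = hzero H" if x: "x \<in> hcarrier H" and orth: "\<And>b. b \<in> M \<Longrightarrow> hinner H b x = 0" for x
  proof (rule ccontr)
    assume nz: "x \<noteq> hzero H"
    define y where "y = rep x"
    have y: "y \<in> L" "x = Q y" using rep[OF x] by (simp_all add: y_def)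
    have "nsq (y - 0) \<noteq> 0" using nz y Q_eq_iff[OF y(1) zero_mem] hzero_Q by simp
    then have ny: "nsq y > 0" using nsq_nonneg[OF y(1)] by simp
    define k where "k = complex_of_real (1 / sqrt (nsq y))"
    define e where "e = sc k y"
    have e: "e \<in> L" unfolding e_def by (rule sc_mem[OF y(1)])
    have "ip e e = k * (cnj k * ip y y)" unfolding e_def by (simp add: ip_sc_left ip_sc_right y sc_mem)
    also have "\<dots> = complex_of_real ((1 / sqrt (nsq y)) * ((1 / sqrt (nsq y)) * nsq y))"
      by (simp only: k_def ip_self[OF y(1)] complex_cnj_complex_of_real of_real_mult)
    also have "(1 / sqrt (nsq y)) * ((1 / sqrt (nsq y)) * nsq y) = 1" using ny by simp
    finally have ee: "hinner H (Q e) (Q e) = 1" by (simp add: hinner_Q e)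
    have eM: "hinner H b (Q e) = 0" "hinner H (Q e) b = 0" if b: "b \<in> M" for b
    proof -
      have bH: "b \<in> hcarrier H" using MH b by blast
      have "ip (rep b) y = 0" using orth[OF b] rep[OF bH] hinner_Q[of "rep b" y] y by simp
      then have *: "ip (rep b) e = 0" unfolding e_def by (simp add: ip_sc_right rep[OF bH] y)
      then show "hinner H b (Q e) = 0" using hinner_Q[of "rep b" e] rep[OF bH] e by simp
      show "hinner H (Q e) b = 0"
        using hinner_Q[of e "rep b"] rep[OF bH] e * ip_cnj[of "rep b" e] by simp
    qed
    then have nin: "Q e \<notin> M" using ee by fastforce
    have "insert (Q e) M \<in> \<S>"
      unfolding \<S>_def using MH on eM ee nin Q_mem[OF e] by auto
    then show False using M(2) nin by blast
  qed
  then have "is_orthonormal_basis H M" unfolding is_orthonormal_basis_def using MH on by auto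
  then show ?thesis by (rule exI)
qed

definition onb :: "'x set" where "onb = rep ` some_basis H"

lemma some_basis: "is_orthonormal_basis H (some_basis H)"
  unfolding some_basis_def by (rule someI_ex[OF basis_exists])

lemma some_basis_subset: "some_basis H \<subseteq> hcarrier H"
  using some_basis unfolding is_orthonormal_basis_def by blast

lemma onb_orthonormal: "orthonormal onb"
proof -
  have "ip (rep b) (rep b') = (if rep b = rep b' then 1 else 0)"
    if b: "b \<in> some_basis H" "b' \<in> some_basis H" for b b'
  proof -
    have bH: "b \<in> hcarrier H" "b' \<in> hcarrier H" using b some_basis_subset by auto
    have "ip (rep b) (rep b') = hinner H b b'"
      using hinner_Q[OF rep(1)[OF bH(1)] rep(1)[OF bH(2)]] rep(2)[OF bH(1)] rep(2)[OF bH(2)] by simp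
    also have "\<dots> = (if b = b' then 1 else 0)" using some_basis b unfolding is_orthonormal_basis_def by blast
    also have "b = b' \<longleftrightarrow> rep b = rep b'" using rep(2)[OF bH(1)] rep(2)[OF bH(2)] by metis
    finally show ?thesis .
  qed
  moreover have "onb \<subseteq> L" unfolding onb_def using rep(1) some_basis_subset by blast
  ultimately show ?thesis unfolding orthonormal_def onb_def by blast
qed

lemma onb_total: "total onb"
  unfolding total_def
proof (intro ballI impI)
  fix x assume x: "x \<in> L" and orth: "\<forall>e\<in>onb. ip e x = 0"
  have "hinner H b (Q x) = 0" if b: "b \<in> some_basis H" for b
  proof -
    have bH: "b \<in> hcarrier H" using b some_basis_subset by blast
    have "ip (rep b) x = 0" using orth b unfolding onb_def by blast
    then show ?thesis using hinner_Q[OF rep(1)[OF bH] x] rep(2)[OF bH] by simp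
  qed
  then have "Q x = hzero H" using some_basis Q_mem[OF x] unfolding is_orthonormal_basis_def by blast
  then show "nsq x = 0" using Q_eq_iff[OF x zero_mem] hzero_Q by simp
qed

lemma fockD:
  assumes "\<Phi> \<in> hcarrier (fock_space H)"
  shows "gs \<notin> lists (hcarrier H) \<Longrightarrow> \<Phi> gs = 0" "multi_antilinear H \<Phi>" "multi_bounded H \<Phi>"
    "(\<lambda>bs. (cmod (\<Phi> bs))\<^sup>2) summable_on lists (some_basis H)"
  using assms unfolding fock_space_def by simp_all

lemma fock_hnorm:
  assumes "\<Phi> \<in> hcarrier (fock_space H)"
  shows "hnorm (fock_space H) \<Phi> = sqrt (\<Sum>\<^sub>\<infinity>bs\<in>lists (some_basis H). (cmod (\<Phi> bs))\<^sup>2)"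
proof -
  have "((\<lambda>bs. (cmod (\<Phi> bs))\<^sup>2) has_sum (\<Sum>\<^sub>\<infinity>bs\<in>lists (some_basis H). (cmod (\<Phi> bs))\<^sup>2)) (lists (some_basis H))"
    using fockD(4)[OF assms] by (rule has_sum_infsum)
  from has_sum_of_real[OF this, where 'a = complex]
  have "((\<lambda>bs. cnj (\<Phi> bs) * \<Phi> bs) has_sum
      complex_of_real (\<Sum>\<^sub>\<infinity>bs\<in>lists (some_basis H). (cmod (\<Phi> bs))\<^sup>2)) (lists (some_basis H))"
    unfolding complex_norm_square by (simp add: mult.commute)
  from infsumI[OF this] show ?thesis unfolding hnorm_def by (simp add: fock_space_def)
qed

text \<open>Singleton tuples of basis vectors contribute at most the whole sum to the squared Fock
  norm, and by totality the values on the basis control the functional.\<close>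

lemma fock_functional:
  assumes \<Phi>: "\<Phi> \<in> hcarrier (fock_space H)"
  shows "bounded_functional (hnorm (fock_space H) \<Phi>) (\<lambda>x. \<Phi> [Q x])"
proof -
  define S where "S = (\<Sum>\<^sub>\<infinity>bs\<in>lists (some_basis H). (cmod (\<Phi> bs))\<^sup>2)"
  have add: "\<Phi> [Q (x + y)] = \<Phi> [Q x] + \<Phi> [Q y]" if "x \<in> L" "y \<in> L" for x y
    using fockD(2)[OF \<Phi>, unfolded multi_antilinear_def, rule_format, of "[]" "[]" "Q x"] Q_mem that
    by (simp add: hadd_Q[symmetric])
  have scale: "\<Phi> [Q (sc z x)] = cnj z * \<Phi> [Q x]" if "x \<in> L" for z x
    using fockD(2)[OF \<Phi>, unfolded multi_antilinear_def, rule_format, of "[]" "[]" "Q x"] Q_mem that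
    by (simp add: hscale_Q[symmetric])
  \<comment> \<open>This preliminary bound for tuples of length one is sharpened to the Fock norm
    below; \<open>max C 0\<close> guards against a negative constant.\<close>
  obtain C where C: "\<And>gs. gs \<in> lists (hcarrier H) \<Longrightarrow> length gs = 1 \<Longrightarrow> cmod (\<Phi> gs) \<le> C * prod_list (map (hnorm H) gs)"
    using fockD(3)[OF \<Phi>] unfolding multi_bounded_def by blast
  have bnd: "cmod (\<Phi> [Q x]) \<le> max C 0 * sqrt (nsq x)" if x: "x \<in> L" for x
  proof -
    have "cmod (\<Phi> [Q x]) \<le> C * sqrt (nsq x)" using C[of "[Q x]"] Q_mem[OF x] by (simp add: hnorm_Q x)
    also have "\<dots> \<le> max C 0 * sqrt (nsq x)" using nsq_nonneg[OF x] by (intro mult_right_mono) auto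
    finally show ?thesis .
  qed
  have b: "bounded_functional (max C 0) (\<lambda>x. \<Phi> [Q x])"
    unfolding bounded_functional_def using add scale bnd by simp
  have "(\<Sum>e\<in>Y. (cmod (\<Phi> [Q e]))\<^sup>2) \<le> S" if Y: "finite Y" "Y \<subseteq> onb" for Y
  proof -
    have inj: "inj_on (\<lambda>e. [Q e]) Y"
    proof (rule inj_onI)
      fix e e' assume e: "e \<in> Y" "e' \<in> Y" "[Q e] = [Q e']"
      then obtain b b' where b: "b \<in> some_basis H" "e = rep b" "b' \<in> some_basis H" "e' = rep b'"
        using Y(2) unfolding onb_def by blast
      then have "b \<in> hcarrier H" "b' \<in> hcarrier H" using some_basis_subset by auto
      then have "b = b'" using e(3) b(2,4) rep(2)[of b] rep(2)[of b'] by simp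
      then show "e = e'" using b by simp
    qed
    have sub: "(\<lambda>e. [Q e]) ` Y \<subseteq> lists (some_basis H)"
      using Y(2) rep(2) some_basis_subset unfolding onb_def by fastforce
    have "(\<Sum>e\<in>Y. (cmod (\<Phi> [Q e]))\<^sup>2) = (\<Sum>bs\<in>(\<lambda>e. [Q e]) ` Y. (cmod (\<Phi> bs))\<^sup>2)"
      by (simp add: sum.reindex[OF inj])
    also have "\<dots> \<le> S"
      unfolding S_def by (rule finite_sum_le_infsum[OF fockD(4)[OF \<Phi>]]) (use Y sub in auto)
    finally show ?thesis .
  qed
  then have "cmod (\<Phi> [Q x]) \<le> sqrt S * sqrt (nsq x)" if "x \<in> L" for x
    by (rule functional_total_bound[OF onb_orthonormal onb_total b _ that])
  moreover have "sqrt S = hnorm (fock_space H) \<Phi>" unfolding S_def fock_hnorm[OF \<Phi>] ..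
  moreover have "0 \<le> sqrt S" unfolding S_def by (intro real_sqrt_ge_zero infsum_nonneg) simp
  ultimately show ?thesis unfolding bounded_functional_def using add scale by simp
qed

definition one_particle :: "('x \<Rightarrow> complex) \<Rightarrow> 'v list \<Rightarrow> complex" where
  "one_particle \<psi> gs = (if gs \<in> lists (hcarrier H) \<and> length gs = 1 then \<psi> (rep (hd gs)) else 0)"

lemma one_particle_Q: "bounded_functional C \<psi> \<Longrightarrow> x \<in> L \<Longrightarrow> one_particle \<psi> [Q x] = \<psi> x"
  unfolding one_particle_def using Q_mem functional_rep by simp

text \<open>Singleton tuples alone contribute. They correspond injectively to elements of
  \<open>onb\<close>, so Bessel's inequality for functionals applies.\<close>

lemma one_particle_finite_sum:
  assumes \<psi>: "bounded_functional C \<psi>" and G: "finite G" "G \<subseteq> lists (some_basis H)"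
  shows "(\<Sum>gs\<in>G. (cmod (one_particle \<psi> gs))\<^sup>2) \<le> C\<^sup>2"
proof -
  define G1 where "G1 = {gs \<in> G. length gs = 1}"
  define Y where "Y = (\<lambda>gs. rep (hd gs)) ` G1"
  have sing: "\<exists>b\<in>some_basis H. gs = [b]" if "gs \<in> G1" for gs
  proof -
    obtain b where "gs = [b]" using \<open>gs \<in> G1\<close> unfolding G1_def by (auto simp: length_Suc_conv)
    then show ?thesis using that G(2) unfolding G1_def by auto
  qed
  have inj: "inj_on (\<lambda>gs. rep (hd gs)) G1"
  proof (rule inj_onI)
    fix gs gs' assume "gs \<in> G1" "gs' \<in> G1" and e: "rep (hd gs) = rep (hd gs')"
    then obtain b b' where b: "b \<in> some_basis H" "gs = [b]" "b' \<in> some_basis H" "gs' = [b']" using sing by metis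
    then have "Q (rep b) = Q (rep b')" using e by simp
    then show "gs = gs'" using b rep(2) some_basis_subset by (metis subsetD)
  qed
  have "(\<Sum>gs\<in>G. (cmod (one_particle \<psi> gs))\<^sup>2) = (\<Sum>gs\<in>G1. (cmod (one_particle \<psi> gs))\<^sup>2)"
    using G(1) by (intro sum.mono_neutral_right) (auto simp: G1_def one_particle_def)
  also have "\<dots> = (\<Sum>gs\<in>G1. (cmod (\<psi> (rep (hd gs))))\<^sup>2)"
  proof (rule sum.cong[OF refl])
    fix gs assume gs: "gs \<in> G1"
    then obtain b where "b \<in> some_basis H" "gs = [b]" using sing by blast
    then show "(cmod (one_particle \<psi> gs))\<^sup>2 = (cmod (\<psi> (rep (hd gs))))\<^sup>2"
      using some_basis_subset by (auto simp: one_particle_def)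
  qed
  also have "\<dots> = (\<Sum>e\<in>Y. (cmod (\<psi> e))\<^sup>2)" unfolding Y_def by (simp add: sum.reindex[OF inj])
  also have "\<dots> \<le> C\<^sup>2"
  proof (rule functional_bessel[OF _ _ \<psi>])
    show "finite Y" using G(1) unfolding Y_def G1_def by simp
    have "Y \<subseteq> onb" unfolding Y_def onb_def using sing by fastforce
    then show "orthonormal Y" by (rule orthonormal_subset[OF onb_orthonormal])
  qed
  finally show ?thesis .
qed

lemma one_particle_fock:
  assumes \<psi>: "bounded_functional C \<psi>"
  shows "one_particle \<psi> \<in> hcarrier (fock_space H)" "hnorm (fock_space H) (one_particle \<psi>) \<le> C"
proof -
  have C: "0 \<le> C" using \<psi> unfolding bounded_functional_def by blast
  have "multi_antilinear H (one_particle \<psi>)" unfolding multi_antilinear_def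
  proof (intro ballI conjI allI)
    fix xs ys f assume xy: "xs \<in> lists (hcarrier H)" "ys \<in> lists (hcarrier H)" and f: "f \<in> hcarrier H"
    obtain x where x: "x \<in> L" "f = Q x" using f unfolding hcarrier_Q by blast
    show "one_particle \<psi> (xs @ hscale H z f # ys) = cnj z * one_particle \<psi> (xs @ f # ys)" for z
    proof (cases "xs = [] \<and> ys = []")
      case True
      then show ?thesis using \<psi> x by (simp add: hscale_Q one_particle_Q[OF \<psi>] sc_mem bounded_functional_def)
    next
      case False
      then show ?thesis by (auto simp: one_particle_def)
    qed
    fix g assume "g \<in> hcarrier H"
    then obtain y where y: "y \<in> L" "g = Q y" unfolding hcarrier_Q by blast
    show "one_particle \<psi> (xs @ hadd H f g # ys) = one_particle \<psi> (xs @ f # ys) + one_particle \<psi> (xs @ g # ys)"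
    proof (cases "xs = [] \<and> ys = []")
      case True
      then show ?thesis using \<psi> x y by (simp add: hadd_Q one_particle_Q[OF \<psi>] add_mem bounded_functional_def)
    next
      case False
      then show ?thesis by (auto simp: one_particle_def)
    qed
  qed
  moreover have "multi_bounded H (one_particle \<psi>)" unfolding multi_bounded_def
  proof (intro allI)
    fix m :: nat
    show "\<exists>C. \<forall>gs\<in>lists (hcarrier H). length gs = m \<longrightarrow> cmod (one_particle \<psi> gs) \<le> C * prod_list (map (hnorm H) gs)"
    proof (cases "m = 1")
      case True
      have "cmod (one_particle \<psi> gs) \<le> C * prod_list (map (hnorm H) gs)"
        if gs: "gs \<in> lists (hcarrier H)" "length gs = 1" for gs
      proof -
        obtain v where "gs = [v]" using gs(2) by (auto simp: length_Suc_conv)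
        then obtain x where "x \<in> L" "gs = [Q x]" using gs(1) unfolding hcarrier_Q by auto
        then show ?thesis using \<psi> by (simp add: one_particle_Q[OF \<psi>] hnorm_Q bounded_functional_def)
      qed
      then show ?thesis using True by blast
    next
      case False
      then show ?thesis by (intro exI[of _ 0]) (auto simp: one_particle_def)
    qed
  qed
  \<comment> \<open>Exchanging two entries requires length at least two, where the form
    vanishes.\<close>
  moreover have "antisymmetric_form H (one_particle \<psi>)" unfolding antisymmetric_form_def
    by (auto simp: one_particle_def)
  moreover have "(\<lambda>bs. (cmod (one_particle \<psi> bs))\<^sup>2) summable_on lists (some_basis H)"
    by (rule nonneg_bdd_above_summable_on)
       (auto intro!: bdd_aboveI2[of _ _ "C\<^sup>2"] one_particle_finite_sum[OF \<psi>])
  ultimately show F: "one_particle \<psi> \<in> hcarrier (fock_space H)"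
    unfolding fock_space_def by (simp add: one_particle_def)
  have "(\<Sum>\<^sub>\<infinity>bs\<in>lists (some_basis H). (cmod (one_particle \<psi> bs))\<^sup>2) \<le> C\<^sup>2"
    by (rule infsum_le_finite_sums[OF fockD(4)[OF F]]) (rule one_particle_finite_sum[OF \<psi>])
  then show "hnorm (fock_space H) (one_particle \<psi>) \<le> C"
    unfolding fock_hnorm[OF F] using C real_sqrt_le_mono by fastforce
qed

text \<open>Compression to the one-particle space, followed by the limit operator and the embedding
  back into Fock space; \<Phi> enters through its values on singletons.\<close>

definition lim_op :: "(nat \<Rightarrow> (real \<times> 'x) list) \<Rightarrow> ('v list \<Rightarrow> complex) \<Rightarrow> 'v list \<Rightarrow> complex" where
  "lim_op p \<Phi> = one_particle (lim_app p (\<lambda>x. \<Phi> [Q x]))"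

lemma one_particle_cong: "(\<And>x. x \<in> L \<Longrightarrow> \<phi> x = \<psi> x) \<Longrightarrow> one_particle \<phi> = one_particle \<psi>"
proof (rule ext)
  fix gs assume e: "\<And>x. x \<in> L \<Longrightarrow> \<phi> x = \<psi> x"
  show "one_particle \<phi> gs = one_particle \<psi> gs"
  proof (cases "gs \<in> lists (hcarrier H) \<and> length gs = 1")
    case True
    then obtain v where "gs = [v]" "v \<in> hcarrier H" by (auto simp: length_Suc_conv)
    then show ?thesis using e rep(1) by (simp add: one_particle_def)
  qed (auto simp: one_particle_def)
qed

lemma lim_op_bounded:
  assumes p: "minseq p"
  shows "lim_op p \<in> bounded_ops (fock_space H)"
proof -
  note b = lim_app_bounded_functional[OF p fock_functional]
  have 1: "lim_op p (hadd (fock_space H) \<Phi> \<Psi>) = hadd (fock_space H) (lim_op p \<Phi>) (lim_op p \<Psi>)"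
    if "\<Phi> \<in> hcarrier (fock_space H)" "\<Psi> \<in> hcarrier (fock_space H)" for \<Phi> \<Psi>
  proof -
    have "lim_op p (hadd (fock_space H) \<Phi> \<Psi>) = one_particle (\<lambda>g. lim_app p (\<lambda>x. \<Phi> [Q x]) g + lim_app p (\<lambda>x. \<Psi> [Q x]) g)"
      unfolding lim_op_def
      using lim_app_functional_add[OF p fock_functional[OF that(1)] fock_functional[OF that(2)]]
      by (intro one_particle_cong) (simp add: fock_space_def)
    also have "\<dots> = hadd (fock_space H) (lim_op p \<Phi>) (lim_op p \<Psi>)"
      by (rule ext) (simp add: one_particle_def lim_op_def fock_space_def)
    finally show ?thesis .
  qed
  have 2: "lim_op p (hscale (fock_space H) z \<Phi>) = hscale (fock_space H) z (lim_op p \<Phi>)"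
    if "\<Phi> \<in> hcarrier (fock_space H)" for z \<Phi>
  proof -
    have "lim_op p (hscale (fock_space H) z \<Phi>) = one_particle (\<lambda>g. z * lim_app p (\<lambda>x. \<Phi> [Q x]) g)"
      unfolding lim_op_def using lim_app_functional_scale[OF p fock_functional[OF that]]
      by (intro one_particle_cong) (simp add: fock_space_def)
    also have "\<dots> = hscale (fock_space H) z (lim_op p \<Phi>)"
      by (rule ext) (simp add: one_particle_def lim_op_def fock_space_def)
    finally show ?thesis .
  qed
  have 3: "hnorm (fock_space H) (lim_op p \<Phi>) \<le> lim_norm p * hnorm (fock_space H) \<Phi>"
    if "\<Phi> \<in> hcarrier (fock_space H)" for \<Phi>
    using one_particle_fock(2)[OF b[OF that]] by (simp add: lim_op_def mult.commute)
  have 4: "lim_op p \<Phi> \<in> hcarrier (fock_space H)" if "\<Phi> \<in> hcarrier (fock_space H)" for \<Phi>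
    unfolding lim_op_def by (rule one_particle_fock(1)[OF b[OF that]])
  show ?thesis
    unfolding bounded_ops_def mem_Collect_eq by (intro conjI ballI allI exI[of _ "lim_norm p"] 1 2 3 4)
qed

definition implements :: "('v \<Rightarrow> 'v) \<Rightarrow> ('x \<Rightarrow> 'x) \<Rightarrow> bool" where
  "implements U A \<longleftrightarrow> (\<forall>x\<in>L. U (Q x) = Q (A x))"

definition lin_isom :: "('x \<Rightarrow> 'x) \<Rightarrow> bool" where
  "lin_isom A \<longleftrightarrow> isom A \<and> (\<forall>x\<in>L. \<forall>y\<in>L. A (x + y) = A x + A y) \<and> (\<forall>z. \<forall>x\<in>L. A (sc z x) = sc z (A x))"

text \<open>\<open>second_quant\<close> relies on \<open>inv_into\<close>, which picks some
  preimage. As \<open>A\<close> is isometric, two preimages differ by a null vector and represent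
  the same element.\<close>

lemma inv_into_implements:
  assumes "implements U A" "isom A" "x \<in> L"
  shows "inv_into (hcarrier H) U (Q (A x)) = Q x"
proof -
  have "Q (A x) \<in> U ` hcarrier H"
    using assms(1,3) Q_mem unfolding implements_def by (metis imageI)
  then have "inv_into (hcarrier H) U (Q (A x)) \<in> hcarrier H" "U (inv_into (hcarrier H) U (Q (A x))) = Q (A x)"
    by (auto intro: inv_into_into f_inv_into_f)
  then obtain y where y: "y \<in> L" "inv_into (hcarrier H) U (Q (A x)) = Q y" "Q (A y) = Q (A x)"
    using assms(1) unfolding implements_def hcarrier_Q by (smt (verit, best) imageE)
  then have "nsq (A y - A x) = 0" using Q_eq_iff isomD(1)[OF assms(2)] assms(3) by blast
  then have "nsq (y - x) = 0" using isomD(4)[OF assms(2) y(1) assms(3)] by simp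
  then show ?thesis using y(2) Q_eq_iff[OF y(1) assms(3)] by simp
qed

lemma second_quant_Q:
  assumes "implements U A" "isom A" "x \<in> L"
  shows "second_quant H U \<Phi> [Q (A x)] = \<Phi> [Q x]"
  using inv_into_implements[OF assms] Q_mem[OF isomD(1)[OF assms(2,3)]] by (simp add: second_quant_def)

lemma second_quant_functional:
  assumes U: "implements U A" "lin_isom A" and \<Phi>: "bounded_functional C (\<lambda>x. \<Phi> [Q x])"
  shows "bounded_functional C (\<lambda>x. second_quant H U \<Phi> [Q x])"
proof -
  have A: "isom A" using U(2) unfolding lin_isom_def by blast
  note S = second_quant_Q[OF U(1) A]
  show ?thesis unfolding bounded_functional_def
  proof (intro conjI ballI allI)
    show "0 \<le> C" using \<Phi> unfolding bounded_functional_def by blast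
    show "second_quant H U \<Phi> [Q (x + y)] = second_quant H U \<Phi> [Q x] + second_quant H U \<Phi> [Q y]"
      if xy: "x \<in> L" "y \<in> L" for x y
    proof -
      obtain x' y' where x': "x' \<in> L" "x = A x'" "y' \<in> L" "y = A y'"
        using isomD(2)[OF A xy(1)] isomD(2)[OF A xy(2)] by blast
      then have "x + y = A (x' + y')" using U(2) unfolding lin_isom_def by simp
      then show ?thesis using x' S[of x'] S[of y'] S[of "x' + y'"] add_mem \<Phi> unfolding bounded_functional_def by simp
    qed
    fix x assume "x \<in> L"
    then obtain x' where x': "x' \<in> L" "x = A x'" using isomD(2)[OF A] by blast
    show "second_quant H U \<Phi> [Q (sc z x)] = cnj z * second_quant H U \<Phi> [Q x]" for z
    proof -
      have "sc z x = A (sc z x')" using U(2) x' unfolding lin_isom_def by simp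
      then show ?thesis using x' S[of x'] S[of "sc z x'"] sc_mem \<Phi> unfolding bounded_functional_def by simp
    qed
    have "nsq x = nsq x'" using isomD(3)[OF A x'(1) x'(1)] x'(2) by (simp add: nsq_def)
    then show "cmod (second_quant H U \<Phi> [Q x]) \<le> C * sqrt (nsq x)"
      using S[OF x'(1)] x' \<Phi> unfolding bounded_functional_def by simp
  qed
qed

text \<open>Second quantization preserves the length of tuples, so both compositions vanish off
  singletons; on singletons they agree by \<open>lim_app_invariant\<close>.\<close>

lemma lim_op_commutant:
  assumes p: "minseq p"
    and impl: "\<And>U. U \<in> \<U> \<Longrightarrow> \<exists>A\<in>\<A>. implements U A" and \<A>: "\<And>A. A \<in> \<A> \<Longrightarrow> lin_isom A"
    and inv: "\<And>n A. A \<in> \<A> \<Longrightarrow> hs (diffp (p n) (mapv A (p n))) (diffp (p n) (mapv A (p n))) \<le> 4 / real (Suc n)"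
  shows "lim_op p \<in> commutant (fock_space H) (second_quant H ` \<U>)"
proof -
  have "lim_op p (second_quant H U \<Phi>) gs = second_quant H U (lim_op p \<Phi>) gs"
    if U: "U \<in> \<U>" and \<Phi>: "\<Phi> \<in> hcarrier (fock_space H)" for U \<Phi> gs
  proof -
    obtain A where A: "A \<in> \<A>" "implements U A" using impl[OF U] by blast
    have iA: "isom A" using \<A>[OF A(1)] unfolding lin_isom_def by blast
    note f = fock_functional[OF \<Phi>]
    note Sf = second_quant_functional[OF A(2) \<A>[OF A(1)] f]
    consider "gs \<notin> lists (hcarrier H)" | "gs \<in> lists (hcarrier H)" "length gs \<noteq> 1" | "gs \<in> lists (hcarrier H)" "length gs = 1"
      by blast
    then show ?thesis
    proof cases
      case 3
      then obtain v where "gs = [v]" "v \<in> hcarrier H" by (auto simp: length_Suc_conv)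
      then obtain x where x: "x \<in> L" "gs = [Q (A x)]" using isomD(2)[OF iA] unfolding hcarrier_Q by (metis imageE)
      have "lim_op p (second_quant H U \<Phi>) gs = lim_app p (\<lambda>x. second_quant H U \<Phi> [Q x]) (A x)"
        unfolding lim_op_def x(2) by (rule one_particle_Q[OF lim_app_bounded_functional[OF p Sf] isomD(1)[OF iA x(1)]])
      also have "\<dots> = lim_app p (\<lambda>x. \<Phi> [Q x]) x"
        by (rule lim_app_invariant[OF p iA inv[OF A(1)] f Sf second_quant_Q[OF A(2) iA] x(1)])
      also have "\<dots> = lim_op p \<Phi> [Q x]"
        unfolding lim_op_def by (rule one_particle_Q[OF lim_app_bounded_functional[OF p f] x(1), symmetric])
      also have "\<dots> = second_quant H U (lim_op p \<Phi>) gs"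
        unfolding x(2) by (rule second_quant_Q[OF A(2) iA x(1), symmetric])
      finally show ?thesis .
    qed (auto simp: lim_op_def one_particle_def second_quant_def)
  qed
  then show ?thesis unfolding commutant_def using lim_op_bounded[OF p] by (auto simp: fun_eq_iff)
qed

text \<open>If the group of the \<open>A \<in> \<A>\<close> were not weakly mixing, the minimizing sequence would yield a
  nonzero Hilbert--Schmidt form invariant under \<open>\<A>\<close>, hence an operator on the one-particle space
  commuting with \<open>\<U>\<close>.  By the bicommutant hypothesis it also commutes with the weakly mixing
  \<open>\<W>\<close>, which is impossible.\<close>

theorem weakly_mixing_if_bicommutant:
  assumes \<A>: "\<And>A. A \<in> \<A> \<Longrightarrow> lin_isom A" "\<And>A A'. A \<in> \<A> \<Longrightarrow> A' \<in> \<A> \<Longrightarrow> A \<circ> A' \<in> \<A>" "\<A> \<noteq> {}"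
    and \<U>: "\<And>U. U \<in> \<U> \<Longrightarrow> \<exists>A\<in>\<A>. implements U A" "\<And>A. A \<in> \<A> \<Longrightarrow> \<exists>U\<in>\<U>. implements U A"
    and \<B>: "\<And>A. A \<in> \<B> \<Longrightarrow> lin_isom A" "\<And>A. A \<in> \<B> \<Longrightarrow> \<exists>W\<in>\<W>. implements W A"
    and bic: "second_quant H ` \<W> \<subseteq> bicommutant (fock_space H) (second_quant H ` \<U>)"
    and mix: "\<And>F \<eta>. finite F \<Longrightarrow> F \<subseteq> L \<Longrightarrow> \<eta> > 0 \<Longrightarrow> \<exists>A\<in>\<B>. \<forall>f\<in>F. \<forall>g\<in>F. cmod (ip (A f) g) < \<eta>"
    and F: "finite F" "F \<subseteq> hcarrier H" and \<delta>: "\<delta> > 0"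
  shows "\<exists>U\<in>\<U>. \<forall>f\<in>F. \<forall>g\<in>F. cmod (hinner H (U f) g) < \<delta>"
proof (rule ccontr)
  assume contr: "\<not> ?thesis"
  have iA: "isom A" if "A \<in> \<A>" for A using \<A>(1)[OF that] unfolding lin_isom_def by blast
  obtain Fl where Fl: "set Fl = rep ` F" "distinct Fl" using finite_distinct_list[of "rep ` F"] F(1) by blast
  have FL: "set Fl \<subseteq> L" using F(2) rep(1) unfolding Fl by blast
  have sumFl: "(\<Sum>f\<leftarrow>Fl. G f) = (\<Sum>f\<in>set Fl. G f)" for G :: "'x \<Rightarrow> real"
    by (rule sum_list_distinct_conv_sum_set[OF Fl(2)])
  \<comment> \<open>If mixing fails, every \<open>A\<close> leaves one coefficient of modulus at
    least \<delta>, whose square is a single term of the double sum.\<close>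
  have low: "\<delta>\<^sup>2 \<le> (\<Sum>f\<leftarrow>Fl. \<Sum>f'\<leftarrow>Fl. (cmod (ip f (A f')))\<^sup>2)" if A: "A \<in> \<A>" for A
  proof -
    obtain U where U: "U \<in> \<U>" "implements U A" using \<U>(2)[OF A] by blast
    obtain f g where fg: "f \<in> F" "g \<in> F" "\<not> cmod (hinner H (U f) g) < \<delta>" using contr U(1) by blast
    have fH: "f \<in> hcarrier H" "g \<in> hcarrier H" using fg F by auto
    have AL: "A (rep f) \<in> L" by (rule isomD(1)[OF iA[OF A] rep(1)[OF fH(1)]])
    have "U f = Q (A (rep f))" using U(2) rep[OF fH(1)] unfolding implements_def by metis
    then have "hinner H (U f) g = ip (A (rep f)) (rep g)"
      using hinner_Q[OF AL rep(1)[OF fH(2)]] rep(2)[OF fH(2)] by simp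
    then have "\<delta> \<le> cmod (ip (rep g) (A (rep f)))"
      using fg(3) cmod_ip_commute[OF AL rep(1)[OF fH(2)]] by simp
    then have "\<delta>\<^sup>2 \<le> (cmod (ip (rep g) (A (rep f))))\<^sup>2" using \<delta> by (intro power_mono) auto
    also have "\<dots> \<le> (\<Sum>f'\<in>set Fl. (cmod (ip (rep g) (A f')))\<^sup>2)"
      by (rule member_le_sum) (use fg Fl F(1) in auto)
    also have "\<dots> \<le> (\<Sum>f\<in>set Fl. \<Sum>f'\<in>set Fl. (cmod (ip f (A f')))\<^sup>2)"
      by (rule member_le_sum[where f = "\<lambda>f. \<Sum>f'\<in>set Fl. (cmod (ip f (A f')))\<^sup>2"])
        (use fg Fl F(1) in \<open>auto intro!: sum_nonneg\<close>)
    finally show ?thesis by (simp only: sumFl)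
  qed
  obtain p where p: "\<And>n::nat. p n \<in> mhull \<A> Fl"
    "\<And>m n. m \<le> n \<Longrightarrow> hs (diffp (p n) (p m)) (diffp (p n) (p m)) \<le> 4 / real (Suc m)"
    "\<And>n A. A \<in> \<A> \<Longrightarrow> hs (diffp (p n) (mapv A (p n))) (diffp (p n) (mapv A (p n))) \<le> 4 / real (Suc n)"
    using minimizing_sequence[OF iA \<A>(2,3) FL] by blast
  have po: "p n \<in> ops" for n by (rule mhull_ops[OF p(1) iA FL])
  have ms: "minseq p" unfolding minseq_def using po p(2) by blast
  note comm = lim_op_commutant[OF ms \<U>(1) \<A>(1) p(3)]
  \<comment> \<open>By the bicommutant hypothesis the limit operator commutes with each
    \<open>second_quant H W\<close>. Evaluated at the one-particle vector of \<open>f\<close>, this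
    says that its diagonal coefficients at \<open>f\<close> and \<open>A f\<close> agree.\<close>
  have inv: "lim_app p (\<lambda>x. ip x (A f)) (A f) = lim_app p (\<lambda>x. ip x f) f" if A: "A \<in> \<B>" and f: "f \<in> L" for A f
  proof -
    obtain W where W: "W \<in> \<W>" "implements W A" using \<B>(2)[OF A] by blast
    have iB: "isom A" using \<B>(1)[OF A] unfolding lin_isom_def by blast
    note bf = bounded_functional_ip[OF f]
    define \<Phi> where "\<Phi> = one_particle (\<lambda>x. ip x f)"
    have \<Phi>: "\<Phi> \<in> hcarrier (fock_space H)" unfolding \<Phi>_def by (rule one_particle_fock(1)[OF bf])
    have \<Phi>Q: "\<Phi> [Q x] = ip x f" if "x \<in> L" for x unfolding \<Phi>_def by (rule one_particle_Q[OF bf that])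
    have Af: "A f \<in> L" by (rule isomD(1)[OF iB f])
    have SQ: "second_quant H W \<Phi> [Q y] = ip y (A f)" if y: "y \<in> L" for y
    proof -
      obtain x where x: "x \<in> L" "y = A x" using isomD(2)[OF iB y] by blast
      show ?thesis unfolding x(2) second_quant_Q[OF W(2) iB x(1)] \<Phi>Q[OF x(1)] isomD(3)[OF iB x(1) f] ..
    qed
    have "second_quant H W \<in> bicommutant (fock_space H) (second_quant H ` \<U>)" using bic W(1) by blast
    then have "second_quant H W (lim_op p \<Phi>) = lim_op p (second_quant H W \<Phi>)"
      unfolding bicommutant_def commutant_def[of _ "commutant _ _"] using comm \<Phi> by blast
    then have "second_quant H W (lim_op p \<Phi>) [Q (A f)] = lim_op p (second_quant H W \<Phi>) [Q (A f)]" by simp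
    moreover have "second_quant H W (lim_op p \<Phi>) [Q (A f)] = lim_app p (\<lambda>x. ip x f) f"
      unfolding second_quant_Q[OF W(2) iB f] lim_op_def
      using one_particle_Q[OF lim_app_bounded_functional[OF ms fock_functional[OF \<Phi>]] f]
        lim_app_cong[OF ms, of "\<lambda>x. \<Phi> [Q x]" "\<lambda>x. ip x f" f] \<Phi>Q by simp
    moreover have "lim_op p (second_quant H W \<Phi>) [Q (A f)] = lim_app p (\<lambda>x. ip x (A f)) (A f)"
      unfolding lim_op_def
      using one_particle_Q[OF lim_app_bounded_functional[OF ms second_quant_functional[OF W(2) \<B>(1)[OF A] fock_functional[OF \<Phi>]]] Af]
        lim_app_cong[OF ms, of "\<lambda>x. second_quant H W \<Phi> [Q x]" "\<lambda>x. ip x (A f)" "A f"] SQ by simp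
    ultimately show ?thesis by simp
  qed
  \<comment> \<open>The error budget: mixing will contribute at most
    \<open>\<delta>\<^sup>2 / 4\<close>, and replacing the limit by the finite rank \<open>q\<close>
    less than \<open>\<delta>\<^sup>2 / 2\<close>, together less than the lower bound
    \<open>\<delta>\<^sup>2\<close>.\<close>
  define N where "N = (\<Sum>f\<in>set Fl. nsq f)"
  have N: "0 \<le> N" unfolding N_def using FL nsq_nonneg by (intro sum_nonneg) auto
  have "\<forall>\<^sub>F n in sequentially. 2 * N * sqrt (4 / real (Suc n)) < \<delta>\<^sup>2 / 2"
    using order_tendstoD(2)[OF sqrt_inverse_tendsto] \<delta> by (metis half_gt_zero zero_less_power)
  then obtain n where n: "2 * N * sqrt (4 / real (Suc n)) < \<delta>\<^sup>2 / 2" unfolding eventually_sequentially by blast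
  define q where "q = p n"
  define r where "r = sqrt (4 / real (Suc n))"
  have err: "\<bar>Re (lim_app p (\<lambda>x. ip x f) f) - Re (app q (\<lambda>x. ip x f) f)\<bar> \<le> nsq f * r" if f: "f \<in> L" for f
  proof -
    have "\<bar>Re (lim_app p (\<lambda>x. ip x f) f - app q (\<lambda>x. ip x f) f)\<bar> \<le> sqrt (nsq f) * sqrt (nsq f) * r"
      unfolding q_def r_def by (rule order_trans[OF abs_Re_le_cmod lim_app_tendsto(2)[OF ms bounded_functional_ip[OF f] f]])
    then show ?thesis using nsq_nonneg[OF f] by simp
  qed
  define R where "R = (\<Sum>(s, x)\<leftarrow>q. \<bar>s\<bar>)"
  have R: "0 \<le> R" unfolding R_def by (intro sum_list_nonneg) auto
  define \<eta> where "\<eta> = sqrt (\<delta>\<^sup>2 / (4 * (R * card (set Fl) + 1)))"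
  have Rc: "0 < R * card (set Fl) + 1" using R by (simp add: add_nonneg_pos)
  have \<eta>: "\<eta> > 0" "\<eta>\<^sup>2 = \<delta>\<^sup>2 / (4 * (R * card (set Fl) + 1))"
    using \<delta> Rc by (simp_all add: \<eta>_def)
  have "finite (set Fl \<union> snd ` set q)" "set Fl \<union> snd ` set q \<subseteq> L" using FL po[of n] unfolding q_def by auto
  then obtain A where A: "A \<in> \<B>" "\<And>f g. f \<in> set Fl \<union> snd ` set q \<Longrightarrow> g \<in> set Fl \<union> snd ` set q \<Longrightarrow> cmod (ip (A f) g) < \<eta>"
    using mix[OF _ _ \<eta>(1)] by meson
  have iB: "isom A" using \<B>(1)[OF A(1)] unfolding lin_isom_def by blast
  \<comment> \<open>Only finitely many vectors occur in \<open>q\<close>, so mixing makes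
    \<open>A f\<close> nearly orthogonal to all of them.\<close>
  have small: "Re (app q (\<lambda>x. ip x (A f)) (A f)) \<le> R * \<eta>\<^sup>2" if f: "f \<in> set Fl" for f
  proof -
    have AfL: "A f \<in> L" using isomD(1)[OF iB] FL f by blast
    have "Re (app q (\<lambda>x. ip x (A f)) (A f)) \<le> cmod (app q (\<lambda>x. ip x (A f)) (A f))" by (rule complex_Re_le_cmod)
    also have "\<dots> \<le> (\<Sum>(s, x)\<leftarrow>q. cmod (complex_of_real s * ip (A f) x * ip x (A f)))"
    proof -
      have "cmod (\<Sum>z\<leftarrow>zs. G z) \<le> (\<Sum>z\<leftarrow>zs. cmod (G z))" for G :: "real \<times> 'x \<Rightarrow> complex" and zs
        by (induction zs) (auto intro: order_trans[OF norm_triangle_ineq])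
      then show ?thesis unfolding app_def case_prod_unfold .
    qed
    also have "\<dots> \<le> (\<Sum>(s, x)\<leftarrow>q. \<bar>s\<bar> * \<eta>\<^sup>2)"
    proof (unfold case_prod_unfold, rule sum_list_mono)
      fix z assume z: "z \<in> set q"
      then have xL: "snd z \<in> L" using po[of n] unfolding q_def by auto
      have "cmod (ip (A f) (snd z)) \<le> \<eta>" using A(2)[of f "snd z"] f z by (simp add: less_imp_le)
      then have "cmod (ip (A f) (snd z)) * cmod (ip (snd z) (A f)) \<le> \<eta> * \<eta>"
        using cmod_ip_commute[OF AfL xL] \<eta>(1) by (intro mult_mono) auto
      then show "cmod (complex_of_real (fst z) * ip (A f) (snd z) * ip (snd z) (A f)) \<le> \<bar>fst z\<bar> * \<eta>\<^sup>2"
        by (simp add: norm_mult mult.assoc power2_eq_square mult_left_mono)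
    qed
    also have "\<dots> = R * \<eta>\<^sup>2" unfolding R_def case_prod_unfold by (simp add: sum_list_mult_const)
    finally show ?thesis .
  qed
  have "\<delta>\<^sup>2 \<le> (\<Sum>f\<in>set Fl. Re (app q (\<lambda>x. ip x f) f))"
    using mhull_lower_bound[OF p(1) iA FL low, of n] unfolding q_def sumFl .
  \<comment> \<open>The coefficient of \<open>q\<close> at \<open>f\<close> is compared with the
    limit at \<open>f\<close>, moved to \<open>A f\<close> by invariance, and compared with
    \<open>q\<close> again; hence two errors \<open>nsq f * r\<close>.\<close>
  also have "\<dots> \<le> (\<Sum>f\<in>set Fl. R * \<eta>\<^sup>2 + 2 * (nsq f * r))"
  proof (rule sum_mono)
    fix f assume f: "f \<in> set Fl"
    then have fL: "f \<in> L" using FL by blast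
    have AfL: "A f \<in> L" by (rule isomD(1)[OF iB fL])
    have nA: "nsq (A f) = nsq f" using isomD(3)[OF iB fL fL] by (simp add: nsq_def)
    show "Re (app q (\<lambda>x. ip x f) f) \<le> R * \<eta>\<^sup>2 + 2 * (nsq f * r)"
      using err[OF fL] err[OF AfL] small[OF f] unfolding nA inv[OF A(1) fL] by linarith
  qed
  also have "\<dots> = (R * card (set Fl)) * \<eta>\<^sup>2 + 2 * N * r"
    by (simp add: sum.distrib N_def sum_distrib_left sum_distrib_right mult_ac)
  also have "(R * card (set Fl)) * \<eta>\<^sup>2 \<le> \<delta>\<^sup>2 / 4"
  proof -
    have "(R * card (set Fl)) * \<eta>\<^sup>2 \<le> (R * card (set Fl) + 1) * \<eta>\<^sup>2" by (intro mult_right_mono) auto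
    also have "\<dots> = \<delta>\<^sup>2 / 4" unfolding \<eta>(2) using Rc by (simp add: field_simps)
    finally show ?thesis .
  qed
  also have "2 * N * r < \<delta>\<^sup>2 / 2" unfolding r_def by (rule n)
  finally show False using \<delta> by simp
qed

end

section \<open>The square integrable functions as a complete semi-inner product space\<close>

lemma bounded_bilinear_cip: "bounded_bilinear (cip :: complex^'n::finite \<Rightarrow> _)"
  unfolding bilinear_conv_bounded_bilinear[symmetric] bilinear_def
  by (auto intro!: linearI simp: cip_def algebra_simps sum.distrib scaleR_sum_right)

context gbundle_measure
begin

definition ipL :: "('m \<Rightarrow> complex^'n) \<Rightarrow> ('m \<Rightarrow> complex^'n) \<Rightarrow> complex" where
  "ipL v w = (\<integral>x. cip (v x) (w x) \<partial>\<mu>)"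

definition scL :: "complex \<Rightarrow> ('m \<Rightarrow> complex^'n) \<Rightarrow> 'm \<Rightarrow> complex^'n" where
  "scL z v = (\<lambda>x. z *s v x)"

definition clsL :: "('m \<Rightarrow> complex^'n) \<Rightarrow> ('m \<Rightarrow> ('p, 'n) epoint) set" where
  "clsL v = ae_class B \<mu> (section_of v)"

lemma L2_sqn: "v \<in> L2 \<Longrightarrow> sqn v < \<infinity>"
  unfolding L2_def by blast

lemma measurable_cip:
  assumes "v \<in> borel_measurable borel" "w \<in> borel_measurable borel"
  shows "(\<lambda>x. cip (v x) (w x)) \<in> borel_measurable \<mu>"
  unfolding borel_measurable_mu by (rule borel_measurable_bilinear[OF bounded_bilinear_cip assms])

lemma integrable_cip:
  assumes "v \<in> L2" "w \<in> L2"
  shows "integrable \<mu> (\<lambda>x. cip (v x) (w x))"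
proof (rule integrableI_bounded)
  have m[measurable]: "v \<in> borel_measurable borel" "w \<in> borel_measurable borel" using assms L2_measurable by auto
  show "(\<lambda>x. cip (v x) (w x)) \<in> borel_measurable \<mu>" by (rule measurable_cip[OF m])
  have "(\<integral>\<^sup>+x. ennreal (cmod (cip (v x) (w x))) \<partial>\<mu>) \<le> (\<integral>\<^sup>+x. ennreal ((norm (v x))\<^sup>2) + ennreal ((norm (w x))\<^sup>2) \<partial>\<mu>)"
    by (intro nn_integral_mono) (simp add: norm_cip_le flip: ennreal_plus)
  also have "\<dots> = sqn v + sqn w" unfolding sqn_def by (rule nn_integral_add) measurable
  also have "\<dots> < \<infinity>" using L2_sqn assms by simp
  finally show "(\<integral>\<^sup>+x. ennreal (cmod (cip (v x) (w x))) \<partial>\<mu>) < \<infinity>" .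
qed

lemma sqn_ipL:
  assumes "v \<in> L2"
  shows "sqn v = ennreal (Re (ipL v v))" "0 \<le> Re (ipL v v)"
proof -
  have R: "Re (ipL v v) = (\<integral>x. (norm (v x))\<^sup>2 \<partial>\<mu>)"
    unfolding ipL_def integral_Re[OF integrable_cip[OF assms assms], symmetric] by (simp add: cip_self)
  have "integrable \<mu> (\<lambda>x. Re (cip (v x) (v x)))" using integrable_cip[OF assms assms] by (rule integrable_Re)
  then have "integrable \<mu> (\<lambda>x. (norm (v x))\<^sup>2)" by (simp add: cip_self)
  then show "sqn v = ennreal (Re (ipL v v))" unfolding R sqn_def by (rule nn_integral_eq_integral) simp
  show "0 \<le> Re (ipL v v)" unfolding R by simp
qed

sublocale sip: sip_space L2 scL ipL
proof
  fix x y w :: "'m \<Rightarrow> complex^'n" and z :: complex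
  show "0 \<in> L2" by (rule L2_zero)
  show "x \<in> L2 \<Longrightarrow> y \<in> L2 \<Longrightarrow> x + y \<in> L2" by (rule L2_add)
  show "x \<in> L2 \<Longrightarrow> scL z x \<in> L2" unfolding scL_def by (rule L2_scale)
  show "x \<in> L2 \<Longrightarrow> scL (-1) x = - x" by (simp add: scL_def fun_eq_iff flip: vector_sneg_minus1)
  show "x \<in> L2 \<Longrightarrow> y \<in> L2 \<Longrightarrow> w \<in> L2 \<Longrightarrow> ipL x (y + w) = ipL x y + ipL x w"
    unfolding ipL_def by (simp add: cip_add_right integrable_cip)
  show "x \<in> L2 \<Longrightarrow> y \<in> L2 \<Longrightarrow> ipL x (scL z y) = z * ipL x y"
    unfolding ipL_def scL_def by (simp add: cip_scale_right)
  show "x \<in> L2 \<Longrightarrow> y \<in> L2 \<Longrightarrow> ipL y x = cnj (ipL x y)"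
    unfolding ipL_def by (simp add: cip_commute[of "x _"])
  show "x \<in> L2 \<Longrightarrow> 0 \<le> Re (ipL x x)" by (rule sqn_ipL(2))
qed

lemma sqn_nsq: "v \<in> L2 \<Longrightarrow> sqn v = ennreal (sip.nsq v)"
  unfolding sip.nsq_def by (rule sqn_ipL)

lemma L2_complete:
  assumes x: "\<And>n::nat. x n \<in> L2" and cau: "\<And>m n. m \<le> n \<Longrightarrow> sip.nsq (x n - x m) \<le> 1 / 4 ^ m"
  shows "\<exists>y\<in>L2. (\<lambda>n. sip.nsq (x n - y)) \<longlonglongrightarrow> 0"
proof -
  have xm[measurable]: "x n \<in> borel_measurable borel" for n using x L2_measurable by blast
  have sq: "sqn (x n - x m) \<le> ennreal (1 / 4 ^ m)" if "m \<le> n" for m n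
    unfolding sqn_nsq[OF sip.diff_mem[OF x x]] by (rule ennreal_leI[OF cau[OF that]])
  define \<Delta> where "\<Delta> k t = norm (x (Suc k) t - x k t)" for k t
  have \<Delta>m[measurable]: "\<Delta> k \<in> borel_measurable borel" for k unfolding \<Delta>_def by measurable
  \<comment> \<open>The weights \<open>2 ^ k\<close> still give a finite integral against the rate
    \<open>1 / 4 ^ k\<close>, and where \<open>G\<close> is finite they force increments of order
    \<open>2 ^ (- k / 2)\<close>, which are summable. Unweighted square sums would not give
    pointwise convergence.\<close>
  define G where "G t = (\<Sum>k. ennreal (2 ^ k * (\<Delta> k t)\<^sup>2))" for t
  have "(\<integral>\<^sup>+t. G t \<partial>\<mu>) = (\<Sum>k. \<integral>\<^sup>+t. ennreal (2 ^ k * (\<Delta> k t)\<^sup>2) \<partial>\<mu>)"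
    unfolding G_def by (rule nn_integral_suminf) measurable
  also have "\<dots> \<le> (\<Sum>k. ennreal ((1/2) ^ k))"
  proof (intro suminf_le summableI)
    fix k
    have "(\<integral>\<^sup>+t. ennreal (2 ^ k * (\<Delta> k t)\<^sup>2) \<partial>\<mu>) = ennreal (2 ^ k) * sqn (x (Suc k) - x k)"
      unfolding sqn_def \<Delta>_def by (simp add: ennreal_mult nn_integral_cmult)
    also have "\<dots> \<le> ennreal (2 ^ k) * ennreal (1 / 4 ^ k)" by (intro mult_left_mono sq) auto
    also have "\<dots> = ennreal (2 ^ k * (1 / 4 ^ k))" by (rule ennreal_mult[symmetric]) auto
    also have "2 ^ k * (1 / 4 ^ k) = (1/2 :: real) ^ k"
      by (simp add: power_divide[symmetric] flip: power_mult_distrib)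
    finally show "(\<integral>\<^sup>+t. ennreal (2 ^ k * (\<Delta> k t)\<^sup>2) \<partial>\<mu>) \<le> ennreal ((1/2) ^ k)" .
  qed
  also have "\<dots> = ennreal (\<Sum>k. (1/2) ^ k)" by (rule suminf_ennreal2) (auto intro: summable_geometric)
  also have "\<dots> < \<infinity>" by simp
  finally have "(\<integral>\<^sup>+t. G t \<partial>\<mu>) \<noteq> \<infinity>" by simp
  moreover have "G \<in> borel_measurable \<mu>" unfolding G_def borel_measurable_mu by measurable
  ultimately have fin: "AE t in \<mu>. G t \<noteq> \<infinity>" by (intro nn_integral_PInf_AE)
  have conv: "convergent (\<lambda>n. x n t)" if Gt: "G t \<noteq> \<infinity>" for t
  proof -
    define S where "S = enn2real (G t)"
    have le: "2 ^ k * (\<Delta> k t)\<^sup>2 \<le> S" for k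
    proof -
      define u where "u k = ennreal (2 ^ k * (\<Delta> k t)\<^sup>2)" for k
      have "sum u {k} \<le> suminf u" by (intro sum_le_suminf summableI) auto
      then have "u k \<le> suminf u" by simp
      then have "ennreal (2 ^ k * (\<Delta> k t)\<^sup>2) \<le> G t" unfolding u_def G_def .
      also have "G t = ennreal S" using Gt by (simp add: S_def less_top)
      finally show ?thesis by (simp add: ennreal_le_iff S_def)
    qed
    have b: "norm (x (Suc k) t - x k t) \<le> sqrt S * (1 / sqrt 2) ^ k" for k
    proof -
      have "(\<Delta> k t)\<^sup>2 \<le> S / 2 ^ k" using le[of k] by (simp add: field_simps)
      then have "\<Delta> k t \<le> sqrt (S / 2 ^ k)" by (rule real_le_rsqrt)
      then show ?thesis by (simp add: \<Delta>_def real_sqrt_divide real_sqrt_power power_divide)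
    qed
    have "summable (\<lambda>k. sqrt S * (1 / sqrt 2) ^ k)"
      by (intro summable_mult summable_geometric) simp
    then have "summable (\<lambda>k. x (Suc k) t - x k t)"
      by (rule summable_comparison_test'[where N = 0]) (use b in auto)
    then have "convergent (\<lambda>n. \<Sum>k<n. x (Suc k) t - x k t)" by (simp add: summable_iff_convergent)
    then have "convergent (\<lambda>n. x n t - x 0 t)" by (simp add: sum_lessThan_telescope[of "\<lambda>k. x k t"])
    then show ?thesis using convergent_add[OF _ convergent_const[of "x 0 t"]] by fastforce
  qed
  define y where "y t = lim (\<lambda>n. x n t)" for t
  have ym[measurable]: "y \<in> borel_measurable borel" unfolding y_def by measurable
  have lim: "AE t in \<mu>. (\<lambda>n. x n t) \<longlonglongrightarrow> y t"
    using fin by eventually_elim (auto simp: y_def convergent_LIMSEQ_iff[symmetric] conv)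
  \<comment> \<open>Fatou's lemma carries the Cauchy estimate over to the pointwise limit.\<close>
  have sqy: "sqn (x m - y) \<le> ennreal (1 / 4 ^ m)" for m
  proof -
    have "sqn (x m - y) = (\<integral>\<^sup>+t. liminf (\<lambda>n. ennreal ((norm (x m t - x n t))\<^sup>2)) \<partial>\<mu>)"
      unfolding sqn_def
    proof (rule nn_integral_cong_AE, use lim in eventually_elim)
      fix t assume "(\<lambda>n. x n t) \<longlonglongrightarrow> y t"
      then have "(\<lambda>n. ennreal ((norm (x m t - x n t))\<^sup>2)) \<longlonglongrightarrow> ennreal ((norm (x m t - y t))\<^sup>2)"
        by (intro tendsto_intros tendsto_ennrealI)
      then have "liminf (\<lambda>n. ennreal ((norm (x m t - x n t))\<^sup>2)) = ennreal ((norm (x m t - y t))\<^sup>2)"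
        by (rule lim_imp_Liminf[OF sequentially_bot])
      then show "ennreal ((norm ((x m - y) t))\<^sup>2) = liminf (\<lambda>n. ennreal ((norm (x m t - x n t))\<^sup>2))"
        by simp
    qed
    also have "\<dots> \<le> liminf (\<lambda>n. \<integral>\<^sup>+t. ennreal ((norm (x m t - x n t))\<^sup>2) \<partial>\<mu>)"
      by (rule nn_integral_liminf) measurable
    also have "\<dots> \<le> ennreal (1 / 4 ^ m)"
    proof (rule Liminf_le)
      have "(\<integral>\<^sup>+t. ennreal ((norm (x m t - x n t))\<^sup>2) \<partial>\<mu>) \<le> ennreal (1 / 4 ^ m)" if "m \<le> n" for n
        using sq[OF that] unfolding sqn_def by (simp add: norm_minus_commute)
      then show "\<forall>\<^sub>F n in sequentially. (\<integral>\<^sup>+t. ennreal ((norm (x m t - x n t))\<^sup>2) \<partial>\<mu>) \<le> ennreal (1 / 4 ^ m)"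
        unfolding eventually_sequentially by blast
    qed simp
    finally show ?thesis .
  qed
  have t0: "(\<lambda>n. 1 / 4 ^ n :: real) \<longlonglongrightarrow> 0"
    using LIMSEQ_realpow_zero[of "1/4::real"] by (simp add: power_divide)
  have y: "y \<in> L2"
  proof (rule L2_closedI[OF ym])
    have "y = (y - x 0) + x 0" by simp
    then have "sqn y \<le> 2 * sqn (y - x 0) + 2 * sqn (x 0)"
      using sqn_add[of "y - x 0" "x 0"] by (simp add: fun_diff_def)
    also have "sqn (y - x 0) = sqn (x 0 - y)" by (rule sqn_pointwise_eq) (simp add: norm_minus_commute)
    also have "2 * sqn (x 0 - y) + 2 * sqn (x 0) < \<infinity>"
      using sqy[of 0] L2_sqn[OF x, of 0] by (simp add: ennreal_mult_less_top order_le_less_trans)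
    finally show "sqn y < \<infinity>" .
    fix \<epsilon> :: real assume "\<epsilon> > 0"
    then have "\<forall>\<^sub>F n in sequentially. 1 / 4 ^ n < \<epsilon>" using order_tendstoD(2)[OF t0] by blast
    then obtain n where "1 / 4 ^ n < \<epsilon>" unfolding eventually_sequentially by blast
    then have "sqn (x n - y) < ennreal \<epsilon>"
      using sqy[of n] \<open>\<epsilon> > 0\<close> by (intro order_le_less_trans[OF sqy]) (simp add: ennreal_lessI)
    then show "\<exists>w\<in>L2. sqn (w - y) < ennreal \<epsilon>" using x by blast
  qed
  have "sip.nsq (x n - y) \<le> 1 / 4 ^ n" for n
    using sqy[of n] unfolding sqn_nsq[OF sip.diff_mem[OF x y]] by (simp add: ennreal_le_iff)
  moreover have "0 \<le> sip.nsq (x n - y)" for n by (rule sip.nsq_nonneg[OF sip.diff_mem[OF x y]])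
  ultimately have "(\<lambda>n. sip.nsq (x n - y)) \<longlonglongrightarrow> 0"
    by (intro tendsto_sandwich[OF _ _ tendsto_const t0]) auto
  then show ?thesis using y by blast
qed

lemma ae_class_cong: "AE x in \<mu>. c x = c' x \<Longrightarrow> ae_class B \<mu> c = ae_class B \<mu> c'"
  unfolding ae_class_def by (intro Collect_cong conj_cong refl iffI; elim AE_mp) (auto intro!: AE_I2)

lemma clsL_cong: "AE x in \<mu>. v x = w x \<Longrightarrow> clsL v = clsL w"
  unfolding clsL_def by (rule ae_class_cong) (auto simp: section_of_eq_iff)

lemma ae_rep_clsL:
  assumes "v \<in> borel_measurable borel"
  obtains v' where "ae_rep (clsL v) = section_of v'" "AE x in \<mu>. v' x = v x" "v' \<in> borel_measurable borel"
proof -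
  have "section_of v \<in> clsL v"
    unfolding clsL_def ae_class_def using measurable_section_of[OF assms] by simp
  then have "ae_rep (clsL v) \<in> clsL v" unfolding ae_rep_def by (rule someI[of "\<lambda>c. c \<in> clsL v"])
  then have c: "measurable_section B (ae_rep (clsL v))" "AE x in \<mu>. ae_rep (clsL v) x = section_of v x"
    unfolding clsL_def ae_class_def by auto
  obtain v' where v': "v' \<in> borel_measurable borel" "ae_rep (clsL v) = section_of v'"
    using measurable_section_cases[OF c(1)] .
  have "AE x in \<mu>. v' x = v x" using c(2) unfolding v'(2) by (simp add: section_of_eq_iff)
  then show ?thesis using that v' by blast
qed

text \<open>Operations on classes are defined through chosen representatives. By the last hypothesis
  values at a point depend only on values at that point, so another representative changes the
  result on a null set only.\<close>

lemma clsL_pointwise: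
  assumes v: "v \<in> borel_measurable borel" and F: "\<And>u x. F x (section_of u x) = section_of (A u) x"
    and A: "\<And>u u' x. u x = u' x \<Longrightarrow> A u x = A u' x"
  shows "ae_class B \<mu> (\<lambda>x. F x (ae_rep (clsL v) x)) = clsL (A v)"
proof -
  obtain v' where v': "ae_rep (clsL v) = section_of v'" "AE x in \<mu>. v' x = v x" using ae_rep_clsL[OF v] .
  have "(\<lambda>x. F x (ae_rep (clsL v) x)) = section_of (A v')" unfolding v'(1) using F by blast
  moreover have "AE x in \<mu>. A v' x = A v x" using v'(2) by eventually_elim (rule A)
  ultimately show ?thesis using clsL_cong by (simp add: clsL_def)
qed

lemma clsL_eq_iff:
  assumes "v \<in> L2" "w \<in> L2"
  shows "clsL v = clsL w \<longleftrightarrow> sip.nsq (v - w) = 0"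
proof -
  have m[measurable]: "v \<in> borel_measurable borel" "w \<in> borel_measurable borel" using assms L2_measurable by auto
  have "sip.nsq (v - w) = 0 \<longleftrightarrow> sqn (v - w) = 0"
    unfolding sqn_nsq[OF sip.diff_mem[OF assms]] using sip.nsq_nonneg[OF sip.diff_mem[OF assms]] by simp
  also have "\<dots> \<longleftrightarrow> (AE x in \<mu>. v x = w x)"
    unfolding sqn_def by (subst nn_integral_0_iff_AE) auto
  also have "\<dots> \<longleftrightarrow> clsL v = clsL w"
  proof
    assume "clsL v = clsL w"
    moreover have "section_of v \<in> clsL v"
      unfolding clsL_def ae_class_def using measurable_section_of[OF m(1)] by simp
    ultimately have "section_of v \<in> clsL w" by simp
    then show "AE x in \<mu>. v x = w x" unfolding clsL_def ae_class_def by (simp add: section_of_eq_iff)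
  qed (rule clsL_cong)
  finally show ?thesis by blast
qed

sublocale sip: sip_hspace L2 scL ipL "L2_space B \<mu>" clsL
proof (unfold_locales, goal_cases)
  case (1 x)
  then show ?case by (rule L2_complete)
next
  case 2
  show ?case unfolding L2_space_def clsL_def by (auto simp: L2_section_iff)
next
  case (3 v w)
  obtain v' where v': "ae_rep (clsL v) = section_of v'" "AE x in \<mu>. v' x = v x"
    using ae_rep_clsL[OF L2_measurable[OF 3(1)]] .
  obtain w' where w': "ae_rep (clsL w) = section_of w'" "AE x in \<mu>. w' x = w x"
    using ae_rep_clsL[OF L2_measurable[OF 3(2)]] .
  have "hadd (L2_space B \<mu>) (clsL v) (clsL w) = ae_class B \<mu> (\<lambda>x. eadd (ae_rep (clsL v) x) (ae_rep (clsL w) x))"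
    by (simp add: L2_space_def)
  also have "\<dots> = clsL (v' + w')"
    unfolding v'(1) w'(1) section_of_pointwise(1) unfolding clsL_def ..
  also have "\<dots> = clsL (v + w)"
  proof (rule clsL_cong)
    show "AE x in \<mu>. (v' + w') x = (v + w) x" using v'(2) w'(2) by eventually_elim simp
  qed
  finally show ?case .
next
  case (4 v z)
  have "hscale (L2_space B \<mu>) z (clsL v) = ae_class B \<mu> (\<lambda>x. escale z (ae_rep (clsL v) x))"
    by (simp add: L2_space_def)
  also have "\<dots> = clsL (scL z v)"
    by (rule clsL_pointwise[OF L2_measurable[OF 4]]) (simp_all add: section_of_pointwise scL_def)
  finally show ?case .
next
  case (5 v w)
  obtain v' where v': "ae_rep (clsL v) = section_of v'" "AE x in \<mu>. v' x = v x" "v' \<in> borel_measurable borel"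
    using ae_rep_clsL[OF L2_measurable[OF 5(1)]] .
  obtain w' where w': "ae_rep (clsL w) = section_of w'" "AE x in \<mu>. w' x = w x" "w' \<in> borel_measurable borel"
    using ae_rep_clsL[OF L2_measurable[OF 5(2)]] .
  have "hinner (L2_space B \<mu>) (clsL v) (clsL w) = (\<integral>x. cip (v' x) (w' x) \<partial>\<mu>)"
    by (simp add: L2_space_def v' w' section_of_pointwise)
  also have "\<dots> = ipL v w" unfolding ipL_def
  proof (rule integral_cong_AE)
    show "AE x in \<mu>. cip (v' x) (w' x) = cip (v x) (w x)" using v'(2) w'(2) by eventually_elim simp
  qed (intro measurable_cip v' w' L2_measurable 5)+
  finally show ?case .
next
  case 6
  show ?case by (simp add: L2_space_def clsL_def section_of_pointwise)
next
  case (7 v w)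
  then show ?case by (rule clsL_eq_iff)
qed

definition gaugeL :: "('p \<Rightarrow> complex^'n^'n) \<Rightarrow> ('m \<Rightarrow> complex^'n) \<Rightarrow> 'm \<Rightarrow> complex^'n" where
  "gaugeL f v = (\<lambda>x. f (lift x) *v v x)"

definition multL :: "('m \<Rightarrow> complex) \<Rightarrow> ('m \<Rightarrow> complex^'n) \<Rightarrow> 'm \<Rightarrow> complex^'n" where
  "multL h v = (\<lambda>x. h x *s v x)"

lemma gaugeL_L2: "gfun f \<Longrightarrow> v \<in> L2 \<Longrightarrow> gaugeL f v \<in> L2"
  unfolding gaugeL_def by (rule L2_gauge)

lemma gauge_op_clsL:
  assumes "\<And>p v. \<gamma> (eorbit B p v) = eorbit B p (f p *v v)" "v \<in> L2"
  shows "gauge_op B \<mu> \<gamma> (clsL v) = clsL (gaugeL f v)"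
  unfolding gauge_op_def
  by (rule clsL_pointwise[OF L2_measurable[OF assms(2)]]) (simp_all add: section_of_def gaugeL_def assms(1))

lemma mult_op_clsL: "v \<in> L2 \<Longrightarrow> mult_op B \<mu> h (clsL v) = clsL (multL h v)"
  unfolding mult_op_def
  by (rule clsL_pointwise[OF L2_measurable, where F = "\<lambda>x. escale (h x)"])
    (simp_all add: section_of_def multL_def escale_eorbit)

lemma gaugeL_lin_isom:
  assumes f: "gfun f"
  shows "sip.lin_isom (gaugeL f)"
proof -
  have "gaugeL f ` L2 = L2"
  proof
    show "gaugeL f ` L2 \<subseteq> L2" using gaugeL_L2[OF f] by blast
    show "L2 \<subseteq> gaugeL f ` L2"
    proof
      fix v assume v: "v \<in> L2"
      have "v = gaugeL f (gaugeL (\<lambda>p. adj (f p)) v)"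
        by (simp add: gaugeL_def adj_mult_vec(2)[OF gfunD(2)[OF f]])
      then show "v \<in> gaugeL f ` L2" using gaugeL_L2[OF gfun_adj[OF f] v] by blast
    qed
  qed
  moreover have "ipL (gaugeL f v) (gaugeL f w) = ipL v w" for v w
    by (simp add: ipL_def gaugeL_def cip_unitary[OF grp_unitary[OF gfunD(2)[OF f]]])
  ultimately show ?thesis
    unfolding sip.lin_isom_def sip.isom_def
    by (auto simp: gaugeL_def scL_def fun_eq_iff matrix_vector_mult_diff_distrib
      matrix_vector_right_distrib matrix_vector_scalar)
qed

lemma multL_lin_isom:
  assumes h: "smooth_fun (base_atlas B) UNIV h" "\<And>x. cmod (h x) = 1"
  shows "sip.lin_isom (multL h)"
proof -
  have hc: "h x * cnj (h x) = 1" for x using h(2)[of x] complex_norm_square[of "h x"] by simp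
  have "multL h ` L2 = L2"
  proof
    show "multL h ` L2 \<subseteq> L2" unfolding multL_def using L2_unimodular[OF _ h] by blast
    show "L2 \<subseteq> multL h ` L2"
    proof
      fix v assume v: "v \<in> L2"
      have "(\<lambda>x. cnj (h x) *s v x) \<in> L2"
        by (rule L2_unimodular[OF v smooth_fun_bounded_linear[OF base_atlas open_UNIV bounded_linear_cnj h(1)]])
          (simp add: h(2))
      moreover have "v = multL h (\<lambda>x. cnj (h x) *s v x)"
        by (simp add: multL_def vector_smult_assoc hc)
      ultimately show "v \<in> multL h ` L2" by blast
    qed
  qed
  moreover have "ipL (multL h v) (multL h w) = ipL v w" for v w
  proof -
    have "cip (z *s a) (z *s b) = (z * cnj z) * cip a b" for z :: complex and a b :: "complex^'n"
      by (simp add: cip_def sum_distrib_left mult_ac)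
    then show ?thesis by (simp add: ipL_def multL_def hc)
  qed
  ultimately show ?thesis
    unfolding sip.lin_isom_def sip.isom_def
    by (auto simp: multL_def scL_def fun_eq_iff vector_ssub_ldistrib vector_add_ldistrib
      vector_smult_assoc mult.commute)
qed

end

section \<open>Weak mixing of smooth phase functions\<close>

text \<open>The bound 1 keeps both angles between \<open>- pi / 2\<close> and \<open>pi / 2\<close>,
  where \<open>sin\<close> is injective.\<close>

lemma cis_inj:
  assumes "\<bar>s\<bar> \<le> 1" "\<bar>t\<bar> \<le> 1" "cis s = cis t"
  shows "s = t"
proof (rule sin_inj_pi)
  show "sin s = sin t" using arg_cong[OF assms(3), of Im] by simp
qed (use assms(1,2) pi_ge_two in linarith)+

lemma flat_0_bounds: "0 \<le> flat 0 t" "flat 0 t \<le> 1" "flat 0 t = 0 \<longleftrightarrow> t \<le> 0"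
  unfolding flat_def by auto

lemma smooth_on_bump:
  fixes q :: "'a::euclidean_space \<Rightarrow> real"
  assumes "smooth_on UNIV q"
  shows "smooth_on UNIV (\<lambda>y. flat 0 (r\<^sup>2 - (y - c) \<bullet> (y - c)) * q y)"
proof (rule smooth_on_bilinear[OF open_UNIV bounded_bilinear_mult _ assms])
  have d: "smooth_on UNIV (\<lambda>y::'a. y + (- c))"
    by (intro smooth_on_add smooth_on_ident smooth_on_const open_UNIV)
  have "smooth_on UNIV (\<lambda>y::'a. (y + (- c)) \<bullet> (y + (- c)))"
    by (rule smooth_on_bilinear[OF open_UNIV bounded_bilinear_inner d d])
  from smooth_on_add[OF open_UNIV smooth_on_const[OF open_UNIV]
      smooth_on_bounded_linear[OF open_UNIV bounded_linear_mult_right this], of "r\<^sup>2" "-1"]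
  have "smooth_on UNIV (\<lambda>y. r\<^sup>2 - (y - c) \<bullet> (y - c))" by simp
  from smooth_on_compose[OF open_UNIV open_UNIV _ this smooth_on_flat]
  show "smooth_on UNIV (\<lambda>y. flat 0 (r\<^sup>2 - (y - c) \<bullet> (y - c)))" by simp
qed

text \<open>In the chart the function is a composition of smooth maps. Off the preimage of the
  closed ball it is constantly 1, and this preimage is compact, hence closed in a Hausdorff space;
  the two open sets cover the manifold.\<close>

lemma smooth_fun_bump:
  fixes \<A> :: "('m::t2_space, 'e::euclidean_space) chart set" and q :: "'e \<Rightarrow> real"
  assumes \<A>: "smooth_atlas \<A>" and U: "(U, \<phi>) \<in> \<A>" and r: "cball c r \<subseteq> \<phi> ` U" "r > 0" and q: "smooth_on UNIV q"
  defines "h \<equiv> \<lambda>x. cis (if x \<in> U then flat 0 (r\<^sup>2 - (\<phi> x - c) \<bullet> (\<phi> x - c)) * q (\<phi> x) else 0)"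
  shows "smooth_fun \<A> UNIV h"
proof (rule smooth_fun_local[OF \<A> open_UNIV])
  fix x :: 'm
  note C = smooth_atlasD[OF \<A> U]
  define \<Psi> where "\<Psi> y = cis (flat 0 (r\<^sup>2 - (y - c) \<bullet> (y - c)) * q y)" for y
  have \<Psi>: "smooth_on UNIV \<Psi>"
    using smooth_on_compose[OF open_UNIV open_UNIV _ smooth_on_bump[OF q] smooth_on_cis] unfolding \<Psi>_def by simp
  show "\<exists>W g. open W \<and> x \<in> W \<and> smooth_fun \<A> W g \<and> (\<forall>y\<in>W \<inter> UNIV. g y = h y)"
  proof (cases "x \<in> U")
    case True
    have "smooth_fun \<A> U (\<Psi> \<circ> \<phi>)" unfolding smooth_fun_def
    proof (intro ballI, clarify)
      fix W \<psi> assume W: "(W, \<psi>) \<in> \<A>"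
      note D = smooth_atlasD[OF \<A> W]
      have "open (\<psi> ` (W \<inter> U))" by (intro D(7) open_Int D(1) C(1)) auto
      from smooth_on_compose[OF this open_UNIV _ D(6)[OF U] \<Psi>]
      show "smooth_on (\<psi> ` (W \<inter> U)) (\<Psi> \<circ> \<phi> \<circ> inv_into W \<psi>)" by (simp add: o_def)
    qed
    moreover have "\<forall>y\<in>U \<inter> UNIV. (\<Psi> \<circ> \<phi>) y = h y" by (simp add: \<Psi>_def h_def)
    ultimately show ?thesis using True C(1) by blast
  next
    case False
    define K where "K = inv_into U \<phi> ` cball c r"
    have "compact K" unfolding K_def
      by (intro compact_continuous_image continuous_on_subset[OF C(4) r(1)] compact_cball)
    then have "open (- K)" by (intro open_Compl compact_imp_closed)
    moreover have "x \<notin> K"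
    proof
      assume "x \<in> K"
      then obtain y where "y \<in> cball c r" "x = inv_into U \<phi> y" unfolding K_def by blast
      then have "x \<in> U" using r(1) inv_into_into by (metis subsetD)
      then show False using False by simp
    qed
    moreover have "1 = h y" if y: "y \<in> - K" for y
    proof (cases "y \<in> U")
      case yU: True
      have "\<phi> y \<notin> cball c r" using y C(5)[OF yU] unfolding K_def by (metis ComplD imageI)
      then have "r < norm (\<phi> y - c)" by (simp add: dist_norm norm_minus_commute)
      then have "r\<^sup>2 < (norm (\<phi> y - c))\<^sup>2" using r(2) by (intro power_strict_mono) auto
      then have "flat 0 (r\<^sup>2 - (\<phi> y - c) \<bullet> (\<phi> y - c)) = 0"
        unfolding flat_0_bounds(3) by (simp add: power2_norm_eq_inner)
      then show ?thesis by (simp add: h_def)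
    qed (simp add: h_def)
    ultimately show ?thesis using smooth_fun_const[OF \<A>, of "- K" 1] by blast
  qed
qed

text \<open>The phase of the bump alone recovers the bump \<beta>; where \<beta> does not vanish,
  the phases of bump times coordinate recover the coordinates. The other point may lie anywhere,
  since equal nonzero values of \<beta> force it into the chart.\<close>

lemma separating_phases:
  fixes \<A> :: "('m::t2_space, 'e::euclidean_space) chart set"
  assumes \<A>: "smooth_atlas \<A>"
  shows "\<exists>N Fam. open N \<and> z \<in> N \<and> finite Fam \<and> (\<forall>h\<in>Fam. smooth_fun \<A> UNIV h \<and> (\<forall>x. cmod (h x) = 1)) \<and>
    (\<forall>y\<in>N. \<forall>x. x \<noteq> y \<longrightarrow> (\<exists>h\<in>Fam. h x \<noteq> h y))"
proof -
  obtain U \<phi> where U: "(U, \<phi>) \<in> \<A>" "z \<in> U" using smooth_atlas_chart[OF \<A>] .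
  note C = smooth_atlasD[OF \<A> U(1)]
  define c where "c = \<phi> z"
  obtain r0 where r0: "r0 > 0" "cball c r0 \<subseteq> \<phi> ` U"
    using C(2) U(2) unfolding c_def open_contains_cball by blast
  \<comment> \<open>\<open>r \<le> 1\<close> keeps the products of bump and coordinate in the range
    where \<open>cis\<close> is injective.\<close>
  define r where "r = min r0 1"
  have r: "r > 0" "r \<le> 1" "cball c r \<subseteq> \<phi> ` U" using r0 by (auto simp: r_def)
  define \<beta> where "\<beta> x = (if x \<in> U then flat 0 (r\<^sup>2 - (\<phi> x - c) \<bullet> (\<phi> x - c)) else 0)" for x
  define h where "h q x = cis (if x \<in> U then flat 0 (r\<^sup>2 - (\<phi> x - c) \<bullet> (\<phi> x - c)) * q (\<phi> x) else 0)"
    for q :: "'e \<Rightarrow> real" and x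
  define qs where "qs = insert (\<lambda>_. 1) ((\<lambda>b y. (y - c) \<bullet> b) ` Basis)"
  have qs: "smooth_on UNIV q" if "q \<in> qs" for q
  proof -
    have "smooth_on UNIV (\<lambda>y::'e. (y - c) \<bullet> b)" for b
    proof -
      have "smooth_on UNIV (\<lambda>y::'e. y + (- c))"
        by (intro smooth_on_add smooth_on_ident smooth_on_const open_UNIV)
      from smooth_on_bounded_linear[OF open_UNIV bounded_linear_inner_left this] show ?thesis by simp
    qed
    then show ?thesis using that smooth_on_const[OF open_UNIV] unfolding qs_def by auto
  qed
  have hs: "smooth_fun \<A> UNIV (h q)" if "q \<in> qs" for q
    unfolding h_def by (rule smooth_fun_bump[OF \<A> U(1) r(3,1) qs[OF that]])
  have near: "norm (\<phi> x - c) \<le> 1" if "\<beta> x \<noteq> 0" for x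
  proof -
    have "(norm (\<phi> x - c))\<^sup>2 < r\<^sup>2"
      using that flat_0_bounds(3) unfolding \<beta>_def power2_norm_eq_inner by (metis diff_gt_0_iff_gt not_le)
    then have "norm (\<phi> x - c) < r" by (rule power2_less_imp_less) (use r(1) in simp)
    then show ?thesis using r(2) by simp
  qed
  have hq: "h q x = cis (\<beta> x * q (\<phi> x))" for q x by (simp add: h_def \<beta>_def)
  have bound: "\<bar>\<beta> x * q (\<phi> x)\<bar> \<le> 1" if qq: "q \<in> qs" for q x
  proof (cases "\<beta> x = 0")
    case False
    have c1: "\<bar>\<beta> x\<bar> \<le> 1" using flat_0_bounds(1,2) by (simp add: \<beta>_def)
    have "\<bar>q (\<phi> x)\<bar> \<le> 1"
    proof (cases "q = (\<lambda>_. 1)")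
      case False
      then obtain b where "b \<in> Basis" "q = (\<lambda>y. (y - c) \<bullet> b)" using qq unfolding qs_def by blast
      then show ?thesis using Basis_le_norm[of b "\<phi> x - c"] near[OF \<open>\<beta> x \<noteq> 0\<close>] by simp
    qed simp
    then show ?thesis using c1 by (simp add: abs_mult mult_le_one)
  qed simp
  define N where "N = U \<inter> \<phi> -` ball c r"
  have oN: "open N" unfolding N_def by (rule continuous_open_preimage[OF C(3,1) open_ball])
  have zN: "z \<in> N" using U(2) r(1) by (simp add: N_def c_def)
  have sep: "\<exists>g\<in>h ` qs. g x \<noteq> g y" if y: "y \<in> N" and ne: "x \<noteq> y" for x y
  proof (rule ccontr)
    assume "\<not> ?thesis"
    then have eq: "h q x = h q y" if "q \<in> qs" for q using that by blast
    have eq': "\<beta> x * q (\<phi> x) = \<beta> y * q (\<phi> y)" if "q \<in> qs" for q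
      using cis_inj[OF bound[OF that] bound[OF that]] eq[OF that] unfolding hq by blast
    have one: "\<beta> x = \<beta> y" using eq'[of "\<lambda>_. 1"] unfolding qs_def by simp
    have yU: "y \<in> U" "norm (\<phi> y - c) < r" using y by (auto simp: N_def dist_norm norm_minus_commute)
    have "(norm (\<phi> y - c))\<^sup>2 < r\<^sup>2" using yU(2) by (intro power_strict_mono) auto
    then have \<beta>y: "\<beta> y \<noteq> 0" using yU(1) flat_0_bounds(3) by (simp add: \<beta>_def power2_norm_eq_inner)
    then have xU: "x \<in> U" using one unfolding \<beta>_def by metis
    have "(\<phi> x - c) \<bullet> b = (\<phi> y - c) \<bullet> b" if "b \<in> Basis" for b
      using eq'[of "\<lambda>y. (y - c) \<bullet> b"] that one \<beta>y unfolding qs_def by simp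
    then have "\<phi> x - c = \<phi> y - c" by (rule euclidean_eqI)
    then have "inv_into U \<phi> (\<phi> x) = inv_into U \<phi> (\<phi> y)" by simp
    then have "x = y" unfolding C(5)[OF xU] C(5)[OF yU(1)] .
    then show False using ne by simp
  qed
  have fin: "finite (h ` qs)" unfolding qs_def by simp
  have "\<forall>g\<in>h ` qs. smooth_fun \<A> UNIV g \<and> (\<forall>x. cmod (g x) = 1)"
    using hs by (auto simp: h_def)
  moreover have "\<forall>y\<in>N. \<forall>x. x \<noteq> y \<longrightarrow> (\<exists>g\<in>h ` qs. g x \<noteq> g y)" using sep by simp
  ultimately show ?thesis using oN zN fin by (intro exI[of _ N] exI[of _ "h ` qs"] conjI)
qed

section \<open>Averages of phases as kernels\<close>

context gbundle_measure
begin

definition phases :: "('m \<Rightarrow> complex) set" where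
  "phases = {h. smooth_fun (base_atlas B) UNIV h \<and> (\<forall>x. cmod (h x) = 1)}"

lemma phasesD:
  assumes "h \<in> phases"
  shows "smooth_fun (base_atlas B) UNIV h" "cmod (h x) = 1" "h \<in> borel_measurable \<mu>"
  using assms smooth_fun_continuous[OF base_atlas open_UNIV]
  unfolding phases_def borel_measurable_mu by (auto intro: borel_measurable_continuous_onI)

lemma phases_mult:
  assumes "h \<in> phases" "k \<in> phases"
  shows "(\<lambda>x. h x * k x) \<in> phases"
  unfolding phases_def
  using smooth_fun_bilinear[OF base_atlas open_UNIV bounded_bilinear_mult phasesD(1)[OF assms(1)] phasesD(1)[OF assms(2)]]
    phasesD(2)[OF assms(1)] phasesD(2)[OF assms(2)] by (simp add: norm_mult)

lemma phases_one: "(\<lambda>x. 1) \<in> phases"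
  unfolding phases_def using smooth_fun_const[OF base_atlas open_UNIV] by simp

lemma separating_sequence:
  obtains h :: "nat \<Rightarrow> 'm \<Rightarrow> complex" where "\<And>l. h l \<in> phases" "\<And>x y. x \<noteq> y \<Longrightarrow> \<exists>l. h l x \<noteq> h l y"
proof -
  define P where "P N Fam \<longleftrightarrow> finite Fam \<and> Fam \<subseteq> phases \<and> (\<forall>y\<in>N. \<forall>x. x \<noteq> y \<longrightarrow> (\<exists>h\<in>Fam. h x \<noteq> h y))" for N Fam
  define \<C> where "\<C> = {N. open N \<and> (\<exists>Fam. P N Fam)}"
  have loc: "\<exists>N\<in>\<C>. z \<in> N" for z
  proof -
    obtain N Fam where "open N" "z \<in> N" "finite Fam"
      "\<forall>h\<in>Fam. smooth_fun (base_atlas B) UNIV h \<and> (\<forall>x. cmod (h x) = 1)"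
      "\<forall>y\<in>N. \<forall>x. x \<noteq> y \<longrightarrow> (\<exists>h\<in>Fam. h x \<noteq> h y)"
      using separating_phases[OF base_atlas, of z] by meson
    then have "P N Fam" unfolding P_def phases_def by blast
    then show ?thesis using \<open>open N\<close> \<open>z \<in> N\<close> unfolding \<C>_def by blast
  qed
  have "\<exists>\<D>\<subseteq>\<C>. countable \<D> \<and> \<Union>\<D> = UNIV"
  proof (rule sigma_compact_countable_subcover[OF sigma_compact])
    show "\<Union>\<C> = UNIV" using loc by blast
  qed (simp add: \<C>_def)
  then obtain \<D> where D: "\<D> \<subseteq> \<C>" "countable \<D>" "\<Union>\<D> = UNIV" by blast
  have "\<forall>N\<in>\<D>. \<exists>Fam. P N Fam" using D(1) unfolding \<C>_def by blast
  then obtain Fm where Fm: "\<And>N. N \<in> \<D> \<Longrightarrow> P N (Fm N)" by metis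
  \<comment> \<open>The constant phase keeps the enumerated family nonempty.\<close>
  define \<F> where "\<F> = insert (\<lambda>x. 1) (\<Union>N\<in>\<D>. Fm N)"
  have "countable \<F>"
    unfolding \<F>_def
  proof (intro countable_insert countable_UN D(2))
    show "countable (Fm N)" if "N \<in> \<D>" for N
      by (rule countable_finite) (use Fm[OF that] P_def in simp)
  qed
  moreover have "\<F> \<noteq> {}" unfolding \<F>_def by blast
  ultimately have ran: "range (from_nat_into \<F>) = \<F>" by (intro range_from_nat_into)
  have sub: "\<F> \<subseteq> phases" using Fm phases_one unfolding \<F>_def P_def by blast
  show ?thesis
  proof (rule that[of "from_nat_into \<F>"])
    show "from_nat_into \<F> l \<in> phases" for l using ran sub by blast
    fix x y :: 'm assume "x \<noteq> y"
    have "y \<in> \<Union>\<D>" using D(3) by simp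
    then obtain N where N: "N \<in> \<D>" "y \<in> N" by (rule UnionE)
    then obtain h where "h \<in> Fm N" "h x \<noteq> h y" using Fm[OF N(1)] \<open>x \<noteq> y\<close> unfolding P_def by blast
    then have "h \<in> \<F>" using N unfolding \<F>_def by blast
    then have "h \<in> range (from_nat_into \<F>)" unfolding ran .
    then obtain l where "h = from_nat_into \<F> l" by (rule rangeE)
    then show "\<exists>l. from_nat_into \<F> l x \<noteq> from_nat_into \<F> l y" using \<open>h x \<noteq> h y\<close> by blast
  qed
qed

text \<open>A point is Lebesgue null in \<open>real^'k\<close> because the dimension is positive,
  and a chart carries this to \<mu>.\<close>

lemma singleton_null: "{y} \<in> null_sets \<mu>"
proof -
  obtain U \<phi> where U: "(U, \<phi>) \<in> base_atlas B" "y \<in> U" using smooth_atlas_chart[OF base_atlas] .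
  note C = smooth_atlasD[OF base_atlas U(1)]
  define \<nu> where "\<nu> = distr (restrict_space \<mu> U) (restrict_space borel (\<phi> ` U)) \<phi>"
  define \<rho> where "\<rho> = restrict_space lborel (\<phi> ` U)"
  have "absolutely_continuous \<rho> \<nu>"
    using loc_Lebesgue U(1) unfolding locally_Lebesgue_def \<nu>_def \<rho>_def Let_def by fast
  moreover have "{\<phi> y} \<in> null_sets \<rho>"
    unfolding \<rho>_def using C(2) U(2) by (subst null_sets_restrict_space) auto
  ultimately have "{\<phi> y} \<in> null_sets \<nu>" unfolding absolutely_continuous_def by blast
  then have 0: "emeasure \<nu> {\<phi> y} = 0" by auto
  have US: "U \<in> sets \<mu>" using C(1) by (simp add: sets_mu)
  have sp: "space (restrict_space \<mu> U) = U" by (simp add: space_restrict_space)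
  have "\<phi> \<in> borel_measurable (restrict_space borel U)" by (rule borel_measurable_continuous_on_restrict[OF C(3)])
  then have "\<phi> \<in> borel_measurable (restrict_space \<mu> U)"
    using measurable_cong_sets[OF sets_restrict_space_cong[OF sets_mu] refl] by blast
  then have m: "\<phi> \<in> measurable (restrict_space \<mu> U) (restrict_space borel (\<phi> ` U))"
    by (intro measurable_restrict_space2) (auto simp: sp)
  have "{\<phi> y} \<in> sets (restrict_space borel (\<phi> ` U))"
    using C(2) U(2) by (subst sets_restrict_space_iff) auto
  then have "emeasure \<nu> {\<phi> y} = emeasure (restrict_space \<mu> U) (\<phi> -` {\<phi> y} \<inter> U)"
    unfolding \<nu>_def using emeasure_distr[OF m] sp by simp
  also have "\<phi> -` {\<phi> y} \<inter> U = {y}" using U(2) C(5) by (auto, metis)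
  also have "emeasure (restrict_space \<mu> U) {y} = emeasure \<mu> {y}"
    using US U(2) by (intro emeasure_restrict_space) auto
  finally have "emeasure \<mu> {y} = 0" using 0 by simp
  then show ?thesis by (intro null_setsI) (simp_all add: sets_mu)
qed

text \<open>Testing such a kernel with \<open>\<phi> x * cnj (\<phi> y)\<close> gives an average of
  the squared moduli of the integrals of \<open>h * \<phi>\<close> over phases
  \<open>h\<close>.\<close>

inductive_set phase_kernels :: "('m \<Rightarrow> 'm \<Rightarrow> complex) set" where
  base: "h \<in> phases \<Longrightarrow> (\<lambda>x y. h x * cnj (h y)) \<in> phase_kernels"
| mid: "W \<in> phase_kernels \<Longrightarrow> W' \<in> phase_kernels \<Longrightarrow> (\<lambda>x y. (W x y + W' x y) / 2) \<in> phase_kernels"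

lemma phase_kernels_mult:
  assumes "W \<in> phase_kernels" "h \<in> phases"
  shows "(\<lambda>x y. W x y * (h x * cnj (h y))) \<in> phase_kernels"
  using assms(1)
proof (induction W rule: phase_kernels.induct)
  case (base k)
  have "(\<lambda>x y. k x * cnj (k y) * (h x * cnj (h y))) = (\<lambda>x y. (k x * h x) * cnj (k y * h y))"
    by (simp add: fun_eq_iff)
  then show ?case using phase_kernels.base[OF phases_mult[OF base assms(2)]] by simp
next
  case (mid W W')
  have "(\<lambda>x y. (W x y + W' x y) / 2 * (h x * cnj (h y))) =
      (\<lambda>x y. (W x y * (h x * cnj (h y)) + W' x y * (h x * cnj (h y))) / 2)"
    by (simp add: fun_eq_iff field_simps)
  then show ?case using phase_kernels.mid[OF mid.IH] by simp
qed

text \<open>One more factor forms the midpoint of a kernel and its product with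
  \<open>h x * cnj (h y)\<close>.\<close>

lemma phase_kernels_factor:
  assumes "W \<in> phase_kernels" "h \<in> phases"
  shows "(\<lambda>x y. W x y * ((1 + h x * cnj (h y)) / 2) ^ n) \<in> phase_kernels"
proof (induction n)
  case (Suc n)
  let ?W = "\<lambda>x y. W x y * ((1 + h x * cnj (h y)) / 2) ^ n"
  have "(\<lambda>x y. W x y * ((1 + h x * cnj (h y)) / 2) ^ Suc n) =
      (\<lambda>x y. (?W x y + ?W x y * (h x * cnj (h y))) / 2)"
    by (simp add: fun_eq_iff field_simps)
  then show ?case using phase_kernels.mid[OF Suc phase_kernels_mult[OF Suc assms(2)]] by simp
qed (use assms in simp)

lemma phase_kernels_prod:
  fixes h :: "nat \<Rightarrow> 'm \<Rightarrow> complex"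
  assumes "\<And>l. h l \<in> phases"
  shows "(\<lambda>x y. \<Prod>l<m. ((1 + h l x * cnj (h l y)) / 2) ^ n) \<in> phase_kernels"
proof (induction m)
  case 0
  show ?case using phase_kernels.base[OF phases_one] by simp
next
  case (Suc m)
  show ?case using phase_kernels_factor[OF Suc assms, of m n] by simp
qed

lemma phase_kernels_bound:
  assumes "W \<in> phase_kernels"
  shows "(\<lambda>x. W x y) \<in> borel_measurable \<mu>" "cmod (W x y) \<le> 1"
proof -
  have "(\<lambda>x. W x y) \<in> borel_measurable \<mu> \<and> (\<forall>x. cmod (W x y) \<le> 1)"
    using assms
  proof (induction W rule: phase_kernels.induct)
    case (base h)
    then show ?case using phasesD[OF base] by (simp add: norm_mult)
  next
    case (mid W W')
    have "cmod ((W x y + W' x y) / 2) \<le> 1" for x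
    proof -
      have "cmod (W x y + W' x y) \<le> 1 + 1" using mid.IH by (intro norm_triangle_mono) auto
      then show ?thesis by (simp add: norm_divide)
    qed
    moreover have "(\<lambda>x. (W x y + W' x y) / 2) \<in> borel_measurable \<mu>"
      using mid.IH by (intro borel_measurable_divide borel_measurable_add borel_measurable_const) auto
    ultimately show ?case by simp
  qed
  then show "(\<lambda>x. W x y) \<in> borel_measurable \<mu>" "cmod (W x y) \<le> 1" by auto
qed

lemma integrable_bounded_mult:
  fixes u \<phi> :: "'m \<Rightarrow> complex"
  assumes "u \<in> borel_measurable \<mu>" "\<And>x. cmod (u x) \<le> K" "integrable \<mu> \<phi>"
  shows "integrable \<mu> (\<lambda>x. u x * \<phi> x)"
proof (rule Bochner_Integration.integrable_bound)
  show "integrable \<mu> (\<lambda>x. K * cmod (\<phi> x))" using assms(3) by (intro integrable_mult_right integrable_norm)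
  show "(\<lambda>x. u x * \<phi> x) \<in> borel_measurable \<mu>" using assms(1) borel_measurable_integrable[OF assms(3)] by simp
  show "AE x in \<mu>. norm (u x * \<phi> x) \<le> norm (K * cmod (\<phi> x))"
  proof (rule AE_I2)
    fix x
    have "0 \<le> K" using assms(2)[of x] norm_ge_zero order_trans by blast
    then show "norm (u x * \<phi> x) \<le> norm (K * cmod (\<phi> x))"
      using assms(2)[of x] by (simp add: norm_mult mult_right_mono)
  qed
qed

text \<open>Iterated integrals take the place of a product measure. Measurability of the inner
  integral follows by induction on the kernel, since the variables separate for a single
  phase.\<close>

lemma kernel_integral:
  assumes W: "W \<in> phase_kernels" and \<phi>: "integrable \<mu> \<phi>"
  shows "(\<lambda>y. \<integral>x. W x y * \<phi> x \<partial>\<mu>) \<in> borel_measurable \<mu>"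
    "cmod (\<integral>x. W x y * \<phi> x \<partial>\<mu>) \<le> (\<integral>x. cmod (\<phi> x) \<partial>\<mu>)"
    "integrable \<mu> (\<lambda>y. (\<integral>x. W x y * \<phi> x \<partial>\<mu>) * cnj (\<phi> y))"
proof -
  have int: "integrable \<mu> (\<lambda>x. W x y * \<phi> x)" if "W \<in> phase_kernels" for W y
    by (rule integrable_bounded_mult[OF phase_kernels_bound[OF that] \<phi>])
  show m: "(\<lambda>y. \<integral>x. W x y * \<phi> x \<partial>\<mu>) \<in> borel_measurable \<mu>"
    using W
  proof (induction W rule: phase_kernels.induct)
    case (base h)
    have eq: "(\<integral>x. h x * cnj (h y) * \<phi> x \<partial>\<mu>) = cnj (h y) * (\<integral>x. h x * \<phi> x \<partial>\<mu>)" for y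
      by (simp flip: integral_mult_right_zero add: mult_ac)
    show ?case unfolding eq
      by (intro borel_measurable_times borel_measurable_const
        borel_measurable_bounded_linear[OF bounded_linear_cnj] phasesD(3)[OF base])
  next
    case (mid W W')
    have "(\<integral>x. (W x y + W' x y) / 2 * \<phi> x \<partial>\<mu>) = ((\<integral>x. W x y * \<phi> x \<partial>\<mu>) + (\<integral>x. W' x y * \<phi> x \<partial>\<mu>)) / 2" for y
      using int[OF mid.hyps(1)] int[OF mid.hyps(2)] by (simp add: distrib_right add_divide_distrib)
    then show ?case using mid.IH by simp
  qed
  show b: "cmod (\<integral>x. W x y * \<phi> x \<partial>\<mu>) \<le> (\<integral>x. cmod (\<phi> x) \<partial>\<mu>)" for y
  proof -
    have "cmod (\<integral>x. W x y * \<phi> x \<partial>\<mu>) \<le> (\<integral>x. cmod (W x y * \<phi> x) \<partial>\<mu>)" by (rule integral_norm_bound)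
    also have "\<dots> \<le> (\<integral>x. cmod (\<phi> x) \<partial>\<mu>)"
      using phase_kernels_bound(2)[OF W]
      by (intro integral_mono integrable_norm int[OF W] \<phi>) (simp add: norm_mult mult_left_le_one_le)
    finally show ?thesis .
  qed
  have "integrable \<mu> (\<lambda>y. cnj (\<phi> y))" using \<phi> by simp
  then show "integrable \<mu> (\<lambda>y. (\<integral>x. W x y * \<phi> x \<partial>\<mu>) * cnj (\<phi> y))"
    by (rule integrable_bounded_mult[OF m b])
qed

text \<open>For a single phase each double integral factors into the squared modulus of an integral,
  and averaging preserves lower bounds.\<close>

lemma kernel_lower_bound:
  assumes W: "W \<in> phase_kernels" and \<phi>: "\<And>i. i \<in> I \<Longrightarrow> integrable \<mu> (\<phi> i)"
    and low: "\<And>h. h \<in> phases \<Longrightarrow> \<epsilon> \<le> (\<Sum>i\<in>I. (cmod (\<integral>x. h x * \<phi> i x \<partial>\<mu>))\<^sup>2)"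
  shows "\<epsilon> \<le> Re (\<Sum>i\<in>I. \<integral>y. (\<integral>x. W x y * \<phi> i x \<partial>\<mu>) * cnj (\<phi> i y) \<partial>\<mu>)"
  using W
proof (induction W rule: phase_kernels.induct)
  case (base h)
  have "(\<integral>y. (\<integral>x. h x * cnj (h y) * \<phi> i x \<partial>\<mu>) * cnj (\<phi> i y) \<partial>\<mu>) =
      complex_of_real ((cmod (\<integral>x. h x * \<phi> i x \<partial>\<mu>))\<^sup>2)" for i
  proof -
    have "(\<integral>x. h x * cnj (h y) * \<phi> i x \<partial>\<mu>) * cnj (\<phi> i y) =
        (\<integral>x. h x * \<phi> i x \<partial>\<mu>) * cnj (h y * \<phi> i y)" for y
    proof -
      have "(\<integral>x. h x * cnj (h y) * \<phi> i x \<partial>\<mu>) = cnj (h y) * (\<integral>x. h x * \<phi> i x \<partial>\<mu>)"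
        by (simp flip: integral_mult_right_zero add: mult_ac)
      then show ?thesis by simp
    qed
    then have "(\<integral>y. (\<integral>x. h x * cnj (h y) * \<phi> i x \<partial>\<mu>) * cnj (\<phi> i y) \<partial>\<mu>) =
        (\<integral>x. h x * \<phi> i x \<partial>\<mu>) * (\<integral>y. cnj (h y * \<phi> i y) \<partial>\<mu>)"
      by (simp only: integral_mult_right_zero)
    also have "(\<integral>y. cnj (h y * \<phi> i y) \<partial>\<mu>) = cnj (\<integral>x. h x * \<phi> i x \<partial>\<mu>)" by (rule Bochner_Integration.integral_cnj)
    finally show ?thesis by (simp only: complex_norm_square)
  qed
  then show ?case using low[OF base] by simp
next
  case (mid W W')
  have "(\<integral>y. (\<integral>x. (W x y + W' x y) / 2 * \<phi> i x \<partial>\<mu>) * cnj (\<phi> i y) \<partial>\<mu>) =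
      ((\<integral>y. (\<integral>x. W x y * \<phi> i x \<partial>\<mu>) * cnj (\<phi> i y) \<partial>\<mu>) + (\<integral>y. (\<integral>x. W' x y * \<phi> i x \<partial>\<mu>) * cnj (\<phi> i y) \<partial>\<mu>)) / 2"
    if i: "i \<in> I" for i
  proof -
    have "(\<integral>x. (W x y + W' x y) / 2 * \<phi> i x \<partial>\<mu>) = ((\<integral>x. W x y * \<phi> i x \<partial>\<mu>) + (\<integral>x. W' x y * \<phi> i x \<partial>\<mu>)) / 2" for y
      using integrable_bounded_mult[OF phase_kernels_bound[OF mid.hyps(1)] \<phi>[OF i]]
        integrable_bounded_mult[OF phase_kernels_bound[OF mid.hyps(2)] \<phi>[OF i]]
      by (simp add: distrib_right add_divide_distrib)
    then show ?thesis
      using kernel_integral(3)[OF mid.hyps(1) \<phi>[OF i]] kernel_integral(3)[OF mid.hyps(2) \<phi>[OF i]]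
      by (simp add: distrib_right add_divide_distrib)
  qed
  then have eq: "(\<Sum>i\<in>I. \<integral>y. (\<integral>x. (W x y + W' x y) / 2 * \<phi> i x \<partial>\<mu>) * cnj (\<phi> i y) \<partial>\<mu>) =
      ((\<Sum>i\<in>I. \<integral>y. (\<integral>x. W x y * \<phi> i x \<partial>\<mu>) * cnj (\<phi> i y) \<partial>\<mu>) +
       (\<Sum>i\<in>I. \<integral>y. (\<integral>x. W' x y * \<phi> i x \<partial>\<mu>) * cnj (\<phi> i y) \<partial>\<mu>)) / 2"
    by (simp add: sum.distrib flip: sum_divide_distrib cong: sum.cong)
  have half: "Re ((a + b) / 2) = (Re a + Re b) / 2" for a b by simp
  have mean: "\<epsilon> \<le> s \<Longrightarrow> \<epsilon> \<le> t \<Longrightarrow> \<epsilon> \<le> (s + t) / 2" for s t :: real by simp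
  show ?case unfolding eq half by (rule mean[OF mid.IH])
qed

text \<open>Strict convexity of the disc: the mean of 1 and a different point of the unit circle
  lies inside.\<close>

lemma mean_phase_less_1:
  assumes "cmod a = 1" "cmod b = 1" "a \<noteq> b"
  shows "cmod ((1 + a * cnj b) / 2) < 1"
proof -
  define u where "u = a * cnj b"
  have "b * cnj b = 1" using assms(2) complex_norm_square[of b] by simp
  then have ub: "u * b = a" by (simp add: u_def mult.assoc mult.commute[of "cnj b"])
  have nu: "cmod u = 1" using assms by (simp add: u_def norm_mult)
  then have sq: "(Re u)\<^sup>2 + (Im u)\<^sup>2 = 1" by (metis cmod_power2 power_one)
  have "Re u \<noteq> 1"
  proof
    assume "Re u = 1"
    then have "u = 1" using sq by (simp add: complex_eq_iff)
    then show False using ub assms(3) by simp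
  qed
  moreover have "Re u \<le> 1" using complex_Re_le_cmod[of u] nu by simp
  ultimately have "Re u < 1" by simp
  have "(cmod (1 + u))\<^sup>2 = (1 + Re u)\<^sup>2 + (Im u)\<^sup>2" by (simp add: cmod_power2)
  also have "\<dots> = 2 + 2 * Re u" using sq by (simp add: power2_eq_square algebra_simps)
  also have "\<dots> < 2\<^sup>2" using \<open>Re u < 1\<close> by simp
  finally have "cmod (1 + u) < 2" by (rule power2_less_imp_less) simp
  then show ?thesis by (simp add: u_def norm_divide)
qed

text \<open>The kernels \<open>\<Prod> ((1 + h\<^sub>l(x) cnj h\<^sub>l(y)) / 2)\<^sup>n\<close> are averages of \<open>h(x) cnj h(y)\<close> over phases \<open>h\<close>
  and tend to zero off the diagonal, which is a null set.\<close>

lemma phases_mixing: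
  assumes I: "finite I" and \<phi>: "\<And>i. i \<in> I \<Longrightarrow> integrable \<mu> (\<phi> i)" and \<epsilon>: "\<epsilon> > 0"
  shows "\<exists>h\<in>phases. \<forall>i\<in>I. cmod (\<integral>x. h x * \<phi> i x \<partial>\<mu>) < \<epsilon>"
proof (rule ccontr)
  assume contr: "\<not> ?thesis"
  have low: "\<epsilon>\<^sup>2 \<le> (\<Sum>i\<in>I. (cmod (\<integral>x. h x * \<phi> i x \<partial>\<mu>))\<^sup>2)" if h: "h \<in> phases" for h
  proof -
    obtain i where i: "i \<in> I" "\<epsilon> \<le> cmod (\<integral>x. h x * \<phi> i x \<partial>\<mu>)" using contr h by force
    then have "\<epsilon>\<^sup>2 \<le> (cmod (\<integral>x. h x * \<phi> i x \<partial>\<mu>))\<^sup>2" using \<epsilon> by (intro power_mono) auto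
    also have "\<dots> \<le> (\<Sum>i\<in>I. (cmod (\<integral>x. h x * \<phi> i x \<partial>\<mu>))\<^sup>2)"
      by (rule member_le_sum[where f = "\<lambda>i. (cmod (\<integral>x. h x * \<phi> i x \<partial>\<mu>))\<^sup>2"]) (use i I in auto)
    finally show ?thesis .
  qed
  obtain h :: "nat \<Rightarrow> 'm \<Rightarrow> complex" where h: "\<And>l. h l \<in> phases" "\<And>x y. x \<noteq> y \<Longrightarrow> \<exists>l. h l x \<noteq> h l y"
    using separating_sequence by blast
  \<comment> \<open>Both the number of factors and the exponent are \<open>n\<close>, so a single
    sequence eventually contains every phase to a growing power.\<close>
  define W where "W n = (\<lambda>x y. \<Prod>l<n. ((1 + h l x * cnj (h l y)) / 2) ^ n)" for n
  have W: "W n \<in> phase_kernels" for n unfolding W_def by (rule phase_kernels_prod[OF h(1)])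
  have W0: "(\<lambda>n. W n x y) \<longlonglongrightarrow> 0" if xy: "x \<noteq> y" for x y
  proof -
    define z where "z l = (1 + h l x * cnj (h l y)) / 2" for l
    obtain k where k: "h k x \<noteq> h k y" using h(2)[OF xy] by blast
    have zk: "cmod (z k) < 1"
      unfolding z_def by (rule mean_phase_less_1[OF phasesD(2)[OF h(1)] phasesD(2)[OF h(1)] k])
    have z1: "cmod (z l) \<le> 1" for l
    proof -
      have "cmod (1 + h l x * cnj (h l y)) \<le> 1 + 1"
        using phasesD(2)[OF h(1)] by (intro norm_triangle_mono) (auto simp: norm_mult)
      then show ?thesis by (simp add: z_def norm_divide)
    qed
    have "cmod (W n x y) \<le> cmod (z k) ^ n" if n: "n > k" for n
    proof -
      have "W n x y = z k ^ n * (\<Prod>l\<in>{..<n} - {k}. z l ^ n)"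
        unfolding W_def z_def using n by (subst prod.remove[of _ k]) auto
      then have "cmod (W n x y) = cmod (z k) ^ n * (\<Prod>l\<in>{..<n} - {k}. cmod (z l) ^ n)"
        by (simp add: norm_mult norm_power flip: prod_norm)
      also have "\<dots> \<le> cmod (z k) ^ n * 1"
        using z1 by (intro mult_left_mono prod_le_1) (auto intro: power_le_one)
      finally show ?thesis by simp
    qed
    then have "\<forall>\<^sub>F n in sequentially. norm (W n x y) \<le> cmod (z k) ^ n"
      by (intro eventually_mono[OF eventually_gt_at_top[of k]])
    moreover have "(\<lambda>n. cmod (z k) ^ n) \<longlonglongrightarrow> 0" using zk by (intro LIMSEQ_realpow_zero) auto
    ultimately show ?thesis by (rule Lim_null_comparison)
  qed
  \<comment> \<open>Dominated convergence in \<open>x\<close> for fixed \<open>y\<close>; the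
    exceptional point \<open>x = y\<close> is null.\<close>
  have inner: "(\<lambda>n. \<integral>x. W n x y * \<phi> i x \<partial>\<mu>) \<longlonglongrightarrow> 0" if i: "i \<in> I" for i y
  proof -
    have "(\<lambda>n. \<integral>x. W n x y * \<phi> i x \<partial>\<mu>) \<longlonglongrightarrow> (\<integral>x. 0 \<partial>\<mu>)"
    proof (rule integral_dominated_convergence[where w = "\<lambda>x. cmod (\<phi> i x)"])
      show "(\<lambda>x. W n x y * \<phi> i x) \<in> borel_measurable \<mu>" for n
        using phase_kernels_bound(1)[OF W] borel_measurable_integrable[OF \<phi>[OF i]] by simp
      show "integrable \<mu> (\<lambda>x. cmod (\<phi> i x))" using \<phi>[OF i] by simp
      show "AE x in \<mu>. (\<lambda>n. W n x y * \<phi> i x) \<longlonglongrightarrow> 0"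
        by (rule AE_I'[OF singleton_null[of y]]) (use W0 in \<open>auto intro: tendsto_mult_left_zero\<close>)
      show "AE x in \<mu>. norm (W n x y * \<phi> i x) \<le> cmod (\<phi> i x)" for n
        using phase_kernels_bound(2)[OF W] by (intro AE_I2) (simp add: norm_mult mult_left_le_one_le)
    qed simp
    then show ?thesis by simp
  qed
  \<comment> \<open>Dominated convergence once more, as the inner integrals are bounded uniformly in
    \<open>y\<close> and \<open>n\<close>.\<close>
  have outer: "(\<lambda>n. \<integral>y. (\<integral>x. W n x y * \<phi> i x \<partial>\<mu>) * cnj (\<phi> i y) \<partial>\<mu>) \<longlonglongrightarrow> 0" if i: "i \<in> I" for i
  proof -
    define K where "K = (\<integral>x. cmod (\<phi> i x) \<partial>\<mu>)"
    have "(\<lambda>n. \<integral>y. (\<integral>x. W n x y * \<phi> i x \<partial>\<mu>) * cnj (\<phi> i y) \<partial>\<mu>) \<longlonglongrightarrow> (\<integral>y. 0 \<partial>\<mu>)"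
    proof (rule integral_dominated_convergence[where w = "\<lambda>y. K * cmod (\<phi> i y)"])
      show "(\<lambda>y. (\<integral>x. W n x y * \<phi> i x \<partial>\<mu>) * cnj (\<phi> i y)) \<in> borel_measurable \<mu>" for n
        by (rule borel_measurable_integrable[OF kernel_integral(3)[OF W \<phi>[OF i]]])
      show "integrable \<mu> (\<lambda>y. K * cmod (\<phi> i y))" using \<phi>[OF i] by simp
      show "AE y in \<mu>. (\<lambda>n. (\<integral>x. W n x y * \<phi> i x \<partial>\<mu>) * cnj (\<phi> i y)) \<longlonglongrightarrow> 0"
        using inner[OF i] by (intro AE_I2 tendsto_mult_left_zero)
      show "AE y in \<mu>. norm ((\<integral>x. W n x y * \<phi> i x \<partial>\<mu>) * cnj (\<phi> i y)) \<le> K * cmod (\<phi> i y)" for n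
        using kernel_integral(2)[OF W \<phi>[OF i]] unfolding K_def
        by (intro AE_I2) (simp add: norm_mult mult_right_mono)
    qed simp
    then show ?thesis by simp
  qed
  have "(\<lambda>n. Re (\<Sum>i\<in>I. \<integral>y. (\<integral>x. W n x y * \<phi> i x \<partial>\<mu>) * cnj (\<phi> i y) \<partial>\<mu>)) \<longlonglongrightarrow> Re (\<Sum>i\<in>I. 0)"
    by (intro tendsto_Re tendsto_sum outer)
  then have "\<epsilon>\<^sup>2 \<le> Re (\<Sum>i\<in>I. 0)"
    using kernel_lower_bound[OF W \<phi> low] by (intro LIMSEQ_le_const) auto
  then show False using \<epsilon> by simp
qed

lemma multL_mixing:
  assumes F: "finite F" "F \<subseteq> L2" and \<eta>: "\<eta> > 0"
  shows "\<exists>h\<in>phases. \<forall>f\<in>F. \<forall>g\<in>F. cmod (ipL (multL h f) g) < \<eta>"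
proof -
  have "\<exists>h\<in>phases. \<forall>i\<in>F \<times> F. cmod (\<integral>x. h x * cip (snd i x) (fst i x) \<partial>\<mu>) < \<eta>"
    by (rule phases_mixing) (use F \<eta> in \<open>auto intro!: integrable_cip\<close>)
  then obtain h where h: "h \<in> phases" "\<And>f g. f \<in> F \<Longrightarrow> g \<in> F \<Longrightarrow> cmod (\<integral>x. h x * cip (g x) (f x) \<partial>\<mu>) < \<eta>"
    by force
  have "cmod (ipL (multL h f) g) < \<eta>" if fg: "f \<in> F" "g \<in> F" for f g
  proof -
    have L: "f \<in> L2" "g \<in> L2" "multL h f \<in> L2"
      using fg F(2) L2_unimodular[OF _ phasesD(1,2)[OF h(1)], of f] by (auto simp: multL_def)
    have "ipL g (multL h f) = (\<integral>x. h x * cip (g x) (f x) \<partial>\<mu>)"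
      by (simp add: ipL_def multL_def cip_scale_right)
    then show ?thesis using h(2)[OF fg] sip.cmod_ip_commute[OF L(3,2)] by simp
  qed
  then show ?thesis using h(1) by blast
qed

end

section \<open>Fixed points of the gauge group\<close>

context gbundle_measure
begin

lemma gauge_op_gfun:
  assumes "\<gamma> \<in> gauge_group B"
  shows "\<exists>f. gfun f \<and> (\<forall>v\<in>L2. gauge_op B \<mu> \<gamma> (clsL v) = clsL (gaugeL f v))"
proof -
  obtain f where f: "gfun f" "\<forall>p v. \<gamma> (eorbit B p v) = eorbit B p (f p *v v)"
    using gauge_group_gfun[OF assms] by blast
  have "gauge_op B \<mu> \<gamma> (clsL v) = clsL (gaugeL f v)" if "v \<in> L2" for v
    by (rule gauge_op_clsL[OF f(2)[rule_format] that])
  then show ?thesis using f(1) by blast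
qed

lemma gfun_gauge_op:
  assumes "gfun f"
  shows "\<exists>\<gamma>\<in>gauge_group B. \<forall>v\<in>L2. gauge_op B \<mu> \<gamma> (clsL v) = clsL (gaugeL f v)"
proof -
  obtain \<gamma> where \<gamma>: "\<gamma> \<in> gauge_group B" "\<forall>p v. \<gamma> (eorbit B p v) = eorbit B p (f p *v v)"
    using gfun_gauge_group[OF assms] by blast
  have "gauge_op B \<mu> \<gamma> (clsL v) = clsL (gaugeL f v)" if "v \<in> L2" for v
    by (rule gauge_op_clsL[OF \<gamma>(2)[rule_format] that])
  then show ?thesis using \<gamma>(1) by blast
qed

lemma gauge_op_mem:
  assumes "\<gamma> \<in> gauge_group B" "c \<in> hcarrier (L2_space B \<mu>)"
  shows "gauge_op B \<mu> \<gamma> c \<in> hcarrier (L2_space B \<mu>)"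
proof -
  obtain f where f: "gfun f" "\<forall>v\<in>L2. gauge_op B \<mu> \<gamma> (clsL v) = clsL (gaugeL f v)"
    using gauge_op_gfun[OF assms(1)] by blast
  show ?thesis using f(2)[rule_format, OF sip.rep(1)[OF assms(2)]] sip.rep(2)[OF assms(2)]
      sip.Q_mem[OF gaugeL_L2[OF f(1) sip.rep(1)[OF assms(2)]]] by simp
qed

lemma gauge_mixing_scalar:
  assumes T: "\<forall>z. cmod z = 1 \<longrightarrow> mat z \<in> grp B"
    and F: "finite F" "F \<subseteq> hcarrier (L2_space B \<mu>)" and \<delta>: "\<delta> > 0"
  shows "\<exists>\<gamma>\<in>gauge_group B. \<forall>f\<in>F. \<forall>g\<in>F. cmod (hinner (L2_space B \<mu>) (gauge_op B \<mu> \<gamma> f) g) < \<delta>"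
proof -
  have "finite (sip.rep ` F)" "sip.rep ` F \<subseteq> L2" using F sip.rep(1) by auto
  from multL_mixing[OF this \<delta>] obtain h where h: "h \<in> phases"
    "\<forall>f\<in>sip.rep ` F. \<forall>g\<in>sip.rep ` F. cmod (ipL (multL h f) g) < \<delta>" by blast
  define f where "f p = (mat (h (bproj B p)) :: complex^'n^'n)" for p
  have f: "gfun f" unfolding f_def by (rule gfun_scalar[OF T phasesD(1,2)[OF h(1)]])
  have fh: "gaugeL f v = multL h v" for v
    by (simp add: gaugeL_def multL_def f_def bproj_lift mat_mult_vec)
  obtain \<gamma> where \<gamma>: "\<gamma> \<in> gauge_group B" "\<forall>v\<in>L2. gauge_op B \<mu> \<gamma> (clsL v) = clsL (gaugeL f v)"
    using gfun_gauge_op[OF f] by blast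
  have "cmod (hinner (L2_space B \<mu>) (gauge_op B \<mu> \<gamma> c) d) < \<delta>" if cd: "c \<in> F" "d \<in> F" for c d
  proof -
    have H: "c \<in> hcarrier (L2_space B \<mu>)" "d \<in> hcarrier (L2_space B \<mu>)" using cd F(2) by auto
    have "gauge_op B \<mu> \<gamma> c = clsL (gaugeL f (sip.rep c))"
      using \<gamma>(2)[rule_format, OF sip.rep(1)[OF H(1)]] sip.rep(2)[OF H(1)] by simp
    then have "hinner (L2_space B \<mu>) (gauge_op B \<mu> \<gamma> c) d = ipL (multL h (sip.rep c)) (sip.rep d)"
      using sip.hinner_Q[OF gaugeL_L2[OF f sip.rep(1)[OF H(1)]] sip.rep(1)[OF H(2)]] sip.rep(2)[OF H(2)]
      by (simp add: fh)
    then show ?thesis using h(2) cd by simp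
  qed
  then show ?thesis using \<gamma>(1) by blast
qed

lemma gauge_mixing_bicommutant:
  assumes bic: "second_quant (L2_space B \<mu>) ` Linfty_unitary_ops B \<mu>
      \<subseteq> bicommutant (fock_space (L2_space B \<mu>)) (second_quant (L2_space B \<mu>) ` gauge_op B \<mu> ` gauge_group B)"
    and F: "finite F" "F \<subseteq> hcarrier (L2_space B \<mu>)" and \<delta>: "\<delta> > 0"
  shows "\<exists>\<gamma>\<in>gauge_group B. \<forall>f\<in>F. \<forall>g\<in>F. cmod (hinner (L2_space B \<mu>) (gauge_op B \<mu> \<gamma> f) g) < \<delta>"
proof -
  have "\<exists>U\<in>gauge_op B \<mu> ` gauge_group B. \<forall>f\<in>F. \<forall>g\<in>F. cmod (hinner (L2_space B \<mu>) (U f) g) < \<delta>"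
  proof (rule sip.weakly_mixing_if_bicommutant[where \<A> = "gaugeL ` Collect gfun" and \<B> = "multL ` phases", OF _ _ _ _ _ _ _ bic _ F \<delta>])
    show "sip.lin_isom A" if "A \<in> gaugeL ` Collect gfun" for A using that gaugeL_lin_isom by blast
    show "A \<circ> A' \<in> gaugeL ` Collect gfun" if A: "A \<in> gaugeL ` Collect gfun" "A' \<in> gaugeL ` Collect gfun" for A A'
    proof -
      obtain f f' where f: "gfun f" "A = gaugeL f" "gfun f'" "A' = gaugeL f'" using A by blast
      then have "A \<circ> A' = gaugeL (\<lambda>p. f p ** f' p)"
        by (simp add: gaugeL_def fun_eq_iff matrix_vector_mul_assoc)
      then show ?thesis using gfun_mult[OF f(1,3)] by blast
    qed
    have "gfun (\<lambda>p. mat 1)"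
      by (rule gfunI) (simp_all add: smooth_fun_const[OF total_atlas] grp_one adj_mult)
    then show "gaugeL ` Collect gfun \<noteq> {}" by blast
    show "\<exists>A\<in>gaugeL ` Collect gfun. sip.implements U A" if U: "U \<in> gauge_op B \<mu> ` gauge_group B" for U
    proof -
      obtain \<gamma> where \<gamma>: "\<gamma> \<in> gauge_group B" "U = gauge_op B \<mu> \<gamma>" using U by blast
      obtain f where "gfun f" "\<forall>v\<in>L2. gauge_op B \<mu> \<gamma> (clsL v) = clsL (gaugeL f v)"
        using gauge_op_gfun[OF \<gamma>(1)] by blast
      then show ?thesis unfolding sip.implements_def \<gamma>(2) by blast
    qed
    show "\<exists>U\<in>gauge_op B \<mu> ` gauge_group B. sip.implements U A" if A: "A \<in> gaugeL ` Collect gfun" for A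
    proof -
      obtain f where f: "gfun f" "A = gaugeL f" using A by blast
      obtain \<gamma> where "\<gamma> \<in> gauge_group B" "\<forall>v\<in>L2. gauge_op B \<mu> \<gamma> (clsL v) = clsL (gaugeL f v)"
        using gfun_gauge_op[OF f(1)] by blast
      then show ?thesis unfolding sip.implements_def f(2) by blast
    qed
    show "sip.lin_isom A" if "A \<in> multL ` phases" for A
      using that multL_lin_isom phasesD(1,2) by blast
    show "\<exists>W\<in>Linfty_unitary_ops B \<mu>. sip.implements W A" if A: "A \<in> multL ` phases" for A
    proof -
      obtain h where h: "h \<in> phases" "A = multL h" using A by blast
      then have "mult_op B \<mu> h \<in> Linfty_unitary_ops B \<mu>"
        unfolding Linfty_unitary_ops_def using phasesD(2,3)[OF h(1)] by auto
      then show ?thesis unfolding sip.implements_def h(2) using mult_op_clsL by blast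
    qed
    show "\<exists>A\<in>multL ` phases. \<forall>f\<in>F. \<forall>g\<in>F. cmod (ipL (A f) g) < \<eta>"
      if "finite F" "F \<subseteq> L2" "\<eta> > 0" for F \<eta>
      using multL_mixing[OF that] by blast
  qed
  then show ?thesis by blast
qed

end

theorem theorem4p1:
  fixes B :: "('m::t2_space, 'k::finite, 'p::t2_space, 'd::euclidean_space, 'n::finite) pbundle"
    and \<mu> :: "'m measure"
    and a :: "('m \<Rightarrow> ('p, 'n) epoint) set \<Rightarrow> 'a::cstar_algebra"
    and \<kappa> :: "(('p, 'n) epoint \<Rightarrow> ('p, 'n) epoint) \<Rightarrow> 'a \<Rightarrow> 'a"
  assumes principal: "principal_bundle B"
    and sigma_compact: "sigma_compact_space TYPE('m)"
    and loc_Lebesgue: "locally_Lebesgue (base_atlas B) \<mu>"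
    and CAR: "is_CAR_algebra (L2_space B \<mu>) a"
    and \<kappa>_aut: "\<And>\<gamma>. \<gamma> \<in> gauge_group B \<Longrightarrow> star_automorphism (\<kappa> \<gamma>)"
    and \<kappa>_gen: "\<And>\<gamma> c. \<gamma> \<in> gauge_group B \<Longrightarrow> c \<in> hcarrier (L2_space B \<mu>) \<Longrightarrow>
                  \<kappa> \<gamma> (a c) = a (gauge_op B \<mu> \<gamma> c)"
    and cond: "(\<forall>z. cmod z = 1 \<longrightarrow> mat z \<in> grp B) \<or>
               second_quant (L2_space B \<mu>) ` Linfty_unitary_ops B \<mu>
                 \<subseteq> bicommutant (fock_space (L2_space B \<mu>))
                     (second_quant (L2_space B \<mu>) ` gauge_op B \<mu> ` gauge_group B)"
  shows "fixed_point_algebra (gauge_group B) \<kappa> = range (\<lambda>z. scaleC z (1::'a))"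
proof -
  interpret gbundle_measure B \<mu>
    by unfold_locales (rule principal sigma_compact loc_Lebesgue)+
  have mix: "\<exists>\<gamma>\<in>gauge_group B. \<forall>f\<in>F. \<forall>g\<in>F. cmod (hinner (L2_space B \<mu>) (gauge_op B \<mu> \<gamma> f) g) < \<delta>"
    if F: "finite F" "F \<subseteq> hcarrier (L2_space B \<mu>)" "\<delta> > 0" for F \<delta>
    using cond gauge_mixing_scalar[OF _ F] gauge_mixing_bicommutant[OF _ F] by (rule disjE)
  have add: "hadd (L2_space B \<mu>) f g \<in> hcarrier (L2_space B \<mu>)"
    if "f \<in> hcarrier (L2_space B \<mu>)" "g \<in> hcarrier (L2_space B \<mu>)" for f g
    using sip.hadd_Q[OF sip.rep(1)[OF that(1)] sip.rep(1)[OF that(2)]] sip.rep that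
      sip.Q_mem[OF sip.add_mem[OF sip.rep(1)[OF that(1)] sip.rep(1)[OF that(2)]]] by simp
  have scale: "hscale (L2_space B \<mu>) z f \<in> hcarrier (L2_space B \<mu>)"
    if "f \<in> hcarrier (L2_space B \<mu>)" for z f
    using sip.hscale_Q[OF sip.rep(1)[OF that], of z] sip.rep(2)[OF that]
      sip.Q_mem[OF sip.sc_mem[OF sip.rep(1)[OF that], of z]] by simp
  show ?thesis
  proof (intro equalityI subsetI)
    fix x assume "x \<in> fixed_point_algebra (gauge_group B) \<kappa>"
    then have x: "\<kappa> \<gamma> x = x" if "\<gamma> \<in> gauge_group B" for \<gamma> using that unfolding fixed_point_algebra_def by blast
    have "\<exists>z. x = scaleC z 1"
      by (rule CAR_fixed_point_scalar[OF CAR add scale gauge_op_mem \<kappa>_aut \<kappa>_gen mix x])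
    then show "x \<in> range (\<lambda>z. scaleC z (1::'a))" by blast
  next
    fix x assume "x \<in> range (\<lambda>z. scaleC z (1::'a))"
    then show "x \<in> fixed_point_algebra (gauge_group B) \<kappa>"
      unfolding fixed_point_algebra_def by (auto simp: star_automorphismD[OF \<kappa>_aut])
  qed
qed

end
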